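(* For every integer $n\ge0$ the filtered complexes of the two-strand braid words $\sigma^{-2n}=(\sigma^{-})^{2n}$ and $\sigma^{-(2n+1)}=(\sigma^{-})^{2n+1}$ satisfy the following homotopy equivalences in $\mathrm{Ch}(\mathbf D_2)$: $$[\sigma^{-2n}]\sim(\mathbf t_s\mathbf a_q)^{-2n}\,\mathbf t_a\Bigl[\underbrace{\mathbf t_{\mathrm{tot}}^{2n-1}G\xrightarrow{\psi_+}\cdots\xrightarrow{\psi_+}\mathbf t_{\mathrm{tot}}^{2}B\xrightarrow{\psi_-}\mathbf t_{\mathrm{tot}}G\xrightarrow{\psi_+}B}_{2n}\xrightarrow{\chi_-}\mathbf t_a^{-1}I\Bigr],$$ $$[\sigma^{-(2n+1)}]\sim(\mathbf t_s\mathbf a_q)^{-(2n+1)}\,\mathbf t_a\Bigl[\underbrace{\mathbf t_{\mathrm{tot}}^{2n}B\xrightarrow{\psi_-}\cdots\xrightarrow{\psi_-}\mathbf t_{\mathrm{tot}}G\xrightarrow{\psi_+}B}_{2n+1}\xrightarrow{\chi_-}\mathbf t_a^{-1}I\Bigr],$$ where $\mathbf t_{\mathrm{tot}}=\mathbf t_a\mathbf s_q$; the term with $\mathbf t_{\mathrm{tot}}^k$ is $B$ for $k$ even and $G$ for $k$ odd, and the maps alternate between $\psi_-$ (from $B$ to $G$) and $\psi_+$ (from $G$ to $B$).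
   Context: Categories. Let $\mathbf x=(x_1,x_2)$, $\mathbf y=(y_1,y_2)$; $\mathbb Q[\mathbf x,\mathbf y]$ is graded by $q$-degree with $\deg x_i=\deg y_i=2$. $\mathbf D_2$ is the derived category of $q$-graded $\mathbb Q[\mathbf x,\mathbf y]$-modules with a decreasing filtration $F^\bullet$: objects are represented by filtered $q$-graded complexes, filtered quasi-isomorphisms (those inducing quasi-isomorphisms on all associated graded pieces) are inverted, and morphisms preserve $q$-degree and filtration. Its homological degree is called $a$-degree; differentials lower it by $1$. Shift functors: $\mathbf q$ ($q$-degree), $\mathbf a$ ($a$-degree), $\mathbf s$ (filtration, $F^i(\mathbf sA)=F^{i-1}A$). $\mathrm{Ch}(\mathbf D_2)$ is the category of bounded chain complexes over the additive category $\mathbf D_2$ ("outer" complexes, in square brackets); the outer degree is the $t$-degree with shift $\mathbf t$, outer differentials lower $t$-degree by $1$, and $a$-degree records total homological degree, so passing to one higher outer position is the shift $\mathbf t_a=\mathbf t\mathbf a$. Half-integer $t$- and $s$-shifts are allowed. Put $\mathbf a_q=\mathbf a\mathbf q^2$, $\mathbf s_q=\mathbf s\mathbf q^2$, $\mathbf t_s=(\mathbf t\mathbf s)^{1/2}$. Homotopy equivalences in $\mathrm{Ch}(\mathbf D_2)$ use only morphisms of $\mathbf D_2$ (hence filtered). Composition: $M\circ N=M(\mathbf z,\mathbf y)\otimes_{\mathbb Q[\mathbf y]}N(\mathbf y,\mathbf x)$ with tensor product filtration (total outer complex in the case of complexes), regarded as a $\mathbb Q[\mathbf x,\mathbf z]$-module.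 Bimodules. Put $x_\pm=x_2\pm x_1$, $y_\pm=y_2\pm y_1$. Let $I=\mathbb Q[\mathbf x,\mathbf y]/(y_1-x_1,y_2-x_2)$ and $V=\mathbb Q[\mathbf x,\mathbf y]/(y_2-x_1,y_1-x_2)$ with trivial filtration ($F^0$ everything, $F^1=0$). Let $M=\mathbb Q[\mathbf x,\mathbf y]/(y_+-x_+,(y_-+x_-)(y_--x_-))$. The black blob bimodule $B$ is $M$ with $F^0=M$, $F^1=(y_--x_-)M\cong\mathbf q^2V$, $F^2=0$ (so $F^0/F^1\cong I$); the gray blob bimodule $G$ is $M$ with $F^0=M$, $F^1=(y_-+x_-)M\cong\mathbf q^2I$, $F^2=0$ (so $F^0/F^1\cong V$). Maps. $\chi_-:B\to I$ is the projection onto $F^0/F^1$. $\psi_-:\mathbf s_qB\to G$ is multiplication by $y_-+x_-$, i.e. the composite of the projection $B\to F^0B/F^1B\cong I$ with the inclusion $\mathbf s_qI\cong F^1G\subset G$; $\psi_+:\mathbf s_qG\to B$ is multiplication by $y_--x_-$, i.e. the composite of the projection $G\to F^0G/F^1G\cong V$ with the inclusion $\mathbf s_qV\cong F^1B\subset B$. The filtered Rouquier complex of the negative elementary braid is $[\sigma^{-}]=(\mathbf t_s\mathbf a_q)^{-1}\bigl[\,\mathbf t_aB\xrightarrow{\chi_-}I\,\bigr]$, and $[(\sigma^-)^k]=[\sigma^-]\circ\cdots\circ[\sigma^-]$ ($k$ factors; $I$ for $k=0$). *)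

theory Defs
  imports Complex_Main "HOL-Library.Poly_Mapping" "HOL-Algebra.Ideal" "HOL-Algebra.Module"
begin

section \<open>The polynomial ring in four variables\<close>

datatype bvar = X1 | X2 | Y1 | Y2

type_synonym bpoly = "(bvar \<Rightarrow>\<^sub>0 nat) \<Rightarrow>\<^sub>0 rat"

definition Const :: "rat \<Rightarrow> bpoly" where
  "Const c = Poly_Mapping.single 0 c"

definition Var :: "bvar \<Rightarrow> bpoly" where
  "Var v = Poly_Mapping.single (Poly_Mapping.single v 1) 1"

definition QXY :: "bpoly ring" where
  "QXY = \<lparr>carrier = UNIV, mult = (*), one = 1, zero = 0, add = (+)\<rparr>"

text \<open>Every variable has \<open>q\<close>-degree 2.\<close>

definition homogeneous :: "int \<Rightarrow> bpoly \<Rightarrow> bool" where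
  "homogeneous q p \<longleftrightarrow>
     (\<forall>\<mu>\<in>Poly_Mapping.keys p. 2 * int (\<Sum>v\<in>Poly_Mapping.keys \<mu>. Poly_Mapping.lookup \<mu> v) = q)"

definition x_plus :: bpoly where "x_plus = Var X2 + Var X1"
definition x_minus :: bpoly where "x_minus = Var X2 - Var X1"
definition y_plus :: bpoly where "y_plus = Var Y2 + Var Y1"
definition y_minus :: bpoly where "y_minus = Var Y2 - Var Y1"


section \<open>Filtered graded modules\<close>

text \<open>
  A module here carries an \<open>a\<close>-grading, a \<open>q\<close>-grading and a decreasing filtration;
  \<open>piece M a q\<close> is the part of \<open>a\<close>-degree \<open>a\<close> and \<open>q\<close>-degree \<open>q\<close>.

  Filtration indices are half-integers, since half-integer \<open>s\<close>-shifts are used: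
  \<^emph>\<open>\<open>filt M p\<close> stands for \<open>F\<^bsup>p/2\<^esup> M\<close>\<close>. A filtration indexed by the integers is extended to the
  half-integers by \<open>F\<^sup>r = F\<^bsup>\<lceil>r\<rceil>\<^esup>\<close>. Likewise \<open>t\<close>-degrees are half-integers, and an integer
  index \<open>i\<close> of an outer complex below stands for \<open>t\<close>-degree \<open>i/2\<close>.

  The fields \<open>mult\<close> and \<open>one\<close>, inherited from the record type \<open>module\<close>, play no role.
\<close>

record 'u fgmod = "(bpoly, 'u) module" +
  piece :: "int \<Rightarrow> int \<Rightarrow> 'u set"
  filt :: "int \<Rightarrow> 'u set"

definition decomposes :: "('u, 'm) fgmod_scheme \<Rightarrow> (int \<times> int \<Rightarrow> 'u) \<Rightarrow> 'u \<Rightarrow> bool" where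
  "decomposes M c x \<longleftrightarrow>
     (\<forall>a q. c (a, q) \<in> piece M a q) \<and> finite {g. c g \<noteq> \<zero>\<^bsub>M\<^esub>} \<and>
     x = finsum M c {g. c g \<noteq> \<zero>\<^bsub>M\<^esub>}"

locale fgmod = module QXY M for M (structure) +
  assumes piece_subgroup: "\<And>a q. subgroup (piece M a q) (add_monoid M)"
    and piece_smult: "\<And>e p x a q. \<lbrakk>homogeneous e p; x \<in> piece M a q\<rbrakk> \<Longrightarrow> p \<odot> x \<in> piece M a (q + e)"
    and direct_sum: "\<And>x. x \<in> carrier M \<Longrightarrow> \<exists>!c. decomposes M c x"
    and filt_submodule: "\<And>p. submodule (filt M p) QXY M"
    and filt_decreasing: "\<And>p. filt M (p + 1) \<subseteq> filt M p"
    and filt_graded: "\<And>x c g p. \<lbrakk>x \<in> filt M p; decomposes M c x\<rbrakk> \<Longrightarrow> c g \<in> filt M p"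

text \<open>Shift by \<open>a\<^sup>m s\<^bsup>k/2\<^esup> q\<^sup>n\<close>.\<close>

definition shift :: "int \<Rightarrow> int \<Rightarrow> int \<Rightarrow> ('u, 'm) fgmod_scheme \<Rightarrow> ('u, 'm) fgmod_scheme" where
  "shift m k n M =
     M\<lparr>piece := \<lambda>a q. piece M (a - m) (q - n), filt := \<lambda>p. filt M (p - k)\<rparr>"


section \<open>Filtered complexes and filtered quasi-isomorphisms\<close>

text \<open>The homological degree of the inner complex is the \<open>a\<close>-degree.\<close>

record 'u fdg = "'u fgmod" +
  dif :: "'u \<Rightarrow> 'u"

locale fdg = fgmod M for M (structure) +
  assumes dif_closed: "\<And>x. x \<in> carrier M \<Longrightarrow> dif M x \<in> carrier M"
    and dif_add: "\<And>x y. \<lbrakk>x \<in> carrier M; y \<in> carrier M\<rbrakk> \<Longrightarrow> dif M (x \<oplus> y) = dif M x \<oplus> dif M y"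
    and dif_smult: "\<And>p x. x \<in> carrier M \<Longrightarrow> dif M (p \<odot> x) = p \<odot> dif M x"
    and dif_dif: "\<And>x. x \<in> carrier M \<Longrightarrow> dif M (dif M x) = \<zero>"
    and dif_piece: "\<And>a q x. x \<in> piece M a q \<Longrightarrow> dif M x \<in> piece M (a - 1) q"
    and dif_filt: "\<And>p x. x \<in> filt M p \<Longrightarrow> dif M x \<in> filt M p"

definition fdg_hom :: "'u fdg \<Rightarrow> 'u fdg \<Rightarrow> ('u \<Rightarrow> 'u) \<Rightarrow> bool" where
  "fdg_hom M N f \<longleftrightarrow> fdg M \<and> fdg N \<and>
     (\<forall>x\<in>carrier M. f x \<in> carrier N) \<and>
     (\<forall>x\<in>carrier M. \<forall>y\<in>carrier M. f (x \<oplus>\<^bsub>M\<^esub> y) = f x \<oplus>\<^bsub>N\<^esub> f y) \<and>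
     (\<forall>p. \<forall>x\<in>carrier M. f (p \<odot>\<^bsub>M\<^esub> x) = p \<odot>\<^bsub>N\<^esub> f x) \<and>
     (\<forall>a q. \<forall>x\<in>piece M a q. f x \<in> piece N a q) \<and>
     (\<forall>p. \<forall>x\<in>filt M p. f x \<in> filt N p) \<and>
     (\<forall>x\<in>carrier M. f (dif M x) = dif N (f x))"

text \<open>
  Homology of the associated graded complex \<open>F\<^sup>r / F\<^bsup>r+1/2\<^esup>\<close>, \<open>r = p/2\<close>: elements of \<open>F\<^sup>r\<close> whose
  class is a cycle, modulo elements whose class is a boundary. (For a filtration indexed by
  the integers the quotient is \<open>F\<^sup>r / F\<^bsup>r+1\<^esup>\<close> if \<open>r\<close> is an integer and \<open>0\<close> otherwise.)
\<close>

definition gr_cycles :: "'u fdg \<Rightarrow> int \<Rightarrow> 'u set" where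
  "gr_cycles M p = {x \<in> filt M p. dif M x \<in> filt M (p + 1)}"

definition gr_boundaries :: "'u fdg \<Rightarrow> int \<Rightarrow> 'u set" where
  "gr_boundaries M p = {dif M y \<oplus>\<^bsub>M\<^esub> z | y z. y \<in> filt M p \<and> z \<in> filt M (p + 1)}"

definition gr_homology :: "'u fdg \<Rightarrow> int \<Rightarrow> 'u set set" where
  "gr_homology M p = (\<lambda>x. gr_boundaries M p +>\<^bsub>M\<^esub> x) ` gr_cycles M p"

definition fqis :: "'u fdg \<Rightarrow> 'u fdg \<Rightarrow> ('u \<Rightarrow> 'u) \<Rightarrow> bool" where
  "fqis M N f \<longleftrightarrow> fdg_hom M N f \<and>
     (\<forall>p. bij_betw (\<lambda>S. \<Union>x\<in>S. gr_boundaries N p +>\<^bsub>N\<^esub> f x) (gr_homology M p) (gr_homology N p))"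


section \<open>The filtered derived category\<close>

text \<open>
  \<open>D\<^sub>2\<close> is the localization of the additive category of filtered complexes at the
  filtered quasi-isomorphisms. Its objects are the filtered complexes (with elements in one
  fixed type \<open>'u\<close>). Its morphisms are presented by generators and relations: they are built
  by composition and addition from the filtered chain maps \<open>Map M f N\<close> and the formal
  inverses \<open>Inv M f N : N \<rightarrow> M\<close> of the filtered quasi-isomorphisms \<open>f : M \<rightarrow> N\<close>, modulo the
  least congruence \<open>d2_eq\<close> that makes composition associative and bilinear, makes
  \<open>f \<mapsto> Map M f N\<close> an additive functor, and makes \<open>Inv M f N\<close> inverse to \<open>Map M f N\<close>.
  Equality of morphisms in \<open>D\<^sub>2\<close> is always \<open>d2_eq\<close>.
\<close>

datatype 'u d2_word =
    Map "'u fdg" "'u \<Rightarrow> 'u" "'u fdg"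
  | Inv "'u fdg" "'u \<Rightarrow> 'u" "'u fdg"
  | Comp "'u d2_word" "'u d2_word"
  | Add "'u d2_word" "'u d2_word"

abbreviation Ident :: "'u fdg \<Rightarrow> 'u d2_word" where
  "Ident M \<equiv> Map M (\<lambda>x. x) M"

abbreviation Zero :: "'u fdg \<Rightarrow> 'u fdg \<Rightarrow> 'u d2_word" where
  "Zero M N \<equiv> Map M (\<lambda>x. \<zero>\<^bsub>N\<^esub>) N"

inductive d2_mor :: "'u fdg \<Rightarrow> 'u fdg \<Rightarrow> 'u d2_word \<Rightarrow> bool" where
  map: "fdg_hom M N f \<Longrightarrow> d2_mor M N (Map M f N)"
| inv: "fqis M N f \<Longrightarrow> d2_mor N M (Inv M f N)"
| comp: "\<lbrakk>d2_mor M N e; d2_mor N P e'\<rbrakk> \<Longrightarrow> d2_mor M P (Comp e' e)"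
| add: "\<lbrakk>d2_mor M N e; d2_mor M N e'\<rbrakk> \<Longrightarrow> d2_mor M N (Add e e')"

inductive d2_eq :: "'u fdg \<Rightarrow> 'u fdg \<Rightarrow> 'u d2_word \<Rightarrow> 'u d2_word \<Rightarrow> bool" where
  refl: "d2_mor M N e \<Longrightarrow> d2_eq M N e e"
| sym: "d2_eq M N e e' \<Longrightarrow> d2_eq M N e' e"
| trans: "\<lbrakk>d2_eq M N e e'; d2_eq M N e' e''\<rbrakk> \<Longrightarrow> d2_eq M N e e''"
| comp_cong: "\<lbrakk>d2_eq M N e e'; d2_eq N P g g'\<rbrakk> \<Longrightarrow> d2_eq M P (Comp g e) (Comp g' e')"
| add_cong: "\<lbrakk>d2_eq M N e e'; d2_eq M N g g'\<rbrakk> \<Longrightarrow> d2_eq M N (Add e g) (Add e' g')"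
| comp_assoc: "\<lbrakk>d2_mor M N e; d2_mor N P g; d2_mor P Q h\<rbrakk>
    \<Longrightarrow> d2_eq M Q (Comp (Comp h g) e) (Comp h (Comp g e))"
| ident_left: "d2_mor M N e \<Longrightarrow> d2_eq M N (Comp (Ident N) e) e"
| ident_right: "d2_mor M N e \<Longrightarrow> d2_eq M N (Comp e (Ident M)) e"
| add_assoc: "\<lbrakk>d2_mor M N e; d2_mor M N g; d2_mor M N h\<rbrakk>
    \<Longrightarrow> d2_eq M N (Add (Add e g) h) (Add e (Add g h))"
| add_commute: "\<lbrakk>d2_mor M N e; d2_mor M N g\<rbrakk> \<Longrightarrow> d2_eq M N (Add e g) (Add g e)"
| add_zero: "d2_mor M N e \<Longrightarrow> d2_eq M N (Add e (Zero M N)) e"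
| add_neg: "d2_mor M N e \<Longrightarrow>
    d2_eq M N (Add e (Comp (Map N (\<lambda>x. \<ominus>\<^bsub>N\<^esub> x) N) e)) (Zero M N)"
| distrib_left: "\<lbrakk>d2_mor M N e; d2_mor M N g; d2_mor N P h\<rbrakk>
    \<Longrightarrow> d2_eq M P (Comp h (Add e g)) (Add (Comp h e) (Comp h g))"
| distrib_right: "\<lbrakk>d2_mor M N e; d2_mor N P g; d2_mor N P h\<rbrakk>
    \<Longrightarrow> d2_eq M P (Comp (Add g h) e) (Add (Comp g e) (Comp h e))"
| map_cong: "\<lbrakk>fdg_hom M N f; fdg_hom M N g; \<And>x. x \<in> carrier M \<Longrightarrow> f x = g x\<rbrakk>
    \<Longrightarrow> d2_eq M N (Map M f N) (Map M g N)"
| map_comp: "\<lbrakk>fdg_hom M N f; fdg_hom N P g\<rbrakk>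
    \<Longrightarrow> d2_eq M P (Comp (Map N g P) (Map M f N)) (Map M (\<lambda>x. g (f x)) P)"
| map_add: "\<lbrakk>fdg_hom M N f; fdg_hom M N g\<rbrakk>
    \<Longrightarrow> d2_eq M N (Add (Map M f N) (Map M g N)) (Map M (\<lambda>x. f x \<oplus>\<^bsub>N\<^esub> g x) N)"
| inv_left: "fqis M N f \<Longrightarrow> d2_eq M M (Comp (Inv M f N) (Map M f N)) (Ident M)"
| inv_right: "fqis M N f \<Longrightarrow> d2_eq N N (Comp (Map M f N) (Inv M f N)) (Ident N)"

text \<open>The \<open>a\<close>-shift functor of \<open>D\<^sub>2\<close> is a pure reindexing (no sign on the differential).\<close>

abbreviation ash :: "int \<Rightarrow> ('u, 'm) fgmod_scheme \<Rightarrow> ('u, 'm) fgmod_scheme" where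
  "ash n \<equiv> shift n 0 0"

primrec ash_mor :: "int \<Rightarrow> 'u d2_word \<Rightarrow> 'u d2_word" where
  "ash_mor n (Map M f N) = Map (ash n M) f (ash n N)"
| "ash_mor n (Inv M f N) = Inv (ash n M) f (ash n N)"
| "ash_mor n (Comp e e') = Comp (ash_mor n e) (ash_mor n e')"
| "ash_mor n (Add e e') = Add (ash_mor n e) (ash_mor n e')"


section \<open>Complexes over the filtered derived category\<close>

text \<open>
  \<open>term C i\<close> is the term of \<open>t\<close>-degree \<open>i/2\<close>, with its total \<open>a\<close>-degree. The outer
  differential lowers \<open>t\<close>-degree and total \<open>a\<close>-degree by one, so the component
  \<open>odif C i\<close> starting at \<open>term C i\<close> is a morphism to \<open>ash 1 (term C (i - 2))\<close>.
\<close>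

record 'u och =
  "term" :: "int \<Rightarrow> 'u fdg"
  odif :: "int \<Rightarrow> 'u d2_word"

definition ch_complex :: "'u och \<Rightarrow> bool" where
  "ch_complex C \<longleftrightarrow>
     (\<forall>i. fdg (term C i)) \<and>
     finite {i. \<not> d2_eq (term C i) (term C i) (Ident (term C i)) (Zero (term C i) (term C i))} \<and>
     (\<forall>i. d2_mor (term C i) (ash 1 (term C (i - 2))) (odif C i)) \<and>
     (\<forall>i. d2_eq (term C i) (ash 2 (term C (i - 4)))
            (Comp (ash_mor 1 (odif C (i - 2))) (odif C i))
            (Zero (term C i) (ash 2 (term C (i - 4)))))"

definition ch_map :: "'u och \<Rightarrow> 'u och \<Rightarrow> (int \<Rightarrow> 'u d2_word) \<Rightarrow> bool" where
  "ch_map C D f \<longleftrightarrow>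
     (\<forall>i. d2_mor (term C i) (term D i) (f i)) \<and>
     (\<forall>i. d2_eq (term C i) (ash 1 (term D (i - 2)))
            (Comp (odif D i) (f i))
            (Comp (ash_mor 1 (f (i - 2))) (odif C i)))"

text \<open>A homotopy raises \<open>t\<close>-degree and total \<open>a\<close>-degree by one; \<open>f = g + (d h + h d)\<close>.\<close>

definition ch_homotopic ::
    "'u och \<Rightarrow> 'u och \<Rightarrow> (int \<Rightarrow> 'u d2_word) \<Rightarrow> (int \<Rightarrow> 'u d2_word) \<Rightarrow> bool" where
  "ch_homotopic C D f g \<longleftrightarrow>
     (\<exists>h. (\<forall>i. d2_mor (term C i) (ash (-1) (term D (i + 2))) (h i)) \<and>
          (\<forall>i. d2_eq (term C i) (term D i) (f i)
                 (Add (g i) (Add (Comp (ash_mor (-1) (odif D (i + 2))) (h i))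
                                 (Comp (ash_mor 1 (h (i - 2))) (odif C i))))))"

definition homotopy_equivalent :: "'u och \<Rightarrow> 'u och \<Rightarrow> bool" (infix \<open>\<simeq>\<^sub>h\<close> 50) where
  "C \<simeq>\<^sub>h D \<longleftrightarrow> ch_complex C \<and> ch_complex D \<and>
     (\<exists>f g. ch_map C D f \<and> ch_map D C g \<and>
        ch_homotopic C C (\<lambda>i. Comp (g i) (f i)) (\<lambda>i. Ident (term C i)) \<and>
        ch_homotopic D D (\<lambda>i. Comp (f i) (g i)) (\<lambda>i. Ident (term D i)))"


section \<open>A universe of module elements\<close>

text \<open>
  A type of elements closed under the constructions needed: quotients of the polynomial ring,
  direct sums over the integers, and tensor products. A class in a quotient is
  represented by a chosen representative. The atoms only serve to make the universe as large
  as desired, so that \<open>D\<^sub>2\<close> contains modules of any prescribed cardinality.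
\<close>

datatype 'a univ =
    Atom 'a
  | Pol (pol: bpoly)
  | Fam (fam: "int \<Rightarrow> 'a univ")
  | Tens (summands: "('a univ \<times> 'a univ) list")

type_synonym 'a bimodule = "'a univ fgmod"


section \<open>Cyclic bimodules\<close>

definition pol_class :: "bpoly set \<Rightarrow> bpoly \<Rightarrow> 'a univ" where
  "pol_class J p = Pol (SOME p'. p' \<in> J +>\<^bsub>QXY\<^esub> p)"

text \<open>The quotient by the ideal \<open>J\<close>, in \<open>a\<close>-degree 0, with the images of the ideals \<open>\<Phi> p\<close> as filtration.\<close>

definition cyclic :: "bpoly set \<Rightarrow> (int \<Rightarrow> bpoly set) \<Rightarrow> 'a bimodule" where
  "cyclic J \<Phi> =
     \<lparr>carrier = range (pol_class J), mult = undefined, one = undefined,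
      zero = pol_class J 0,
      add = \<lambda>u v. pol_class J (pol u + pol v),
      smult = \<lambda>p u. pol_class J (p * pol u),
      piece = \<lambda>a q. if a = 0 then pol_class J ` {p. homogeneous q p} else {pol_class J 0},
      filt = \<lambda>p. pol_class J ` \<Phi> p\<rparr>"

definition trivial_filt :: "int \<Rightarrow> bpoly set" where
  "trivial_filt p = (if p \<le> 0 then UNIV else {0})"

definition two_step_filt :: "bpoly \<Rightarrow> int \<Rightarrow> bpoly set" where
  "two_step_filt f p = (if p \<le> 0 then UNIV else if p \<le> 2 then PIdl\<^bsub>QXY\<^esub> f else {0})"

definition JI :: "bpoly set" where
  "JI = Idl\<^bsub>QXY\<^esub> {Var Y1 - Var X1, Var Y2 - Var X2}"

definition JM :: "bpoly set" where
  "JM = Idl\<^bsub>QXY\<^esub> {y_plus - x_plus, (y_minus + x_minus) * (y_minus - x_minus)}"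

definition bimI :: "'a bimodule" where
  "bimI = cyclic JI trivial_filt"

definition bimB :: "'a bimodule" where
  "bimB = cyclic JM (two_step_filt (y_minus - x_minus))"

definition bimG :: "'a bimodule" where
  "bimG = cyclic JM (two_step_filt (y_minus + x_minus))"

definition bim0 :: "'a bimodule" where
  "bim0 = cyclic UNIV trivial_filt"

definition chi_minus :: "'a univ \<Rightarrow> 'a univ" where
  "chi_minus u = pol_class JI (pol u)"

definition psi_minus :: "'a univ \<Rightarrow> 'a univ" where
  "psi_minus u = pol_class JM ((y_minus + x_minus) * pol u)"

definition psi_plus :: "'a univ \<Rightarrow> 'a univ" where
  "psi_plus u = pol_class JM ((y_minus - x_minus) * pol u)"


section \<open>Tensor products and direct sums\<close>

text \<open>
  The tensor product \<open>M(z,y) \<otimes> N(y,x)\<close> over \<open>Q[y]\<close>: the variables \<open>X1, X2\<close> act on \<open>M\<close>, and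
  \<open>Y1, Y2\<close> act on \<open>N\<close>, by \<open>y\<^sub>1, y\<^sub>2\<close>; in the result, \<open>Y1, Y2\<close> act on \<open>M\<close> (these are the
  \<open>z\<close>-variables) and \<open>X1, X2\<close> act on \<open>N\<close>. It is the free abelian group on the pairs modulo
  the subgroup \<open>tens_rel\<close>; since the constants and \<open>y\<^sub>1, y\<^sub>2\<close> generate \<open>Q[y]\<close> as a ring,
  balancedness need only be imposed for these. A list of pairs stands for the corresponding
  sum of elementary tensors.
\<close>

inductive_set tens_rel :: "'a bimodule \<Rightarrow> 'a bimodule \<Rightarrow> ('a univ \<times> 'a univ \<Rightarrow>\<^sub>0 int) set"
  for M N where
  zero: "0 \<in> tens_rel M N"
| diff: "\<lbrakk>f \<in> tens_rel M N; g \<in> tens_rel M N\<rbrakk> \<Longrightarrow> f - g \<in> tens_rel M N"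
| add_left: "\<lbrakk>m \<in> carrier M; m' \<in> carrier M; n \<in> carrier N\<rbrakk>
    \<Longrightarrow> frag_of (m \<oplus>\<^bsub>M\<^esub> m', n) - frag_of (m, n) - frag_of (m', n) \<in> tens_rel M N"
| add_right: "\<lbrakk>m \<in> carrier M; n \<in> carrier N; n' \<in> carrier N\<rbrakk>
    \<Longrightarrow> frag_of (m, n \<oplus>\<^bsub>N\<^esub> n') - frag_of (m, n) - frag_of (m, n') \<in> tens_rel M N"
| const: "\<lbrakk>m \<in> carrier M; n \<in> carrier N\<rbrakk>
    \<Longrightarrow> frag_of (Const c \<odot>\<^bsub>M\<^esub> m, n) - frag_of (m, Const c \<odot>\<^bsub>N\<^esub> n) \<in> tens_rel M N"
| y1: "\<lbrakk>m \<in> carrier M; n \<in> carrier N\<rbrakk>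
    \<Longrightarrow> frag_of (Var X1 \<odot>\<^bsub>M\<^esub> m, n) - frag_of (m, Var Y1 \<odot>\<^bsub>N\<^esub> n) \<in> tens_rel M N"
| y2: "\<lbrakk>m \<in> carrier M; n \<in> carrier N\<rbrakk>
    \<Longrightarrow> frag_of (Var X2 \<odot>\<^bsub>M\<^esub> m, n) - frag_of (m, Var Y2 \<odot>\<^bsub>N\<^esub> n) \<in> tens_rel M N"

definition formal_sum :: "('a univ \<times> 'a univ) list \<Rightarrow> ('a univ \<times> 'a univ \<Rightarrow>\<^sub>0 int)" where
  "formal_sum l = sum_list (map frag_of l)"

definition tens_class ::
    "'a bimodule \<Rightarrow> 'a bimodule \<Rightarrow> ('a univ \<times> 'a univ) list \<Rightarrow> 'a univ" where
  "tens_class M N l =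
     Tens (SOME l'. set l' \<subseteq> carrier M \<times> carrier N \<and> formal_sum l' - formal_sum l \<in> tens_rel M N)"

definition x_part :: "(bvar \<Rightarrow>\<^sub>0 nat) \<Rightarrow> bpoly" where
  "x_part \<mu> = Var X1 ^ Poly_Mapping.lookup \<mu> X1 * Var X2 ^ Poly_Mapping.lookup \<mu> X2"

definition y_part :: "(bvar \<Rightarrow>\<^sub>0 nat) \<Rightarrow> bpoly" where
  "y_part \<mu> = Var Y1 ^ Poly_Mapping.lookup \<mu> Y1 * Var Y2 ^ Poly_Mapping.lookup \<mu> Y2"

definition tens_scale ::
    "'a bimodule \<Rightarrow> 'a bimodule \<Rightarrow> (bvar \<Rightarrow>\<^sub>0 nat) \<Rightarrow> rat \<Rightarrow> 'a univ \<Rightarrow> ('a univ \<times> 'a univ) list" where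
  "tens_scale M N \<mu> c u =
     map (\<lambda>(m, n). ((Const c * y_part \<mu>) \<odot>\<^bsub>M\<^esub> m, x_part \<mu> \<odot>\<^bsub>N\<^esub> n)) (summands u)"

definition tens_span ::
    "'a bimodule \<Rightarrow> 'a bimodule \<Rightarrow> ('a univ \<times> 'a univ) set \<Rightarrow> 'a univ set" where
  "tens_span M N S = tens_class M N ` {l. set l \<subseteq> S}"

definition tens_group :: "'a bimodule \<Rightarrow> 'a bimodule \<Rightarrow> 'a univ ring" where
  "tens_group M N =
     \<lparr>carrier = tens_span M N (carrier M \<times> carrier N), mult = undefined, one = undefined,
      zero = tens_class M N [],
      add = \<lambda>u v. tens_class M N (summands u @ summands v)\<rparr>"

definition tens :: "'a bimodule \<Rightarrow> 'a bimodule \<Rightarrow> 'a bimodule" where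
  "tens M N =
     (let T = tens_group M N
      in \<lparr>carrier = carrier T, mult = undefined, one = undefined, zero = zero T, add = add T,
          smult = \<lambda>p u. finsum T
             (\<lambda>\<mu>. tens_class M N (tens_scale M N \<mu> (Poly_Mapping.lookup p \<mu>) u))
             (Poly_Mapping.keys p),
          piece = \<lambda>a q. tens_span M N (\<Union>a1 q1. piece M a1 q1 \<times> piece N (a - a1) (q - q1)),
          filt = \<lambda>p. tens_span M N (\<Union>i. filt M i \<times> filt N (p - i))\<rparr>)"

definition tens_map ::
    "'a bimodule \<Rightarrow> 'a bimodule \<Rightarrow> ('a univ \<Rightarrow> 'a univ) \<Rightarrow> ('a univ \<Rightarrow> 'a univ) \<Rightarrow> 'a univ \<Rightarrow> 'a univ"
  where "tens_map M' N' f g u = tens_class M' N' (map (\<lambda>(m, n). (f m, g n)) (summands u))"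

definition dsum :: "(int \<Rightarrow> 'a bimodule) \<Rightarrow> 'a bimodule" where
  "dsum M =
     (let fams = \<lambda>S. Fam ` {x. (\<forall>i. x i \<in> S i) \<and> finite {i. x i \<noteq> \<zero>\<^bsub>M i\<^esub>}}
      in \<lparr>carrier = fams (\<lambda>i. carrier (M i)), mult = undefined, one = undefined,
          zero = Fam (\<lambda>i. \<zero>\<^bsub>M i\<^esub>),
          add = \<lambda>u v. Fam (\<lambda>i. fam u i \<oplus>\<^bsub>M i\<^esub> fam v i),
          smult = \<lambda>p u. Fam (\<lambda>i. p \<odot>\<^bsub>M i\<^esub> fam u i),
          piece = \<lambda>a q. fams (\<lambda>i. piece (M i) a q),
          filt = \<lambda>p. fams (\<lambda>i. filt (M i) p)\<rparr>)"


section \<open>Outer complexes of bimodules\<close>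

text \<open>
  As above, \<open>bterm C i\<close> is the term of \<open>t\<close>-degree \<open>i/2\<close> with its total \<open>a\<close>-degree, and
  \<open>bdif C i\<close> maps it to \<open>ash 1 (bterm C (i - 2))\<close>.
\<close>

record 'a bcomplex =
  bterm :: "int \<Rightarrow> 'a bimodule"
  bdif :: "int \<Rightarrow> 'a univ \<Rightarrow> 'a univ"

text \<open>A bimodule is viewed in \<open>D\<^sub>2\<close> as a complex with zero inner differential.\<close>

definition to_fdg :: "'a bimodule \<Rightarrow> 'a univ fdg" where
  "to_fdg M = fgmod.extend M (fdg.fields (\<lambda>x. \<zero>\<^bsub>M\<^esub>))"

definition to_ch :: "'a bcomplex \<Rightarrow> 'a univ och" where
  "to_ch C =
     \<lparr>term = \<lambda>i. to_fdg (bterm C i),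
      odif = \<lambda>i. Map (to_fdg (bterm C i)) (bdif C i) (ash 1 (to_fdg (bterm C (i - 2))))\<rparr>"

text \<open>Shift by \<open>t\<^bsup>l/2\<^esup> a\<^sup>m s\<^bsup>k/2\<^esup> q\<^sup>n\<close>.\<close>

definition bshift :: "int \<Rightarrow> int \<Rightarrow> int \<Rightarrow> int \<Rightarrow> 'a bcomplex \<Rightarrow> 'a bcomplex" where
  "bshift l m k n C =
     \<lparr>bterm = \<lambda>i. shift m k n (bterm C (i - l)), bdif = \<lambda>i. bdif C (i - l)\<rparr>"

text \<open>Shift by \<open>(t\<^sub>s a\<^sub>q)\<^sup>k\<close>, where \<open>t\<^sub>s a\<^sub>q = t\<^bsup>1/2\<^esup> s\<^bsup>1/2\<^esup> a q\<^sup>2\<close>, and by \<open>t\<^sub>a = t a\<close>.\<close>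

definition ts_aq_shift :: "int \<Rightarrow> 'a bcomplex \<Rightarrow> 'a bcomplex" where
  "ts_aq_shift k = bshift k k k (2 * k)"

definition ta_shift :: "'a bcomplex \<Rightarrow> 'a bcomplex" where
  "ta_shift = bshift 2 1 0 0"

text \<open>
  The composite has \<open>\<Oplus>\<^sub>i M\<^sub>i \<otimes> N\<^bsub>k-i\<^esub>\<close> as term of \<open>t\<close>-degree \<open>k/2\<close>, with differential
  \<open>d \<otimes> 1 \<plusminus> 1 \<otimes> d\<close>. As \<open>t\<close>-degrees may be half-integers, the sign on \<open>M\<^sub>i\<close> is taken to
  be \<open>(-1)\<close> to the power \<open>\<lfloor>i/2\<rfloor>\<close>.
\<close>

definition bcomp :: "'a bcomplex \<Rightarrow> 'a bcomplex \<Rightarrow> 'a bcomplex" (infixr \<open>\<circ>\<^sub>b\<close> 70) where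
  "M \<circ>\<^sub>b N =
     \<lparr>bterm = \<lambda>k. dsum (\<lambda>i. tens (bterm M i) (bterm N (k - i))),
      bdif = \<lambda>k u. Fam (\<lambda>i.
        let T = tens (bterm M i) (bterm N (k - 2 - i));
            v = tens_map (bterm M i) (bterm N (k - 2 - i)) (bdif M (i + 2)) (\<lambda>n. n) (fam u (i + 2));
            w = tens_map (bterm M i) (bterm N (k - 2 - i)) (\<lambda>m. m) (bdif N (k - i)) (fam u i)
        in v \<oplus>\<^bsub>T\<^esub> (if even (i div 2) then w else \<ominus>\<^bsub>T\<^esub> w))\<rparr>"


section \<open>The complexes of the theorem\<close>

text \<open>
  The complex \<open>M\<^sub>h \<rightarrow> \<dots> \<rightarrow> M\<^sub>l\<close> concentrated in the integral \<open>t\<close>-degrees from \<open>l\<close> to \<open>h\<close>,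
  with \<open>d j\<close> starting at \<open>M j\<close>.
\<close>

definition integral_term :: "int \<Rightarrow> int \<Rightarrow> (int \<Rightarrow> 'a bimodule) \<Rightarrow> int \<Rightarrow> 'a bimodule" where
  "integral_term l h M i = (if even i \<and> i div 2 \<in> {l..h} then M (i div 2) else bim0)"

definition integral_complex ::
    "int \<Rightarrow> int \<Rightarrow> (int \<Rightarrow> 'a bimodule) \<Rightarrow> (int \<Rightarrow> 'a univ \<Rightarrow> 'a univ) \<Rightarrow> 'a bcomplex" where
  "integral_complex l h M d =
     \<lparr>bterm = integral_term l h M,
      bdif = \<lambda>i. if even i \<and> i div 2 \<in> {l<..h} then d (i div 2)
                  else (\<lambda>u. \<zero>\<^bsub>integral_term l h M (i - 2)\<^esub>)\<rparr>"

definition identity_complex :: "'a bcomplex" where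
  "identity_complex = integral_complex 0 0 (\<lambda>j. bimI) (\<lambda>j. undefined)"

definition sigma_minus :: "'a bcomplex" where
  "sigma_minus = ts_aq_shift (-1)
     (integral_complex 0 1 (\<lambda>j. if j = 0 then bimI else ash 1 bimB) (\<lambda>j. chi_minus))"

fun sigma_minus_power :: "nat \<Rightarrow> 'a bcomplex" where
  "sigma_minus_power 0 = identity_complex"
| "sigma_minus_power (Suc 0) = sigma_minus"
| "sigma_minus_power (Suc (Suc k)) = sigma_minus \<circ>\<^sub>b sigma_minus_power (Suc k)"

text \<open>
  The complex in square brackets with \<open>k\<close> blob bimodules: in \<open>t\<close>-degree \<open>j\<close>, for
  \<open>0 \<le> j < k\<close>, it has \<open>B\<close> or \<open>G\<close> shifted by the \<open>j\<close>-th power of \<open>t\<^sub>a s\<^sub>q = t a s q\<^sup>2\<close>, and in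
  \<open>t\<close>-degree \<open>-1\<close> it has \<open>I\<close> shifted by the inverse of \<open>t\<^sub>a = t a\<close>.
\<close>

definition blob_complex :: "nat \<Rightarrow> 'a bcomplex" where
  "blob_complex k = integral_complex (-1) (int k - 1)
     (\<lambda>j. if j = -1 then ash (-1) bimI
          else shift j (2 * j) (2 * j) (if even j then bimB else bimG))
     (\<lambda>j. if j = 0 then chi_minus else if odd j then psi_plus else psi_minus)"

end

(*
  Over the polynomial ring in y, the bimodule B(z,y) is free on 1 and z_- - y_-. Hence
  composing a complex N with the negative crossing gives N + (N x N), with p acting on N x N by
  p (n, n') = (p n, D(p) n + w(p) n'), for the Demazure operator D and the transposition w of
  the variables. For the blob complexes this makes the
  splittings of B o B into a copy of B and a shift of G, and of B o G into a copy of G and a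
  shift of B, explicit: the maps in both directions, and the contracting homotopy that cancels
  one copy against the term coming from I, are given by polynomial formulas in the Demazure
  operator. They are honest filtered bimodule maps, so the equivalence holds before any
  quasi-isomorphism is inverted. Composition with a crossing and the passage to the cone
  preserve deformation retracts, and the theorem follows by induction on the number of
  crossings.
*)

theory Submission
  imports "HOL-Algebra.Free_Abelian_Groups" Defs
begin

section \<open>Polynomials\<close>

text \<open>Classes in the universe are chosen representatives, so a tensor product cannot be
  computed with directly. Evaluation on the basis 1, z_- - y_- replaces it by coordinates; the
  second basis element spans F^1 of B over the polynomials in y, so the tensor filtration splits
  along the basis. The coordinates are triples, outside the universe; retracts are therefore formed
  between complexes with different element types, and D_2 is entered only at the very end. The
  retraction is Gaussian elimination. For j \<ge> 0 the summand N_j coming from I cancels against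
  the copy of N_j inside B o N_j given by u -> (u, D u). This map exists modulo the ideal of M but
  not modulo that of I, so the I in degree -1 survives. The complement of the copy is N_j with the
  action twisted by w. As w exchanges y_- - x_- and -(y_- + x_-), the twist turns B into G and back,
  and the minus sign forces alternating signs in the maps. The elimination needs a blob in degree 0,
  hence the words with no letter and with one letter are matched directly.\<close>

instantiation bvar :: linorder
begin

text \<open>A linear order on the variables induces one on the monomials, and this makes
  \<open>bpoly\<close> a ring without zero divisors. Division by \<open>y_minus\<close> rests on
  that.\<close>

definition bvar_rank :: "bvar \<Rightarrow> nat" where
  "bvar_rank v = (case v of X1 \<Rightarrow> 0 | X2 \<Rightarrow> 1 | Y1 \<Rightarrow> 2 | Y2 \<Rightarrow> 3)"

definition less_eq_bvar :: "bvar \<Rightarrow> bvar \<Rightarrow> bool" where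
  "v \<le> w \<longleftrightarrow> bvar_rank v \<le> bvar_rank w"

definition less_bvar :: "bvar \<Rightarrow> bvar \<Rightarrow> bool" where
  "v < w \<longleftrightarrow> bvar_rank v < bvar_rank w"

instance
  by standard (auto simp: less_eq_bvar_def less_bvar_def bvar_rank_def split: bvar.splits)

end

section \<open>Induction on monomials and polynomials\<close>

lemma UNIV_bvar: "(UNIV :: bvar set) = {X1, X2, Y1, Y2}"
  by (auto intro: bvar.exhaust)

instance bvar :: finite
  by standard (simp add: UNIV_bvar)

lemma Const_simps [simp]:
  "Const 0 = 0" "Const 1 = 1"
  by (simp_all add: Const_def)

lemma Const_add: "Const (c + d) = Const c + Const d"
  by (simp add: Const_def single_add)

lemma Const_mult: "Const (c * d) = Const c * Const d"
  by (simp add: Const_def mult_single)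

lemma poly_mapping_sum_singles:
  fixes p :: "'a \<Rightarrow>\<^sub>0 'b::comm_monoid_add"
  shows "p = (\<Sum>\<mu>\<in>Poly_Mapping.keys p. Poly_Mapping.single \<mu> (Poly_Mapping.lookup p \<mu>))"
  by (rule poly_mapping_eqI)
     (auto simp: lookup_sum lookup_single when_def sum.delta in_keys_iff)

lemma poly_mapping_add_induct [case_names zero add single]:
  fixes p :: "'a \<Rightarrow>\<^sub>0 'b::comm_monoid_add"
  assumes "P 0" and "\<And>p q. P p \<Longrightarrow> P q \<Longrightarrow> P (p + q)"
    and "\<And>\<mu> c. P (Poly_Mapping.single \<mu> c)"
  shows "P p"
proof -
  have "P (\<Sum>\<mu>\<in>A. Poly_Mapping.single \<mu> (Poly_Mapping.lookup p \<mu>))" if "finite A" for A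
    using that by induction (auto intro: assms)
  then show ?thesis
    using poly_mapping_sum_singles[of p] finite_keys[of p] by metis
qed

lemma monomial_induct [case_names zero Var]:
  fixes \<mu> :: "bvar \<Rightarrow>\<^sub>0 nat"
  assumes "P 0" and "\<And>v \<mu>. P \<mu> \<Longrightarrow> P (Poly_Mapping.single v 1 + \<mu>)"
  shows "P \<mu>"
proof -
  have *: "P (Poly_Mapping.single v n + \<mu>)" if "P \<mu>" for v n \<mu>
  proof (induction n)
    case (Suc n)
    then have "P (Poly_Mapping.single v 1 + (Poly_Mapping.single v n + \<mu>))"
      by (rule assms(2))
    then show ?case
      by (metis add.assoc plus_1_eq_Suc single_add)
  qed (use that in simp)
  have "P p" for p :: "bvar \<Rightarrow>\<^sub>0 nat"
  proof -
    have "P (\<Sum>v\<in>A. Poly_Mapping.single v (Poly_Mapping.lookup p v))" if "finite A" for A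
      using that by induction (auto intro: assms *)
    then show ?thesis
      using poly_mapping_sum_singles[of p] finite_keys[of p] by metis
  qed
  then show ?thesis .
qed

text \<open>Reduces identities between substitutions, and the divisibility behind
  \<open>dem\<close>, to constants, sums and multiplication by one variable.\<close>

lemma bpoly_induct [case_names Const add Var]:
  assumes "\<And>c. P (Const c)" and "\<And>p q. P p \<Longrightarrow> P q \<Longrightarrow> P (p + q)"
    and "\<And>v p. P p \<Longrightarrow> P (Var v * p)"
  shows "P p"
proof (induction p rule: poly_mapping_add_induct)
  case (single \<mu> c)
  show ?case
  proof (induction \<mu> rule: monomial_induct)
    case zero
    then show ?case using assms(1)[of c] by (simp add: Const_def)
  next
    case (Var v \<mu>)
    then show ?case using assms(3)[of "Poly_Mapping.single \<mu> c" v]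
      by (simp add: Var_def mult_single)
  qed
qed (use assms(1)[of 0] assms(2) in auto)

section \<open>Substitution homomorphisms\<close>

definition subst :: "(bvar \<Rightarrow> bpoly) \<Rightarrow> bpoly \<Rightarrow> bpoly" where
  "subst s p = (\<Sum>\<mu>\<in>Poly_Mapping.keys p.
     Const (Poly_Mapping.lookup p \<mu>) * (\<Prod>v\<in>UNIV. s v ^ Poly_Mapping.lookup \<mu> v))"

lemma subst_superset:
  assumes "finite A" "Poly_Mapping.keys p \<subseteq> A"
  shows "subst s p = (\<Sum>\<mu>\<in>A. Const (Poly_Mapping.lookup p \<mu>) *
    (\<Prod>v\<in>UNIV. s v ^ Poly_Mapping.lookup \<mu> v))"
  unfolding subst_def
  by (rule sum.mono_neutral_left) (use assms in \<open>auto simp: in_keys_iff\<close>)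

lemma subst_add: "subst s (p + q) = subst s p + subst s q"
proof -
  let ?A = "Poly_Mapping.keys p \<union> Poly_Mapping.keys q"
  show ?thesis
    by (subst (1 2 3) subst_superset[of ?A])
       (use keys_add[of p q] in \<open>auto simp: lookup_add Const_add semiring_class.distrib_right sum.distrib\<close>)
qed

lemma subst_0 [simp]: "subst s 0 = 0"
  by (simp add: subst_def)

lemma subst_single:
  "subst s (Poly_Mapping.single \<mu> c) = Const c * (\<Prod>v\<in>UNIV. s v ^ Poly_Mapping.lookup \<mu> v)"
  by (subst subst_superset[of "{\<mu>}"]) auto

lemma subst_mult: "subst s (p * q) = subst s p * subst s q"
proof (induction p rule: poly_mapping_add_induct)
  case (single \<mu> c)
  show ?case
  proof (induction q rule: poly_mapping_add_induct)
    case (single \<nu> d)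
    then show ?case
      by (simp add: mult_single subst_single lookup_add power_add prod.distrib Const_mult mult_ac)
  qed (simp_all add: semiring_class.distrib_left subst_add)
qed (simp_all add: semiring_class.distrib_right subst_add)

lemma subst_Const [simp]: "subst s (Const c) = Const c"
  by (simp add: Const_def[of c] subst_single) 

lemma subst_1 [simp]: "subst s 1 = 1"
  using subst_Const[of s 1] by simp

lemma subst_Var [simp]: "subst s (Var v) = s v"
proof -
  have "(\<Prod>w\<in>UNIV. s w ^ Poly_Mapping.lookup (Poly_Mapping.single v (1::nat)) w) =
      (\<Prod>w\<in>UNIV. if w = v then s v else 1)"
    by (rule prod.cong) (auto simp: lookup_single when_def)
  then show ?thesis
    unfolding Var_def by (subst subst_single) simp
qed

lemma subst_uminus: "subst s (- p) = - subst s p"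
  using subst_add[of s p "- p"] by (simp add: eq_neg_iff_add_eq_0 add.commute)

lemma subst_diff: "subst s (p - q) = subst s p - subst s q"
  using subst_add[of s p "- q"] by (simp add: subst_uminus)

lemmas subst_hom = subst_add subst_mult subst_uminus subst_diff

definition swapY :: "bpoly \<Rightarrow> bpoly" where
  "swapY = subst (\<lambda>v. case v of X1 \<Rightarrow> Var X1 | X2 \<Rightarrow> Var X2 | Y1 \<Rightarrow> Var Y2 | Y2 \<Rightarrow> Var Y1)"

text \<open>The middle variables of a composite are the X variables of the left factor and the Y
  variables of the right one. \<open>XtoY\<close> turns a scalar of the left factor into its action
  on the right factor.\<close>

definition XtoY :: "bpoly \<Rightarrow> bpoly" where
  "XtoY = subst (\<lambda>v. case v of X1 \<Rightarrow> Var Y1 | X2 \<Rightarrow> Var Y2 | Y1 \<Rightarrow> Var Y1 | Y2 \<Rightarrow> Var Y2)"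

definition YtoX :: "bpoly \<Rightarrow> bpoly" where
  "YtoX = subst (\<lambda>v. case v of X1 \<Rightarrow> Var X1 | X2 \<Rightarrow> Var X2 | Y1 \<Rightarrow> Var X1 | Y2 \<Rightarrow> Var X2)"

lemma substs_hom [simp]:
  "swapY (p + q) = swapY p + swapY q" "swapY (p * q) = swapY p * swapY q"
  "swapY (p - q) = swapY p - swapY q" "swapY (- p) = - swapY p"
  "swapY 0 = 0" "swapY 1 = 1" "swapY (Const c) = Const c"
  "XtoY (p + q) = XtoY p + XtoY q" "XtoY (p * q) = XtoY p * XtoY q"
  "XtoY (p - q) = XtoY p - XtoY q" "XtoY (- p) = - XtoY p"
  "XtoY 0 = 0" "XtoY 1 = 1" "XtoY (Const c) = Const c"
  "YtoX (p + q) = YtoX p + YtoX q" "YtoX (p * q) = YtoX p * YtoX q"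
  "YtoX (p - q) = YtoX p - YtoX q" "YtoX (- p) = - YtoX p"
  "YtoX 0 = 0" "YtoX 1 = 1" "YtoX (Const c) = Const c"
  by (simp_all add: swapY_def XtoY_def YtoX_def subst_hom)

lemma substs_Var [simp]:
  "swapY (Var X1) = Var X1" "swapY (Var X2) = Var X2"
  "swapY (Var Y1) = Var Y2" "swapY (Var Y2) = Var Y1"
  "XtoY (Var X1) = Var Y1" "XtoY (Var X2) = Var Y2"
  "XtoY (Var Y1) = Var Y1" "XtoY (Var Y2) = Var Y2"
  "YtoX (Var X1) = Var X1" "YtoX (Var X2) = Var X2"
  "YtoX (Var Y1) = Var X1" "YtoX (Var Y2) = Var X2"
  by (simp_all add: swapY_def XtoY_def YtoX_def)

lemma swapY_swapY [simp]: "swapY (swapY p) = p"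
proof (induction p rule: bpoly_induct)
  case (Var v p)
  then show ?case by (cases v) simp_all
qed simp_all

lemma swapY_YtoX [simp]: "swapY (YtoX p) = YtoX p"
proof (induction p rule: bpoly_induct)
  case (Var v p)
  then show ?case by (cases v) simp_all
qed simp_all

lemma YtoX_YtoX [simp]: "YtoX (YtoX p) = YtoX p"
proof (induction p rule: bpoly_induct)
  case (Var v p)
  then show ?case by (cases v) simp_all
qed simp_all

text \<open>Setting y = x first loses nothing. As the kernel of \<open>YtoX\<close> is
  \<open>JI\<close>, this makes \<open>XtoY\<close> well defined on classes modulo
  \<open>JI\<close>.\<close>

lemma XtoY_YtoX [simp]: "XtoY (YtoX p) = XtoY p"
proof (induction p rule: bpoly_induct)
  case (Var v p)
  then show ?case by (cases v) simp_all
qed simp_all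

section \<open>The Demazure operator\<close>

lemma y_minus_nonzero: "y_minus \<noteq> 0"
proof
  assume "y_minus = 0"
  then have "subst (\<lambda>v. if v = Y2 then 1 else 0) y_minus = 0" by simp
  then show False by (simp add: y_minus_def subst_hom)
qed

lemma Const_half: "2 * (Const (1/2) * p) = (p :: bpoly)"
proof -
  have "2 * Const (1/2) = Const (1/2 + 1/2)"
    by (simp only: mult_2 Const_add)
  then show ?thesis by (simp flip: mult.assoc)
qed

lemma bpoly_two_cancel: "2 * (p :: bpoly) = 2 * q \<longleftrightarrow> p = q"
proof
  assume "2 * p = 2 * q"
  then have "2 * (Const (1/2) * p) = 2 * (Const (1/2) * q)"
    by (simp only: mult.left_commute[of 2])
  then show "p = q" by (simp only: Const_half)
qed simp

text \<open>The difference for \<open>Var v * p\<close> is \<open>Var v\<close> times the difference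
  for \<open>p\<close>, plus the difference for \<open>Var v\<close> times \<open>swapY p\<close>;
  so divisibility spreads from the variables to all polynomials.\<close>

lemma dem_exists: "\<exists>r. p - swapY p = 2 * y_minus * r"
proof (induction p rule: bpoly_induct)
  case (Const c)
  then show ?case by (auto intro: exI[of _ 0])
next
  case (add p q)
  then obtain r s where "p - swapY p = 2 * y_minus * r" "q - swapY q = 2 * y_minus * s" by auto
  moreover have "(p + q) - swapY (p + q) = (p - swapY p) + (q - swapY q)"
    by simp
  ultimately have "(p + q) - swapY (p + q) = 2 * y_minus * (r + s)"
    by (simp only: semiring_class.distrib_left)
  then show ?case by blast
next
  case (Var v p)
  then obtain r where r: "p - swapY p = 2 * y_minus * r" by auto
  have "\<exists>r. Var v * p - swapY (Var v) * swapY p = 2 * y_minus * r"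
  proof -
    have *: "Var v * p - swapY (Var v) * swapY p =
        Var v * (p - swapY p) + (Var v - swapY (Var v)) * swapY p"
      by (simp add: algebra_simps)
    \<comment> \<open>The difference is 0 for the x-variables and \<open>y_minus\<close> up to sign
      for the y-variables, hence the quotient by \<open>2 * y_minus\<close> is 0 or plus or minus
      1/2.\<close>
    have "\<exists>s. Var v - swapY (Var v) = 2 * y_minus * s"
    proof (cases v)
      case Y1
      then show ?thesis
        by (intro exI[of _ "- Const (1/2)"]) (use Const_half[of "Var Y1 - Var Y2"] in \<open>simp add: y_minus_def algebra_simps\<close>)
    next
      case Y2
      then show ?thesis
        by (intro exI[of _ "Const (1/2)"]) (use Const_half[of "Var Y2 - Var Y1"] in \<open>simp add: y_minus_def algebra_simps\<close>)
    qed (auto intro: exI[of _ 0])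
    then obtain s where "Var v - swapY (Var v) = 2 * y_minus * s" by auto
    then have "Var v * p - swapY (Var v) * swapY p =
        Var v * (2 * y_minus * r) + (2 * y_minus * s) * swapY p"
      by (simp only: * r)
    then have "Var v * p - swapY (Var v) * swapY p = 2 * y_minus * (Var v * r + s * swapY p)"
      by (simp add: algebra_simps)
    then show ?thesis by blast
  qed
  then show ?case by simp
qed

text \<open>The Demazure operator of the transposition of \<open>y\<^sub>1\<close> and \<open>y\<^sub>2\<close>, normalised by \<open>dem y_minus = 1\<close>.\<close>

definition dem :: "bpoly \<Rightarrow> bpoly" where
  "dem p = (SOME r. p - swapY p = 2 * y_minus * r)"

lemma dem_spec: "p - swapY p = 2 * y_minus * dem p"
  unfolding dem_def by (rule someI_ex[OF dem_exists])

text \<open>\<open>2 * y_minus\<close> is not a zero divisor. Every rule for \<open>dem\<close>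
  below follows by exhibiting the quotient.\<close>

lemma dem_unique:
  assumes "p - swapY p = 2 * y_minus * r"
  shows "dem p = r"
proof -
  have "2 * (y_minus * dem p) = 2 * (y_minus * r)"
    using assms dem_spec[of p] by (simp add: mult.assoc)
  then show ?thesis
    using y_minus_nonzero by (simp only: bpoly_two_cancel mult_cancel_left) simp
qed

lemma dem_add: "dem (p + q) = dem p + dem q"
proof (rule dem_unique)
  have "(p + q) - swapY (p + q) = (p - swapY p) + (q - swapY q)"
    by simp
  then show "(p + q) - swapY (p + q) = 2 * y_minus * (dem p + dem q)"
    by (simp only: dem_spec semiring_class.distrib_left)
qed

text \<open>This twisted Leibniz rule is what makes the action on the triples of
  \<open>bcone\<close> associative.\<close>

lemma dem_mult: "dem (p * q) = dem p * q + swapY p * dem q"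
proof (rule dem_unique)
  have "p * q - swapY (p * q) = (p - swapY p) * q + swapY p * (q - swapY q)"
    by (simp add: algebra_simps)
  also have "\<dots> = 2 * y_minus * (dem p * q + swapY p * dem q)"
    by (simp add: dem_spec algebra_simps)
  finally show "p * q - swapY (p * q) = 2 * y_minus * (dem p * q + swapY p * dem q)" .
qed

lemma dem_swap_fixed: "swapY p = p \<Longrightarrow> dem p = 0"
  by (rule dem_unique) simp

lemma dem_simps [simp]: "dem 0 = 0" "dem 1 = 0" "dem (Const c) = 0" "dem (YtoX p) = 0"
  "dem (Var X1) = 0" "dem (Var X2) = 0" "dem x_minus = 0" "dem x_plus = 0" "dem y_plus = 0"
  by (rule dem_swap_fixed; simp add: x_minus_def x_plus_def y_plus_def)+

lemma dem_y_minus [simp]: "dem y_minus = 1"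
  by (rule dem_unique) (simp add: y_minus_def)

lemma dem_uminus: "dem (- p) = - dem p"
  using dem_add[of p "- p"] by (simp add: eq_neg_iff_add_eq_0 add.commute)

lemma dem_diff: "dem (p - q) = dem p - dem q"
  using dem_add[of p "- q"] by (simp add: dem_uminus)

lemmas dem_linear = dem_add dem_uminus dem_diff

lemma swapY_pm [simp]:
  "swapY x_minus = x_minus" "swapY x_plus = x_plus" "swapY y_plus = y_plus" "swapY y_minus = - y_minus"
  by (simp_all add: x_minus_def x_plus_def y_plus_def y_minus_def)

lemma XtoY_pm [simp]:
  "XtoY x_minus = y_minus" "XtoY x_plus = y_plus" "XtoY y_plus = y_plus" "XtoY y_minus = y_minus"
  by (simp_all add: x_minus_def x_plus_def y_plus_def y_minus_def)

lemma YtoX_pm [simp]: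
  "YtoX x_minus = x_minus" "YtoX x_plus = x_plus" "YtoX y_plus = x_plus" "YtoX y_minus = x_minus"
  by (simp_all add: x_minus_def x_plus_def y_plus_def y_minus_def)

lemma swapY_eq: "swapY p = p - 2 * y_minus * dem p"
  using dem_spec[of p] by (simp add: algebra_simps)

subsection \<open>Homogeneous components\<close>

definition mdeg :: "(bvar \<Rightarrow>\<^sub>0 nat) \<Rightarrow> int" where
  "mdeg \<mu> = 2 * int (\<Sum>v\<in>Poly_Mapping.keys \<mu>. Poly_Mapping.lookup \<mu> v)"

lemma homogeneous_iff: "homogeneous q p \<longleftrightarrow> (\<forall>\<mu>\<in>Poly_Mapping.keys p. mdeg \<mu> = q)"
  by (simp add: homogeneous_def mdeg_def)

lemma mdeg_UNIV: "mdeg \<mu> = 2 * int (\<Sum>v\<in>UNIV. Poly_Mapping.lookup \<mu> v)"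
  unfolding mdeg_def by (subst sum.mono_neutral_left[of UNIV]) (auto simp: in_keys_iff)

lemma mdeg_add: "mdeg (\<mu> + \<nu>) = mdeg \<mu> + mdeg \<nu>"
  by (simp add: mdeg_UNIV lookup_add sum.distrib)

text \<open>These parts become the projections that grade the cyclic bimodules; closure under them
  expresses that an ideal is homogeneous.\<close>

definition hpart :: "int \<Rightarrow> bpoly \<Rightarrow> bpoly" where
  "hpart q p = Abs_poly_mapping (\<lambda>\<mu>. Poly_Mapping.lookup p \<mu> when mdeg \<mu> = q)"

lemma lookup_hpart: "Poly_Mapping.lookup (hpart q p) \<mu> = (Poly_Mapping.lookup p \<mu> when mdeg \<mu> = q)"
proof -
  have "finite {\<mu>. (Poly_Mapping.lookup p \<mu> when mdeg \<mu> = q) \<noteq> 0}"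
    by (rule finite_subset[OF _ finite_lookup[of p]]) auto
  then show ?thesis by (simp add: hpart_def)
qed

lemma hpart_add: "hpart q (p + p') = hpart q p + hpart q p'"
  by (rule poly_mapping_eqI) (simp add: lookup_hpart lookup_add when_add_distrib)

lemma hpart_0 [simp]: "hpart q 0 = 0"
  by (rule poly_mapping_eqI) (simp add: lookup_hpart)

lemma hpart_uminus: "hpart q (- p) = - hpart q p"
  by (rule poly_mapping_eqI) (simp add: lookup_hpart when_uminus_distrib)

lemma hpart_diff: "hpart q (p - p') = hpart q p - hpart q p'"
  by (rule poly_mapping_eqI) (simp add: lookup_hpart lookup_minus when_diff_distrib)

lemma homogeneous_hpart [simp]: "homogeneous q (hpart q p)"
  by (auto simp: homogeneous_iff in_keys_iff lookup_hpart)

lemma hpart_homogeneous: "homogeneous q p \<Longrightarrow> hpart q' p = (if q = q' then p else 0)"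
  by (rule poly_mapping_eqI) (force simp: homogeneous_iff in_keys_iff lookup_hpart when_def)

lemma homogeneous_iff_hpart: "homogeneous q p \<longleftrightarrow> hpart q p = p"
  by (metis homogeneous_hpart hpart_homogeneous)

lemma homogeneous_0 [simp]: "homogeneous q 0"
  by (simp add: homogeneous_iff)

lemma homogeneous_add: "homogeneous q p \<Longrightarrow> homogeneous q p' \<Longrightarrow> homogeneous q (p + p')"
  by (simp add: homogeneous_iff_hpart hpart_add)

lemma homogeneous_uminus: "homogeneous q p \<Longrightarrow> homogeneous q (- p)"
  by (simp add: homogeneous_iff_hpart hpart_uminus)

lemma homogeneous_diff: "homogeneous q p \<Longrightarrow> homogeneous q p' \<Longrightarrow> homogeneous q (p - p')"
  by (simp add: homogeneous_iff_hpart hpart_diff)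

lemma homogeneous_mult: "homogeneous q p \<Longrightarrow> homogeneous q' p' \<Longrightarrow> homogeneous (q + q') (p * p')"
  unfolding homogeneous_iff using keys_mult[of p p'] by (fastforce simp: mdeg_add)

lemma homogeneous_Const [simp]: "homogeneous 0 (Const c)"
  by (auto simp: homogeneous_iff Const_def mdeg_def)

lemma homogeneous_1 [simp]: "homogeneous 0 1"
  using homogeneous_Const[of 1] by simp

lemma mdeg_single: "mdeg (Poly_Mapping.single v n) = 2 * int n"
  by (simp add: mdeg_UNIV lookup_single when_def)

lemma homogeneous_Var [simp]: "homogeneous 2 (Var v)"
  by (auto simp: homogeneous_iff Var_def mdeg_single)

lemma homogeneous_pm [simp]:
  "homogeneous 2 x_plus" "homogeneous 2 x_minus" "homogeneous 2 y_plus" "homogeneous 2 y_minus"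
  by (simp_all add: x_plus_def x_minus_def y_plus_def y_minus_def homogeneous_add homogeneous_diff)

lemma hpart_eqI:
  assumes "\<And>q. hpart q p = hpart q p'"
  shows "p = p'"
proof (rule poly_mapping_eqI)
  fix \<mu>
  show "Poly_Mapping.lookup p \<mu> = Poly_Mapping.lookup p' \<mu>"
    using arg_cong[OF assms[of "mdeg \<mu>"], of "\<lambda>p. Poly_Mapping.lookup p \<mu>"]
    by (simp add: lookup_hpart)
qed

lemma finite_hpart: "finite {q. hpart q p \<noteq> 0}"
proof (rule finite_subset)
  show "{q. hpart q p \<noteq> 0} \<subseteq> mdeg ` Poly_Mapping.keys p"
  proof
    fix q assume "q \<in> {q. hpart q p \<noteq> 0}"
    then obtain \<mu> where "Poly_Mapping.lookup (hpart q p) \<mu> \<noteq> 0"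
      by (auto simp: poly_mapping_eq_iff fun_eq_iff)
    then show "q \<in> mdeg ` Poly_Mapping.keys p"
      by (auto simp: lookup_hpart in_keys_iff)
  qed
qed simp

lemma hpart_sum: "hpart q (sum f A) = (\<Sum>x\<in>A. hpart q (f x))"
  by (induction A rule: infinite_finite_induct) (simp_all add: hpart_add)

lemma sum_hpart:
  assumes "finite A" "{q. hpart q p \<noteq> 0} \<subseteq> A"
  shows "(\<Sum>q\<in>A. hpart q p) = p"
proof (rule hpart_eqI)
  fix q
  have "hpart q (\<Sum>q\<in>A. hpart q p) = (\<Sum>r\<in>A. if q = r then hpart q p else 0)"
    by (simp add: hpart_sum hpart_homogeneous[OF homogeneous_hpart]) (rule sum.cong; simp)
  also have "\<dots> = hpart q p"
    using assms by (auto simp: sum.delta)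
  finally show "hpart q (\<Sum>q\<in>A. hpart q p) = hpart q p" .
qed

text \<open>Split \<open>a\<close> into its homogeneous parts: only the one of degree
  \<open>q - e\<close> reaches degree \<open>q\<close>. It yields that principal ideals with
  homogeneous generator are homogeneous, and that quotients by homogeneous polynomials are.\<close>

lemma hpart_mult:
  assumes "homogeneous e f"
  shows "hpart q (a * f) = hpart (q - e) a * f"
proof -
  have "a * f = (\<Sum>d\<in>{d. hpart d a \<noteq> 0}. hpart d a) * f"
    using sum_hpart[OF finite_hpart order_refl, of a] by simp
  then have "hpart q (a * f) = (\<Sum>d\<in>{d. hpart d a \<noteq> 0}. hpart q (hpart d a * f))"
    by (metis (no_types, lifting) hpart_sum sum.cong sum_distrib_right)
  also have "\<dots> = (\<Sum>d\<in>{d. hpart d a \<noteq> 0}. if d = q - e then hpart (q - e) a * f else 0)"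
    using hpart_homogeneous[OF homogeneous_mult[OF homogeneous_hpart assms]]
    by (intro sum.cong) auto
  also have "\<dots> = hpart (q - e) a * f"
    using finite_hpart[of a] by (auto simp: sum.delta)
  finally show ?thesis .
qed

lemma homogeneous_subst:
  assumes "\<And>v. homogeneous 2 (s v)"
  shows "homogeneous q p \<Longrightarrow> homogeneous q (subst s p)"
proof -
  have pow: "homogeneous (2 * int n) (s v ^ n)" for v n
    by (induction n) (use homogeneous_mult[OF assms] in \<open>auto simp: distrib_left\<close>)
  have pr: "homogeneous (2 * int (\<Sum>v\<in>A. f v)) (\<Prod>v\<in>A. s v ^ f v)" if "finite A" for A f
    using that
    by induction (use homogeneous_mult[OF pow] in \<open>auto simp: distrib_left\<close>)
  have m: "homogeneous (mdeg \<mu>) (Const c * (\<Prod>v\<in>UNIV. s v ^ Poly_Mapping.lookup \<mu> v))" for \<mu> c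
    using homogeneous_mult[OF homogeneous_Const pr[of UNIV "Poly_Mapping.lookup \<mu>"]]
    by (simp add: mdeg_UNIV)
  have sm: "homogeneous q (sum f A)" if "\<And>x. x \<in> A \<Longrightarrow> homogeneous q (f x)" for f and A :: "(bvar \<Rightarrow>\<^sub>0 nat) set"
    using that by (induction A rule: infinite_finite_induct) (auto intro: homogeneous_add)
  show "homogeneous q p \<Longrightarrow> homogeneous q (subst s p)"
    unfolding subst_def by (rule sm) (use m in \<open>auto simp: homogeneous_iff\<close>)
qed

lemma homogeneous_substs:
  assumes "homogeneous q p"
  shows "homogeneous q (swapY p)" "homogeneous q (XtoY p)" "homogeneous q (YtoX p)"
  unfolding swapY_def XtoY_def YtoX_def
  by (rule homogeneous_subst; use assms in \<open>auto split: bvar.split\<close>)+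

text \<open>The product of \<open>dem p\<close> with the homogeneous polynomial
  \<open>2 * y_minus\<close> is homogeneous; comparing parts and cancelling gives the claim.\<close>

lemma homogeneous_dem:
  assumes "homogeneous q p"
  shows "homogeneous (q - 2) (dem p)"
proof -
  have "homogeneous q (p - swapY p)"
    using assms by (intro homogeneous_diff homogeneous_substs)
  then have "hpart q (dem p * (2 * y_minus)) = dem p * (2 * y_minus)"
    by (simp only: dem_spec homogeneous_iff_hpart mult_ac)
  moreover have "homogeneous 2 (2 * y_minus)"
    unfolding mult_2 by (simp only: homogeneous_add homogeneous_pm)
  ultimately have "hpart (q - 2) (dem p) * (2 * y_minus) = dem p * (2 * y_minus)"
    by (simp only: hpart_mult)
  moreover have "2 * y_minus \<noteq> 0"
    using y_minus_nonzero bpoly_two_cancel[of y_minus 0] by (simp only: mult_zero_right not_False_eq_True)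
  ultimately have "hpart (q - 2) (dem p) = dem p"
    by (metis mult_right_cancel)
  then show ?thesis
    by (simp only: homogeneous_iff_hpart)
qed

section \<open>Filtered graded modules\<close>

lemma QXY_simps [simp]:
  "carrier QXY = UNIV" "x \<otimes>\<^bsub>QXY\<^esub> y = x * y" "\<one>\<^bsub>QXY\<^esub> = 1" "\<zero>\<^bsub>QXY\<^esub> = 0" "x \<oplus>\<^bsub>QXY\<^esub> y = x + y"
  by (simp_all add: QXY_def)

lemma cring_QXY: "cring QXY"
proof (rule cringI)
  show "abelian_group QXY"
    by (rule abelian_groupI) (auto simp: algebra_simps intro: exI[of _ "- x" for x])
  show "comm_monoid QXY"
    by (rule comm_monoidI) (auto simp: mult_ac)
qed (auto simp: algebra_simps)

text \<open>Here the grading is given by projections \<open>\<pi>\<close> instead of unique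
  decompositions. Each axiom becomes a closure property or an equation, which can be checked
  separately for shifts, quotients and cones. The two presentations are equivalent, by
  \<open>fgm.fgmod\<close> and \<open>fgmod.fgm\<close>.\<close>

locale fgm =
  fixes M :: "('u, 'm) fgmod_scheme" (structure) and \<pi> :: "int \<times> int \<Rightarrow> 'u \<Rightarrow> 'u"
  assumes zero_closed: "\<zero> \<in> carrier M"
    and add_closed: "\<And>x y. x \<in> carrier M \<Longrightarrow> y \<in> carrier M \<Longrightarrow> x \<oplus> y \<in> carrier M"
    and add_assoc: "\<And>x y z. x \<in> carrier M \<Longrightarrow> y \<in> carrier M \<Longrightarrow> z \<in> carrier M \<Longrightarrow>
      (x \<oplus> y) \<oplus> z = x \<oplus> (y \<oplus> z)"
    and add_comm: "\<And>x y. x \<in> carrier M \<Longrightarrow> y \<in> carrier M \<Longrightarrow> x \<oplus> y = y \<oplus> x"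
    and zero_add: "\<And>x. x \<in> carrier M \<Longrightarrow> \<zero> \<oplus> x = x"
    and neg_ex: "\<And>x. x \<in> carrier M \<Longrightarrow> \<exists>y\<in>carrier M. y \<oplus> x = \<zero>"
    and smult_closed: "\<And>p x. x \<in> carrier M \<Longrightarrow> p \<odot> x \<in> carrier M"
    and smult_ladd: "\<And>p q x. x \<in> carrier M \<Longrightarrow> (p + q) \<odot> x = p \<odot> x \<oplus> q \<odot> x"
    and smult_radd: "\<And>p x y. x \<in> carrier M \<Longrightarrow> y \<in> carrier M \<Longrightarrow> p \<odot> (x \<oplus> y) = p \<odot> x \<oplus> p \<odot> y"
    and smult_mult: "\<And>p q x. x \<in> carrier M \<Longrightarrow> (p * q) \<odot> x = p \<odot> (q \<odot> x)"
    and smult_one: "\<And>x. x \<in> carrier M \<Longrightarrow> 1 \<odot> x = x"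
    and piece_carrier: "\<And>a q x. x \<in> piece M a q \<Longrightarrow> x \<in> carrier M"
    and zero_piece: "\<And>a q. \<zero> \<in> piece M a q"
    and add_piece: "\<And>a q x y. x \<in> piece M a q \<Longrightarrow> y \<in> piece M a q \<Longrightarrow> x \<oplus> y \<in> piece M a q"
    and smult_piece: "\<And>e p a q x. homogeneous e p \<Longrightarrow> x \<in> piece M a q \<Longrightarrow> p \<odot> x \<in> piece M a (q + e)"
    and filt_carrier: "\<And>p x. x \<in> filt M p \<Longrightarrow> x \<in> carrier M"
    and zero_filt: "\<And>p. \<zero> \<in> filt M p"
    and add_filt: "\<And>p x y. x \<in> filt M p \<Longrightarrow> y \<in> filt M p \<Longrightarrow> x \<oplus> y \<in> filt M p"
    and smult_filt: "\<And>p r x. x \<in> filt M p \<Longrightarrow> r \<odot> x \<in> filt M p"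
    and filt_Suc: "\<And>p x. x \<in> filt M (p + 1) \<Longrightarrow> x \<in> filt M p"
    and proj_piece: "\<And>a q x. x \<in> carrier M \<Longrightarrow> \<pi> (a, q) x \<in> piece M a q"
    and proj_add: "\<And>g x y. x \<in> carrier M \<Longrightarrow> y \<in> carrier M \<Longrightarrow> \<pi> g (x \<oplus> y) = \<pi> g x \<oplus> \<pi> g y"
    and proj_same: "\<And>a q x. x \<in> piece M a q \<Longrightarrow> \<pi> (a, q) x = x"
    and proj_other: "\<And>a q g x. x \<in> piece M a q \<Longrightarrow> g \<noteq> (a, q) \<Longrightarrow> \<pi> g x = \<zero>"
    and proj_finite: "\<And>x. x \<in> carrier M \<Longrightarrow> finite {g. \<pi> g x \<noteq> \<zero>}"
    and proj_zero: "\<And>x. x \<in> carrier M \<Longrightarrow> (\<And>g. \<pi> g x = \<zero>) \<Longrightarrow> x = \<zero>"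
    and proj_filt: "\<And>p g x. x \<in> filt M p \<Longrightarrow> \<pi> g x \<in> filt M p"

lemma module_QXY_I:
  fixes M (structure)
  assumes "\<zero> \<in> carrier M"
    and "\<And>x y. x \<in> carrier M \<Longrightarrow> y \<in> carrier M \<Longrightarrow> x \<oplus> y \<in> carrier M"
    and "\<And>x y z. x \<in> carrier M \<Longrightarrow> y \<in> carrier M \<Longrightarrow> z \<in> carrier M \<Longrightarrow>
      (x \<oplus> y) \<oplus> z = x \<oplus> (y \<oplus> z)"
    and "\<And>x y. x \<in> carrier M \<Longrightarrow> y \<in> carrier M \<Longrightarrow> x \<oplus> y = y \<oplus> x"
    and "\<And>x. x \<in> carrier M \<Longrightarrow> \<zero> \<oplus> x = x"
    and "\<And>x. x \<in> carrier M \<Longrightarrow> \<exists>y\<in>carrier M. y \<oplus> x = \<zero>"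
    and "\<And>p x. x \<in> carrier M \<Longrightarrow> p \<odot> x \<in> carrier M"
    and "\<And>p q x. x \<in> carrier M \<Longrightarrow> (p + q) \<odot> x = p \<odot> x \<oplus> q \<odot> x"
    and "\<And>p x y. x \<in> carrier M \<Longrightarrow> y \<in> carrier M \<Longrightarrow> p \<odot> (x \<oplus> y) = p \<odot> x \<oplus> p \<odot> y"
    and "\<And>p q x. x \<in> carrier M \<Longrightarrow> (p * q) \<odot> x = p \<odot> (q \<odot> x)"
    and "\<And>x. x \<in> carrier M \<Longrightarrow> 1 \<odot> x = x"
  shows "module QXY M"
  by (rule moduleI[OF cring_QXY]; (rule abelian_groupI)?) (use assms in auto)

context fgm
begin

lemma module_QXY: "module QXY M"
  by (rule module_QXY_I)
     (fact zero_closed add_closed add_assoc add_comm zero_add neg_ex smult_closed smult_ladd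
       smult_radd smult_mult smult_one)+

sublocale module QXY M
  by (rule module_QXY)

lemma neg_eq_smult: "x \<in> carrier M \<Longrightarrow> \<ominus> x = (-1) \<odot> x"
proof -
  assume x: "x \<in> carrier M"
  have "(-1) \<odot> x \<oplus> x = ((-1) + 1) \<odot> x"
    using smult_ladd[OF x, of "-1" 1] smult_one[OF x] by simp
  also have "\<dots> = \<zero>"
    using smult_l_null[OF x] by simp
  finally show ?thesis
    using x by (intro M.minus_equality) (auto simp: smult_closed)
qed

lemma neg_piece: "x \<in> piece M a q \<Longrightarrow> \<ominus> x \<in> piece M a q"
  using smult_piece[OF homogeneous_uminus[OF homogeneous_1]] neg_eq_smult[OF piece_carrier]
  by simp

lemma neg_filt: "x \<in> filt M p \<Longrightarrow> \<ominus> x \<in> filt M p"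
  using smult_filt neg_eq_smult[OF filt_carrier] by simp

lemma proj_closed: "x \<in> carrier M \<Longrightarrow> \<pi> g x \<in> carrier M"
  using proj_piece[of x "fst g" "snd g"] piece_carrier by simp

lemma proj_0: "\<pi> g \<zero> = \<zero>"
  using proj_same[OF zero_piece] by (cases g) auto

lemma proj_finsum:
  assumes "finite A" "\<And>h. h \<in> A \<Longrightarrow> c h \<in> carrier M"
  shows "\<pi> g (finsum M c A) = finsum M (\<lambda>h. \<pi> g (c h)) A"
  using assms
proof (induction rule: finite_induct)
  case (insert h A)
  then show ?case
    by (simp add: Pi_def proj_add proj_closed finsum_closed)
qed (simp add: proj_0)

text \<open>Applying a projection to the sum leaves a single summand; this gives the uniqueness of
  decompositions.\<close>

lemma decomposes_proj:
  assumes "decomposes M c x"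
  shows "c g = \<pi> g x"
proof -
  let ?S = "{g. c g \<noteq> \<zero>}"
  have p: "c (a, q) \<in> piece M a q" for a q using assms by (simp add: decomposes_def)
  have fin: "finite ?S" and x: "x = finsum M c ?S" using assms by (auto simp: decomposes_def)
  have c: "c h \<in> carrier M" for h
    using p[of "fst h" "snd h"] piece_carrier by simp
  have "\<pi> g x = finsum M (\<lambda>h. \<pi> g (c h)) ?S"
    unfolding x by (rule proj_finsum[OF fin c])
  also have "\<dots> = finsum M (\<lambda>h. if g = h then c h else \<zero>) ?S"
  proof (rule M.finsum_cong')
    fix h assume "h \<in> ?S"
    show "\<pi> g (c h) = (if g = h then c h else \<zero>)"
      using proj_same[OF p] proj_other[OF p] by (cases h) auto
  qed (use c in auto)
  also have "\<dots> = c g"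
  proof (cases "g \<in> ?S")
    case True
    then show ?thesis using fin c by (simp add: M.finsum_singleton Pi_def)
  next
    case False
    then have "finsum M (\<lambda>h. if g = h then c h else \<zero>) ?S = finsum M (\<lambda>h. \<zero>) ?S"
      by (intro M.finsum_cong') auto
    then show ?thesis using False by simp
  qed
  finally show ?thesis by simp
qed

text \<open>The element minus the sum of its projections has all projections zero, so it vanishes by
  \<open>proj_zero\<close>.\<close>

lemma proj_decomposes:
  assumes x: "x \<in> carrier M"
  shows "decomposes M (\<lambda>g. \<pi> g x) x"
proof -
  let ?S = "{g. \<pi> g x \<noteq> \<zero>}"
  let ?y = "finsum M (\<lambda>g. \<pi> g x) ?S"
  have fin: "finite ?S" by (rule proj_finite[OF x])
  have y: "?y \<in> carrier M" using x by (intro finsum_closed) (auto simp: proj_closed)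
  have d: "\<pi> g ?y = \<pi> g x" for g
  proof -
    have "decomposes M (\<lambda>g. \<pi> g x) ?y"
      using fin proj_piece[OF x] by (simp add: decomposes_def)
    then show ?thesis using decomposes_proj by metis
  qed
  have "x \<oplus> \<ominus> ?y = \<zero>"
  proof (rule proj_zero)
    fix g
    have n: "\<pi> g (\<ominus> ?y) = \<ominus> \<pi> g ?y"
      using proj_add[of ?y "\<ominus> ?y" g] y proj_0 proj_closed
      by (simp add: M.r_neg) (metis M.a_inv_closed M.minus_equality M.a_comm)
    show "\<pi> g (x \<oplus> \<ominus> ?y) = \<zero>"
      using x y by (simp add: proj_add n d proj_closed M.r_neg)
  qed (use x y in simp)
  then have "x = ?y"
    using x y by (metis M.minus_equality M.minus_minus M.a_inv_closed)
  then show ?thesis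
    using fin proj_piece[OF x] by (simp add: decomposes_def)
qed

lemma subgroup_add:
  assumes "H \<subseteq> carrier M" "\<zero> \<in> H" "\<And>x y. x \<in> H \<Longrightarrow> y \<in> H \<Longrightarrow> x \<oplus> y \<in> H"
    "\<And>x. x \<in> H \<Longrightarrow> \<ominus> x \<in> H"
  shows "subgroup H (add_monoid M)"
  using assms by (intro subgroup.intro) (auto simp: a_inv_def)

lemma fgmod: "fgmod M"
proof (intro fgmod.intro module_QXY fgmod_axioms.intro)
  show "subgroup (piece M a q) (add_monoid M)" for a q
    by (rule subgroup_add) (auto intro: piece_carrier zero_piece add_piece neg_piece)
  show "\<exists>!c. decomposes M c x" if "x \<in> carrier M" for x
    using proj_decomposes[OF that] decomposes_proj by (intro ex1I) auto
  show "submodule (filt M p) QXY M" for p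
    by (intro submodule.intro subgroup_add submodule_axioms.intro)
       (auto intro: filt_carrier zero_filt add_filt neg_filt smult_filt)
  show "c g \<in> filt M p" if "x \<in> filt M p" "decomposes M c x" for x c g p
    using proj_filt[OF that(1)] decomposes_proj[OF that(2)] by simp
qed (auto intro: smult_piece filt_Suc)

end

context fgmod
begin

lemma decomposesI:
  assumes "\<And>a q. c (a, q) \<in> piece M a q" "finite A" "\<And>g. g \<notin> A \<Longrightarrow> c g = \<zero>"
    "x = finsum M c A"
  shows "decomposes M c x"
proof -
  have c: "c h \<in> carrier M" for h
    using assms(1)[of "fst h" "snd h"] subgroup.subset[OF piece_subgroup] by auto
  have "finsum M c A = finsum M c {g. c g \<noteq> \<zero>}"
    by (rule M.add.finprod_mono_neutral_cong_right) (use assms c in auto)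
  moreover have "finite {g. c g \<noteq> \<zero>}"
    by (rule finite_subset[OF _ assms(2)]) (use assms(3) in auto)
  ultimately show ?thesis
    using assms by (simp add: decomposes_def)
qed

lemma piece_closed: "x \<in> piece M a q \<Longrightarrow> x \<in> carrier M"
  using subgroup.subset[OF piece_subgroup] by auto

lemma piece_zero: "\<zero> \<in> piece M a q"
  using subgroup.one_closed[OF piece_subgroup] by simp

lemma piece_add: "x \<in> piece M a q \<Longrightarrow> y \<in> piece M a q \<Longrightarrow> x \<oplus> y \<in> piece M a q"
  using subgroup.m_closed[OF piece_subgroup] by simp

lemma filt_closed: "x \<in> filt M p \<Longrightarrow> x \<in> carrier M"
  using subgroup.subset[OF submodule.axioms(1)[OF filt_submodule]] by auto

lemma filt_zero: "\<zero> \<in> filt M p"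
  using subgroup.one_closed[OF submodule.axioms(1)[OF filt_submodule]] by simp

lemma filt_add: "x \<in> filt M p \<Longrightarrow> y \<in> filt M p \<Longrightarrow> x \<oplus> y \<in> filt M p"
  using subgroup.m_closed[OF submodule.axioms(1)[OF filt_submodule]] by simp

lemma filt_smult: "x \<in> filt M p \<Longrightarrow> r \<odot> x \<in> filt M p"
  using submodule.smult_closed[OF filt_submodule] by simp

lemma filt_mono: "x \<in> filt M p \<Longrightarrow> p' \<le> p \<Longrightarrow> x \<in> filt M p'"
proof (induction "nat (p - p')" arbitrary: p)
  case (Suc n)
  then have "x \<in> filt M (p - 1)" using filt_decreasing[of "p - 1"] by auto
  then show ?case using Suc by (intro Suc.hyps(1)[of "p - 1"]) auto
qed simp

lemma neg_eq_smult: "x \<in> carrier M \<Longrightarrow> \<ominus> x = (-1) \<odot> x"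
proof -
  assume x: "x \<in> carrier M"
  have "(-1) \<odot> x \<oplus> x = ((-1) + 1) \<odot> x"
    using x smult_l_distr[of "-1" 1 x] smult_one[of x] by simp
  also have "\<dots> = \<zero>"
    using smult_l_null[OF x] by simp
  finally show ?thesis
    using x smult_closed by (intro M.minus_equality) auto
qed

lemma piece_neg: "x \<in> piece M a q \<Longrightarrow> \<ominus> x \<in> piece M a q"
  using subgroup.m_inv_closed[OF piece_subgroup] by (simp add: a_inv_def)

lemma filt_neg: "x \<in> filt M p \<Longrightarrow> \<ominus> x \<in> filt M p"
  using filt_smult neg_eq_smult[OF filt_closed] by simp

definition component :: "int \<times> int \<Rightarrow> 'a \<Rightarrow> 'a" where
  "component g x = (THE c. decomposes M c x) g"

lemma decomposes_component:
  assumes "decomposes M c x" "x \<in> carrier M"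
  shows "component g x = c g"
proof -
  have "(THE c. decomposes M c x) = c"
    using direct_sum[OF assms(2)] assms(1) by (intro the1_equality)
  then show ?thesis by (simp add: component_def)
qed

lemma component_decomposes:
  assumes "x \<in> carrier M"
  shows "decomposes M (\<lambda>g. component g x) x"
proof -
  from direct_sum[OF assms] obtain c where c: "decomposes M c x" by auto
  then have "(\<lambda>g. component g x) = c"
    using decomposes_component assms by blast
  with c show ?thesis by simp
qed

text \<open>The components of the unique decomposition are the projections. Their additivity holds
  because the sum of two decompositions decomposes the sum.\<close>

lemma fgm: "fgm M component"
proof
  show 1: "component (a, q) x \<in> piece M a q" if "x \<in> carrier M" for a q x
    using component_decomposes[OF that] by (auto simp: decomposes_def)
  show "component g (x \<oplus> y) = component g x \<oplus> component g y"
    if x: "x \<in> carrier M" and y: "y \<in> carrier M" for g x y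
  proof -
    from direct_sum[OF x] obtain c where c: "decomposes M c x" by auto
    from direct_sum[OF y] obtain d where d: "decomposes M d y" by auto
    \<comment> \<open>Both decompositions are first rewritten as sums over this common finite
      support.\<close>
    let ?A = "{g. c g \<noteq> \<zero>} \<union> {g. d g \<noteq> \<zero>}"
    have cc: "c h \<in> carrier M" and dd: "d h \<in> carrier M" for h
      using c d piece_closed unfolding decomposes_def by (metis surj_pair)+
    have fin: "finite ?A" using c d by (auto simp: decomposes_def)
    have "x = finsum M c {g. c g \<noteq> \<zero>}" "y = finsum M d {g. d g \<noteq> \<zero>}"
      using c d by (auto simp: decomposes_def)
    moreover have "finsum M c {g. c g \<noteq> \<zero>} = finsum M c ?A"
      "finsum M d {g. d g \<noteq> \<zero>} = finsum M d ?A"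
      by (rule M.add.finprod_mono_neutral_cong_left; use fin cc dd in \<open>auto simp: Pi_def\<close>)+
    ultimately have "x \<oplus> y = finsum M (\<lambda>g. c g \<oplus> d g) ?A"
      using cc dd by (simp add: M.finsum_addf Pi_def)
    then have "decomposes M (\<lambda>g. c g \<oplus> d g) (x \<oplus> y)"
      using fin c d by (intro decomposesI[of _ ?A]) (auto simp: decomposes_def piece_add)
    then show ?thesis
      using decomposes_component[OF c x] decomposes_component[OF d y] x y
      by (subst decomposes_component) auto
  qed
  have sing: "component g x = (if g = (a, q) then x else \<zero>)" if "x \<in> piece M a q" for g a q x
  proof -
    have "decomposes M (\<lambda>g. if g = (a, q) then x else \<zero>) x"
      using that piece_zero piece_closed[OF that] by (intro decomposesI[of _ "{(a, q)}"]) (auto simp: Pi_def)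
    then show ?thesis using decomposes_component piece_closed[OF that] by simp
  qed
  show "component (a, q) x = x" if "x \<in> piece M a q" for a q x
    using sing[OF that] by simp
  show "component g x = \<zero>" if "x \<in> piece M a q" "g \<noteq> (a, q)" for g a q x
    using sing[OF that(1)] that(2) by simp
  show "finite {g. component g x \<noteq> \<zero>}" if "x \<in> carrier M" for x
    using component_decomposes[OF that] by (auto simp: decomposes_def)
  show "x = \<zero>" if "x \<in> carrier M" "\<And>g. component g x = \<zero>" for x
    using component_decomposes[OF that(1)] that(2) by (auto simp: decomposes_def)
  show "component g x \<in> filt M p" if "x \<in> filt M p" for p g x
    by (rule filt_graded[OF that component_decomposes[OF filt_closed[OF that]]])
  show "(p + q) \<odot> x = p \<odot> x \<oplus> q \<odot> x" if "x \<in> carrier M" for p q x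
    using smult_l_distr[of p q x] that by simp
  show "(p * q) \<odot> x = p \<odot> (q \<odot> x)" if "x \<in> carrier M" for p q x
    using smult_assoc1[of p q x] that by simp
  show "\<exists>y\<in>carrier M. y \<oplus> x = \<zero>" if "x \<in> carrier M" for x
    using that by (intro bexI[of _ "\<ominus> x"]) (auto simp: M.l_neg)
  show "x \<in> filt M p" if "x \<in> filt M (p + 1)" for p x
    using that filt_decreasing by auto
  show "1 \<odot> x = x" if "x \<in> carrier M" for x
    using smult_one[OF that] by simp
  show "p \<odot> (x \<oplus> y) = p \<odot> x \<oplus> p \<odot> y" if "x \<in> carrier M" "y \<in> carrier M" for p x y
    using smult_r_distr[of p x y] that by simp
qed (auto simp: M.a_ac intro: piece_closed piece_zero piece_add piece_smult filt_closed filt_zero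
    filt_add filt_smult)

end

text \<open>The source is an arbitrary structure, so the closure conditions are part of the notion.
  This allows the module axioms to be pulled back from \<open>N\<close>; for a direct sum of tensor
  products they are obtained in this way and not verified by hand.\<close>

definition fgiso :: "('u, 'm) fgmod_scheme \<Rightarrow> ('v, 'n) fgmod_scheme \<Rightarrow> ('u \<Rightarrow> 'v) \<Rightarrow> bool" where
  "fgiso M N f \<longleftrightarrow> bij_betw f (carrier M) (carrier N) \<and>
     \<zero>\<^bsub>M\<^esub> \<in> carrier M \<and> f \<zero>\<^bsub>M\<^esub> = \<zero>\<^bsub>N\<^esub> \<and>
     (\<forall>x\<in>carrier M. \<forall>y\<in>carrier M. x \<oplus>\<^bsub>M\<^esub> y \<in> carrier M \<and> f (x \<oplus>\<^bsub>M\<^esub> y) = f x \<oplus>\<^bsub>N\<^esub> f y) \<and>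
     (\<forall>p. \<forall>x\<in>carrier M. p \<odot>\<^bsub>M\<^esub> x \<in> carrier M \<and> f (p \<odot>\<^bsub>M\<^esub> x) = p \<odot>\<^bsub>N\<^esub> f x) \<and>
     (\<forall>a q. piece M a q \<subseteq> carrier M) \<and> (\<forall>p. filt M p \<subseteq> carrier M) \<and>
     (\<forall>a q. \<forall>x\<in>carrier M. x \<in> piece M a q \<longleftrightarrow> f x \<in> piece N a q) \<and>
     (\<forall>p. \<forall>x\<in>carrier M. x \<in> filt M p \<longleftrightarrow> f x \<in> filt N p)"

lemma fgiso_fgmod:
  assumes iso: "fgiso M N f" and "fgmod N"
  shows "fgmod M"
proof -
  interpret N: fgmod N by fact
  interpret P: fgm N N.component by (rule N.fgm)
  let ?g = "inv_into (carrier M) f"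
  have bij: "bij_betw f (carrier M) (carrier N)"
    and z: "\<zero>\<^bsub>M\<^esub> \<in> carrier M" "f \<zero>\<^bsub>M\<^esub> = \<zero>\<^bsub>N\<^esub>"
    and ad: "\<And>x y. x \<in> carrier M \<Longrightarrow> y \<in> carrier M \<Longrightarrow> x \<oplus>\<^bsub>M\<^esub> y \<in> carrier M"
      "\<And>x y. x \<in> carrier M \<Longrightarrow> y \<in> carrier M \<Longrightarrow> f (x \<oplus>\<^bsub>M\<^esub> y) = f x \<oplus>\<^bsub>N\<^esub> f y"
    and sm: "\<And>p x. x \<in> carrier M \<Longrightarrow> p \<odot>\<^bsub>M\<^esub> x \<in> carrier M"
      "\<And>p x. x \<in> carrier M \<Longrightarrow> f (p \<odot>\<^bsub>M\<^esub> x) = p \<odot>\<^bsub>N\<^esub> f x"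
    and pc: "\<And>x a q. x \<in> piece M a q \<longleftrightarrow> x \<in> carrier M \<and> f x \<in> piece N a q"
    and fl: "\<And>x p. x \<in> filt M p \<longleftrightarrow> x \<in> carrier M \<and> f x \<in> filt N p"
    using iso unfolding fgiso_def by blast+
  have fc: "x \<in> carrier M \<Longrightarrow> f x \<in> carrier N" for x
    using bij by (auto simp: bij_betw_def)
  have gc: "y \<in> carrier N \<Longrightarrow> ?g y \<in> carrier M" for y
    using bij by (auto simp: bij_betw_def inv_into_into)
  have fg: "y \<in> carrier N \<Longrightarrow> f (?g y) = y" for y
    using bij by (auto simp: bij_betw_def f_inv_into_f)
  have inj: "x = y" if "f x = f y" "x \<in> carrier M" "y \<in> carrier M" for x y
    using bij that by (auto simp: bij_betw_def inj_on_def)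
  have gzero: "?g y = \<zero>\<^bsub>M\<^esub> \<longleftrightarrow> y = \<zero>\<^bsub>N\<^esub>" if "y \<in> carrier N" for y
    using fg[OF that] gc[OF that] z inj by metis
  have pcl: "N.component g (f x) \<in> carrier N" if "x \<in> carrier M" for g x
    using P.proj_closed[OF fc[OF that]] .
  have "fgm M (\<lambda>g x. ?g (N.component g (f x)))"
  proof
    show "\<exists>y\<in>carrier M. y \<oplus>\<^bsub>M\<^esub> x = \<zero>\<^bsub>M\<^esub>" if "x \<in> carrier M" for x
    proof (intro bexI)
      show "?g (\<ominus>\<^bsub>N\<^esub> f x) \<oplus>\<^bsub>M\<^esub> x = \<zero>\<^bsub>M\<^esub>"
        by (rule inj) (use that in \<open>auto simp: ad z fg gc fc N.M.l_neg\<close>)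
    qed (use that fc gc in auto)
    show "x \<oplus>\<^bsub>M\<^esub> y \<oplus>\<^bsub>M\<^esub> w = x \<oplus>\<^bsub>M\<^esub> (y \<oplus>\<^bsub>M\<^esub> w)"
      if "x \<in> carrier M" "y \<in> carrier M" "w \<in> carrier M" for x y w
      by (rule inj) (use that in \<open>auto simp: ad fc N.M.a_assoc\<close>)
    show "x \<oplus>\<^bsub>M\<^esub> y = y \<oplus>\<^bsub>M\<^esub> x" if "x \<in> carrier M" "y \<in> carrier M" for x y
      by (rule inj) (use that in \<open>auto simp: ad fc N.M.a_comm\<close>)
    show "\<zero>\<^bsub>M\<^esub> \<oplus>\<^bsub>M\<^esub> x = x" if "x \<in> carrier M" for x
      by (rule inj) (use that in \<open>auto simp: ad z fc\<close>)
    show "(p + q) \<odot>\<^bsub>M\<^esub> x = p \<odot>\<^bsub>M\<^esub> x \<oplus>\<^bsub>M\<^esub> q \<odot>\<^bsub>M\<^esub> x" if "x \<in> carrier M" for p q x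
      by (rule inj) (use that in \<open>auto simp: ad sm fc P.smult_ladd\<close>)
    show "(p * q) \<odot>\<^bsub>M\<^esub> x = p \<odot>\<^bsub>M\<^esub> (q \<odot>\<^bsub>M\<^esub> x)" if "x \<in> carrier M" for p q x
      by (rule inj) (use that in \<open>auto simp: sm fc P.smult_mult\<close>)
    show "1 \<odot>\<^bsub>M\<^esub> x = x" if "x \<in> carrier M" for x
      by (rule inj) (use that in \<open>auto simp: sm fc P.smult_one\<close>)
    show "p \<odot>\<^bsub>M\<^esub> (x \<oplus>\<^bsub>M\<^esub> y) = p \<odot>\<^bsub>M\<^esub> x \<oplus>\<^bsub>M\<^esub> p \<odot>\<^bsub>M\<^esub> y" if "x \<in> carrier M" "y \<in> carrier M" for p x y
      by (rule inj) (use that in \<open>auto simp: ad sm fc P.smult_radd\<close>)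
    show "?g (N.component (a, q) (f x)) \<in> piece M a q" if "x \<in> carrier M" for a q x
      using that pcl[OF that] P.proj_piece[OF fc[OF that]] by (auto simp: pc fg gc)
    show "?g (N.component g (f (x \<oplus>\<^bsub>M\<^esub> y))) =
        ?g (N.component g (f x)) \<oplus>\<^bsub>M\<^esub> ?g (N.component g (f y))"
      if "x \<in> carrier M" "y \<in> carrier M" for g x y
      by (rule inj) (use that pcl in \<open>auto simp: ad fg gc fc P.proj_add\<close>)
    show "?g (N.component (a, q) (f x)) = x" if "x \<in> piece M a q" for a q x
      by (rule inj) (use that pcl in \<open>auto simp: pc fg gc fc P.proj_same\<close>)
    show "?g (N.component g (f x)) = \<zero>\<^bsub>M\<^esub>" if "x \<in> piece M a q" "g \<noteq> (a, q)" for g a q x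
      using that P.proj_other[of "f x" a q g] pcl by (auto simp: pc gzero)
    show "finite {g. ?g (N.component g (f x)) \<noteq> \<zero>\<^bsub>M\<^esub>}" if "x \<in> carrier M" for x
      using P.proj_finite[OF fc[OF that]] gzero[OF pcl[OF that]] by simp
    show "x = \<zero>\<^bsub>M\<^esub>" if x: "x \<in> carrier M" and "\<And>g. ?g (N.component g (f x)) = \<zero>\<^bsub>M\<^esub>" for x
    proof (rule inj)
      have "N.component g (f x) = \<zero>\<^bsub>N\<^esub>" for g
        using that(2)[of g] gzero[OF pcl[OF x]] by simp
      then show "f x = f \<zero>\<^bsub>M\<^esub>" using P.proj_zero[OF fc[OF x]] z by simp
    qed (use x z in auto)
    show "?g (N.component g (f x)) \<in> filt M p" if "x \<in> filt M p" for p g x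
      using that P.proj_filt[of "f x" p g] pcl by (auto simp: fl fg gc)
    show "p \<odot>\<^bsub>M\<^esub> x \<in> piece M a (q + e)" if "homogeneous e p" "x \<in> piece M a q" for e p a q x
      using that P.smult_piece by (auto simp: pc sm)
  qed (auto simp: z ad sm pc fl intro: P.zero_piece P.add_piece P.zero_filt
      P.add_filt P.smult_filt P.filt_Suc)
  then show ?thesis by (rule fgm.fgmod)
qed

lemma shift_simps [simp]:
  "carrier (shift m k n M) = carrier M" "\<zero>\<^bsub>shift m k n M\<^esub> = \<zero>\<^bsub>M\<^esub>"
  "x \<oplus>\<^bsub>shift m k n M\<^esub> y = x \<oplus>\<^bsub>M\<^esub> y" "p \<odot>\<^bsub>shift m k n M\<^esub> x = p \<odot>\<^bsub>M\<^esub> x"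
  "piece (shift m k n M) a q = piece M (a - m) (q - n)"
  "filt (shift m k n M) i = filt M (i - k)"
  by (simp_all add: shift_def)

lemma fgmod_shift:
  assumes "fgmod M"
  shows "fgmod (shift m k n M)"
proof -
  interpret fgmod M by fact
  interpret P: fgm M component by (rule fgm)
  have "fgm (shift m k n M) (\<lambda>g. component (fst g - m, snd g - n))"
  proof
    show "x \<in> filt (shift m k n M) p" if "x \<in> filt (shift m k n M) (p + 1)" for p x
      using P.filt_Suc[of x "p - k"] that by (simp add: algebra_simps)
    show "p \<odot>\<^bsub>shift m k n M\<^esub> x \<in> piece (shift m k n M) a (q + e)"
      if "homogeneous e p" "x \<in> piece (shift m k n M) a q" for e p a q x
      using P.smult_piece[of e p x "a - m" "q - n"] that by (simp add: algebra_simps)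
    show "finite {g. component (fst g - m, snd g - n) x \<noteq> \<zero>\<^bsub>shift m k n M\<^esub>}"
      if "x \<in> carrier (shift m k n M)" for x
    proof -
      have "{g. component (fst g - m, snd g - n) x \<noteq> \<zero>\<^bsub>M\<^esub>} \<subseteq>
          (\<lambda>g. (fst g + m, snd g + n)) ` {g. component g x \<noteq> \<zero>\<^bsub>M\<^esub>}"
      proof
        fix g assume "g \<in> {g. component (fst g - m, snd g - n) x \<noteq> \<zero>\<^bsub>M\<^esub>}"
        then show "g \<in> (\<lambda>g. (fst g + m, snd g + n)) ` {g. component g x \<noteq> \<zero>\<^bsub>M\<^esub>}"
          by (intro image_eqI[of _ _ "(fst g - m, snd g - n)"]) auto
      qed
      then show ?thesis
        using finite_subset P.proj_finite that by fastforce
    qed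
    show "x = \<zero>\<^bsub>shift m k n M\<^esub>"
      if "x \<in> carrier (shift m k n M)"
        "\<And>g. component (fst g - m, snd g - n) x = \<zero>\<^bsub>shift m k n M\<^esub>" for x
    proof -
      have "component g x = \<zero>\<^bsub>M\<^esub>" for g
        using that(2)[of "(fst g + m, snd g + n)"] by simp
      then show ?thesis using P.proj_zero that(1) by simp
    qed
    show "component (fst g - m, snd g - n) x = \<zero>\<^bsub>shift m k n M\<^esub>"
      if "x \<in> piece (shift m k n M) a q" "g \<noteq> (a, q)" for g a q x
      using that P.proj_other[of x "a - m" "q - n" "(fst g - m, snd g - n)"] by (cases g) auto
  qed (auto simp: P.neg_ex P.smult_ladd P.smult_radd P.smult_mult P.smult_one M.a_ac P.proj_add P.proj_same
      P.proj_other intro: P.zero_closed P.add_closed P.smult_closed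
      P.piece_carrier P.zero_piece P.add_piece P.filt_carrier P.zero_filt P.add_filt P.smult_filt
      P.proj_piece P.proj_filt)
  then show ?thesis by (rule fgm.fgmod)
qed

section \<open>Symmetry rules for the Demazure operator\<close>

lemma substs_2 [simp]: "swapY 2 = 2" "XtoY 2 = 2" "YtoX 2 = 2"
proof -
  have 2: "(2 :: bpoly) = 1 + 1" by simp
  show "swapY 2 = 2" "XtoY 2 = 2" "YtoX 2 = 2"
    unfolding 2 by (simp_all only: substs_hom)
qed

text \<open>Both \<open>p - swapY p\<close> and \<open>2 * y_minus\<close> change sign under the
  transposition, so their quotient is symmetric.\<close>

lemma swapY_dem [simp]: "swapY (dem p) = dem p"
proof -
  have "2 * (y_minus * swapY (dem p)) = 2 * (y_minus * dem p)"
  proof -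
    have "- (2 * y_minus * swapY (dem p)) = swapY (2 * y_minus * dem p)"
      by simp
    also have "\<dots> = swapY (p - swapY p)"
      by (simp only: dem_spec)
    also have "\<dots> = - (p - swapY p)"
      by simp
    also have "\<dots> = - (2 * y_minus * dem p)"
      by (simp only: dem_spec)
    finally show ?thesis
      by (simp only: neg_equal_iff_equal mult.assoc)
  qed
  then show ?thesis
    using y_minus_nonzero by (simp only: bpoly_two_cancel mult_cancel_left) simp
qed

lemma dem_dem [simp]: "dem (dem p) = 0"
  by (rule dem_swap_fixed) simp

lemma dem_swapY [simp]: "dem (swapY p) = - dem p"
proof (rule dem_unique)
  have "swapY p - swapY (swapY p) = - (p - swapY p)" by simp
  then show "swapY p - swapY (swapY p) = 2 * y_minus * (- dem p)"
    by (simp only: dem_spec mult_minus_right)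
qed

text \<open>The Demazure operator preserves polynomials in the y-variables alone, and these are
  exactly the images under \<open>XtoY\<close>.\<close>

lemma XtoY_dem: "XtoY (dem (XtoY p)) = dem (XtoY p)"
proof -
  have 1: "XtoY (swapY (XtoY p)) = swapY (XtoY p)" for p
  proof (induction p rule: bpoly_induct)
    case (Var v p)
    then show ?case by (cases v) simp_all
  qed simp_all
  have 2: "XtoY (XtoY p) = XtoY p" for p
  proof (induction p rule: bpoly_induct)
    case (Var v p)
    then show ?case by (cases v) simp_all
  qed simp_all
  have "2 * (y_minus * XtoY (dem (XtoY p))) = XtoY (2 * y_minus * dem (XtoY p))"
    by simp
  also have "\<dots> = XtoY (XtoY p - swapY (XtoY p))"
    by (simp only: dem_spec)
  also have "\<dots> = XtoY p - swapY (XtoY p)"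
    by (simp add: 1 2)
  also have "\<dots> = 2 * (y_minus * dem (XtoY p))"
    by (simp only: dem_spec mult.assoc)
  finally show ?thesis
    using y_minus_nonzero by (simp only: bpoly_two_cancel mult_cancel_left) simp
qed

text \<open>The left side is the class of \<open>p\<close> in V. The formula expresses it by the two
  coordinates of \<open>p\<close> in M, so that all later checks become identities in
  \<open>YtoX p\<close> and \<open>YtoX (dem p)\<close>.\<close>

lemma YtoX_swapY: "YtoX (swapY p) = YtoX p - 2 * x_minus * YtoX (dem p)"
proof -
  have "YtoX (2 * y_minus * dem p) = 2 * x_minus * YtoX (dem p)"
    by simp
  then show ?thesis by (subst swapY_eq) simp
qed

lemma YtoX_dem_mult:
  "YtoX (dem (p * q)) = YtoX (dem p) * YtoX q + (YtoX p - 2 * x_minus * YtoX (dem p)) * YtoX (dem q)"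
  by (simp add: dem_mult YtoX_swapY)

section \<open>The ideals\<close>

text \<open>Homogeneous ideals, in the form in which the projections \<open>hpart\<close> descend to
  the quotient.\<close>

definition hideal :: "bpoly set \<Rightarrow> bool" where
  "hideal J \<longleftrightarrow> 0 \<in> J \<and> (\<forall>p\<in>J. \<forall>q\<in>J. p + q \<in> J) \<and> (\<forall>r. \<forall>p\<in>J. r * p \<in> J) \<and>
     (\<forall>q. \<forall>p\<in>J. hpart q p \<in> J)"

lemma hidealD:
  assumes "hideal J"
  shows "0 \<in> J" "p \<in> J \<Longrightarrow> q \<in> J \<Longrightarrow> p + q \<in> J" "p \<in> J \<Longrightarrow> r * p \<in> J" "p \<in> J \<Longrightarrow> hpart d p \<in> J"
    "p \<in> J \<Longrightarrow> - p \<in> J" "p \<in> J \<Longrightarrow> q \<in> J \<Longrightarrow> p - q \<in> J"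
proof -
  show 1: "0 \<in> J" "p \<in> J \<Longrightarrow> q \<in> J \<Longrightarrow> p + q \<in> J" "p \<in> J \<Longrightarrow> r * p \<in> J" "p \<in> J \<Longrightarrow> hpart d p \<in> J" for p q r d
    using assms by (auto simp: hideal_def)
  show 2: "p \<in> J \<Longrightarrow> - p \<in> J" for p
    using 1(3)[of p "-1"] by simp
  show "p \<in> J \<Longrightarrow> q \<in> J \<Longrightarrow> p - q \<in> J"
    using 1(2)[of p "- q"] 2[of q] by simp
qed

lemma ideal_QXY_I:
  assumes "0 \<in> J" "\<And>p q. p \<in> J \<Longrightarrow> q \<in> J \<Longrightarrow> p + q \<in> J" "\<And>r p. p \<in> J \<Longrightarrow> r * p \<in> J"
  shows "ideal J QXY"
proof -
  interpret cring QXY by (rule cring_QXY)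
  have inv: "\<ominus>\<^bsub>QXY\<^esub> p = - p" for p
    by (rule minus_equality) auto
  have "- p \<in> J" if "p \<in> J" for p
    using assms(3)[OF that, of "-1"] by simp
  then have "subgroup J (add_monoid QXY)"
    using assms inv by (intro subgroup.intro) (auto simp: a_inv_def)
  then show ?thesis
    using assms by (intro idealI ring_axioms) (auto simp: mult.commute)
qed

lemma genideal_pair: "Idl\<^bsub>QXY\<^esub> {f, g} = {a * f + b * g | a b. True}"
proof
  interpret cring QXY by (rule cring_QXY)
  have "ideal {a * f + b * g | a b. True} QXY"
  proof (rule ideal_QXY_I)
    show "0 \<in> {a * f + b * g | a b. True}"
      by (auto intro!: exI[of _ 0])
    show "p + q \<in> {a * f + b * g | a b. True}"
      if "p \<in> {a * f + b * g | a b. True}" "q \<in> {a * f + b * g | a b. True}" for p q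
    proof -
      from that obtain a b a' b' where "p = a * f + b * g" "q = a' * f + b' * g" by auto
      then have "p + q = (a + a') * f + (b + b') * g" by (simp add: algebra_simps)
      then show ?thesis by blast
    qed
    show "r * p \<in> {a * f + b * g | a b. True}" if "p \<in> {a * f + b * g | a b. True}" for r p
    proof -
      from that obtain a b where "p = a * f + b * g" by auto
      then have "r * p = (r * a) * f + (r * b) * g" by (simp add: algebra_simps)
      then show ?thesis by blast
    qed
  qed
  moreover have "f \<in> {a * f + b * g | a b. True}"
    by (rule CollectI, rule exI[of _ 1], rule exI[of _ 0]) simp
  moreover have "g \<in> {a * f + b * g | a b. True}"
    by (rule CollectI, rule exI[of _ 0], rule exI[of _ 1]) simp
  ultimately show "Idl\<^bsub>QXY\<^esub> {f, g} \<subseteq> {a * f + b * g | a b. True}"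
    by (intro genideal_minimal) auto
  have i: "ideal (Idl\<^bsub>QXY\<^esub> {f, g}) QXY" by (rule genideal_ideal) simp
  have "f \<in> Idl\<^bsub>QXY\<^esub> {f, g}" "g \<in> Idl\<^bsub>QXY\<^esub> {f, g}"
    using genideal_self[of "{f, g}"] by auto
  then show "{a * f + b * g | a b. True} \<subseteq> Idl\<^bsub>QXY\<^esub> {f, g}"
    using ideal.I_l_closed[OF i] additive_subgroup.a_closed[OF ideal.axioms(1)[OF i]] by fastforce
qed

text \<open>\<open>p - YtoX p\<close> is always a combination of the two generators, by induction on
  \<open>p\<close>; thus I is identified with the polynomials in x.\<close>

lemma JI_iff: "p \<in> JI \<longleftrightarrow> YtoX p = 0"
proof
  assume "p \<in> JI"
  then show "YtoX p = 0" by (auto simp: JI_def genideal_pair)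
next
  have gen: "a * (Var Y1 - Var X1) + b * (Var Y2 - Var X2) \<in> JI" for a b
    unfolding JI_def genideal_pair by auto
  have "p - YtoX p \<in> JI"
  proof (induction p rule: bpoly_induct)
    case (Const c)
    then show ?case using gen[of 0 0] by simp
  next
    case (add p q)
    then obtain a b a' b' where "p - YtoX p = a * (Var Y1 - Var X1) + b * (Var Y2 - Var X2)"
      "q - YtoX q = a' * (Var Y1 - Var X1) + b' * (Var Y2 - Var X2)"
      unfolding JI_def genideal_pair by auto
    moreover have "p + q - YtoX (p + q) = (p - YtoX p) + (q - YtoX q)" by simp
    ultimately have "p + q - YtoX (p + q) = (a + a') * (Var Y1 - Var X1) + (b + b') * (Var Y2 - Var X2)"
      by (simp only:) (simp add: algebra_simps)
    then show ?case using gen by simp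
  next
    case (Var v p)
    then obtain a b where ab: "p - YtoX p = a * (Var Y1 - Var X1) + b * (Var Y2 - Var X2)"
      unfolding JI_def genideal_pair by auto
    have "Var v * p - YtoX (Var v * p) = YtoX (Var v) * (p - YtoX p) + p * (Var v - YtoX (Var v))"
      by (simp add: algebra_simps)
    then have *: "Var v * p - YtoX (Var v * p) =
        YtoX (Var v) * (a * (Var Y1 - Var X1) + b * (Var Y2 - Var X2)) + p * (Var v - YtoX (Var v))"
      by (simp only: ab)
    have "Var v * p - YtoX (Var v * p) =
      (YtoX (Var v) * a + (if v = Y1 then p else 0)) * (Var Y1 - Var X1) +
      (YtoX (Var v) * b + (if v = Y2 then p else 0)) * (Var Y2 - Var X2)"
      unfolding * by (cases v) (simp_all add: algebra_simps)
    then show ?case using gen by simp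
  qed
  then show "YtoX p = 0 \<Longrightarrow> p \<in> JI" by simp
qed

text \<open>
  \<open>M\<close> is free over \<open>Q[x]\<close> with basis \<open>1\<close>, \<open>y_minus - x_minus\<close>; the coordinates of \<open>p\<close>
  are \<open>YtoX p\<close> and \<open>YtoX (dem p)\<close>.
\<close>

lemma JM_gen: "a * (y_plus - x_plus) + b * ((y_minus + x_minus) * (y_minus - x_minus)) \<in> JM"
  unfolding JM_def genideal_pair by auto

lemma JM_add: "p \<in> JM \<Longrightarrow> q \<in> JM \<Longrightarrow> p + q \<in> JM"
proof -
  assume "p \<in> JM" "q \<in> JM"
  then obtain a b a' b' where "p = a * (y_plus - x_plus) + b * ((y_minus + x_minus) * (y_minus - x_minus))"
      "q = a' * (y_plus - x_plus) + b' * ((y_minus + x_minus) * (y_minus - x_minus))"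
    unfolding JM_def genideal_pair by auto
  then have "p + q = (a + a') * (y_plus - x_plus) + (b + b') * ((y_minus + x_minus) * (y_minus - x_minus))"
    by (simp only:) (simp add: algebra_simps)
  then show ?thesis using JM_gen by simp
qed

lemma JM_mult: "p \<in> JM \<Longrightarrow> r * p \<in> JM"
proof -
  assume "p \<in> JM"
  then obtain a b where "p = a * (y_plus - x_plus) + b * ((y_minus + x_minus) * (y_minus - x_minus))"
    unfolding JM_def genideal_pair by auto
  then have "r * p = (r * a) * (y_plus - x_plus) + (r * b) * ((y_minus + x_minus) * (y_minus - x_minus))"
    by (simp only:) (simp add: algebra_simps)
  then show ?thesis using JM_gen by simp
qed

lemma Const_half_Var:
  "Var Y1 = Const (1/2) * (y_plus - y_minus)" "Var Y2 = Const (1/2) * (y_plus + y_minus)"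
  "Var X1 = Const (1/2) * (x_plus - x_minus)" "Var X2 = Const (1/2) * (x_plus + x_minus)"
  by (simp_all only: bpoly_two_cancel[symmetric, of "Var _"] Const_half)
     (simp_all add: x_plus_def x_minus_def y_plus_def y_minus_def)

lemma JM_normal_form: "p - (YtoX p + (y_minus - x_minus) * YtoX (dem p)) \<in> JM"
proof (induction p rule: bpoly_induct)
  case (Const c)
  then show ?case using JM_gen[of 0 0] by simp
next
  case (add p q)
  have "p + q - (YtoX (p + q) + (y_minus - x_minus) * YtoX (dem (p + q))) =
    (p - (YtoX p + (y_minus - x_minus) * YtoX (dem p))) + (q - (YtoX q + (y_minus - x_minus) * YtoX (dem q)))"
    by (simp add: dem_add algebra_simps)
  then show ?case using JM_add[OF add.IH] by (simp only:)
next
  case (Var v p)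
  let ?b = "y_minus - x_minus"
  let ?e = "YtoX p" and ?f = "YtoX (dem p)"
  have y_plus: "y_plus * p - (x_plus * ?e + ?b * (x_plus * ?f)) \<in> JM" (is "?l \<in> _")
  proof -
    have "?l = x_plus * (p - (?e + ?b * ?f)) +
      (p * (y_plus - x_plus) + 0 * ((y_minus + x_minus) * (y_minus - x_minus)))"
      by (simp add: algebra_simps)
    then show ?thesis using JM_add[OF JM_mult[OF Var.IH] JM_gen] by (simp only:)
  qed
  \<comment> \<open>With b = \<open>y_minus - x_minus\<close>, the relations of M give y_minus =
    x_minus + b and y_minus b = - x_minus b; so multiplication by \<open>y_minus\<close> takes the
    coordinates (e, f) to (x_minus e, e - x_minus f).\<close>
  have y_minus: "y_minus * p - (x_minus * ?e + ?b * (?e - x_minus * ?f)) \<in> JM" (is "?l \<in> _")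
  proof -
    have "?l = y_minus * (p - (?e + ?b * ?f)) +
      (0 * (y_plus - x_plus) + ?f * ((y_minus + x_minus) * (y_minus - x_minus)))"
      by (simp add: algebra_simps)
    then show ?thesis using JM_add[OF JM_mult[OF Var.IH] JM_gen] by (simp only:)
  qed
  let ?h = "Const (1/2)"
  have X: "Var w * p - (Var w * ?e + ?b * (Var w * ?f)) \<in> JM" for w
  proof -
    have "Var w * p - (Var w * ?e + ?b * (Var w * ?f)) = Var w * (p - (?e + ?b * ?f))"
      by (simp add: algebra_simps)
    then show ?thesis using JM_mult[OF Var.IH] by (simp only:)
  qed
  have dY1: "dem (Var Y1) = - ?h" and dY2: "dem (Var Y2) = ?h"
    by (simp_all add: Const_half_Var dem_mult dem_linear)
  show ?case
  proof (cases v)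
    case Y1
    have "Var Y1 * p - (YtoX (Var Y1 * p) + ?b * YtoX (dem (Var Y1 * p))) =
      ?h * (y_plus * p - (x_plus * ?e + ?b * (x_plus * ?f))) +
      (- ?h) * (y_minus * p - (x_minus * ?e + ?b * (?e - x_minus * ?f)))"
      by (simp add: dem_mult dY1) (simp add: Const_half_Var algebra_simps)
    then show ?thesis using JM_add[OF JM_mult[OF y_plus] JM_mult[OF y_minus]] Y1 by (simp only:)
  next
    case Y2
    have "Var Y2 * p - (YtoX (Var Y2 * p) + ?b * YtoX (dem (Var Y2 * p))) =
      ?h * (y_plus * p - (x_plus * ?e + ?b * (x_plus * ?f))) +
      ?h * (y_minus * p - (x_minus * ?e + ?b * (?e - x_minus * ?f)))"
      by (simp add: dem_mult dY2) (simp add: Const_half_Var algebra_simps)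
    then show ?thesis using JM_add[OF JM_mult[OF y_plus] JM_mult[OF y_minus]] Y2 by (simp only:)
  qed (use X in \<open>simp_all add: dem_mult\<close>)
qed

text \<open>The coordinates vanish on multiples of the generators by the Leibniz rule; the converse
  is the normal form.\<close>

lemma JM_iff: "p \<in> JM \<longleftrightarrow> YtoX p = 0 \<and> YtoX (dem p) = 0"
proof
  assume "p \<in> JM"
  then obtain a b where "p = a * (y_plus - x_plus) + b * ((y_minus + x_minus) * (y_minus - x_minus))"
    unfolding JM_def genideal_pair by auto
  then show "YtoX p = 0 \<and> YtoX (dem p) = 0"
    by (simp add: dem_linear YtoX_dem_mult YtoX_swapY)
next
  assume "YtoX p = 0 \<and> YtoX (dem p) = 0"
  then show "p \<in> JM" using JM_normal_form[of p] by simp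
qed

lemma hpart_substs: "hpart q (YtoX p) = YtoX (hpart q p)" "hpart q (dem p) = dem (hpart (q + 2) p)"
proof -
  \<comment> \<open>Any additive map that lowers degrees by \<open>e\<close> commutes with taking
    homogeneous parts up to this shift; it is applied with \<open>e = 0\<close> and
    \<open>e = 2\<close>.\<close>
  have 1: "hpart q (L p) = L (hpart (q + e) p)"
    if L: "\<And>p p'. L (p + p') = L p + L p'" "\<And>d p. homogeneous d p \<Longrightarrow> homogeneous (d - e) (L p)" for L e
  proof -
    have L0: "L 0 = 0" using L(1)[of 0 0] by simp
    have Ls: "L (sum f A) = (\<Sum>x\<in>A. L (f x))" for f and A :: "int set"
      by (induction A rule: infinite_finite_induct) (simp_all add: L0 L(1))
    let ?A = "insert (q + e) {d. hpart d p \<noteq> 0}"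
    have "L p = (\<Sum>d\<in>?A. L (hpart d p))"
      using sum_hpart[of ?A p] finite_hpart[of p] by (metis Ls finite_insert subset_insertI)
    then have "hpart q (L p) = (\<Sum>d\<in>?A. hpart q (L (hpart d p)))"
      by (simp only: hpart_sum)
    also have "\<dots> = (\<Sum>d\<in>?A. if d = q + e then L (hpart d p) else 0)"
      by (intro sum.cong refl) (use hpart_homogeneous[OF L(2)[OF homogeneous_hpart]] in auto)
    also have "\<dots> = L (hpart (q + e) p)"
      using finite_hpart[of p] by (subst sum.delta) auto
    finally show ?thesis .
  qed
  show "hpart q (YtoX p) = YtoX (hpart q p)"
    using 1[of YtoX 0] homogeneous_substs by simp
  show "hpart q (dem p) = dem (hpart (q + 2) p)"
    using 1[of dem 2] homogeneous_dem by (simp add: dem_add)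
qed

lemma hideal_JI: "hideal JI"
  by (auto simp: hideal_def JI_iff simp flip: hpart_substs)

lemma hideal_JM: "hideal JM"
proof -
  have "YtoX (dem (hpart q p)) = 0" if "p \<in> JM" for q p
  proof -
    have "YtoX (dem (hpart q p)) = hpart (q - 2) (YtoX (dem p))"
      by (simp add: hpart_substs)
    then show ?thesis using that by (simp add: JM_iff)
  qed
  then show ?thesis
    by (auto simp: hideal_def JM_iff dem_linear dem_mult simp flip: hpart_substs(1))
qed

lemma hideal_UNIV: "hideal UNIV"
  by (simp add: hideal_def)

lemma hideal_0: "hideal {0}"
  by (simp add: hideal_def)

lemma PIdl_QXY: "PIdl\<^bsub>QXY\<^esub> f = {a * f | a. True}"
  by (auto simp: cgenideal_def)

lemma hideal_PIdl:
  assumes "homogeneous e f"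
  shows "hideal (PIdl\<^bsub>QXY\<^esub> f)"
  unfolding hideal_def PIdl_QXY
proof (intro conjI allI ballI)
  show "0 \<in> {a * f | a. True}" by (auto intro: exI[of _ 0])
  show "p + q \<in> {a * f | a. True}" if "p \<in> {a * f | a. True}" "q \<in> {a * f | a. True}" for p q
    using that by (auto simp flip: semiring_class.distrib_right)
  show "r * p \<in> {a * f | a. True}" if "p \<in> {a * f | a. True}" for r p
    using that by (auto simp flip: mult.assoc)
  show "hpart q p \<in> {a * f | a. True}" if "p \<in> {a * f | a. True}" for q p
    using that hpart_mult[OF assms] by auto
qed

section \<open>Cyclic bimodules\<close>

lemma coset_iff:
  assumes "hideal J"
  shows "p' \<in> J +>\<^bsub>QXY\<^esub> p \<longleftrightarrow> p' - p \<in> J"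
proof
  assume "p' - p \<in> J"
  then show "p' \<in> J +>\<^bsub>QXY\<^esub> p"
    by (auto simp: a_r_coset_def r_coset_def QXY_def intro!: bexI[of _ "p' - p"])
qed (auto simp: a_r_coset_def r_coset_def QXY_def)

lemma pol_class_eq_iff:
  assumes "hideal J"
  shows "pol_class J p = pol_class J q \<longleftrightarrow> p - q \<in> J"
proof
  have s: "(SOME p'. p' - p \<in> J) - p \<in> J" for p
    using someI[of "\<lambda>p'. p' - p \<in> J" p] hidealD(1)[OF assms] by simp
  assume "pol_class J p = pol_class J q"
  then have "(SOME p'. p' - p \<in> J) = (SOME p'. p' - q \<in> J)"
    by (simp add: pol_class_def coset_iff[OF assms])
  then show "p - q \<in> J"
    using hidealD(6)[OF assms s[of q] s[of p]] by simp
next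
  assume pq: "p - q \<in> J"
  have "p' - p \<in> J \<longleftrightarrow> p' - q \<in> J" for p'
    using hidealD(2)[OF assms _ pq, of "p' - p"] hidealD(6)[OF assms _ pq, of "p' - q"] by auto
  then show "pol_class J p = pol_class J q"
    by (simp add: pol_class_def coset_iff[OF assms])
qed

lemma pol_pol_class:
  assumes "hideal J"
  shows "pol (pol_class J p) - p \<in> J"
  using someI[of "\<lambda>p'. p' - p \<in> J" p] hidealD(1)[OF assms]
  by (simp add: pol_class_def coset_iff[OF assms])

text \<open>Maps between quotients are defined on the chosen representative; a subtractive map that
  takes the one ideal into the other does not see the choice.\<close>

lemma pol_class_rep:
  assumes "hideal J" "hideal J'" "\<And>p q. L (p - q) = L p - L q" "\<And>p. p \<in> J \<Longrightarrow> L p \<in> J'"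
  shows "pol_class J' (L (pol (pol_class J p))) = pol_class J' (L p)"
  using assms(4)[OF pol_pol_class[OF assms(1), of p]] by (simp add: assms(3) pol_class_eq_iff[OF assms(2)])

lemma cyclic_simps [simp]:
  "carrier (cyclic J \<Phi>) = range (pol_class J)" "\<zero>\<^bsub>cyclic J \<Phi>\<^esub> = pol_class J 0"
  "piece (cyclic J \<Phi>) a q = (if a = 0 then pol_class J ` {p. homogeneous q p} else {pol_class J 0})"
  "filt (cyclic J \<Phi>) i = pol_class J ` \<Phi> i"
  by (simp_all add: cyclic_def)

lemma cyclic_add:
  assumes "hideal J"
  shows "pol_class J p \<oplus>\<^bsub>cyclic J \<Phi> :: 'a bimodule\<^esub> pol_class J q = pol_class J (p + q)"
proof -
  let ?r = "\<lambda>p. pol (pol_class J p :: 'a univ)"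
  have "?r p + ?r q - (p + q) = (?r p - p) + (?r q - q)" by simp
  moreover have "(?r p - p) + (?r q - q) \<in> J"
    using assms pol_pol_class[OF assms] by (intro hidealD(2))
  ultimately have "?r p + ?r q - (p + q) \<in> J" by (simp only:)
  then show ?thesis
    by (simp add: cyclic_def pol_class_eq_iff[OF assms])
qed

lemma cyclic_smult:
  assumes "hideal J"
  shows "r \<odot>\<^bsub>cyclic J \<Phi>\<^esub> pol_class J p = pol_class J (r * p)"
  using hidealD(3)[OF assms pol_pol_class[OF assms], of r p]
  by (simp add: cyclic_def pol_class_eq_iff[OF assms] algebra_simps)

lemma fgmod_cyclic:
  assumes J: "hideal J" and \<Phi>: "\<And>i. hideal (\<Phi> i)" "\<And>i. \<Phi> (i + 1) \<subseteq> \<Phi> i"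
  shows "fgmod (cyclic J \<Phi> :: 'a bimodule)"
proof -
  let ?c = "pol_class J :: bpoly \<Rightarrow> 'a univ"
  \<comment> \<open>A cyclic module sits in \<open>a\<close>-degree 0, so the projections to the
    other \<open>a\<close>-degrees are zero.\<close>
  define \<pi> where "\<pi> g u = (if fst g = 0 then ?c (hpart (snd g) (pol u)) else ?c 0)" for g :: "int \<times> int" and u :: "'a univ"
  have \<pi>: "\<pi> g (?c p) = (if fst g = 0 then ?c (hpart (snd g) p) else ?c 0)" for g p
    unfolding \<pi>_def
    by (simp add: pol_class_rep[OF J J, of "hpart (snd g)"] hpart_diff hidealD[OF J])
  note ops = cyclic_add[OF J] cyclic_smult[OF J]
  have "fgm (cyclic J \<Phi> :: 'a bimodule) \<pi>"
  proof
    show "\<exists>y\<in>carrier (cyclic J \<Phi>). y \<oplus>\<^bsub>cyclic J \<Phi>\<^esub> x = \<zero>\<^bsub>cyclic J \<Phi>\<^esub>"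
      if "x \<in> carrier (cyclic J \<Phi>)" for x :: "'a univ"
    proof -
      from that obtain p where "x = ?c p" by auto
      then show ?thesis by (intro bexI[of _ "?c (- p)"]) (auto simp: ops)
    qed
    show "x \<oplus>\<^bsub>cyclic J \<Phi>\<^esub> y \<in> piece (cyclic J \<Phi>) a q"
      if "x \<in> piece (cyclic J \<Phi>) a q" "y \<in> piece (cyclic J \<Phi>) a q" for a q and x y :: "'a univ"
      using that by (auto simp: ops homogeneous_add split: if_splits)
    show "p \<odot>\<^bsub>cyclic J \<Phi>\<^esub> x \<in> piece (cyclic J \<Phi>) a (q + e)"
      if "homogeneous e p" "x \<in> piece (cyclic J \<Phi>) a q" for e p a q and x :: "'a univ"
      using that homogeneous_mult[of e p q] by (auto simp: ops add.commute split: if_splits)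
    show "\<pi> g (x \<oplus>\<^bsub>cyclic J \<Phi>\<^esub> y) = \<pi> g x \<oplus>\<^bsub>cyclic J \<Phi>\<^esub> \<pi> g y"
      if "x \<in> carrier (cyclic J \<Phi>)" "y \<in> carrier (cyclic J \<Phi>)" for g and x y :: "'a univ"
      using that by (auto simp: ops \<pi> hpart_add)
    show "\<pi> (a, q) x = x" if "x \<in> piece (cyclic J \<Phi>) a q" for a q and x :: "'a univ"
      using that by (auto simp: \<pi> hpart_homogeneous split: if_splits)
    show "\<pi> g x = \<zero>\<^bsub>cyclic J \<Phi>\<^esub>" if "x \<in> piece (cyclic J \<Phi>) a q" "g \<noteq> (a, q)" for a q g and x :: "'a univ"
      using that by (cases g) (auto simp: \<pi> hpart_homogeneous split: if_splits)
    show "\<pi> (a, q) x \<in> piece (cyclic J \<Phi>) a q" if "x \<in> carrier (cyclic J \<Phi>)" for a q and x :: "'a univ"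
      using that by (auto simp: \<pi>)
    show "finite {g. \<pi> g x \<noteq> \<zero>\<^bsub>cyclic J \<Phi>\<^esub>}" if "x \<in> carrier (cyclic J \<Phi>)" for x :: "'a univ"
    proof -
      from that obtain p where p: "x = ?c p" by auto
      have "{g. \<pi> g x \<noteq> \<zero>\<^bsub>cyclic J \<Phi>\<^esub>} \<subseteq> Pair 0 ` {q. hpart q p \<noteq> 0}"
      proof
        fix g assume "g \<in> {g. \<pi> g x \<noteq> \<zero>\<^bsub>cyclic J \<Phi>\<^esub>}"
        then show "g \<in> Pair 0 ` {q. hpart q p \<noteq> 0}"
          by (cases g) (auto simp: p \<pi> split: if_splits)
      qed
      then show ?thesis using finite_hpart[of p] finite_subset by blast
    qed
    show "x = \<zero>\<^bsub>cyclic J \<Phi>\<^esub>"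
      if x: "x \<in> carrier (cyclic J \<Phi>)" and z: "\<And>g. \<pi> g x = \<zero>\<^bsub>cyclic J \<Phi>\<^esub>" for x :: "'a univ"
    proof -
      from x obtain p where p: "x = ?c p" by auto
      \<comment> \<open>All homogeneous parts of \<open>p\<close> lie in \<open>J\<close>, hence so
        does their sum \<open>p\<close>.\<close>
      have "hpart q p \<in> J" for q
        using z[of "(0, q)"] by (simp add: p \<pi> pol_class_eq_iff[OF J])
      then have "(\<Sum>q\<in>A. hpart q p) \<in> J" for A
        by (induction A rule: infinite_finite_induct) (simp_all add: hidealD[OF J])
      then have "p \<in> J"
        using sum_hpart[OF finite_hpart order_refl, of p] by metis
      then show ?thesis by (simp add: p pol_class_eq_iff[OF J])
    qed
    show "\<pi> g x \<in> filt (cyclic J \<Phi>) i" if "x \<in> filt (cyclic J \<Phi>) i" for i g and x :: "'a univ"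
      using that hidealD[OF \<Phi>(1)] by (auto simp: \<pi>)
    show "x \<oplus>\<^bsub>cyclic J \<Phi>\<^esub> y \<in> filt (cyclic J \<Phi>) i"
      if "x \<in> filt (cyclic J \<Phi>) i" "y \<in> filt (cyclic J \<Phi>) i" for i and x y :: "'a univ"
      using that hidealD[OF \<Phi>(1)] by (auto simp: ops)
    show "r \<odot>\<^bsub>cyclic J \<Phi>\<^esub> x \<in> filt (cyclic J \<Phi>) i"
      if "x \<in> filt (cyclic J \<Phi>) i" for i r and x :: "'a univ"
      using that hidealD[OF \<Phi>(1)] by (auto simp: ops)
    show "\<zero>\<^bsub>cyclic J \<Phi>\<^esub> \<in> filt (cyclic J \<Phi>) i" for i
      using hidealD(1)[OF \<Phi>(1)] by auto
  qed (use \<Phi>(2) in \<open>auto simp: ops algebra_simps split: if_splits\<close>)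
  then show ?thesis by (rule fgm.fgmod)
qed

lemma hideal_trivial_filt: "hideal (trivial_filt i)"
  by (simp add: trivial_filt_def hideal_UNIV hideal_0)

lemma hideal_two_step_filt: "homogeneous 2 f \<Longrightarrow> hideal (two_step_filt f i)"
  by (simp add: two_step_filt_def hideal_UNIV hideal_0 hideal_PIdl)

lemma fgmod_bims: "fgmod bimI" "fgmod bimB" "fgmod bimG" "fgmod bim0"
  unfolding bimI_def bimB_def bimG_def bim0_def
  by (rule fgmod_cyclic; (intro hideal_JI hideal_JM hideal_UNIV hideal_trivial_filt hideal_two_step_filt
        homogeneous_add homogeneous_diff homogeneous_pm)?; auto simp: trivial_filt_def two_step_filt_def
        PIdl_QXY intro: exI[of _ 0])+

section \<open>Complexes of filtered bimodules\<close>

text \<open>Two element types occur because the cone model consists of triples, which are not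
  elements of the universe. These maps become morphisms of D_2 only between modules of one
  type.\<close>

definition bhom :: "('u, 'm) fgmod_scheme \<Rightarrow> ('v, 'n) fgmod_scheme \<Rightarrow> ('u \<Rightarrow> 'v) \<Rightarrow> bool" where
  "bhom M N f \<longleftrightarrow> (\<forall>x\<in>carrier M. f x \<in> carrier N) \<and>
     (\<forall>x\<in>carrier M. \<forall>y\<in>carrier M. f (x \<oplus>\<^bsub>M\<^esub> y) = f x \<oplus>\<^bsub>N\<^esub> f y) \<and>
     (\<forall>p. \<forall>x\<in>carrier M. f (p \<odot>\<^bsub>M\<^esub> x) = p \<odot>\<^bsub>N\<^esub> f x) \<and>
     (\<forall>a q. \<forall>x\<in>piece M a q. f x \<in> piece N a q) \<and>
     (\<forall>i. \<forall>x\<in>filt M i. f x \<in> filt N i)"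

lemma bhomD:
  assumes "bhom M N f"
  shows "x \<in> carrier M \<Longrightarrow> f x \<in> carrier N"
    "x \<in> carrier M \<Longrightarrow> y \<in> carrier M \<Longrightarrow> f (x \<oplus>\<^bsub>M\<^esub> y) = f x \<oplus>\<^bsub>N\<^esub> f y"
    "x \<in> carrier M \<Longrightarrow> f (p \<odot>\<^bsub>M\<^esub> x) = p \<odot>\<^bsub>N\<^esub> f x"
    "x \<in> piece M a q \<Longrightarrow> f x \<in> piece N a q"
    "x \<in> filt M i \<Longrightarrow> f x \<in> filt N i"
  using assms by (auto simp: bhom_def)

lemma bhom_zero:
  assumes "fgmod M" "fgmod N" "bhom M N f"
  shows "f \<zero>\<^bsub>M\<^esub> = \<zero>\<^bsub>N\<^esub>"
proof -
  interpret M: fgmod M by fact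
  interpret N: fgmod N by fact
  have "f (0 \<odot>\<^bsub>M\<^esub> \<zero>\<^bsub>M\<^esub>) = 0 \<odot>\<^bsub>N\<^esub> f \<zero>\<^bsub>M\<^esub>"
    by (rule bhomD(3)[OF assms(3)]) simp
  then show ?thesis
    using bhomD(1)[OF assms(3), of "\<zero>\<^bsub>M\<^esub>"] M.smult_l_null[of "\<zero>\<^bsub>M\<^esub>"] N.smult_l_null[of "f \<zero>\<^bsub>M\<^esub>"] by simp
qed

lemma bhom_neg:
  assumes "fgmod M" "fgmod N" "bhom M N f" "x \<in> carrier M"
  shows "f (\<ominus>\<^bsub>M\<^esub> x) = \<ominus>\<^bsub>N\<^esub> f x"
proof -
  interpret M: fgmod M by fact
  interpret N: fgmod N by fact
  show ?thesis
    using assms(4) bhomD(1)[OF assms(3,4)]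
    by (simp add: M.neg_eq_smult N.neg_eq_smult bhomD(3)[OF assms(3,4)])
qed

lemma bhom_comp: "bhom M N f \<Longrightarrow> bhom N P g \<Longrightarrow> bhom M P (\<lambda>x. g (f x))"
  by (simp add: bhom_def)

lemma bhom_cong: "bhom M N f \<Longrightarrow> fgmod M \<Longrightarrow> (\<And>x. x \<in> carrier M \<Longrightarrow> g x = f x) \<Longrightarrow> bhom M N g"
proof -
  assume f: "bhom M N f" and "fgmod M" and eq: "\<And>x. x \<in> carrier M \<Longrightarrow> g x = f x"
  then interpret M: fgmod M by simp
  show "bhom M N g"
    using f by (simp add: bhom_def eq M.piece_closed M.filt_closed)
qed

lemma bhom_id: "bhom M M (\<lambda>x. x)"
  by (simp add: bhom_def)

lemma bhom_shift: "bhom M N f \<Longrightarrow> bhom (shift m k n M) (shift m k n N) f"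
  by (simp add: bhom_def)

lemma bhom_add:
  assumes "fgmod M" "fgmod N" "bhom M N f" "bhom M N g"
  shows "bhom M N (\<lambda>x. f x \<oplus>\<^bsub>N\<^esub> g x)"
proof -
  interpret M: fgmod M by fact
  interpret N: fgmod N by fact
  note f = bhomD[OF assms(3)] and g = bhomD[OF assms(4)]
  show ?thesis
    unfolding bhom_def
    by (auto simp: f g N.a_ac N.smult_r_distr intro: N.piece_add N.filt_add)
qed

lemma bhom_uminus:
  assumes "fgmod M" "fgmod N" "bhom M N f"
  shows "bhom M N (\<lambda>x. \<ominus>\<^bsub>N\<^esub> f x)"
proof -
  interpret M: fgmod M by fact
  interpret N: fgmod N by fact
  note f = bhomD[OF assms(3)]
  show ?thesis
    unfolding bhom_def
    by (auto simp: f N.minus_add N.a_comm N.smult_r_minus intro: N.piece_neg N.filt_neg)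
qed

lemma bhom_0:
  assumes "fgmod M" "fgmod N"
  shows "bhom M N (\<lambda>x. \<zero>\<^bsub>N\<^esub>)"
proof -
  interpret M: fgmod M by fact
  interpret N: fgmod N by fact
  show ?thesis unfolding bhom_def by (auto intro: N.piece_zero N.filt_zero)
qed

text \<open>Complexes with honest filtered maps, where equations hold elementwise and boundedness
  means that almost all carriers are trivial; each gives an object of Ch(D_2) by
  \<open>ch_complex_to_ch\<close>.\<close>

definition bcpx :: "(int \<Rightarrow> 'u fgmod) \<Rightarrow> (int \<Rightarrow> 'u \<Rightarrow> 'u) \<Rightarrow> bool" where
  "bcpx T d \<longleftrightarrow> (\<forall>i. fgmod (T i)) \<and> (\<forall>i. bhom (T i) (ash 1 (T (i - 2))) (d i)) \<and>
     (\<forall>i. \<forall>x\<in>carrier (T i). d (i - 2) (d i x) = \<zero>\<^bsub>T (i - 4)\<^esub>) \<and>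
     finite {i. carrier (T i) \<noteq> {\<zero>\<^bsub>T i\<^esub>}}"

text \<open>Deformation retracts, without the side conditions on the homotopy.\<close>

definition sdr :: "(int \<Rightarrow> 'u fgmod) \<Rightarrow> (int \<Rightarrow> 'u \<Rightarrow> 'u) \<Rightarrow> (int \<Rightarrow> 'v fgmod) \<Rightarrow> (int \<Rightarrow> 'v \<Rightarrow> 'v) \<Rightarrow>
    (int \<Rightarrow> 'u \<Rightarrow> 'v) \<Rightarrow> (int \<Rightarrow> 'v \<Rightarrow> 'u) \<Rightarrow> (int \<Rightarrow> 'u \<Rightarrow> 'u) \<Rightarrow> bool" where
  "sdr T d T' d' p s h \<longleftrightarrow>
     (\<forall>i. bhom (T i) (T' i) (p i)) \<and> (\<forall>i. bhom (T' i) (T i) (s i)) \<and>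
     (\<forall>i. bhom (T i) (ash (-1) (T (i + 2))) (h i)) \<and>
     (\<forall>i. \<forall>x\<in>carrier (T i). p (i - 2) (d i x) = d' i (p i x)) \<and>
     (\<forall>i. \<forall>x\<in>carrier (T' i). s (i - 2) (d' i x) = d i (s i x)) \<and>
     (\<forall>i. \<forall>x\<in>carrier (T' i). p i (s i x) = x) \<and>
     (\<forall>i. \<forall>x\<in>carrier (T i). s i (p i x) = x \<oplus>\<^bsub>T i\<^esub> (d (i + 2) (h i x) \<oplus>\<^bsub>T i\<^esub> h (i - 2) (d i x)))"

lemma sdrD:
  assumes "sdr T d T' d' p s h"
  shows "bhom (T i) (T' i) (p i)" "bhom (T' i) (T i) (s i)" "bhom (T i) (ash (-1) (T (i + 2))) (h i)"
    "x \<in> carrier (T i) \<Longrightarrow> p (i - 2) (d i x) = d' i (p i x)"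
    "y \<in> carrier (T' i) \<Longrightarrow> s (i - 2) (d' i y) = d i (s i y)"
    "y \<in> carrier (T' i) \<Longrightarrow> p i (s i y) = y"
    "x \<in> carrier (T i) \<Longrightarrow> s i (p i x) = x \<oplus>\<^bsub>T i\<^esub> (d (i + 2) (h i x) \<oplus>\<^bsub>T i\<^esub> h (i - 2) (d i x))"
  using assms unfolding sdr_def by auto

lemma bcpxD:
  assumes "bcpx T d"
  shows "fgmod (T i)" "bhom (T i) (ash 1 (T (i - 2))) (d i)"
    "x \<in> carrier (T i) \<Longrightarrow> d (i - 2) (d i x) = \<zero>\<^bsub>T (i - 4)\<^esub>"
    "finite {i. carrier (T i) \<noteq> {\<zero>\<^bsub>T i\<^esub>}}"
  using assms unfolding bcpx_def by auto

text \<open>Insert the homotopy relation of the second retract between \<open>s\<close> and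
  \<open>p\<close> of the first; moving the differentials past \<open>s\<close> and \<open>p\<close>
  produces the extra summand of the homotopy.\<close>

lemma sdr_trans:
  assumes T: "bcpx T d" and T': "bcpx T' d'"
    and 1: "sdr T d T' d' p s h" and 2: "sdr T' d' T'' d'' p' s' h'"
  shows "sdr T d T'' d'' (\<lambda>i x. p' i (p i x)) (\<lambda>i x. s i (s' i x))
    (\<lambda>i x. h i x \<oplus>\<^bsub>T (i + 2)\<^esub> s (i + 2) (h' i (p i x)))"
  unfolding sdr_def
proof (intro conjI allI ballI)
  note p = sdrD[OF 1] and q = sdrD[OF 2]
  note pc = bhomD(1)[OF p(1)] and sc = bhomD(1)[OF p(2)] and hc = bhomD(1)[OF p(3), simplified]
    and dc = bhomD(1)[OF bcpxD(2)[OF T], simplified]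
  note p'c = bhomD(1)[OF q(1)] and s'c = bhomD(1)[OF q(2)] and h'c = bhomD(1)[OF q(3), simplified]
    and d'c = bhomD(1)[OF bcpxD(2)[OF T'], simplified]
  fix i
  show "bhom (T i) (T'' i) (\<lambda>x. p' i (p i x))" by (rule bhom_comp[OF p(1) q(1)])
  show "bhom (T'' i) (T i) (\<lambda>x. s i (s' i x))" by (rule bhom_comp[OF q(2) p(2)])
  have "bhom (T i) (ash (-1) (T (i + 2))) (\<lambda>x. s (i + 2) (h' i (p i x)))"
    by (rule bhom_comp[OF bhom_comp[OF p(1) q(3)] bhom_shift[OF p(2)]])
  from bhom_add[OF bcpxD(1)[OF T] fgmod_shift[OF bcpxD(1)[OF T]] p(3) this]
  show "bhom (T i) (ash (-1) (T (i + 2))) (\<lambda>x. h i x \<oplus>\<^bsub>T (i + 2)\<^esub> s (i + 2) (h' i (p i x)))"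
    by simp
  show "p' (i - 2) (p (i - 2) (d i x)) = d'' i (p' i (p i x))" if "x \<in> carrier (T i)" for x
    using that p(4) q(4) pc by simp
  show "s (i - 2) (s' (i - 2) (d'' i x)) = d i (s i (s' i x))" if "x \<in> carrier (T'' i)" for x
    using that p(5) q(5) s'c by simp
  show "p' i (p i (s i (s' i x))) = x" if "x \<in> carrier (T'' i)" for x
    using that p(6) q(6) s'c by simp
  show "s i (s' i (p' i (p i x))) = x \<oplus>\<^bsub>T i\<^esub>
      (d (i + 2) (h i x \<oplus>\<^bsub>T (i + 2)\<^esub> s (i + 2) (h' i (p i x))) \<oplus>\<^bsub>T i\<^esub>
      (h (i - 2) (d i x) \<oplus>\<^bsub>T (i - 2 + 2)\<^esub> s (i - 2 + 2) (h' (i - 2) (p (i - 2) (d i x)))))"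
    if x: "x \<in> carrier (T i)" for x
  proof -
    interpret Ti: fgmod "T i" by (rule bcpxD(1)[OF T])
    interpret T'i: fgmod "T' i" by (rule bcpxD(1)[OF T'])
    have hd: "h (i - 2) (d i x) \<in> carrier (T i)"
      using hc[of "d i x" "i - 2"] dc[OF x] by simp
    have dh: "d (i + 2) (h i x) \<in> carrier (T i)"
      using dc[OF hc[OF x]] by simp
    have h'd: "h' (i - 2) (d' i (p i x)) \<in> carrier (T' i)"
      using h'c[of "d' i (p i x)" "i - 2"] d'c[OF pc[OF x]] by simp
    have dh': "d' (i + 2) (h' i (p i x)) \<in> carrier (T' i)"
      using d'c[OF h'c[OF pc[OF x]]] by simp
    have 3: "s i (d' (i + 2) (h' i (p i x))) = d (i + 2) (s (i + 2) (h' i (p i x)))"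
      using p(5)[of "h' i (p i x)" "i + 2"] h'c[OF pc[OF x]] by simp
    have "s i (s' i (p' i (p i x))) =
        s i (p i x \<oplus>\<^bsub>T' i\<^esub> (d' (i + 2) (h' i (p i x)) \<oplus>\<^bsub>T' i\<^esub> h' (i - 2) (d' i (p i x))))"
      using q(7)[OF pc[OF x]] by simp
    also have "\<dots> = s i (p i x) \<oplus>\<^bsub>T i\<^esub>
        (s i (d' (i + 2) (h' i (p i x))) \<oplus>\<^bsub>T i\<^esub> s i (h' (i - 2) (d' i (p i x))))"
      using pc[OF x] dh' h'd by (simp add: bhomD(2)[OF p(2)])
    also have "\<dots> = (x \<oplus>\<^bsub>T i\<^esub> (d (i + 2) (h i x) \<oplus>\<^bsub>T i\<^esub> h (i - 2) (d i x))) \<oplus>\<^bsub>T i\<^esub>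
        (d (i + 2) (s (i + 2) (h' i (p i x))) \<oplus>\<^bsub>T i\<^esub> s i (h' (i - 2) (p (i - 2) (d i x))))"
      using p(7)[OF x] p(4)[OF x] 3 by simp
    also have "\<dots> = x \<oplus>\<^bsub>T i\<^esub> ((d (i + 2) (h i x) \<oplus>\<^bsub>T i\<^esub> d (i + 2) (s (i + 2) (h' i (p i x)))) \<oplus>\<^bsub>T i\<^esub>
        (h (i - 2) (d i x) \<oplus>\<^bsub>T i\<^esub> s i (h' (i - 2) (p (i - 2) (d i x)))))"
      using x dh hd sc[OF dh'] sc[OF h'd] 3 p(4)[OF x] by (simp add: Ti.a_ac)
    also have "d (i + 2) (h i x) \<oplus>\<^bsub>T i\<^esub> d (i + 2) (s (i + 2) (h' i (p i x))) =
        d (i + 2) (h i x \<oplus>\<^bsub>T (i + 2)\<^esub> s (i + 2) (h' i (p i x)))"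
      using bhomD(2)[OF bcpxD(2)[OF T], of "h i x" "i + 2" "s (i + 2) (h' i (p i x))"]
        hc[OF x] sc[OF h'c[OF pc[OF x]]] by simp
    finally show ?thesis by simp
  qed
qed

lemma sdr_iso:
  assumes T: "bcpx T d" and T': "\<And>i. fgmod (T' i)"
    and "\<And>i. bhom (T i) (T' i) (p i)" "\<And>i. bhom (T' i) (T i) (s i)"
    and "\<And>i x. x \<in> carrier (T i) \<Longrightarrow> p (i - 2) (d i x) = d' i (p i x)"
    and ps: "\<And>i x. x \<in> carrier (T' i) \<Longrightarrow> p i (s i x) = x"
    and sp: "\<And>i x. x \<in> carrier (T i) \<Longrightarrow> s i (p i x) = x"
  shows "sdr T d T' d' p s (\<lambda>i x. \<zero>\<^bsub>T (i + 2)\<^esub>)"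
  unfolding sdr_def
proof (intro conjI allI ballI assms)
  note dc = bhomD(1)[OF bcpxD(2)[OF T], simplified]
  fix i
  interpret Ti: fgmod "T i" by (rule bcpxD(1)[OF T])
  show "bhom (T i) (ash (-1) (T (i + 2))) (\<lambda>x. \<zero>\<^bsub>T (i + 2)\<^esub>)"
    using bhom_0[OF bcpxD(1)[OF T] fgmod_shift[OF bcpxD(1)[OF T]]] by simp
  show "s (i - 2) (d' i x) = d i (s i x)" if "x \<in> carrier (T' i)" for x
    using assms(5)[of "s i x" i] bhomD(1)[OF assms(4) that] ps[OF that] sp dc by metis
  show "s i (p i x) = x \<oplus>\<^bsub>T i\<^esub> (d (i + 2) \<zero>\<^bsub>T (i + 2)\<^esub> \<oplus>\<^bsub>T i\<^esub> \<zero>\<^bsub>T (i - 2 + 2)\<^esub>)"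
    if "x \<in> carrier (T i)" for x
  proof -
    have "d (i + 2) \<zero>\<^bsub>T (i + 2)\<^esub> = \<zero>\<^bsub>T i\<^esub>"
      using bhom_zero[OF bcpxD(1)[OF T] fgmod_shift[OF bcpxD(1)[OF T]] bcpxD(2)[OF T], of "i + 2"] by simp
    then show ?thesis using that sp by simp
  qed
qed

subsection \<open>Passage to the derived category\<close>

lemma to_fdg_simps [simp]:
  "carrier (to_fdg M) = carrier M" "\<zero>\<^bsub>to_fdg M\<^esub> = \<zero>\<^bsub>M\<^esub>"
  "x \<oplus>\<^bsub>to_fdg M\<^esub> y = x \<oplus>\<^bsub>M\<^esub> y" "p \<odot>\<^bsub>to_fdg M\<^esub> x = p \<odot>\<^bsub>M\<^esub> x"
  "piece (to_fdg M) = piece M" "filt (to_fdg M) = filt M" "dif (to_fdg M) x = \<zero>\<^bsub>M\<^esub>"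
  by (simp_all add: to_fdg_def fgmod.defs fdg.defs)

lemma shift_shift [simp]: "shift m k n (shift m' k' n' M) = shift (m + m') (k + k') (n + n') M"
  by (simp add: shift_def algebra_simps)

lemma shift_0 [simp]: "shift 0 0 0 M = M"
  by (simp add: shift_def)

lemma shift_to_fdg [simp]: "shift m k n (to_fdg M) = to_fdg (shift m k n M)"
  by (simp add: shift_def to_fdg_def fgmod.defs fdg.defs)

lemma fgmod_to_fdg: "fgmod M \<Longrightarrow> fgmod (to_fdg M)"
proof (rule fgiso_fgmod)
  assume "fgmod M"
  then interpret M: fgmod M .
  show "fgiso (to_fdg M) M (\<lambda>x. x)"
    using M.smult_closed by (auto simp: fgiso_def bij_betw_def M.piece_closed M.filt_closed)
qed

lemma fdg_to_fdg:
  assumes "fgmod M"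
  shows "fdg (to_fdg M)"
proof -
  interpret M: fgmod M by fact
  show ?thesis
    by (intro fdg.intro fgmod_to_fdg assms fdg_axioms.intro)
       (auto intro: M.piece_zero M.filt_zero)
qed

lemma fdg_hom_to_fdg:
  assumes "fgmod M" "fgmod N" "bhom M N f"
  shows "fdg_hom (to_fdg M) (to_fdg N) f"
  using assms by (auto simp: fdg_hom_def fdg_to_fdg bhomD bhom_zero)

definition bmap :: "'a bimodule \<Rightarrow> ('a univ \<Rightarrow> 'a univ) \<Rightarrow> 'a bimodule \<Rightarrow> 'a univ d2_word" where
  "bmap M f N = Map (to_fdg M) f (to_fdg N)"

lemma bmap_mor: "fgmod M \<Longrightarrow> fgmod N \<Longrightarrow> bhom M N f \<Longrightarrow> d2_mor (to_fdg M) (to_fdg N) (bmap M f N)"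
  unfolding bmap_def by (intro d2_mor.map fdg_hom_to_fdg)

lemma bmap_cong:
  "fgmod M \<Longrightarrow> fgmod N \<Longrightarrow> bhom M N f \<Longrightarrow> bhom M N g \<Longrightarrow> (\<And>x. x \<in> carrier M \<Longrightarrow> f x = g x) \<Longrightarrow>
    d2_eq (to_fdg M) (to_fdg N) (bmap M f N) (bmap M g N)"
  unfolding bmap_def by (intro d2_eq.map_cong fdg_hom_to_fdg) auto

lemma bmap_comp:
  assumes "fgmod M" "fgmod N" "fgmod P" "bhom M N f" "bhom N P g" "bhom M P k"
    "\<And>x. x \<in> carrier M \<Longrightarrow> g (f x) = k x"
  shows "d2_eq (to_fdg M) (to_fdg P) (Comp (bmap N g P) (bmap M f N)) (bmap M k P)"
proof (rule d2_eq.trans)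
  show "d2_eq (to_fdg M) (to_fdg P) (Comp (bmap N g P) (bmap M f N)) (bmap M (\<lambda>x. g (f x)) P)"
    unfolding bmap_def by (intro d2_eq.map_comp fdg_hom_to_fdg assms)
  show "d2_eq (to_fdg M) (to_fdg P) (bmap M (\<lambda>x. g (f x)) P) (bmap M k P)"
    by (intro bmap_cong assms bhom_comp[OF assms(4,5)])
qed

lemma bmap_add:
  assumes "fgmod M" "fgmod N" "bhom M N f" "bhom M N g"
  shows "d2_eq (to_fdg M) (to_fdg N) (Add (bmap M f N) (bmap M g N)) (bmap M (\<lambda>x. f x \<oplus>\<^bsub>N\<^esub> g x) N)"
  using d2_eq.map_add[OF fdg_hom_to_fdg[OF assms(1-3)] fdg_hom_to_fdg[OF assms(1,2,4)]]
  by (simp add: bmap_def)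

lemma ash_bmap [simp]: "ash_mor n (bmap M f N) = bmap (ash n M) f (ash n N)"
  by (simp add: bmap_def)

lemma to_ch_simps [simp]:
  "term (to_ch C) i = to_fdg (bterm C i)"
  "odif (to_ch C) i = bmap (bterm C i) (bdif C i) (ash 1 (bterm C (i - 2)))"
  by (simp_all add: to_ch_def bmap_def)

text \<open>On a module with trivial carrier the identity and the zero map agree on elements, so
  they are equal in D_2; this gives boundedness.\<close>

lemma ch_complex_to_ch:
  assumes "bcpx (bterm C) (bdif C)"
  shows "ch_complex (to_ch C)"
proof -
  note C = bcpxD[OF assms]
  have "finite {i. \<not> d2_eq (term (to_ch C) i) (term (to_ch C) i) (Ident (term (to_ch C) i))
      (Zero (term (to_ch C) i) (term (to_ch C) i))}"
  proof (rule finite_subset[OF _ C(4)], rule subsetI, rule ccontr)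
    fix i assume *: "i \<in> {i. \<not> d2_eq (term (to_ch C) i) (term (to_ch C) i) (Ident (term (to_ch C) i))
      (Zero (term (to_ch C) i) (term (to_ch C) i))}"
    assume "i \<notin> {i. carrier (bterm C i) \<noteq> {\<zero>\<^bsub>bterm C i\<^esub>}}"
    then have "carrier (bterm C i) = {\<zero>\<^bsub>bterm C i\<^esub>}" by simp
    then have "d2_eq (to_fdg (bterm C i)) (to_fdg (bterm C i))
        (bmap (bterm C i) (\<lambda>x. x) (bterm C i)) (bmap (bterm C i) (\<lambda>x. \<zero>\<^bsub>bterm C i\<^esub>) (bterm C i))"
      by (intro bmap_cong C(1) bhom_id bhom_0) auto
    with * show False by (simp add: bmap_def)
  qed
  moreover have "d2_eq (term (to_ch C) i) (ash 2 (term (to_ch C) (i - 4)))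
            (Comp (ash_mor 1 (odif (to_ch C) (i - 2))) (odif (to_ch C) i))
            (Zero (term (to_ch C) i) (ash 2 (term (to_ch C) (i - 4))))" for i
  proof -
    have d: "bhom (ash 1 (bterm C (i - 2))) (ash 2 (bterm C (i - 4))) (bdif C (i - 2))"
      using bhom_shift[OF C(2)[of "i - 2"], of 1 0 0] by simp
    have z: "bhom (bterm C i) (ash 2 (bterm C (i - 4))) (\<lambda>x. \<zero>\<^bsub>bterm C (i - 4)\<^esub>)"
      using bhom_0[OF C(1) fgmod_shift[OF C(1)]] by simp
    have "d2_eq (to_fdg (bterm C i)) (to_fdg (ash 2 (bterm C (i - 4))))
        (Comp (bmap (ash 1 (bterm C (i - 2))) (bdif C (i - 2)) (ash 2 (bterm C (i - 4))))
              (bmap (bterm C i) (bdif C i) (ash 1 (bterm C (i - 2)))))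
        (bmap (bterm C i) (\<lambda>x. \<zero>\<^bsub>bterm C (i - 4)\<^esub>) (ash 2 (bterm C (i - 4))))"
      by (intro bmap_comp C fgmod_shift d z)
    then show ?thesis by (simp add: bmap_def)
  qed
  ultimately show ?thesis
    using C bmap_mor[OF C(1) fgmod_shift[OF C(1)] C(2)] by (simp add: ch_complex_def fdg_to_fdg)
qed

text \<open>All maps of a retract are honest filtered maps, so both sides of each required equation
  in D_2 reduce to a single generator \<open>Map\<close>. No formal inverse enters.\<close>

lemma sdr_homotopy_equivalent:
  assumes C: "bcpx (bterm C) (bdif C)" and D: "bcpx (bterm D) (bdif D)"
    and sdr: "sdr (bterm C) (bdif C) (bterm D) (bdif D) p s h"
  shows "to_ch C \<simeq>\<^sub>h to_ch D"
proof -
  note c = bcpxD[OF C] and d = bcpxD[OF D] and r = sdrD[OF sdr]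
  let ?p = "\<lambda>i. bmap (bterm C i) (p i) (bterm D i)"
  let ?s = "\<lambda>i. bmap (bterm D i) (s i) (bterm C i)"
  have p: "ch_map (to_ch C) (to_ch D) ?p"
    unfolding ch_map_def
  proof (intro conjI allI)
    fix i
    show "d2_mor (term (to_ch C) i) (term (to_ch D) i) (?p i)"
      using bmap_mor[OF c(1) d(1) r(1)] by simp
    let ?k = "\<lambda>x. bdif D i (p i x)"
    have k: "bhom (bterm C i) (ash 1 (bterm D (i - 2))) ?k"
      by (rule bhom_comp[OF r(1) d(2)])
    have "d2_eq (to_fdg (bterm C i)) (to_fdg (ash 1 (bterm D (i - 2))))
        (Comp (bmap (bterm D i) (bdif D i) (ash 1 (bterm D (i - 2)))) (?p i))
        (bmap (bterm C i) ?k (ash 1 (bterm D (i - 2))))"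
      by (intro bmap_comp c d r fgmod_shift k HOL.refl)
    moreover have "d2_eq (to_fdg (bterm C i)) (to_fdg (ash 1 (bterm D (i - 2))))
        (Comp (bmap (ash 1 (bterm C (i - 2))) (p (i - 2)) (ash 1 (bterm D (i - 2))))
              (bmap (bterm C i) (bdif C i) (ash 1 (bterm C (i - 2)))))
        (bmap (bterm C i) ?k (ash 1 (bterm D (i - 2))))"
      by (intro bmap_comp c d r fgmod_shift k bhom_shift)
    ultimately show "d2_eq (term (to_ch C) i) (ash 1 (term (to_ch D) (i - 2)))
        (Comp (odif (to_ch D) i) (?p i)) (Comp (ash_mor 1 (?p (i - 2))) (odif (to_ch C) i))"
      using d2_eq.trans d2_eq.sym by (simp, blast)
  qed
  have s: "ch_map (to_ch D) (to_ch C) ?s"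
    unfolding ch_map_def
  proof (intro conjI allI)
    fix i
    show "d2_mor (term (to_ch D) i) (term (to_ch C) i) (?s i)"
      using bmap_mor[OF d(1) c(1) r(2)] by simp
    let ?k = "\<lambda>x. bdif C i (s i x)"
    have k: "bhom (bterm D i) (ash 1 (bterm C (i - 2))) ?k"
      by (rule bhom_comp[OF r(2) c(2)])
    have "d2_eq (to_fdg (bterm D i)) (to_fdg (ash 1 (bterm C (i - 2))))
        (Comp (bmap (bterm C i) (bdif C i) (ash 1 (bterm C (i - 2)))) (?s i))
        (bmap (bterm D i) ?k (ash 1 (bterm C (i - 2))))"
      by (intro bmap_comp c d r fgmod_shift k HOL.refl)
    moreover have "d2_eq (to_fdg (bterm D i)) (to_fdg (ash 1 (bterm C (i - 2))))
        (Comp (bmap (ash 1 (bterm D (i - 2))) (s (i - 2)) (ash 1 (bterm C (i - 2))))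
              (bmap (bterm D i) (bdif D i) (ash 1 (bterm D (i - 2)))))
        (bmap (bterm D i) ?k (ash 1 (bterm C (i - 2))))"
      by (intro bmap_comp c d r fgmod_shift k bhom_shift)
    ultimately show "d2_eq (term (to_ch D) i) (ash 1 (term (to_ch C) (i - 2)))
        (Comp (odif (to_ch C) i) (?s i)) (Comp (ash_mor 1 (?s (i - 2))) (odif (to_ch D) i))"
      using d2_eq.trans d2_eq.sym by (simp, blast)
  qed
  have sp: "ch_homotopic (to_ch C) (to_ch C) (\<lambda>i. Comp (?s i) (?p i)) (\<lambda>i. Ident (term (to_ch C) i))"
    unfolding ch_homotopic_def
  proof (intro exI conjI allI)
    let ?h = "\<lambda>i. bmap (bterm C i) (h i) (ash (-1) (bterm C (i + 2)))"
    fix i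
    let ?C = "bterm C i"
    show "d2_mor (term (to_ch C) i) (ash (-1) (term (to_ch C) (i + 2))) (?h i)"
      using bmap_mor[OF c(1) fgmod_shift[OF c(1)] r(3)] by simp
    let ?u = "\<lambda>x. bdif C (i + 2) (h i x)" and ?v = "\<lambda>x. h (i - 2) (bdif C i x)"
    have d1: "bhom (ash (-1) (bterm C (i + 2))) ?C (bdif C (i + 2))"
      using bhom_shift[OF c(2)[of "i + 2"], of "-1" 0 0] by simp
    have h1: "bhom (ash 1 (bterm C (i - 2))) ?C (h (i - 2))"
      using bhom_shift[OF r(3)[of "i - 2"], of 1 0 0] by simp
    have u: "bhom ?C ?C ?u" by (rule bhom_comp[OF r(3) d1])
    have v: "bhom ?C ?C ?v" by (rule bhom_comp[OF c(2) h1])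
    have uv: "bhom ?C ?C (\<lambda>x. ?u x \<oplus>\<^bsub>?C\<^esub> ?v x)" by (intro bhom_add c u v)
    have iuv: "bhom ?C ?C (\<lambda>x. x \<oplus>\<^bsub>?C\<^esub> (?u x \<oplus>\<^bsub>?C\<^esub> ?v x))" by (intro bhom_add c uv bhom_id)
    have eu: "d2_eq (to_fdg ?C) (to_fdg ?C)
        (Comp (bmap (ash (-1) (bterm C (i + 2))) (bdif C (i + 2)) ?C) (?h i)) (bmap ?C ?u ?C)"
      by (intro bmap_comp c fgmod_shift r d1 u HOL.refl)
    have ev: "d2_eq (to_fdg ?C) (to_fdg ?C)
        (Comp (bmap (ash 1 (bterm C (i - 2))) (h (i - 2)) ?C) (bmap ?C (bdif C i) (ash 1 (bterm C (i - 2)))))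
        (bmap ?C ?v ?C)"
      by (intro bmap_comp c fgmod_shift h1 v HOL.refl)
    have euv: "d2_eq (to_fdg ?C) (to_fdg ?C)
        (Add (Comp (bmap (ash (-1) (bterm C (i + 2))) (bdif C (i + 2)) ?C) (?h i))
             (Comp (bmap (ash 1 (bterm C (i - 2))) (h (i - 2)) ?C) (bmap ?C (bdif C i) (ash 1 (bterm C (i - 2))))))
        (bmap ?C (\<lambda>x. ?u x \<oplus>\<^bsub>?C\<^esub> ?v x) ?C)"
      by (rule d2_eq.trans[OF d2_eq.add_cong[OF eu ev] bmap_add[OF c(1) c(1) u v]])
    have "d2_eq (to_fdg ?C) (to_fdg ?C)
        (Add (bmap ?C (\<lambda>x. x) ?C)
          (Add (Comp (bmap (ash (-1) (bterm C (i + 2))) (bdif C (i + 2)) ?C) (?h i))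
             (Comp (bmap (ash 1 (bterm C (i - 2))) (h (i - 2)) ?C) (bmap ?C (bdif C i) (ash 1 (bterm C (i - 2)))))))
        (bmap ?C (\<lambda>x. x \<oplus>\<^bsub>?C\<^esub> (?u x \<oplus>\<^bsub>?C\<^esub> ?v x)) ?C)"
      by (rule d2_eq.trans[OF d2_eq.add_cong[OF d2_eq.refl[OF bmap_mor[OF c(1) c(1) bhom_id]] euv]
            bmap_add[OF c(1) c(1) bhom_id uv]])
    moreover have "d2_eq (to_fdg ?C) (to_fdg ?C) (Comp (?s i) (?p i))
        (bmap ?C (\<lambda>x. x \<oplus>\<^bsub>?C\<^esub> (?u x \<oplus>\<^bsub>?C\<^esub> ?v x)) ?C)"
      by (intro bmap_comp c d r iuv)
    ultimately show "d2_eq (term (to_ch C) i) (term (to_ch C) i) (Comp (?s i) (?p i))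
       (Add (Ident (term (to_ch C) i))
         (Add (Comp (ash_mor (-1) (odif (to_ch C) (i + 2))) (?h i))
           (Comp (ash_mor 1 (?h (i - 2))) (odif (to_ch C) i))))"
      using d2_eq.trans d2_eq.sym by (simp add: bmap_def[of _ "\<lambda>x. x"], blast)
  qed
  have ps: "ch_homotopic (to_ch D) (to_ch D) (\<lambda>i. Comp (?p i) (?s i)) (\<lambda>i. Ident (term (to_ch D) i))"
    unfolding ch_homotopic_def
  proof (intro exI conjI allI)
    \<comment> \<open>Since \<open>p\<close> after \<open>s\<close> is the identity strictly, the
      zero homotopy serves on this side.\<close>
    let ?z = "\<lambda>i x. \<zero>\<^bsub>bterm D (i + 2)\<^esub>"
    let ?h = "\<lambda>i. bmap (bterm D i) (?z i) (ash (-1) (bterm D (i + 2)))"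
    fix i
    let ?D = "bterm D i"
    interpret Di: fgmod "bterm D i" by (rule d(1))
    have z: "bhom (bterm D i) (ash (-1) (bterm D (i + 2))) (?z i)" for i
      using bhom_0[OF d(1) fgmod_shift[OF d(1)]] by simp
    show "d2_mor (term (to_ch D) i) (ash (-1) (term (to_ch D) (i + 2))) (?h i)"
      using bmap_mor[OF d(1) fgmod_shift[OF d(1)] z] by simp
    let ?o = "\<lambda>x. \<zero>\<^bsub>?D\<^esub>"
    have d1: "bhom (ash (-1) (bterm D (i + 2))) ?D (bdif D (i + 2))"
      using bhom_shift[OF d(2)[of "i + 2"], of "-1" 0 0] by simp
    have h1: "bhom (ash 1 (bterm D (i - 2))) ?D ?o"
      using bhom_0[OF fgmod_shift[OF d(1)] d(1)] by simp
    have o: "bhom ?D ?D ?o" by (intro bhom_0 d)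
    have eu: "d2_eq (to_fdg ?D) (to_fdg ?D)
        (Comp (bmap (ash (-1) (bterm D (i + 2))) (bdif D (i + 2)) ?D) (?h i)) (bmap ?D ?o ?D)"
      by (intro bmap_comp d fgmod_shift z d1 o)
         (use bhom_zero[OF fgmod_shift[OF d(1)] d(1) d1] in simp)
    have ev: "d2_eq (to_fdg ?D) (to_fdg ?D)
        (Comp (bmap (ash 1 (bterm D (i - 2))) ?o ?D) (bmap ?D (bdif D i) (ash 1 (bterm D (i - 2)))))
        (bmap ?D ?o ?D)"
      by (intro bmap_comp d fgmod_shift h1 o HOL.refl)
    have euv: "d2_eq (to_fdg ?D) (to_fdg ?D)
        (Add (Comp (bmap (ash (-1) (bterm D (i + 2))) (bdif D (i + 2)) ?D) (?h i))
             (Comp (bmap (ash 1 (bterm D (i - 2))) ?o ?D) (bmap ?D (bdif D i) (ash 1 (bterm D (i - 2))))))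
        (bmap ?D (\<lambda>x. ?o x \<oplus>\<^bsub>?D\<^esub> ?o x) ?D)"
      by (rule d2_eq.trans[OF d2_eq.add_cong[OF eu ev] bmap_add[OF d(1) d(1) o o]])
    have "d2_eq (to_fdg ?D) (to_fdg ?D)
        (Add (bmap ?D (\<lambda>x. x) ?D)
          (Add (Comp (bmap (ash (-1) (bterm D (i + 2))) (bdif D (i + 2)) ?D) (?h i))
             (Comp (bmap (ash 1 (bterm D (i - 2))) ?o ?D) (bmap ?D (bdif D i) (ash 1 (bterm D (i - 2)))))))
        (bmap ?D (\<lambda>x. x \<oplus>\<^bsub>?D\<^esub> (?o x \<oplus>\<^bsub>?D\<^esub> ?o x)) ?D)"
      by (rule d2_eq.trans[OF d2_eq.add_cong[OF d2_eq.refl[OF bmap_mor[OF d(1) d(1) bhom_id]] euv]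
            bmap_add[OF d(1) d(1) bhom_id bhom_add[OF d(1) d(1) o o]]])
    moreover have "d2_eq (to_fdg ?D) (to_fdg ?D) (Comp (?p i) (?s i))
        (bmap ?D (\<lambda>x. x \<oplus>\<^bsub>?D\<^esub> (?o x \<oplus>\<^bsub>?D\<^esub> ?o x)) ?D)"
      by (intro bmap_comp c d r bhom_add o bhom_id) (use r(6) in simp)
    ultimately show "d2_eq (term (to_ch D) i) (term (to_ch D) i) (Comp (?p i) (?s i))
       (Add (Ident (term (to_ch D) i))
         (Add (Comp (ash_mor (-1) (odif (to_ch D) (i + 2))) (?h i))
           (Comp (ash_mor 1 (?h (i - 2))) (odif (to_ch D) i))))"
      using d2_eq.trans d2_eq.sym by (simp add: bmap_def[of _ "\<lambda>x. x"], blast)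
  qed
  show ?thesis
    unfolding homotopy_equivalent_def
    using ch_complex_to_ch[OF C] ch_complex_to_ch[OF D] p s sp ps by blast
qed

section \<open>The cone model of the composition with the elementary braid\<close>

text \<open>
  Over \<open>Q[y]\<close>, the bimodule \<open>B(z,y)\<close> is free on \<open>1\<close> and \<open>z_minus - y_minus\<close>, so that
  \<open>B \<circ> N\<close> is \<open>N \<times> N\<close> with the action below. \<open>bcone A N\<close> is \<open>A \<times> (B \<circ> N)\<close> with the degree
  shifts of the two terms of \<open>[\<sigma>\<^sup>-]\<close>.
\<close>

definition bcone :: "('u, 'm) fgmod_scheme \<Rightarrow> ('v, 'n) fgmod_scheme \<Rightarrow> ('u \<times> 'v \<times> 'v) fgmod" where
  "bcone A N =
     \<lparr>carrier = carrier A \<times> carrier N \<times> carrier N, monoid.mult = undefined, monoid.one = undefined,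
      ring.zero = (\<zero>\<^bsub>A\<^esub>, \<zero>\<^bsub>N\<^esub>, \<zero>\<^bsub>N\<^esub>),
      ring.add = \<lambda>(x, y, z) (x', y', z'). (x \<oplus>\<^bsub>A\<^esub> x', y \<oplus>\<^bsub>N\<^esub> y', z \<oplus>\<^bsub>N\<^esub> z'),
      smult = \<lambda>p (x, y, z). (p \<odot>\<^bsub>A\<^esub> x, p \<odot>\<^bsub>N\<^esub> y, dem p \<odot>\<^bsub>N\<^esub> y \<oplus>\<^bsub>N\<^esub> swapY p \<odot>\<^bsub>N\<^esub> z),
      piece = \<lambda>a q. piece A (a + 1) (q + 2) \<times> piece N a (q + 2) \<times> piece N a q,
      filt = \<lambda>i. filt A (i + 1) \<times> filt N (i + 1) \<times> filt N (i - 1)\<rparr>"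

lemma cone_simps [simp]:
  "carrier (bcone A N) = carrier A \<times> carrier N \<times> carrier N"
  "\<zero>\<^bsub>bcone A N\<^esub> = (\<zero>\<^bsub>A\<^esub>, \<zero>\<^bsub>N\<^esub>, \<zero>\<^bsub>N\<^esub>)"
  "(x, y, z) \<oplus>\<^bsub>bcone A N\<^esub> (x', y', z') = (x \<oplus>\<^bsub>A\<^esub> x', y \<oplus>\<^bsub>N\<^esub> y', z \<oplus>\<^bsub>N\<^esub> z')"
  "p \<odot>\<^bsub>bcone A N\<^esub> (x, y, z) = (p \<odot>\<^bsub>A\<^esub> x, p \<odot>\<^bsub>N\<^esub> y, dem p \<odot>\<^bsub>N\<^esub> y \<oplus>\<^bsub>N\<^esub> swapY p \<odot>\<^bsub>N\<^esub> z)"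
  "piece (bcone A N) a q = piece A (a + 1) (q + 2) \<times> piece N a (q + 2) \<times> piece N a q"
  "filt (bcone A N) i = filt A (i + 1) \<times> filt N (i + 1) \<times> filt N (i - 1)"
  by (simp_all add: bcone_def)

text \<open>The action moves the second entry into the third by \<open>dem p\<close>, which lowers
  the q-degree by 2; this matches the offset 2 between the degrees of these entries, which is the
  degree of the basis element z_minus - y_minus. Associativity is the twisted Leibniz rule.\<close>

lemma fgmod_cone:
  assumes "fgmod A" "fgmod N"
  shows "fgmod (bcone A N)"
proof -
  interpret A: fgmod A by fact
  interpret N: fgmod N by fact
  interpret PA: fgm A A.component by (rule A.fgm)
  interpret PN: fgm N N.component by (rule N.fgm)
  define \<pi> where "\<pi> = (\<lambda>g (x, y, z). (A.component (fst g + 1, snd g + 2) x,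
     N.component (fst g, snd g + 2) y, N.component g z))"
  have \<pi>: "\<pi> g (x, y, z) = (A.component (fst g + 1, snd g + 2) x,
     N.component (fst g, snd g + 2) y, N.component g z)" for g x y z
    by (simp add: \<pi>_def)
  have sm: "swapY p \<odot>\<^bsub>N\<^esub> z \<in> piece N a (q + e)" if "homogeneous e p" "z \<in> piece N a q" for e p z a q
    using that by (intro PN.smult_piece homogeneous_substs)
  have dm: "dem p \<odot>\<^bsub>N\<^esub> y \<in> piece N a (q + e)" if "homogeneous e p" "y \<in> piece N a (q + 2)" for e p y a q
    using PN.smult_piece[OF homogeneous_dem[OF that(1)] that(2)] by (simp add: algebra_simps)
  have "fgm (bcone A N) \<pi>"
  proof
    show "\<exists>y\<in>carrier (bcone A N). y \<oplus>\<^bsub>bcone A N\<^esub> x = \<zero>\<^bsub>bcone A N\<^esub>" if "x \<in> carrier (bcone A N)" for x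
    proof (cases x)
      case (fields u v w)
      then show ?thesis using that
        by (intro bexI[of _ "(\<ominus>\<^bsub>A\<^esub> u, \<ominus>\<^bsub>N\<^esub> v, \<ominus>\<^bsub>N\<^esub> w)"]) (auto simp: A.M.l_neg N.M.l_neg)
    qed
    show "(p + q) \<odot>\<^bsub>bcone A N\<^esub> x = p \<odot>\<^bsub>bcone A N\<^esub> x \<oplus>\<^bsub>bcone A N\<^esub> q \<odot>\<^bsub>bcone A N\<^esub> x"
      if "x \<in> carrier (bcone A N)" for p q x
      using that by (cases x) (auto simp: PA.smult_ladd PN.smult_ladd dem_add PN.smult_closed N.M.a_ac)
    show "(p * q) \<odot>\<^bsub>bcone A N\<^esub> x = p \<odot>\<^bsub>bcone A N\<^esub> (q \<odot>\<^bsub>bcone A N\<^esub> x)"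
      if "x \<in> carrier (bcone A N)" for p q x
      using that by (cases x)
        (auto simp: PA.smult_mult PN.smult_mult dem_mult PN.smult_ladd PN.smult_radd PN.smult_closed N.M.a_ac)
    show "p \<odot>\<^bsub>bcone A N\<^esub> (x \<oplus>\<^bsub>bcone A N\<^esub> y) = p \<odot>\<^bsub>bcone A N\<^esub> x \<oplus>\<^bsub>bcone A N\<^esub> p \<odot>\<^bsub>bcone A N\<^esub> y"
      if "x \<in> carrier (bcone A N)" "y \<in> carrier (bcone A N)" for p x y
      using that by (cases x; cases y)
        (auto simp: PA.smult_radd PN.smult_radd PN.smult_closed N.M.a_ac)
    show "1 \<odot>\<^bsub>bcone A N\<^esub> x = x" if "x \<in> carrier (bcone A N)" for x
      using that N.smult_l_null by (cases x) (auto simp: PA.smult_one PN.smult_one)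
    show "p \<odot>\<^bsub>bcone A N\<^esub> x \<in> piece (bcone A N) a (q + e)"
      if "homogeneous e p" "x \<in> piece (bcone A N) a q" for e p a q x
    proof (cases x)
      case (fields u v w)
      with that have "u \<in> piece A (a + 1) (q + 2)" "v \<in> piece N a (q + 2)" "w \<in> piece N a q" by auto
      then show ?thesis
        using PA.smult_piece[OF that(1), of u "a + 1" "q + 2"] PN.smult_piece[OF that(1), of v a "q + 2"]
          dm[OF that(1)] sm[OF that(1)] fields
        by (auto intro!: PN.add_piece simp: add.assoc add.commute[of 2])
    qed
    show "x \<in> filt (bcone A N) i" if "x \<in> filt (bcone A N) (i + 1)" for i x
      using that PA.filt_Suc PN.filt_Suc[of _ "i + 1"] PN.filt_Suc[of _ "i - 1"] by (cases x) auto
    show "finite {g. \<pi> g x \<noteq> \<zero>\<^bsub>bcone A N\<^esub>}" if "x \<in> carrier (bcone A N)" for x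
    proof (cases x)
      case (fields u v w)
      let ?S = "(\<lambda>g. (fst g - 1, snd g - 2)) ` {g. A.component g u \<noteq> \<zero>\<^bsub>A\<^esub>} \<union>
        (\<lambda>g. (fst g, snd g - 2)) ` {g. N.component g v \<noteq> \<zero>\<^bsub>N\<^esub>} \<union> {g. N.component g w \<noteq> \<zero>\<^bsub>N\<^esub>}"
      have "{g. \<pi> g x \<noteq> \<zero>\<^bsub>bcone A N\<^esub>} \<subseteq> ?S"
      proof
        fix g assume "g \<in> {g. \<pi> g x \<noteq> \<zero>\<^bsub>bcone A N\<^esub>}"
        then consider "A.component (fst g + 1, snd g + 2) u \<noteq> \<zero>\<^bsub>A\<^esub>"
          | "N.component (fst g, snd g + 2) v \<noteq> \<zero>\<^bsub>N\<^esub>" | "N.component g w \<noteq> \<zero>\<^bsub>N\<^esub>"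
          by (auto simp: fields \<pi>)
        then show "g \<in> ?S"
        proof cases
          case 1
          then show ?thesis by (intro UnI1 image_eqI[of _ _ "(fst g + 1, snd g + 2)"]) auto
        next
          case 2
          then have "g \<in> (\<lambda>g. (fst g, snd g - 2)) ` {g. N.component g v \<noteq> \<zero>\<^bsub>N\<^esub>}"
            by (intro image_eqI[of _ _ "(fst g, snd g + 2)"]) auto
          then show ?thesis by blast
        qed simp
      qed
      moreover have "finite ?S" using that fields PA.proj_finite PN.proj_finite by auto
      ultimately show ?thesis by (rule finite_subset)
    qed
    show "x = \<zero>\<^bsub>bcone A N\<^esub>" if "x \<in> carrier (bcone A N)" "\<And>g. \<pi> g x = \<zero>\<^bsub>bcone A N\<^esub>" for x
    proof (cases x)
      case (fields u v w)
      have "A.component g u = \<zero>\<^bsub>A\<^esub>" for g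
        using that(2)[of "(fst g - 1, snd g - 2)"] by (simp add: fields \<pi>)
      moreover have "N.component g v = \<zero>\<^bsub>N\<^esub>" for g
        using that(2)[of "(fst g, snd g - 2)"] by (simp add: fields \<pi>)
      moreover have "N.component g w = \<zero>\<^bsub>N\<^esub>" for g
        using that(2)[of g] by (simp add: fields \<pi>)
      ultimately show ?thesis
        using that(1) fields PA.proj_zero PN.proj_zero by simp
    qed
    show "\<pi> g x = \<zero>\<^bsub>bcone A N\<^esub>" if "x \<in> piece (bcone A N) a q" "g \<noteq> (a, q)" for g a q x
      using that by (cases x; cases g) (auto simp: \<pi> intro!: PA.proj_other PN.proj_other)
    show "r \<odot>\<^bsub>bcone A N\<^esub> x \<in> filt (bcone A N) i" if "x \<in> filt (bcone A N) i" for i r x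
      \<comment> \<open>\<open>dem p\<close> carries an element of filtration index
        \<open>i + 1\<close> into the third entry, where only \<open>i - 1\<close> is
        demanded.\<close>
      using that N.filt_mono[of _ "i + 1" "i - 1"]
      by (cases x) (auto intro!: N.filt_add A.filt_smult N.filt_smult)
  qed (auto simp: \<pi> A.M.a_ac N.M.a_ac PA.proj_add PN.proj_add PA.proj_same PN.proj_same
      intro: PA.smult_closed PN.smult_closed
      PA.piece_carrier PN.piece_carrier PA.filt_carrier PN.filt_carrier
      PA.zero_piece PN.zero_piece PA.zero_filt PN.zero_filt
      PA.add_piece PN.add_piece PA.add_filt PN.add_filt PA.smult_filt PN.smult_filt
      PA.proj_piece PN.proj_piece PA.proj_filt PN.proj_filt)
  then show ?thesis by (rule fgm.fgmod)
qed

text \<open>The crossing has I in t-degree -1/2 and B in t-degree 1/2, that is, at the indices -1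
  and 1; hence the neighbours \<open>k + 1\<close> and \<open>k - 1\<close>.\<close>

definition cone_term :: "(int \<Rightarrow> 'u fgmod) \<Rightarrow> int \<Rightarrow> ('u \<times> 'u \<times> 'u) fgmod" where
  "cone_term T k = bcone (T (k + 1)) (T (k - 1))"

text \<open>\<open>chi_minus\<close> kills the basis element z_minus - y_minus, so it sends (y, z)
  to y. The sign of the differential of \<open>x\<close> is that of the composite at index
  -1.\<close>

definition cone_dif :: "(int \<Rightarrow> 'u fgmod) \<Rightarrow> (int \<Rightarrow> 'u \<Rightarrow> 'u) \<Rightarrow> int \<Rightarrow> 'u \<times> 'u \<times> 'u \<Rightarrow> 'u \<times> 'u \<times> 'u" where
  "cone_dif T d k = (\<lambda>(x, y, z). (y \<oplus>\<^bsub>T (k - 1)\<^esub> \<ominus>\<^bsub>T (k - 1)\<^esub> d (k + 1) x, d (k - 1) y, d (k - 1) z))"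

lemma bcpx_cone:
  assumes T: "bcpx T d"
  shows "bcpx (cone_term T) (cone_dif T d)"
  unfolding bcpx_def
proof (intro conjI allI ballI)
  note D = bcpxD[OF T]
  fix k
  show "fgmod (cone_term T k)" unfolding cone_term_def by (intro fgmod_cone D)
  interpret N: fgmod "T (k - 1)" by (rule D)
  interpret N': fgmod "T (k - 3)" by (rule D)
  have d1: "bhom (T (k + 1)) (ash 1 (T (k - 1))) (d (k + 1))" using D(2)[of "k + 1"] by simp
  have d2: "bhom (T (k - 1)) (ash 1 (T (k - 3))) (d (k - 1))" using D(2)[of "k - 1"] by simp
  note e = bhomD[OF d1, simplified] and f = bhomD[OF d2, simplified]
  show "bhom (cone_term T k) (ash 1 (cone_term T (k - 2))) (cone_dif T d k)"
    unfolding bhom_def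
  proof (intro conjI allI ballI)
    show "cone_dif T d k x \<in> carrier (ash 1 (cone_term T (k - 2)))" if "x \<in> carrier (cone_term T k)" for x
      using that e f by (cases x) (auto simp: cone_term_def cone_dif_def)
    show "cone_dif T d k (x \<oplus>\<^bsub>cone_term T k\<^esub> y) =
        cone_dif T d k x \<oplus>\<^bsub>ash 1 (cone_term T (k - 2))\<^esub> cone_dif T d k y"
      if "x \<in> carrier (cone_term T k)" "y \<in> carrier (cone_term T k)" for x y
      using that e f by (cases x; cases y)
        (auto simp: cone_term_def cone_dif_def N.M.minus_add N.M.a_ac)
    show "cone_dif T d k (p \<odot>\<^bsub>cone_term T k\<^esub> x) = p \<odot>\<^bsub>ash 1 (cone_term T (k - 2))\<^esub> cone_dif T d k x"
      if "x \<in> carrier (cone_term T k)" for p x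
      using that e f by (cases x)
        (auto simp: cone_term_def cone_dif_def N.smult_r_minus N.smult_r_distr)
    show "cone_dif T d k x \<in> piece (ash 1 (cone_term T (k - 2))) a q"
      if "x \<in> piece (cone_term T k) a q" for a q x
      using that e(4)[of _ "a + 1" "q + 2"] f(4)
      by (cases x) (auto simp: cone_term_def cone_dif_def intro!: N.piece_add N.piece_neg)
    show "cone_dif T d k x \<in> filt (ash 1 (cone_term T (k - 2))) i"
      if "x \<in> filt (cone_term T k) i" for i x
      using that e(5) f(5)
      by (cases x) (auto simp: cone_term_def cone_dif_def intro!: N.filt_add N.filt_neg)
  qed
  show "cone_dif T d (k - 2) (cone_dif T d k x) = \<zero>\<^bsub>cone_term T (k - 4)\<^esub>"
    if x: "x \<in> carrier (cone_term T k)" for x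
  proof (cases x)
    case (fields u v w)
    with x have c: "u \<in> carrier (T (k + 1))" "v \<in> carrier (T (k - 1))" "w \<in> carrier (T (k - 1))"
      by (auto simp: cone_term_def)
    have 1: "d (k - 1) (\<ominus>\<^bsub>T (k - 1)\<^esub> d (k + 1) u) = \<zero>\<^bsub>T (k - 3)\<^esub>"
    proof -
      have "d (k - 1) (\<ominus>\<^bsub>T (k - 1)\<^esub> d (k + 1) u) = (-1) \<odot>\<^bsub>T (k - 3)\<^esub> d (k - 1) (d (k + 1) u)"
        using e(1)[OF c(1)] f(3) by (simp add: N.neg_eq_smult)
      then show ?thesis using D(3)[of u "k + 1"] c by simp
    qed
    have 2: "d (k - 3) (d (k - 1) y) = \<zero>\<^bsub>T (k - 5)\<^esub>" if "y \<in> carrier (T (k - 1))" for y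
      using D(3)[of y "k - 1"] that by simp
    \<comment> \<open>Hence the first entry of the square of the differential is d v minus d
      v.\<close>
    have "d (k - 1) (v \<oplus>\<^bsub>T (k - 1)\<^esub> \<ominus>\<^bsub>T (k - 1)\<^esub> d (k + 1) u) = d (k - 1) v"
      using c e(1)[OF c(1)] f(1)[OF c(2)] f(2)[of v "\<ominus>\<^bsub>T (k - 1)\<^esub> d (k + 1) u"] by (simp add: 1)
    then show ?thesis
      using c f(1)[OF c(2)] by (simp add: fields cone_term_def cone_dif_def 2 N'.M.r_neg)
  qed
next
  let ?S = "{i. carrier (T i) \<noteq> {\<zero>\<^bsub>T i\<^esub>}}"
  have "{k. carrier (cone_term T k) \<noteq> {\<zero>\<^bsub>cone_term T k\<^esub>}} \<subseteq> (\<lambda>i. i - 1) ` ?S \<union> (\<lambda>i. i + 1) ` ?S"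
  proof
    fix k assume k: "k \<in> {k. carrier (cone_term T k) \<noteq> {\<zero>\<^bsub>cone_term T k\<^esub>}}"
    have "k + 1 \<in> ?S \<or> k - 1 \<in> ?S"
    proof (rule ccontr)
      assume "\<not> (k + 1 \<in> ?S \<or> k - 1 \<in> ?S)"
      then have "carrier (T (k + 1)) = {\<zero>\<^bsub>T (k + 1)\<^esub>}" "carrier (T (k - 1)) = {\<zero>\<^bsub>T (k - 1)\<^esub>}" by auto
      with k show False by (simp add: cone_term_def)
    qed
    then show "k \<in> (\<lambda>i. i - 1) ` ?S \<union> (\<lambda>i. i + 1) ` ?S"
      by (auto intro: image_eqI[of _ _ "k + 1"] image_eqI[of _ _ "k - 1"])
  qed
  then show "finite {k. carrier (cone_term T k) \<noteq> {\<zero>\<^bsub>cone_term T k\<^esub>}}"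
    using bcpxD(4)[OF T] finite_subset by blast
qed

text \<open>In the third entry the polynomials \<open>dem p\<close> and \<open>swapY p\<close> act
  by ordinary scalar multiplication, so applying a linear \<open>g\<close> entrywise respects the
  twisted action.\<close>

lemma bhom_cone:
  assumes "fgmod A" "fgmod N" "fgmod A'" "fgmod N'" "bhom A A' f" "bhom N N' g"
  shows "bhom (bcone A N) (bcone A' N') (\<lambda>(x, y, z). (f x, g y, g z))"
proof -
  interpret N: fgmod N by fact
  note f = bhomD[OF assms(5)] and g = bhomD[OF assms(6)]
  show ?thesis
    unfolding bhom_def by (auto simp: f g N.smult_closed)
qed

lemma cone_shift: "bcone (shift m k n A) (shift m k n N) = shift m k n (bcone A N)"
  by (simp add: bcone_def shift_def algebra_simps)

text \<open>The minus sign in the first entry of the homotopy serves twice: it compensates the sign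
  of the differential there, and it makes the two mixed terms h y, one from d h and one from h d,
  cancel.\<close>

lemma sdr_cone:
  assumes T: "bcpx T d" and T': "bcpx T' d'" and r: "sdr T d T' d' p s h"
  shows "sdr (cone_term T) (cone_dif T d) (cone_term T') (cone_dif T' d')
    (\<lambda>k (x, y, z). (p (k + 1) x, p (k - 1) y, p (k - 1) z))
    (\<lambda>k (x, y, z). (s (k + 1) x, s (k - 1) y, s (k - 1) z))
    (\<lambda>k (x, y, z). (\<ominus>\<^bsub>T (k + 3)\<^esub> h (k + 1) x, h (k - 1) y, h (k - 1) z))"
  unfolding sdr_def
proof (intro conjI allI ballI)
  note D = bcpxD[OF T] and D' = bcpxD[OF T'] and R = sdrD[OF r]
  fix k
  interpret N: fgmod "T (k - 1)" by (rule D)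
  interpret N': fgmod "T' (k - 1)" by (rule D')
  interpret A: fgmod "T (k + 1)" by (rule D)
  interpret A3: fgmod "T (k + 3)" by (rule D)
  show "bhom (cone_term T k) (cone_term T' k) (\<lambda>(x, y, z). (p (k + 1) x, p (k - 1) y, p (k - 1) z))"
    unfolding cone_term_def by (intro bhom_cone D D' R)
  show "bhom (cone_term T' k) (cone_term T k) (\<lambda>(x, y, z). (s (k + 1) x, s (k - 1) y, s (k - 1) z))"
    unfolding cone_term_def by (intro bhom_cone D D' R)
  have h1: "bhom (T (k + 1)) (ash (-1) (T (k + 3))) (h (k + 1))"
    using R(3)[of "k + 1"] by (simp add: add.assoc)
  have h2: "bhom (T (k - 1)) (ash (-1) (T (k + 1))) (h (k - 1))"
    using R(3)[of "k - 1"] by (simp add: add.commute)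
  have "bhom (T (k + 1)) (ash (-1) (T (k + 3))) (\<lambda>x. \<ominus>\<^bsub>ash (-1) (T (k + 3))\<^esub> h (k + 1) x)"
    by (rule bhom_uminus[OF D(1) fgmod_shift[OF D(1)] h1])
  then have "bhom (T (k + 1)) (ash (-1) (T (k + 3))) (\<lambda>x. \<ominus>\<^bsub>T (k + 3)\<^esub> h (k + 1) x)"
    by (simp add: a_inv_def m_inv_def shift_def)
  from bhom_cone[OF D(1) D(1) fgmod_shift[OF D(1)] fgmod_shift[OF D(1)] this h2]
  show "bhom (cone_term T k) (ash (-1) (cone_term T (k + 2)))
      (\<lambda>(x, y, z). (\<ominus>\<^bsub>T (k + 3)\<^esub> h (k + 1) x, h (k - 1) y, h (k - 1) z))"
    by (simp add: cone_term_def cone_shift add.commute)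
  have d1: "bhom (T (k + 1)) (ash 1 (T (k - 1))) (d (k + 1))" using D(2)[of "k + 1"] by simp
  have d2: "bhom (T (k - 1)) (ash 1 (T (k - 3))) (d (k - 1))" using D(2)[of "k - 1"] by simp
  have d3: "bhom (T (k + 3)) (ash 1 (T (k + 1))) (d (k + 3))" using D(2)[of "k + 3"] by (simp add: add.commute)
  have d1': "bhom (T' (k + 1)) (ash 1 (T' (k - 1))) (d' (k + 1))" using D'(2)[of "k + 1"] by simp
  note dc = bhomD(1)[OF d1, simplified] bhomD(1)[OF d2, simplified] bhomD(1)[OF d3, simplified]
    bhomD(1)[OF d1', simplified] bhomD(1)[OF h1, simplified] bhomD(1)[OF h2, simplified]
    bhomD(1)[OF R(1)] bhomD(1)[OF R(2)]
  show "(\<lambda>(x, y, z). (p (k - 2 + 1) x, p (k - 2 - 1) y, p (k - 2 - 1) z)) (cone_dif T d k x) =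
      cone_dif T' d' k ((\<lambda>(x, y, z). (p (k + 1) x, p (k - 1) y, p (k - 1) z)) x)"
    if "x \<in> carrier (cone_term T k)" for x
  proof (cases x)
    case (fields u v w)
    with that have c: "u \<in> carrier (T (k + 1))" "v \<in> carrier (T (k - 1))" "w \<in> carrier (T (k - 1))"
      by (auto simp: cone_term_def)
    show ?thesis
      using c R(4)[of u "k + 1"] R(4)[of _ "k - 1"] dc(1)[OF c(1)] bhom_neg[OF D(1) D'(1) R(1)]
      by (simp add: fields cone_dif_def bhomD(2)[OF R(1)])
  qed
  show "(\<lambda>(x, y, z). (s (k - 2 + 1) x, s (k - 2 - 1) y, s (k - 2 - 1) z)) (cone_dif T' d' k x) =
      cone_dif T d k ((\<lambda>(x, y, z). (s (k + 1) x, s (k - 1) y, s (k - 1) z)) x)"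
    if "x \<in> carrier (cone_term T' k)" for x
  proof (cases x)
    case (fields u v w)
    with that have c: "u \<in> carrier (T' (k + 1))" "v \<in> carrier (T' (k - 1))" "w \<in> carrier (T' (k - 1))"
      by (auto simp: cone_term_def)
    show ?thesis
      using c R(5)[of u "k + 1"] R(5)[of _ "k - 1"] dc(4)[OF c(1)] bhom_neg[OF D'(1) D(1) R(2)]
      by (simp add: fields cone_dif_def bhomD(2)[OF R(2)])
  qed
  show "(\<lambda>(x, y, z). (p (k + 1) x, p (k - 1) y, p (k - 1) z))
      ((\<lambda>(x, y, z). (s (k + 1) x, s (k - 1) y, s (k - 1) z)) x) = x"
    if "x \<in> carrier (cone_term T' k)" for x
    using that R(6) by (cases x) (auto simp: cone_term_def)
  show "(\<lambda>(x, y, z). (s (k + 1) x, s (k - 1) y, s (k - 1) z))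
      ((\<lambda>(x, y, z). (p (k + 1) x, p (k - 1) y, p (k - 1) z)) x) =
      x \<oplus>\<^bsub>cone_term T k\<^esub> (cone_dif T d (k + 2)
        ((\<lambda>(x, y, z). (\<ominus>\<^bsub>T (k + 3)\<^esub> h (k + 1) x, h (k - 1) y, h (k - 1) z)) x) \<oplus>\<^bsub>cone_term T k\<^esub>
      (\<lambda>(x, y, z). (\<ominus>\<^bsub>T (k - 2 + 3)\<^esub> h (k - 2 + 1) x, h (k - 2 - 1) y, h (k - 2 - 1) z)) (cone_dif T d k x))"
    if "x \<in> carrier (cone_term T k)" for x
  proof (cases x)
    case (fields u v w)
    with that have c: "u \<in> carrier (T (k + 1))" "v \<in> carrier (T (k - 1))" "w \<in> carrier (T (k - 1))"
      by (auto simp: cone_term_def)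
    have hdc: "h (k - 1) (d (k + 1) u) \<in> carrier (T (k + 1))" "h (k - 1) v \<in> carrier (T (k + 1))"
      "d (k + 3) (h (k + 1) u) \<in> carrier (T (k + 1))"
      using c dc by auto
    have hd: "h (k - 1) (v \<oplus>\<^bsub>T (k - 1)\<^esub> \<ominus>\<^bsub>T (k - 1)\<^esub> d (k + 1) u) =
        h (k - 1) v \<oplus>\<^bsub>T (k + 1)\<^esub> \<ominus>\<^bsub>T (k + 1)\<^esub> h (k - 1) (d (k + 1) u)"
    proof -
      have "h (k - 1) (v \<oplus>\<^bsub>T (k - 1)\<^esub> \<ominus>\<^bsub>T (k - 1)\<^esub> d (k + 1) u) =
        h (k - 1) v \<oplus>\<^bsub>T (k + 1)\<^esub> (-1) \<odot>\<^bsub>T (k + 1)\<^esub> h (k - 1) (d (k + 1) u)"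
        using c dc(1) bhomD(2,3)[OF h2] by (simp add: N.neg_eq_smult N.smult_closed)
      then show ?thesis using hdc by (simp add: A.neg_eq_smult)
    qed
    have dh: "d (k + 3) (\<ominus>\<^bsub>T (k + 3)\<^esub> h (k + 1) u) = \<ominus>\<^bsub>T (k + 1)\<^esub> d (k + 3) (h (k + 1) u)"
      using c dc(5) hdc bhomD(3)[OF d3] by (simp add: A3.neg_eq_smult A.neg_eq_smult)
    have 1: "s (k + 1) (p (k + 1) u) = u \<oplus>\<^bsub>T (k + 1)\<^esub>
        (h (k - 1) v \<oplus>\<^bsub>T (k + 1)\<^esub> \<ominus>\<^bsub>T (k + 1)\<^esub> (\<ominus>\<^bsub>T (k + 1)\<^esub> d (k + 3) (h (k + 1) u)) \<oplus>\<^bsub>T (k + 1)\<^esub>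
         \<ominus>\<^bsub>T (k + 1)\<^esub> (h (k - 1) v \<oplus>\<^bsub>T (k + 1)\<^esub> \<ominus>\<^bsub>T (k + 1)\<^esub> h (k - 1) (d (k + 1) u)))"
      (is "_ = ?rhs")
    proof -
      have "?rhs = u \<oplus>\<^bsub>T (k + 1)\<^esub> (d (k + 3) (h (k + 1) u) \<oplus>\<^bsub>T (k + 1)\<^esub> h (k - 1) (d (k + 1) u))"
      proof -
        have "h (k - 1) v \<oplus>\<^bsub>T (k + 1)\<^esub> x \<oplus>\<^bsub>T (k + 1)\<^esub> (\<ominus>\<^bsub>T (k + 1)\<^esub> h (k - 1) v \<oplus>\<^bsub>T (k + 1)\<^esub> y) = x \<oplus>\<^bsub>T (k + 1)\<^esub> y"
          if "x \<in> carrier (T (k + 1))" "y \<in> carrier (T (k + 1))" for x y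
          using that hdc by (simp add: A.M.a_ac A.M.r_neg A.M.r_neg1 A.M.r_neg2)
        then show ?thesis using hdc by (simp add: A.M.minus_add)
      qed
      then show ?thesis
        using R(7)[OF c(1)] by (simp add: algebra_simps)
    qed
    have 2: "s (k - 1) (p (k - 1) y) =
        y \<oplus>\<^bsub>T (k - 1)\<^esub> (d (k + 1) (h (k - 1) y) \<oplus>\<^bsub>T (k - 1)\<^esub> h (k - 3) (d (k - 1) y))"
      if "y \<in> carrier (T (k - 1))" for y
      using R(7)[OF that] by (simp add: algebra_simps)
    show ?thesis
      using c by (simp add: fields cone_term_def cone_dif_def hd dh add.assoc 1[unfolded add.assoc] 2 add.commute[of 1 k])
  qed
qed

section \<open>Tensor products\<close>

lemma formal_sum_simps [simp]:
  "formal_sum [] = 0" "formal_sum (x # l) = frag_of x + formal_sum l"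
  "formal_sum (l @ l') = formal_sum l + formal_sum l'"
  by (simp_all add: formal_sum_def)

lemma tens_rel_uminus: "f \<in> tens_rel M N \<Longrightarrow> - f \<in> tens_rel M N"
  using tens_rel.diff[OF tens_rel.zero, of f M N] by simp

lemma tens_rel_add: "f \<in> tens_rel M N \<Longrightarrow> g \<in> tens_rel M N \<Longrightarrow> f + g \<in> tens_rel M N"
  using tens_rel.diff[of f M N "- g"] tens_rel_uminus[of g M N] by simp

text \<open>Equality of sums of elementary tensors before a representative is chosen; calculations
  with tensors take place at this level.\<close>

definition tens_eq :: "'a bimodule \<Rightarrow> 'a bimodule \<Rightarrow> ('a univ \<times> 'a univ) list \<Rightarrow> ('a univ \<times> 'a univ) list \<Rightarrow> bool" where
  "tens_eq M N l l' \<longleftrightarrow> formal_sum l - formal_sum l' \<in> tens_rel M N"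

lemma tens_eq_refl [simp]: "tens_eq M N l l"
  by (simp add: tens_eq_def tens_rel.zero)

lemma tens_eq_sym: "tens_eq M N l l' \<Longrightarrow> tens_eq M N l' l"
  using tens_rel_uminus[of "formal_sum l - formal_sum l'" M N] by (simp add: tens_eq_def)

lemma tens_eq_trans [trans]: "tens_eq M N l l' \<Longrightarrow> tens_eq M N l' l'' \<Longrightarrow> tens_eq M N l l''"
  using tens_rel_add[of "formal_sum l - formal_sum l'" M N "formal_sum l' - formal_sum l''"]
  by (simp add: tens_eq_def)

lemma tens_eq_append: "tens_eq M N l l' \<Longrightarrow> tens_eq M N k k' \<Longrightarrow> tens_eq M N (l @ k) (l' @ k')"
  using tens_rel_add[of "formal_sum l - formal_sum l'" M N "formal_sum k - formal_sum k'"]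
  by (simp add: tens_eq_def algebra_simps)

lemma tens_eq_commute: "tens_eq M N (l @ k) (k @ l)"
  by (simp add: tens_eq_def add.commute tens_rel.zero)

lemma tens_class_cong:
  assumes "tens_eq M N l l'"
  shows "tens_class M N l = tens_class M N l'"
proof -
  have "tens_eq M N k l \<longleftrightarrow> tens_eq M N k l'" for k
    using assms tens_eq_trans tens_eq_sym by blast
  then have "(\<lambda>k. set k \<subseteq> carrier M \<times> carrier N \<and> formal_sum k - formal_sum l \<in> tens_rel M N) =
      (\<lambda>k. set k \<subseteq> carrier M \<times> carrier N \<and> formal_sum k - formal_sum l' \<in> tens_rel M N)"
    by (simp add: tens_eq_def)
  then show ?thesis by (simp add: tens_class_def)
qed

lemma summands_tens_class:
  assumes "set l \<subseteq> carrier M \<times> carrier N"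
  shows "set (summands (tens_class M N l)) \<subseteq> carrier M \<times> carrier N"
    "tens_eq M N (summands (tens_class M N l)) l"
proof -
  let ?P = "\<lambda>k. set k \<subseteq> carrier M \<times> carrier N \<and> formal_sum k - formal_sum l \<in> tens_rel M N"
  have "?P (SOME k. ?P k)"
    by (rule someI[of ?P l]) (use assms in \<open>simp add: tens_rel.zero\<close>)
  then show "set (summands (tens_class M N l)) \<subseteq> carrier M \<times> carrier N"
    "tens_eq M N (summands (tens_class M N l)) l"
    by (auto simp: tens_class_def tens_eq_def)
qed

lemma tens_simps:
  "carrier (tens M N) = tens_span M N (carrier M \<times> carrier N)" "\<zero>\<^bsub>tens M N\<^esub> = tens_class M N []"
  "x \<oplus>\<^bsub>tens M N\<^esub> y = tens_class M N (summands x @ summands y)"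
  "piece (tens M N) a q = tens_span M N (\<Union>a1 q1. piece M a1 q1 \<times> piece N (a - a1) (q - q1))"
  "filt (tens M N) i = tens_span M N (\<Union>j. filt M j \<times> filt N (i - j))"
  by (simp_all add: tens_def tens_group_def Let_def)

lemma tens_carrier_iff:
  "u \<in> carrier (tens M N) \<longleftrightarrow>
     set (summands u) \<subseteq> carrier M \<times> carrier N \<and> tens_class M N (summands u) = u"
proof
  assume "u \<in> carrier (tens M N)"
  then obtain l where l: "set l \<subseteq> carrier M \<times> carrier N" "u = tens_class M N l"
    by (auto simp: tens_simps tens_span_def)
  then show "set (summands u) \<subseteq> carrier M \<times> carrier N \<and> tens_class M N (summands u) = u"
    using summands_tens_class[OF l(1)] tens_class_cong by blast
next
  assume "set (summands u) \<subseteq> carrier M \<times> carrier N \<and> tens_class M N (summands u) = u"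
  then show "u \<in> carrier (tens M N)"
    unfolding tens_simps tens_span_def by (metis (mono_tags, lifting) image_eqI mem_Collect_eq)
qed

lemma tens_class_carrier: "set l \<subseteq> carrier M \<times> carrier N \<Longrightarrow> tens_class M N l \<in> carrier (tens M N)"
  by (auto simp: tens_simps tens_span_def)

lemma tens_class_add:
  assumes "set l \<subseteq> carrier M \<times> carrier N" "set l' \<subseteq> carrier M \<times> carrier N"
  shows "tens_class M N l \<oplus>\<^bsub>tens M N\<^esub> tens_class M N l' = tens_class M N (l @ l')"
  unfolding tens_simps
  by (intro tens_class_cong tens_eq_append summands_tens_class assms)

locale tens_mods = M: fgmod M + N: fgmod N for M N :: "'a bimodule"
begin

lemma tens_rel_zero_left: "n \<in> carrier N \<Longrightarrow> frag_of (\<zero>\<^bsub>M\<^esub>, n) \<in> tens_rel M N"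
  using tens_rel_uminus[OF tens_rel.add_left[of "\<zero>\<^bsub>M\<^esub>" M "\<zero>\<^bsub>M\<^esub>" n N]] by simp

lemma tens_eq_neg: "set l \<subseteq> carrier M \<times> carrier N \<Longrightarrow>
    tens_eq M N (map (\<lambda>(m, n). (\<ominus>\<^bsub>M\<^esub> m, n)) l @ l) []"
proof (induction l)
  case (Cons x l)
  obtain m n where x: "x = (m, n)" "m \<in> carrier M" "n \<in> carrier N" using Cons.prems by (cases x) auto
  have "frag_of (\<ominus>\<^bsub>M\<^esub> m \<oplus>\<^bsub>M\<^esub> m, n) - frag_of (\<ominus>\<^bsub>M\<^esub> m, n) - frag_of (m, n) \<in> tens_rel M N"
    using x by (intro tens_rel.add_left) auto
  then have "frag_of (\<zero>\<^bsub>M\<^esub>, n) - (frag_of (\<ominus>\<^bsub>M\<^esub> m, n) + frag_of (m, n)) \<in> tens_rel M N"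
    using x by (simp add: M.M.l_neg algebra_simps)
  from tens_rel.diff[OF tens_rel_zero_left[OF x(3)] this]
  have "frag_of (\<ominus>\<^bsub>M\<^esub> m, n) + frag_of (m, n) \<in> tens_rel M N" by (simp add: add.commute)
  moreover have "formal_sum (map (\<lambda>(m, n). (\<ominus>\<^bsub>M\<^esub> m, n)) (x # l) @ x # l) =
      (frag_of (\<ominus>\<^bsub>M\<^esub> m, n) + frag_of (m, n)) + formal_sum (map (\<lambda>(m, n). (\<ominus>\<^bsub>M\<^esub> m, n)) l @ l)"
    by (simp add: x algebra_simps)
  moreover have "formal_sum (map (\<lambda>(m, n). (\<ominus>\<^bsub>M\<^esub> m, n)) l @ l) \<in> tens_rel M N"
    using Cons by (simp add: tens_eq_def)
  ultimately have "formal_sum (map (\<lambda>(m, n). (\<ominus>\<^bsub>M\<^esub> m, n)) (x # l) @ x # l) \<in> tens_rel M N"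
    by (simp only: tens_rel_add)
  then show ?case
    unfolding tens_eq_def formal_sum_simps(1) by (simp only: diff_zero)
qed simp

text \<open>Scalar multiplication in \<open>tens\<close> is a finite sum formed in
  \<open>tens_group\<close>, so the group laws have to be available before \<open>tens\<close> can
  be treated as a module.\<close>

lemma abelian_group_tens_group: "abelian_group (tens_group M N)"
proof -
  have car: "carrier (tens_group M N) = carrier (tens M N)"
    and add: "\<And>x y. x \<oplus>\<^bsub>tens_group M N\<^esub> y = x \<oplus>\<^bsub>tens M N\<^esub> y"
    and zero: "\<zero>\<^bsub>tens_group M N\<^esub> = \<zero>\<^bsub>tens M N\<^esub>"
    by (simp_all add: tens_def Let_def)
  have cls: "\<exists>l. set l \<subseteq> carrier M \<times> carrier N \<and> u = tens_class M N l" if "u \<in> carrier (tens M N)" for u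
    using that tens_carrier_iff by metis
  have z: "\<zero>\<^bsub>tens M N\<^esub> = tens_class M N []" by (simp add: tens_simps)
  have "abelian_group (tens_group M N)"
  proof (rule abelian_groupI; unfold car add zero z)
    fix x y assume xy: "x \<in> carrier (tens M N)" "y \<in> carrier (tens M N)"
    then obtain l l' where l: "set l \<subseteq> carrier M \<times> carrier N" "x = tens_class M N l"
      "set l' \<subseteq> carrier M \<times> carrier N" "y = tens_class M N l'" using cls by metis
    show "x \<oplus>\<^bsub>tens M N\<^esub> y \<in> carrier (tens M N)"
      using l tens_class_carrier[of "l @ l'"] by (simp add: tens_class_add)
    show "x \<oplus>\<^bsub>tens M N\<^esub> y = y \<oplus>\<^bsub>tens M N\<^esub> x"
      using l tens_class_cong[OF tens_eq_commute] by (simp add: tens_class_add)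
    fix w assume "w \<in> carrier (tens M N)"
    then obtain l'' where "set l'' \<subseteq> carrier M \<times> carrier N" "w = tens_class M N l''" using cls by metis
    then show "x \<oplus>\<^bsub>tens M N\<^esub> y \<oplus>\<^bsub>tens M N\<^esub> w = x \<oplus>\<^bsub>tens M N\<^esub> (y \<oplus>\<^bsub>tens M N\<^esub> w)"
      using l by (simp add: tens_class_add)
  next
    fix x assume "x \<in> carrier (tens M N)"
    then obtain l where l: "set l \<subseteq> carrier M \<times> carrier N" "x = tens_class M N l" using cls by metis
    show "tens_class M N [] \<oplus>\<^bsub>tens M N\<^esub> x = x"
      using l by (simp add: tens_class_add)
    let ?l = "map (\<lambda>(m, n). (\<ominus>\<^bsub>M\<^esub> m, n)) l"
    have "set ?l \<subseteq> carrier M \<times> carrier N" using l(1) by auto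
    then show "\<exists>y\<in>carrier (tens M N). y \<oplus>\<^bsub>tens M N\<^esub> x = tens_class M N []"
      using l tens_class_cong[OF tens_eq_neg[OF l(1)]]
      by (intro bexI[of _ "tens_class M N ?l"]) (simp_all add: tens_class_add tens_class_carrier)
  qed (auto intro: tens_class_carrier)
  then show ?thesis .
qed

end

lemma (in abelian_group) a_inv_ring_eq:
  assumes "carrier H = carrier G" "\<And>x y. x \<oplus>\<^bsub>H\<^esub> y = x \<oplus> y" "\<zero>\<^bsub>H\<^esub> = \<zero>"
  shows "\<ominus>\<^bsub>H\<^esub> x = \<ominus> x"
  using assms by (simp add: a_inv_def m_inv_def)

text \<open>A balanced map \<open>\<phi>\<close> into a module \<open>P\<close> whose axioms are
  already known, whereas \<open>tens M N\<close> is so far a bare structure.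
  \<open>\<phi>_scale\<close> says that the split action of a monomial, with its y-part on the left
  factor and its x-part on the right one, matches the action on \<open>P\<close>.\<close>

locale tens_eval = tens_mods M N + P: fgmod P
  for M N :: "'a bimodule" and P :: "'p fgmod" +
  fixes \<phi> :: "'a univ \<Rightarrow> 'a univ \<Rightarrow> 'p"
  assumes \<phi>_closed: "\<And>m n. m \<in> carrier M \<Longrightarrow> n \<in> carrier N \<Longrightarrow> \<phi> m n \<in> carrier P"
    and \<phi>_add_left: "\<And>m m' n. m \<in> carrier M \<Longrightarrow> m' \<in> carrier M \<Longrightarrow> n \<in> carrier N \<Longrightarrow>
      \<phi> (m \<oplus>\<^bsub>M\<^esub> m') n = \<phi> m n \<oplus>\<^bsub>P\<^esub> \<phi> m' n"
    and \<phi>_add_right: "\<And>m n n'. m \<in> carrier M \<Longrightarrow> n \<in> carrier N \<Longrightarrow> n' \<in> carrier N \<Longrightarrow>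
      \<phi> m (n \<oplus>\<^bsub>N\<^esub> n') = \<phi> m n \<oplus>\<^bsub>P\<^esub> \<phi> m n'"
    and \<phi>_const: "\<And>c m n. m \<in> carrier M \<Longrightarrow> n \<in> carrier N \<Longrightarrow>
      \<phi> (Const c \<odot>\<^bsub>M\<^esub> m) n = \<phi> m (Const c \<odot>\<^bsub>N\<^esub> n)"
    and \<phi>_y1: "\<And>m n. m \<in> carrier M \<Longrightarrow> n \<in> carrier N \<Longrightarrow> \<phi> (Var X1 \<odot>\<^bsub>M\<^esub> m) n = \<phi> m (Var Y1 \<odot>\<^bsub>N\<^esub> n)"
    and \<phi>_y2: "\<And>m n. m \<in> carrier M \<Longrightarrow> n \<in> carrier N \<Longrightarrow> \<phi> (Var X2 \<odot>\<^bsub>M\<^esub> m) n = \<phi> m (Var Y2 \<odot>\<^bsub>N\<^esub> n)"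
    and \<phi>_scale: "\<And>c \<mu> m n. m \<in> carrier M \<Longrightarrow> n \<in> carrier N \<Longrightarrow>
      \<phi> ((Const c * y_part \<mu>) \<odot>\<^bsub>M\<^esub> m) (x_part \<mu> \<odot>\<^bsub>N\<^esub> n) = Poly_Mapping.single \<mu> c \<odot>\<^bsub>P\<^esub> \<phi> m n"
begin

definition lsum :: "('a univ \<times> 'a univ) list \<Rightarrow> 'p" where
  "lsum l = foldr (\<lambda>(m, n) s. \<phi> m n \<oplus>\<^bsub>P\<^esub> s) l \<zero>\<^bsub>P\<^esub>"

definition ev :: "'a univ \<Rightarrow> 'p" where
  "ev u = lsum (summands u)"

lemma lsum_simps [simp]: "lsum [] = \<zero>\<^bsub>P\<^esub>" "lsum ((m, n) # l) = \<phi> m n \<oplus>\<^bsub>P\<^esub> lsum l"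
  by (simp_all add: lsum_def)

lemma lsum_closed: "set l \<subseteq> carrier M \<times> carrier N \<Longrightarrow> lsum l \<in> carrier P"
  by (induction l) (auto simp: \<phi>_closed)

lemma lsum_append: "set l \<subseteq> carrier M \<times> carrier N \<Longrightarrow> set l' \<subseteq> carrier M \<times> carrier N \<Longrightarrow>
    lsum (l @ l') = lsum l \<oplus>\<^bsub>P\<^esub> lsum l'"
  by (induction l) (auto simp: \<phi>_closed lsum_closed P.M.a_assoc)

text \<open>\<open>\<phi>\<close> extends to a homomorphism on the free abelian group on pairs, and
  this kills the relations of the tensor product; so the value of a class does not depend on the
  chosen list.\<close>

lemma lsum_cong:
  assumes l: "set l \<subseteq> carrier M \<times> carrier N" and l': "set l' \<subseteq> carrier M \<times> carrier N"
    and eq: "tens_eq M N l l'"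
  shows "lsum l = lsum l'"
proof -
  let ?C = "carrier M \<times> carrier N"
  have "(\<lambda>(m, n). \<phi> m n) ` ?C \<subseteq> carrier (add_monoid P)"
    by (auto simp: \<phi>_closed)
  from comm_group.free_Abelian_group_universal[OF P.M.a_comm_group this]
  obtain h where h: "h \<in> hom (free_Abelian_group ?C) (add_monoid P)"
    "\<And>x. x \<in> ?C \<Longrightarrow> h (frag_of x) = (\<lambda>(m, n). \<phi> m n) x" by blast
  interpret H: group_hom "free_Abelian_group ?C" "add_monoid P" h
    using h(1) by (intro group_hom.intro group_hom_axioms.intro) (auto intro: P.M.a_group)
  \<comment> \<open>The homomorphism laws are available for combinations supported on pairs from the
    carriers, so the support is tracked through the induction over the relations.\<close>
  let ?K = "\<lambda>f. Poly_Mapping.keys f \<subseteq> ?C"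
  have frag: "?K (frag_of (m, n))" "h (frag_of (m, n)) = \<phi> m n"
    if "m \<in> carrier M" "n \<in> carrier N" for m n
    using that h(2) by (auto simp: keys_frag_of)
  have h0: "h 0 = \<zero>\<^bsub>P\<^esub>" using H.hom_one by simp
  have hadd: "h (f + g) = h f \<oplus>\<^bsub>P\<^esub> h g" "?K (f + g)" if "?K f" "?K g" for f g
    using that H.hom_mult[of f g] keys_add[of f g] by auto
  have hdiff: "h (f - g) = h f \<oplus>\<^bsub>P\<^esub> \<ominus>\<^bsub>P\<^esub> h g" "?K (f - g)" if "?K f" "?K g" for f g
  proof -
    have "h (- g) = \<ominus>\<^bsub>P\<^esub> h g" using H.hom_inv[of g] that by (simp add: a_inv_def)
    then show "h (f - g) = h f \<oplus>\<^bsub>P\<^esub> \<ominus>\<^bsub>P\<^esub> h g" using hadd(1)[of f "- g"] that by simp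
    show "?K (f - g)" using that keys_diff[of f g] by auto
  qed
  have hcl: "h f \<in> carrier P" if "?K f" for f
    using H.hom_closed[of f] that by simp
  have rel: "?K f \<and> h f = \<zero>\<^bsub>P\<^esub>" if "f \<in> tens_rel M N" for f
    using that
  proof induction
    case zero
    then show ?case by (simp add: h0)
  next
    case (diff f g)
    then show ?case using hdiff by auto
  next
    case (add_left m m' n)
    then show ?case
      using \<phi>_add_left[of m m' n] by (simp add: hdiff frag \<phi>_closed P.M.r_neg P.M.a_ac P.M.r_neg2)
  next
    case (add_right m n n')
    then show ?case
      using \<phi>_add_right[of m n n'] by (simp add: hdiff frag \<phi>_closed P.M.r_neg P.M.a_ac P.M.r_neg2)
  next
    case (const m n c)
    then show ?case
      using \<phi>_const[of m n c] by (simp add: hdiff frag \<phi>_closed M.smult_closed N.smult_closed P.M.r_neg)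
  next
    case (y1 m n)
    then show ?case
      using \<phi>_y1[of m n] by (simp add: hdiff frag \<phi>_closed M.smult_closed N.smult_closed P.M.r_neg)
  next
    case (y2 m n)
    then show ?case
      using \<phi>_y2[of m n] by (simp add: hdiff frag \<phi>_closed M.smult_closed N.smult_closed P.M.r_neg)
  qed
  have fs: "?K (formal_sum l) \<and> h (formal_sum l) = lsum l" if "set l \<subseteq> ?C" for l
    using that by (induction l) (auto simp: h0 hadd frag)
  have "h (formal_sum l - formal_sum l') = \<zero>\<^bsub>P\<^esub>"
    using rel eq by (simp add: tens_eq_def)
  then have "lsum l \<oplus>\<^bsub>P\<^esub> \<ominus>\<^bsub>P\<^esub> lsum l' = \<zero>\<^bsub>P\<^esub>"
    using fs[OF l] fs[OF l'] hdiff(1)[of "formal_sum l" "formal_sum l'"] by simp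
  then show ?thesis
    using lsum_closed[OF l] lsum_closed[OF l'] P.M.minus_equality P.M.minus_minus P.M.a_inv_closed by metis
qed

lemma ev_class: "set l \<subseteq> carrier M \<times> carrier N \<Longrightarrow> ev (tens_class M N l) = lsum l"
  unfolding ev_def by (intro lsum_cong summands_tens_class)

lemma ev_closed: "u \<in> carrier (tens M N) \<Longrightarrow> ev u \<in> carrier P"
  unfolding ev_def by (intro lsum_closed) (simp add: tens_carrier_iff)

lemma tens_add_closed:
  "u \<in> carrier (tens M N) \<Longrightarrow> v \<in> carrier (tens M N) \<Longrightarrow> u \<oplus>\<^bsub>tens M N\<^esub> v \<in> carrier (tens M N)"
  unfolding tens_simps(3) by (intro tens_class_carrier) (simp add: tens_carrier_iff)

lemma ev_add:
  "u \<in> carrier (tens M N) \<Longrightarrow> v \<in> carrier (tens M N) \<Longrightarrow> ev (u \<oplus>\<^bsub>tens M N\<^esub> v) = ev u \<oplus>\<^bsub>P\<^esub> ev v"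
  unfolding tens_simps(3) by (simp add: ev_class tens_carrier_iff lsum_append) (simp add: ev_def)

lemma ev_zero: "ev \<zero>\<^bsub>tens M N\<^esub> = \<zero>\<^bsub>P\<^esub>"
  by (simp add: tens_simps ev_class)

lemma tens_zero_closed: "\<zero>\<^bsub>tens M N\<^esub> \<in> carrier (tens M N)"
  by (simp add: tens_simps(2) tens_class_carrier)

lemma tens_group_eqs:
  "carrier (tens_group M N) = carrier (tens M N)"
  "x \<oplus>\<^bsub>tens_group M N\<^esub> y = x \<oplus>\<^bsub>tens M N\<^esub> y" "\<zero>\<^bsub>tens_group M N\<^esub> = \<zero>\<^bsub>tens M N\<^esub>"
  by (simp_all add: tens_def Let_def)

lemma tens_neg:
  assumes "u \<in> carrier (tens M N)"
  shows "\<ominus>\<^bsub>tens M N\<^esub> u \<in> carrier (tens M N)" "ev (\<ominus>\<^bsub>tens M N\<^esub> u) = \<ominus>\<^bsub>P\<^esub> ev u"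
proof -
  interpret T: abelian_group "tens_group M N" by (rule abelian_group_tens_group)
  have inv: "\<ominus>\<^bsub>tens M N\<^esub> u = \<ominus>\<^bsub>tens_group M N\<^esub> u"
    by (rule T.a_inv_ring_eq) (simp_all add: tens_group_eqs)
  show c: "\<ominus>\<^bsub>tens M N\<^esub> u \<in> carrier (tens M N)"
    unfolding inv using assms T.a_inv_closed[of u] by (simp add: tens_group_eqs)
  have "\<ominus>\<^bsub>tens M N\<^esub> u \<oplus>\<^bsub>tens M N\<^esub> u = \<zero>\<^bsub>tens M N\<^esub>"
    unfolding inv using assms T.l_neg[of u] by (simp add: tens_group_eqs)
  then have "ev (\<ominus>\<^bsub>tens M N\<^esub> u) \<oplus>\<^bsub>P\<^esub> ev u = \<zero>\<^bsub>P\<^esub>"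
    using ev_add[OF c assms] ev_zero by simp
  then show "ev (\<ominus>\<^bsub>tens M N\<^esub> u) = \<ominus>\<^bsub>P\<^esub> ev u"
    using P.M.minus_equality ev_closed c assms by metis
qed

text \<open>A polynomial is the sum of its monomials, and on each monomial
  \<open>\<phi>_scale\<close> applies summand by summand.\<close>

lemma tens_smult:
  assumes u: "u \<in> carrier (tens M N)"
  shows "p \<odot>\<^bsub>tens M N\<^esub> u \<in> carrier (tens M N)" "ev (p \<odot>\<^bsub>tens M N\<^esub> u) = p \<odot>\<^bsub>P\<^esub> ev u"
proof -
  interpret T: abelian_group "tens_group M N" by (rule abelian_group_tens_group)
  let ?c = "Poly_Mapping.lookup p"
  let ?t = "\<lambda>\<mu>. tens_class M N (tens_scale M N \<mu> (?c \<mu>) u)"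
  have sm: "p \<odot>\<^bsub>tens M N\<^esub> u = finsum (tens_group M N) ?t (Poly_Mapping.keys p)"
    by (simp add: tens_def Let_def)
  have su: "set (summands u) \<subseteq> carrier M \<times> carrier N" using u by (simp add: tens_carrier_iff)
  have set: "set (tens_scale M N \<mu> c u) \<subseteq> carrier M \<times> carrier N" for \<mu> c
    unfolding tens_scale_def using su by (auto simp: M.smult_closed N.smult_closed)
  have tc: "?t \<mu> \<in> carrier (tens M N)" for \<mu>
    by (rule tens_class_carrier[OF set])
  have ls: "lsum (map (\<lambda>(m, n). ((Const c * y_part \<mu>) \<odot>\<^bsub>M\<^esub> m, x_part \<mu> \<odot>\<^bsub>N\<^esub> n)) l) =
      Poly_Mapping.single \<mu> c \<odot>\<^bsub>P\<^esub> lsum l" if "set l \<subseteq> carrier M \<times> carrier N" for l \<mu> c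
    using that
    by (induction l) (auto simp: \<phi>_scale \<phi>_closed lsum_closed P.smult_r_distr P.smult_r_null)
  have et: "ev (?t \<mu>) = Poly_Mapping.single \<mu> (?c \<mu>) \<odot>\<^bsub>P\<^esub> ev u" for \<mu>
    using ls[OF su] by (simp add: ev_class[OF set]) (simp add: tens_scale_def ev_def)
  have "finsum (tens_group M N) ?t A \<in> carrier (tens M N) \<and>
      ev (finsum (tens_group M N) ?t A) = (\<Sum>\<mu>\<in>A. Poly_Mapping.single \<mu> (?c \<mu>)) \<odot>\<^bsub>P\<^esub> ev u"
    if "finite A" for A
    using that
  proof (induction A)
    case empty
    then show ?case
      using P.smult_l_null[OF ev_closed[OF u]] ev_zero tens_zero_closed by (simp add: tens_group_eqs)
  next
    case (insert \<mu> A)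
    have f: "finsum (tens_group M N) ?t (insert \<mu> A) = ?t \<mu> \<oplus>\<^bsub>tens M N\<^esub> finsum (tens_group M N) ?t A"
      using insert.hyps tc by (simp add: tens_group_eqs Pi_def)
    show ?case
      unfolding f using insert tc P.smult_l_distr[OF _ _ ev_closed[OF u]] et
      by (simp add: ev_add tens_add_closed)
  qed
  from this[of "Poly_Mapping.keys p"] poly_mapping_sum_singles[of p]
  show "p \<odot>\<^bsub>tens M N\<^esub> u \<in> carrier (tens M N)" "ev (p \<odot>\<^bsub>tens M N\<^esub> u) = p \<odot>\<^bsub>P\<^esub> ev u"
    by (simp_all add: sm)
qed

text \<open>The pieces and filtration steps of a tensor product are spans, so their images are
  controlled by elementary tensors.\<close>

lemma ev_span:
  assumes "u \<in> tens_span M N S" "S \<subseteq> carrier M \<times> carrier N"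
    and "\<And>m n. (m, n) \<in> S \<Longrightarrow> \<phi> m n \<in> H" "\<zero>\<^bsub>P\<^esub> \<in> H" "\<And>x y. x \<in> H \<Longrightarrow> y \<in> H \<Longrightarrow> x \<oplus>\<^bsub>P\<^esub> y \<in> H"
  shows "ev u \<in> H"
proof -
  from assms(1) obtain l where l: "set l \<subseteq> S" "u = tens_class M N l"
    by (auto simp: tens_span_def)
  have "lsum l \<in> H" using l(1) by (induction l) (auto simp: assms)
  then show ?thesis using l assms(2) by (simp add: ev_class subset_trans)
qed

end

lemma tens_eq_add_left: "m \<in> carrier M \<Longrightarrow> m' \<in> carrier M \<Longrightarrow> n \<in> carrier N \<Longrightarrow>
    tens_eq M N [(m \<oplus>\<^bsub>M\<^esub> m', n)] [(m, n), (m', n)]"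
  using tens_rel.add_left[of m M m' n N] by (simp add: tens_eq_def algebra_simps)

lemma tens_eq_add_right: "m \<in> carrier M \<Longrightarrow> n \<in> carrier N \<Longrightarrow> n' \<in> carrier N \<Longrightarrow>
    tens_eq M N [(m, n \<oplus>\<^bsub>N\<^esub> n')] [(m, n), (m, n')]"
  using tens_rel.add_right[of m M n N n'] by (simp add: tens_eq_def algebra_simps)

context tens_mods
begin

lemma tens_eq_zero_left: "n \<in> carrier N \<Longrightarrow> tens_eq M N [(\<zero>\<^bsub>M\<^esub>, n)] []"
  using tens_rel_zero_left by (simp add: tens_eq_def)

lemma tens_eq_zero_right: "m \<in> carrier M \<Longrightarrow> tens_eq M N [(m, \<zero>\<^bsub>N\<^esub>)] []"
  using tens_rel_uminus[OF tens_rel.add_right[of m M "\<zero>\<^bsub>N\<^esub>" N "\<zero>\<^bsub>N\<^esub>"]] by (simp add: tens_eq_def)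

end

lemma tens_rel_shift: "tens_rel (shift m k n M) N = tens_rel M N"
proof (intro Set.set_eqI iffI)
  fix f assume "f \<in> tens_rel (shift m k n M) N"
  then show "f \<in> tens_rel M N"
    by induction (auto intro: tens_rel.intros)
next
  fix f assume "f \<in> tens_rel M N"
  then show "f \<in> tens_rel (shift m k n M) N"
  proof induction
    case (add_left m1 m2 n1)
    then show ?case using tens_rel.add_left[of m1 "shift m k n M" m2 n1 N] by simp
  next
    case (const m1 n1 c)
    then show ?case using tens_rel.const[of m1 "shift m k n M" n1 N c] by simp
  next
    case (y1 m1 n1)
    then show ?case using tens_rel.y1[of m1 "shift m k n M" n1 N] by simp
  next
    case (y2 m1 n1)
    then show ?case using tens_rel.y2[of m1 "shift m k n M" n1 N] by simp
  qed (auto intro: tens_rel.intros)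
qed

lemma tens_class_shift: "tens_class (shift m k n M) N = tens_class M N"
  by (simp add: tens_class_def tens_rel_shift fun_eq_iff)

text \<open>Relations and classes do not involve degrees, and in the pieces and filtration steps a
  shift of the left factor is absorbed by the index of the union. The shifts in the crossing can
  thus be pulled out of the composite.\<close>

lemma tens_shift: "tens (shift m k n M) N = shift m k n (tens M N)"
proof -
  note cls = tens_class_shift[of m k n M N]
  have span: "tens_span (shift m k n M) N = tens_span M N"
    by (simp add: tens_span_def cls fun_eq_iff)
  have grp: "tens_group (shift m k n M) N = tens_group M N"
    by (simp add: tens_group_def span cls)
  have 1: "(\<Union>a1 q1. piece M (a1 - m) (q1 - n) \<times> piece N (a - a1) (q - q1)) =
      (\<Union>a1 q1. piece M a1 q1 \<times> piece N (a - m - a1) (q - n - q1))" for a q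
  proof (intro Set.set_eqI iffI)
    fix x assume "x \<in> (\<Union>a1 q1. piece M (a1 - m) (q1 - n) \<times> piece N (a - a1) (q - q1))"
    then obtain a1 q1 where "x \<in> piece M (a1 - m) (q1 - n) \<times> piece N (a - a1) (q - q1)" by blast
    then show "x \<in> (\<Union>a1 q1. piece M a1 q1 \<times> piece N (a - m - a1) (q - n - q1))"
      by (intro UN_I[of "a1 - m"] UN_I[of "q1 - n"]) auto
  next
    fix x assume "x \<in> (\<Union>a1 q1. piece M a1 q1 \<times> piece N (a - m - a1) (q - n - q1))"
    then obtain a1 q1 where "x \<in> piece M a1 q1 \<times> piece N (a - m - a1) (q - n - q1)" by blast
    then show "x \<in> (\<Union>a1 q1. piece M (a1 - m) (q1 - n) \<times> piece N (a - a1) (q - q1))"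
      by (intro UN_I[of "a1 + m"] UN_I[of "q1 + n"]) (auto simp: algebra_simps)
  qed
  have 2: "(\<Union>j. filt M (j - k) \<times> filt N (i - j)) = (\<Union>j. filt M j \<times> filt N (i - k - j))" for i
  proof (intro Set.set_eqI iffI)
    fix x assume "x \<in> (\<Union>j. filt M (j - k) \<times> filt N (i - j))"
    then obtain j where "x \<in> filt M (j - k) \<times> filt N (i - j)" by blast
    then show "x \<in> (\<Union>j. filt M j \<times> filt N (i - k - j))"
      by (intro UN_I[of "j - k"]) auto
  next
    fix x assume "x \<in> (\<Union>j. filt M j \<times> filt N (i - k - j))"
    then obtain j where "x \<in> filt M j \<times> filt N (i - k - j)" by blast
    then show "x \<in> (\<Union>j. filt M (j - k) \<times> filt N (i - j))"
      by (intro UN_I[of "j + k"]) (auto simp: algebra_simps)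
  qed
  show ?thesis
    unfolding tens_def Let_def grp span shift_simps 1 2 tens_scale_def cls
    by (simp add: shift_def)
qed

lemma tens_map_shift: "tens_map (shift m k n M) N = tens_map M N"
  by (simp add: tens_map_def tens_class_shift fun_eq_iff)

section \<open>Composition with I and with B in coordinates\<close>

definition phi_I :: "'a bimodule \<Rightarrow> 'a univ \<Rightarrow> 'a univ \<Rightarrow> 'a univ" where
  "phi_I N m n = XtoY (pol m) \<odot>\<^bsub>N\<^esub> n"

text \<open>The class of \<open>m\<close> has the coordinates \<open>YtoX (pol m)\<close> and
  \<open>YtoX (dem (pol m))\<close> with respect to 1 and y_minus - x_minus; \<open>XtoY\<close>
  moves them across the tensor sign. The first entry is constantly zero, so that
  \<open>bcone N N\<close>, whose axioms are known, can serve as the target.\<close>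

definition phi_B :: "'a bimodule \<Rightarrow> 'a univ \<Rightarrow> 'a univ \<Rightarrow> 'a univ \<times> 'a univ \<times> 'a univ" where
  "phi_B N m n = (\<zero>\<^bsub>N\<^esub>, XtoY (pol m) \<odot>\<^bsub>N\<^esub> n, XtoY (dem (pol m)) \<odot>\<^bsub>N\<^esub> n)"

lemma XtoY_pol_JI: "XtoY (pol (pol_class JI p)) = XtoY p"
proof -
  have "YtoX (pol (pol_class JI p)) = YtoX p"
    using pol_pol_class[OF hideal_JI, of p] by (simp add: JI_iff)
  then show ?thesis by (metis XtoY_YtoX)
qed

lemma YtoX_pol_JM: "YtoX (pol (pol_class JM p)) = YtoX p" "YtoX (dem (pol (pol_class JM p))) = YtoX (dem p)"
  using pol_pol_class[OF hideal_JM, of p] by (auto simp: JM_iff dem_diff)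

lemma XtoY_pol_JM: "XtoY (pol (pol_class JM p)) = XtoY p" "XtoY (dem (pol (pol_class JM p))) = XtoY (dem p)"
  using YtoX_pol_JM XtoY_YtoX by metis+

lemma single_parts: "Poly_Mapping.single \<mu> c = Const c * (x_part \<mu> * y_part \<mu>)"
proof -
  \<comment> \<open>Replacing each variable by itself is the identity, so
    \<open>subst_single\<close> writes a monomial as a product of powers of variables.\<close>
  have "subst Var p = p" for p
    by (induction p rule: bpoly_induct) (simp_all add: subst_hom)
  then have "Poly_Mapping.single \<mu> c = subst Var (Poly_Mapping.single \<mu> c)" by simp
  then show ?thesis
    by (simp add: subst_single UNIV_bvar x_part_def y_part_def mult_ac)
qed

lemma fixed_power:
  assumes "\<And>p q :: bpoly. L (p * q) = L p * L q" "L 1 = (1 :: bpoly)"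
  shows "L (p ^ n) = L p ^ n"
  by (induction n) (simp_all add: assms)

lemma XtoY_y_part: "XtoY (y_part \<mu>) = y_part \<mu>"
  by (simp add: y_part_def fixed_power[of XtoY])

lemma swapY_x_part: "swapY (x_part \<mu>) = x_part \<mu>"
  by (simp add: x_part_def fixed_power[of swapY])

lemma XtoY_dem_y_part: "XtoY (dem (y_part \<mu>)) = dem (y_part \<mu>)"
  using XtoY_dem[of "y_part \<mu>"] by (simp add: XtoY_y_part)

lemma XtoY_swapY_y_part: "XtoY (swapY (y_part \<mu>)) = swapY (y_part \<mu>)"
  by (simp add: swapY_eq XtoY_y_part XtoY_dem_y_part)

lemma bimI_simps:
  "u \<in> carrier bimI \<longleftrightarrow> (\<exists>p. u = pol_class JI p)" "\<zero>\<^bsub>bimI\<^esub> = pol_class JI 0"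
  "pol_class JI p \<oplus>\<^bsub>bimI\<^esub> pol_class JI q = pol_class JI (p + q)"
  "r \<odot>\<^bsub>bimI\<^esub> pol_class JI p = pol_class JI (r * p)"
  unfolding bimI_def using cyclic_add[OF hideal_JI] cyclic_smult[OF hideal_JI] by auto

lemma bimB_simps:
  "u \<in> carrier bimB \<longleftrightarrow> (\<exists>p. u = pol_class JM p)" "\<zero>\<^bsub>bimB\<^esub> = pol_class JM 0"
  "pol_class JM p \<oplus>\<^bsub>bimB\<^esub> pol_class JM q = pol_class JM (p + q)"
  "r \<odot>\<^bsub>bimB\<^esub> pol_class JM p = pol_class JM (r * p)"
  unfolding bimB_def using cyclic_add[OF hideal_JM] cyclic_smult[OF hideal_JM] by auto

text \<open>This evaluation gives access to the closure properties proved inside the locale for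
  tensor products whose values do not matter.\<close>

lemma tens_eval_zero:
  assumes "fgmod M" "fgmod N"
  shows "tens_eval M N N (\<lambda>m n. \<zero>\<^bsub>N\<^esub>)"
proof -
  interpret M: fgmod M by fact
  interpret N: fgmod N by fact
  show ?thesis by unfold_locales auto
qed

lemma tens_eval_I:
  assumes "fgmod N"
  shows "tens_eval bimI N N (phi_I N)"
proof -
  interpret I: fgmod bimI by (rule fgmod_bims)
  interpret N: fgmod N by fact
  interpret P: fgm N N.component by (rule N.fgm)
  have 1: "p \<odot>\<^bsub>N\<^esub> (q \<odot>\<^bsub>N\<^esub> n) = (p * q) \<odot>\<^bsub>N\<^esub> n" if "n \<in> carrier N" for p q n
    using P.smult_mult[OF that] by simp
  show ?thesis
  proof unfold_locales
    show "phi_I N ((Const c * y_part \<mu>) \<odot>\<^bsub>bimI\<^esub> m) (x_part \<mu> \<odot>\<^bsub>N\<^esub> n) =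
        Poly_Mapping.single \<mu> c \<odot>\<^bsub>N\<^esub> phi_I N m n"
      if "m \<in> carrier bimI" "n \<in> carrier N" for c \<mu> m n
      using that by (auto simp: bimI_simps phi_I_def XtoY_pol_JI 1 single_parts XtoY_y_part mult_ac)
  qed (auto simp: bimI_simps phi_I_def XtoY_pol_JI P.smult_closed P.smult_ladd P.smult_radd 1 mult_ac)
qed

lemma tens_eval_B:
  assumes "fgmod N"
  shows "tens_eval bimB N (bcone N N) (phi_B N)"
proof -
  interpret B: fgmod bimB by (rule fgmod_bims)
  interpret N: fgmod N by fact
  interpret P: fgm N N.component by (rule N.fgm)
  interpret C: fgmod "bcone N N" by (intro fgmod_cone assms)
  have 1: "p \<odot>\<^bsub>N\<^esub> (q \<odot>\<^bsub>N\<^esub> n) = (p * q) \<odot>\<^bsub>N\<^esub> n" if "n \<in> carrier N" for p q n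
    using P.smult_mult[OF that] by simp
  have 2: "p \<odot>\<^bsub>N\<^esub> n \<oplus>\<^bsub>N\<^esub> q \<odot>\<^bsub>N\<^esub> n = (p + q) \<odot>\<^bsub>N\<^esub> n" if "n \<in> carrier N" for p q n
    using P.smult_ladd[OF that] by simp
  show ?thesis
  proof unfold_locales
    show "phi_B N ((Const c * y_part \<mu>) \<odot>\<^bsub>bimB\<^esub> m) (x_part \<mu> \<odot>\<^bsub>N\<^esub> n) =
        Poly_Mapping.single \<mu> c \<odot>\<^bsub>bcone N N\<^esub> phi_B N m n"
      if "m \<in> carrier bimB" "n \<in> carrier N" for c \<mu> m n
    proof -
      from that obtain p where m: "m = pol_class JM p" by (auto simp: bimB_simps)
      \<comment> \<open>Leibniz rule for the y-part; the x-part is fixed by the transposition and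
        killed by \<open>dem\<close>, so it passes through as a factor.\<close>
      have "XtoY (dem (Const c * y_part \<mu> * p)) * x_part \<mu> =
          dem (Poly_Mapping.single \<mu> c) * XtoY p + swapY (Poly_Mapping.single \<mu> c) * XtoY (dem p)"
      proof -
        have dx: "dem (x_part \<mu>) = 0" by (rule dem_swap_fixed[OF swapY_x_part])
        show ?thesis
          by (simp add: single_parts dem_mult dx swapY_x_part XtoY_y_part XtoY_dem_y_part XtoY_swapY_y_part)
             (simp add: algebra_simps)
      qed
      then show ?thesis
        using that(2) by (simp add: m bimB_simps phi_B_def XtoY_pol_JM 1 2)
          (simp add: single_parts XtoY_y_part mult_ac)
    qed
  qed (auto simp: bimB_simps phi_B_def XtoY_pol_JM P.smult_closed P.smult_ladd P.smult_radd 1 mult_ac dem_add dem_mult)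
qed

text \<open>The relations move only constants and single variables across, so the general case is an
  induction on \<open>g\<close>. \<open>YtoX g\<close> on the left and \<open>XtoY g\<close> on the
  right are the same polynomial in the middle variables.\<close>

lemma tens_eq_balance:
  fixes N :: "'a bimodule"
  assumes J: "hideal J" and M: "fgmod (cyclic J \<Phi> :: 'a bimodule)" and N: "fgmod N" and n: "n \<in> carrier N"
  shows "tens_eq (cyclic J \<Phi>) N [(pol_class J (YtoX g * r), n)] [(pol_class J r, XtoY g \<odot>\<^bsub>N\<^esub> n)]"
  using n
proof (induction g arbitrary: n rule: bpoly_induct)
  interpret N: fgmod N by fact
  interpret P: fgm N N.component by (rule N.fgm)
  let ?M = "cyclic J \<Phi> :: 'a bimodule"
  let ?c = "pol_class J :: bpoly \<Rightarrow> 'a univ"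
  note ops = cyclic_add[OF J, where \<Phi> = \<Phi>] cyclic_smult[OF J, where \<Phi> = \<Phi>]
  {
    case (Const c)
    then show ?case
      using tens_rel.const[of "?c r" ?M n N c] by (simp add: tens_eq_def ops)
  next
    case (add p q)
    have "tens_eq ?M N [(?c (YtoX (p + q) * r), n)] [(?c (YtoX p * r), n), (?c (YtoX q * r), n)]"
      using tens_eq_add_left[of "?c (YtoX p * r)" ?M "?c (YtoX q * r)" n N] add.prems
      by (simp add: ops ring_distribs)
    also have "tens_eq ?M N \<dots> ([(?c r, XtoY p \<odot>\<^bsub>N\<^esub> n)] @ [(?c r, XtoY q \<odot>\<^bsub>N\<^esub> n)])"
      using tens_eq_append[OF add.IH[OF add.prems]] by simp
    also have "tens_eq ?M N \<dots> [(?c r, XtoY (p + q) \<odot>\<^bsub>N\<^esub> n)]"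
      using tens_eq_sym[OF tens_eq_add_right[of "?c r" ?M "XtoY p \<odot>\<^bsub>N\<^esub> n" N "XtoY q \<odot>\<^bsub>N\<^esub> n"]] add.prems
      by (simp add: P.smult_closed P.smult_ladd)
    finally show ?case .
  next
    case (Var v p)
    \<comment> \<open>\<open>w\<close> is the variable of the right factor that corresponds to
      \<open>Var v\<close> after either substitution.\<close>
    define w where "w = (if v = X1 \<or> v = Y1 then Y1 else Y2)"
    have w: "w = Y1 \<or> w = Y2" "XtoY (Var v) = Var w" "YtoX (Var v) = (if w = Y1 then Var X1 else Var X2)"
      by (cases v; simp add: w_def)+
    have "tens_eq ?M N [(?c (YtoX (Var v * p) * r), n)] [(?c (YtoX p * r), Var w \<odot>\<^bsub>N\<^esub> n)]"
      using w Var.prems tens_rel.y1[of "?c (YtoX p * r)" ?M n N] tens_rel.y2[of "?c (YtoX p * r)" ?M n N]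
      by (auto simp: tens_eq_def ops mult.assoc)
    also have "tens_eq ?M N \<dots> [(?c r, XtoY p \<odot>\<^bsub>N\<^esub> (Var w \<odot>\<^bsub>N\<^esub> n))]"
      using Var.prems by (intro Var.IH P.smult_closed)
    finally show ?case
      using Var.prems P.smult_mult[of n "XtoY p" "Var w"] by (simp add: w(2) mult.commute)
  }
qed

definition sec_I :: "'a bimodule \<Rightarrow> 'a univ \<Rightarrow> 'a univ" where
  "sec_I N x = tens_class bimI N [(pol_class JI 1, x)]"

text \<open>The element of B o N with given coordinates; inverse to \<open>ev_B\<close> up to the
  zero entry.\<close>

definition sec_B :: "'a bimodule \<Rightarrow> 'a univ \<Rightarrow> 'a univ \<Rightarrow> 'a univ" where
  "sec_B N y z = tens_class bimB N [(pol_class JM 1, y), (pol_class JM (y_minus - x_minus), z)]"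

definition ev_I :: "'a bimodule \<Rightarrow> 'a univ \<Rightarrow> 'a univ" where
  "ev_I N = tens_eval.ev N (phi_I N)"

definition ev_B :: "'a bimodule \<Rightarrow> 'a univ \<Rightarrow> 'a univ \<times> 'a univ \<times> 'a univ" where
  "ev_B N = tens_eval.ev (bcone N N) (phi_B N)"

lemma ev_I_sec_I:
  assumes N: "fgmod N" and x: "x \<in> carrier N"
  shows "sec_I N x \<in> carrier (tens bimI N)" "ev_I N (sec_I N x) = x"
proof -
  interpret E: tens_eval bimI N N "phi_I N" by (rule tens_eval_I[OF N])
  have s: "set [(pol_class JI 1, x)] \<subseteq> carrier bimI \<times> carrier N"
    using x by (auto simp: bimI_simps)
  show "sec_I N x \<in> carrier (tens bimI N)"
    unfolding sec_I_def by (rule tens_class_carrier[OF s])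
  show "ev_I N (sec_I N x) = x"
    unfolding sec_I_def ev_I_def using x E.N.smult_one[OF x] E.ev_class[OF s]
    by (simp add: phi_I_def XtoY_pol_JI)
qed

lemma sec_I_ev_I:
  assumes N: "fgmod N" and u: "u \<in> carrier (tens bimI N)"
  shows "sec_I N (ev_I N u) = u"
proof -
  interpret E: tens_eval bimI N N "phi_I N" by (rule tens_eval_I[OF N])
  let ?i = "pol_class JI 1 :: 'a univ"
  have i: "?i \<in> carrier bimI" by (auto simp: bimI_simps)
  have "tens_eq bimI N l [(?i, E.lsum l)]" if "set l \<subseteq> carrier bimI \<times> carrier N" for l
    using that
  proof (induction l)
    case Nil
    then show ?case using tens_eq_sym[OF E.tens_eq_zero_right[OF i]] by simp
  next
    case (Cons x l)
    obtain m n where x: "x = (m, n)" by (cases x)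
    with Cons.prems obtain p where m: "m = pol_class JI p" and n: "n \<in> carrier N"
      by (auto simp: bimI_simps)
    have l: "E.lsum l \<in> carrier N" using Cons.prems by (intro E.lsum_closed) auto
    have "p - YtoX p * 1 \<in> JI" by (simp add: JI_iff)
    then have m': "m = pol_class JI (YtoX p * 1)"
      unfolding m using pol_class_eq_iff[OF hideal_JI] by blast
    have "tens_eq bimI N [(m, n)] [(?i, XtoY p \<odot>\<^bsub>N\<^esub> n)]"
      unfolding m' bimI_def
      by (rule tens_eq_balance[OF hideal_JI fgmod_bims(1)[unfolded bimI_def] N n])
    from tens_eq_append[OF this Cons.IH] Cons.prems
    have "tens_eq bimI N (x # l) [(?i, XtoY p \<odot>\<^bsub>N\<^esub> n), (?i, E.lsum l)]" by (simp add: x)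
    also have "tens_eq bimI N \<dots> [(?i, XtoY p \<odot>\<^bsub>N\<^esub> n \<oplus>\<^bsub>N\<^esub> E.lsum l)]"
      by (rule tens_eq_sym[OF tens_eq_add_right[OF i]]) (use n l in auto)
    finally have F: "tens_eq bimI N (x # l) [(?i, XtoY p \<odot>\<^bsub>N\<^esub> n \<oplus>\<^bsub>N\<^esub> E.lsum l)]" .
    have "phi_I N m n = XtoY p \<odot>\<^bsub>N\<^esub> n"
      by (simp add: phi_I_def m XtoY_pol_JI)
    with F show ?case
      by (simp add: x)
  qed
  from tens_class_cong[OF this, of "summands u"] u show ?thesis
    by (simp add: tens_carrier_iff sec_I_def ev_I_def E.ev_def)
qed

lemma ev_B_sec_B:
  assumes N: "fgmod N" and y: "y \<in> carrier N" and z: "z \<in> carrier N"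
  shows "sec_B N y z \<in> carrier (tens bimB N)" "ev_B N (sec_B N y z) = (\<zero>\<^bsub>N\<^esub>, y, z)"
proof -
  interpret E: tens_eval bimB N "bcone N N" "phi_B N" by (rule tens_eval_B[OF N])
  have s: "set [(pol_class JM 1, y), (pol_class JM (y_minus - x_minus), z)] \<subseteq> carrier bimB \<times> carrier N"
    using y z by (auto simp: bimB_simps)
  show "sec_B N y z \<in> carrier (tens bimB N)"
    unfolding sec_B_def by (rule tens_class_carrier[OF s])
  show "ev_B N (sec_B N y z) = (\<zero>\<^bsub>N\<^esub>, y, z)"
    unfolding sec_B_def ev_B_def
    using y z E.N.smult_one[OF y] E.N.smult_one[OF z] E.N.smult_l_null[OF y] E.N.smult_l_null[OF z] E.ev_class[OF s]
    by (simp add: phi_B_def XtoY_pol_JM dem_diff)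
qed

lemma ev_B_closed:
  assumes N: "fgmod N" and u: "u \<in> carrier (tens bimB N)"
  shows "fst (ev_B N u) = \<zero>\<^bsub>N\<^esub>" "fst (snd (ev_B N u)) \<in> carrier N" "snd (snd (ev_B N u)) \<in> carrier N"
proof -
  interpret E: tens_eval bimB N "bcone N N" "phi_B N" by (rule tens_eval_B[OF N])
  show "fst (snd (ev_B N u)) \<in> carrier N" "snd (snd (ev_B N u)) \<in> carrier N"
    using E.ev_closed[OF u] by (auto simp: ev_B_def)
  have "E.ev u \<in> {\<zero>\<^bsub>N\<^esub>} \<times> carrier N \<times> carrier N"
    by (rule E.ev_span[OF u[unfolded tens_simps] order_refl]) (auto simp: phi_B_def E.N.smult_closed)
  then show "fst (ev_B N u) = \<zero>\<^bsub>N\<^esub>" by (auto simp: ev_B_def)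
qed

text \<open>By the normal form modulo \<open>JM\<close> every left entry is a combination of 1 and
  y_minus - x_minus with coefficients in x. Balancing moves the coefficients to the right, and the
  sum collapses to two elementary tensors.\<close>

lemma sec_B_ev_B:
  assumes N: "fgmod N" and u: "u \<in> carrier (tens bimB N)"
  shows "sec_B N (fst (snd (ev_B N u))) (snd (snd (ev_B N u))) = u"
proof -
  interpret E: tens_eval bimB N "bcone N N" "phi_B N" by (rule tens_eval_B[OF N])
  let ?i = "pol_class JM 1 :: 'a univ" and ?b = "pol_class JM (y_minus - x_minus) :: 'a univ"
  have ib: "?i \<in> carrier bimB" "?b \<in> carrier bimB" by (auto simp: bimB_simps)
  have "tens_eq bimB N l [(?i, fst (snd (E.lsum l))), (?b, snd (snd (E.lsum l)))]"
    if "set l \<subseteq> carrier bimB \<times> carrier N" for l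
    using that
  proof (induction l)
    case Nil
    then show ?case
      using tens_eq_sym[OF tens_eq_append[OF E.tens_eq_zero_right[OF ib(1)] E.tens_eq_zero_right[OF ib(2)]]]
      by simp
  next
    case (Cons x l)
    obtain m n where x: "x = (m, n)" by (cases x)
    with Cons.prems obtain p where m: "m = pol_class JM p" and n: "n \<in> carrier N"
      by (auto simp: bimB_simps)
    obtain a0 y z where l0: "E.lsum l = (a0, y, z)" by (cases "E.lsum l")
    have l: "y \<in> carrier N" "z \<in> carrier N"
      using Cons.prems E.lsum_closed[of l] by (auto simp: l0)
    let ?m1 = "pol_class JM (YtoX p * 1) :: 'a univ" and ?m2 = "pol_class JM (YtoX (dem p) * (y_minus - x_minus)) :: 'a univ"
    have m': "m = ?m1 \<oplus>\<^bsub>bimB\<^esub> ?m2"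
      using JM_normal_form[of p] by (simp add: m bimB_simps pol_class_eq_iff[OF hideal_JM] mult.commute)
    let ?e = "XtoY p \<odot>\<^bsub>N\<^esub> n" and ?f = "XtoY (dem p) \<odot>\<^bsub>N\<^esub> n"
    have ef: "?e \<in> carrier N" "?f \<in> carrier N" using n by (auto simp: E.N.smult_closed)
    have "tens_eq bimB N [(m, n)] [(?m1, n), (?m2, n)]"
      unfolding m' by (rule tens_eq_add_left) (use n in \<open>auto simp: bimB_simps\<close>)
    also have "tens_eq bimB N \<dots> ([(?i, ?e)] @ [(?b, ?f)])"
      unfolding bimB_def
      using tens_eq_append[OF tens_eq_balance[OF hideal_JM fgmod_bims(2)[unfolded bimB_def] N n, of p 1]
          tens_eq_balance[OF hideal_JM fgmod_bims(2)[unfolded bimB_def] N n, of "dem p" "y_minus - x_minus"]]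
      by simp
    finally have "tens_eq bimB N [(m, n)] [(?i, ?e), (?b, ?f)]" by simp
    from tens_eq_append[OF this Cons.IH] Cons.prems
    have "tens_eq bimB N (x # l) [(?i, ?e), (?b, ?f), (?i, y), (?b, z)]" by (simp add: x l0)
    also have "tens_eq bimB N \<dots> ([(?i, ?e), (?i, y)] @ [(?b, ?f), (?b, z)])"
      by (simp add: tens_eq_def tens_rel.zero algebra_simps)
    also have "tens_eq bimB N \<dots> ([(?i, ?e \<oplus>\<^bsub>N\<^esub> y)] @ [(?b, ?f \<oplus>\<^bsub>N\<^esub> z)])"
      by (intro tens_eq_append tens_eq_sym[OF tens_eq_add_right] ib ef l)
    finally have F: "tens_eq bimB N (x # l) ([(?i, ?e \<oplus>\<^bsub>N\<^esub> y)] @ [(?b, ?f \<oplus>\<^bsub>N\<^esub> z)])" .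
    have "phi_B N m n = (\<zero>\<^bsub>N\<^esub>, ?e, ?f)"
      by (simp add: phi_B_def m XtoY_pol_JM)
    with F show ?case
      by (simp add: x l0)
  qed
  from tens_class_cong[OF this, of "summands u"] u show ?thesis
    by (simp add: tens_carrier_iff sec_B_def ev_B_def E.ev_def)
qed

lemma bimI_parts:
  "piece bimI a q = (if a = 0 then pol_class JI ` {p. homogeneous q p} else {pol_class JI 0})"
  "filt bimI i = (if i \<le> 0 then range (pol_class JI) else {pol_class JI 0})"
  by (simp_all add: bimI_def trivial_filt_def)

lemma bimB_parts:
  "piece bimB a q = (if a = 0 then pol_class JM ` {p. homogeneous q p} else {pol_class JM 0})"
  "filt bimB i = (if i \<le> 0 then range (pol_class JM) else if i \<le> 2
     then pol_class JM ` {r * (y_minus - x_minus) | r. True} else {pol_class JM 0})"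
  by (simp_all add: bimB_def two_step_filt_def PIdl_QXY)

lemma tens_span_mono: "S \<subseteq> S' \<Longrightarrow> tens_span M N S \<subseteq> tens_span M N S'"
  by (auto simp: tens_span_def)

lemma tens_spanI: "set l \<subseteq> S \<Longrightarrow> tens_class M N l \<in> tens_span M N S"
  by (auto simp: tens_span_def)

lemma tens_parts_subset:
  assumes "fgmod M" "fgmod N"
  shows "(\<Union>a1 q1. piece M a1 q1 \<times> piece N (a - a1) (q - q1)) \<subseteq> carrier M \<times> carrier N"
    "(\<Union>j. filt M j \<times> filt N (i - j)) \<subseteq> carrier M \<times> carrier N"
    "piece (tens M N) a q \<subseteq> carrier (tens M N)" "filt (tens M N) i \<subseteq> carrier (tens M N)"
proof -
  interpret M: fgmod M by fact
  interpret N: fgmod N by fact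
  show 1: "(\<Union>a1 q1. piece M a1 q1 \<times> piece N (a - a1) (q - q1)) \<subseteq> carrier M \<times> carrier N"
    "(\<Union>j. filt M j \<times> filt N (i - j)) \<subseteq> carrier M \<times> carrier N"
    using M.piece_closed N.piece_closed M.filt_closed N.filt_closed by auto
  show "piece (tens M N) a q \<subseteq> carrier (tens M N)" "filt (tens M N) i \<subseteq> carrier (tens M N)"
    unfolding tens_simps by (intro tens_span_mono 1)+
qed

lemma tens_I_parts:
  fixes N :: "'a bimodule"
  assumes N: "fgmod N" and u: "u \<in> carrier (tens bimI N)"
  shows "u \<in> piece (tens bimI N) a q \<longleftrightarrow> ev_I N u \<in> piece N a q"
    "u \<in> filt (tens bimI N) i \<longleftrightarrow> ev_I N u \<in> filt N i"
proof -
  interpret E: tens_eval bimI N N "phi_I N" by (rule tens_eval_I[OF N])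
  interpret N: fgm N E.N.component by (rule E.N.fgm)
  note sub = tens_parts_subset[OF fgmod_bims(1) N]
  have us: "u = tens_class bimI N [(pol_class JI 1, ev_I N u)]"
    using sec_I_ev_I[OF N u] by (simp add: sec_I_def)
  have "ev_I N u \<in> piece N a q" if "u \<in> piece (tens bimI N) a q"
    unfolding ev_I_def
  proof (rule E.ev_span[OF that[unfolded tens_simps] sub(1)])
    fix m n :: "'a univ" assume "(m, n) \<in> (\<Union>a1 q1. piece bimI a1 q1 \<times> piece N (a - a1) (q - q1))"
    then obtain a1 q1 where mn: "m \<in> piece bimI a1 q1" "n \<in> piece N (a - a1) (q - q1)" by blast
    show "phi_I N m n \<in> piece N a q"
    proof (cases "a1 = 0")
      case True
      with mn obtain p where "m = pol_class JI p" "homogeneous q1 p" by (auto simp: bimI_parts)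
      then show ?thesis
        using True mn N.smult_piece[of q1 "XtoY p" n a "q - q1"] homogeneous_substs
        by (simp add: phi_I_def XtoY_pol_JI)
    next
      case False
      with mn have "m = pol_class JI 0" by (simp add: bimI_parts)
      then show ?thesis
        using E.N.smult_l_null[OF E.N.piece_closed[OF mn(2)]] N.zero_piece by (simp add: phi_I_def XtoY_pol_JI)
    qed
  qed (auto intro: N.zero_piece N.add_piece)
  moreover have "u \<in> piece (tens bimI N) a q" if "ev_I N u \<in> piece N a q"
  proof -
    have "(pol_class JI 1, ev_I N u) \<in> piece bimI 0 0 \<times> piece N (a - 0) (q - 0)"
      using that by (auto simp: bimI_parts)
    then show ?thesis
      unfolding tens_simps by (subst us, intro tens_spanI) fastforce
  qed
  ultimately show "u \<in> piece (tens bimI N) a q \<longleftrightarrow> ev_I N u \<in> piece N a q" by blast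
  have "ev_I N u \<in> filt N i" if "u \<in> filt (tens bimI N) i"
    unfolding ev_I_def
  proof (rule E.ev_span[OF that[unfolded tens_simps] sub(2)])
    fix m n :: "'a univ" assume "(m, n) \<in> (\<Union>j. filt bimI j \<times> filt N (i - j))"
    then obtain j where mn: "m \<in> filt bimI j" "n \<in> filt N (i - j)" by blast
    show "phi_I N m n \<in> filt N i"
    proof (cases "j \<le> 0")
      case True
      then show ?thesis
        using E.N.filt_mono[OF mn(2), of i] by (simp add: phi_I_def N.smult_filt)
    next
      case False
      with mn have "m = pol_class JI 0" by (simp add: bimI_parts)
      then show ?thesis
        using E.N.smult_l_null[OF E.N.filt_closed[OF mn(2)]] N.zero_filt by (simp add: phi_I_def XtoY_pol_JI)
    qed
  qed (auto intro: N.zero_filt N.add_filt)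
  moreover have "u \<in> filt (tens bimI N) i" if "ev_I N u \<in> filt N i"
  proof -
    have "(pol_class JI 1, ev_I N u) \<in> filt bimI 0 \<times> filt N (i - 0)"
      using that by (auto simp: bimI_parts)
    then show ?thesis
      unfolding tens_simps by (subst us, intro tens_spanI) fastforce
  qed
  ultimately show "u \<in> filt (tens bimI N) i \<longleftrightarrow> ev_I N u \<in> filt N i" by blast
qed

text \<open>The basis element 1 lies in q-degree 0 and F^0, the element y_minus - x_minus in
  q-degree 2 and F^1, which has filtration index 2. Hence both structures of B o N split into those
  of the coordinates; the offsets 2 and 1 remove the shifts built into \<open>bcone\<close>.\<close>

lemma tens_B_parts:
  fixes N :: "'a bimodule"
  assumes N: "fgmod N" and u: "u \<in> carrier (tens bimB N)"
  shows "u \<in> piece (tens bimB N) a q \<longleftrightarrow> ev_B N u \<in> piece (bcone N N) a (q - 2)"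
    "u \<in> filt (tens bimB N) i \<longleftrightarrow> ev_B N u \<in> filt (bcone N N) (i - 1)"
proof -
  interpret E: tens_eval bimB N "bcone N N" "phi_B N" by (rule tens_eval_B[OF N])
  interpret N: fgm N E.N.component by (rule E.N.fgm)
  note sub = tens_parts_subset[OF fgmod_bims(2) N]
  obtain y z where yz: "ev_B N u = (\<zero>\<^bsub>N\<^esub>, y, z)"
    using ev_B_closed[OF N u] by (cases "ev_B N u") auto
  have us: "u = tens_class bimB N [(pol_class JM 1, y), (pol_class JM (y_minus - x_minus), z)]"
    using sec_B_ev_B[OF N u] by (simp add: sec_B_def yz)
  have "ev_B N u \<in> piece (bcone N N) a (q - 2)" if "u \<in> piece (tens bimB N) a q"
    unfolding ev_B_def
  proof (rule E.ev_span[OF that[unfolded tens_simps] sub(1)])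
    fix m n :: "'a univ" assume "(m, n) \<in> (\<Union>a1 q1. piece bimB a1 q1 \<times> piece N (a - a1) (q - q1))"
    then obtain a1 q1 where mn: "m \<in> piece bimB a1 q1" "n \<in> piece N (a - a1) (q - q1)" by blast
    show "phi_B N m n \<in> piece (bcone N N) a (q - 2)"
    proof (cases "a1 = 0")
      case True
      with mn obtain p where p: "m = pol_class JM p" "homogeneous q1 p" by (auto simp: bimB_parts)
      have "XtoY p \<odot>\<^bsub>N\<^esub> n \<in> piece N a q"
        using True mn N.smult_piece[of q1 "XtoY p" n a "q - q1"] homogeneous_substs p by simp
      moreover have "XtoY (dem p) \<odot>\<^bsub>N\<^esub> n \<in> piece N a (q - 2)"
        using True mn N.smult_piece[of "q1 - 2" "XtoY (dem p)" n a "q - q1"]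
          homogeneous_substs(2)[OF homogeneous_dem[OF p(2)]] by simp
      ultimately show ?thesis
        by (simp add: phi_B_def p XtoY_pol_JM N.zero_piece)
    next
      case False
      with mn have "m = pol_class JM 0" by (simp add: bimB_parts)
      then show ?thesis
        using E.N.smult_l_null[OF E.N.piece_closed[OF mn(2)]] N.zero_piece by (simp add: phi_B_def XtoY_pol_JM)
    qed
  qed (use E.P.piece_zero E.P.piece_add in blast)+
  moreover have "u \<in> piece (tens bimB N) a q" if "ev_B N u \<in> piece (bcone N N) a (q - 2)"
  proof -
    have "(pol_class JM 1, y) \<in> piece bimB 0 0 \<times> piece N (a - 0) (q - 0)"
      using that by (auto simp: bimB_parts yz)
    moreover have "(pol_class JM (y_minus - x_minus), z) \<in> piece bimB 0 2 \<times> piece N (a - 0) (q - 2)"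
      using that by (auto simp: bimB_parts yz homogeneous_diff)
    ultimately have "set [(pol_class JM 1, y), (pol_class JM (y_minus - x_minus), z)] \<subseteq>
        (\<Union>a1 q1. piece bimB a1 q1 \<times> piece N (a - a1) (q - q1))"
      unfolding list.set insert_subset by blast
    then show ?thesis
      unfolding tens_simps by (subst us, rule tens_spanI)
  qed
  ultimately show "u \<in> piece (tens bimB N) a q \<longleftrightarrow> ev_B N u \<in> piece (bcone N N) a (q - 2)" by blast
  have "ev_B N u \<in> filt (bcone N N) (i - 1)" if "u \<in> filt (tens bimB N) i"
    unfolding ev_B_def
  proof (rule E.ev_span[OF that[unfolded tens_simps] sub(2)])
    fix m n :: "'a univ" assume "(m, n) \<in> (\<Union>j. filt bimB j \<times> filt N (i - j))"
    then obtain j where mn: "m \<in> filt bimB j" "n \<in> filt N (i - j)" by blast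
    note null = E.N.smult_l_null[OF E.N.filt_closed[OF mn(2)]]
    consider "j \<le> 0" | "0 < j" "j \<le> 2" | "j > 2" by linarith
    then show "phi_B N m n \<in> filt (bcone N N) (i - 1)"
    proof cases
      case 1
      then show ?thesis
        using E.N.filt_mono[OF mn(2), of i] E.N.filt_mono[OF mn(2), of "i - 2"]
        by (simp add: phi_B_def N.smult_filt N.zero_filt)
    next
      \<comment> \<open>A multiple of y_minus - x_minus has first coordinate zero, and for the
        second \<open>j \<le> 2\<close> gives \<open>i - 2 \<le> i - j\<close>.\<close>
      case 2
      with mn obtain r where "m = pol_class JM (r * (y_minus - x_minus))" by (auto simp: bimB_parts)
      then show ?thesis
        using 2 E.N.filt_mono[OF mn(2), of "i - 2"] null
        by (simp add: phi_B_def XtoY_pol_JM N.smult_filt N.zero_filt)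
    next
      case 3
      with mn have "m = pol_class JM 0" by (simp add: bimB_parts)
      then show ?thesis
        using null by (simp add: phi_B_def XtoY_pol_JM N.zero_filt)
    qed
  qed (use E.P.filt_zero E.P.filt_add in blast)+
  moreover have "u \<in> filt (tens bimB N) i" if "ev_B N u \<in> filt (bcone N N) (i - 1)"
  proof -
    have "(pol_class JM 1, y) \<in> filt bimB 0 \<times> filt N (i - 0)"
      using that by (auto simp: bimB_parts yz)
    moreover have "(pol_class JM (y_minus - x_minus), z) \<in> filt bimB 2 \<times> filt N (i - 2)"
      using that by (auto simp: bimB_parts yz intro!: image_eqI[of _ _ "y_minus - x_minus"] exI[of _ 1])
    ultimately have "set [(pol_class JM 1, y), (pol_class JM (y_minus - x_minus), z)] \<subseteq>
        (\<Union>j. filt bimB j \<times> filt N (i - j))"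
      unfolding list.set insert_subset by blast
    then show ?thesis
      unfolding tens_simps by (subst us, rule tens_spanI)
  qed
  ultimately show "u \<in> filt (tens bimB N) i \<longleftrightarrow> ev_B N u \<in> filt (bcone N N) (i - 1)" by blast
qed

text \<open>What is needed to discard a summand of a direct sum, stated for a bare structure, as the
  summands are tensor products.\<close>

definition trivial_mod :: "('u, 'm) fgmod_scheme \<Rightarrow> bool" where
  "trivial_mod M \<longleftrightarrow> carrier M = {\<zero>\<^bsub>M\<^esub>} \<and> (\<forall>a q. piece M a q = {\<zero>\<^bsub>M\<^esub>}) \<and> (\<forall>i. filt M i = {\<zero>\<^bsub>M\<^esub>}) \<and>
     \<zero>\<^bsub>M\<^esub> \<oplus>\<^bsub>M\<^esub> \<zero>\<^bsub>M\<^esub> = \<zero>\<^bsub>M\<^esub> \<and> (\<forall>p. p \<odot>\<^bsub>M\<^esub> \<zero>\<^bsub>M\<^esub> = \<zero>\<^bsub>M\<^esub>)"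

lemma trivial_mod_shift: "trivial_mod M \<Longrightarrow> trivial_mod (shift m k n M)"
  by (simp add: trivial_mod_def)

lemma carrier_bim0: "carrier bim0 = {\<zero>\<^bsub>bim0\<^esub>}"
  by (auto simp: bim0_def pol_class_eq_iff[OF hideal_UNIV])

lemma trivial_mod_tens:
  assumes M: "fgmod M" and N: "fgmod N" and c: "carrier M = {\<zero>\<^bsub>M\<^esub>}"
  shows "trivial_mod (tens M N)"
proof -
  interpret E: tens_eval M N N "\<lambda>m n. \<zero>\<^bsub>N\<^esub>" by (rule tens_eval_zero[OF M N])
  have "tens_eq M N l []" if "set l \<subseteq> carrier M \<times> carrier N" for l
    using that
  proof (induction l)
    case (Cons x l)
    then obtain n where x: "x = (\<zero>\<^bsub>M\<^esub>, n)" "n \<in> carrier N" by (cases x) (auto simp: c)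
    from tens_eq_append[OF E.tens_eq_zero_left[OF x(2)] Cons.IH] Cons.prems show ?case
      by (simp add: x)
  qed simp
  then have cls: "tens_class M N l = \<zero>\<^bsub>tens M N\<^esub>" if "set l \<subseteq> carrier M \<times> carrier N" for l
    using tens_class_cong that by (fastforce simp: tens_simps)
  then have car: "carrier (tens M N) = {\<zero>\<^bsub>tens M N\<^esub>}"
    using E.tens_zero_closed by (auto simp: tens_carrier_iff)
  have "\<zero>\<^bsub>tens M N\<^esub> \<in> tens_span M N S" for S
    by (auto simp: tens_simps tens_span_def intro: image_eqI[of _ _ "[]"])
  then have "\<zero>\<^bsub>tens M N\<^esub> \<in> piece (tens M N) a q" "\<zero>\<^bsub>tens M N\<^esub> \<in> filt (tens M N) i" for a q i
    by (simp_all add: tens_simps)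
  then show ?thesis
    unfolding trivial_mod_def
    using tens_parts_subset(3,4)[OF M N] car E.tens_smult(1)[OF E.tens_zero_closed]
      E.tens_add_closed[OF E.tens_zero_closed E.tens_zero_closed] by blast
qed

section \<open>The direct sum in the composite with a crossing\<close>

lemma dsum_simps:
  "carrier (dsum D) = Fam ` {x. (\<forall>i. x i \<in> carrier (D i)) \<and> finite {i. x i \<noteq> \<zero>\<^bsub>D i\<^esub>}}"
  "\<zero>\<^bsub>dsum D\<^esub> = Fam (\<lambda>i. \<zero>\<^bsub>D i\<^esub>)"
  "u \<oplus>\<^bsub>dsum D\<^esub> v = Fam (\<lambda>i. fam u i \<oplus>\<^bsub>D i\<^esub> fam v i)"
  "p \<odot>\<^bsub>dsum D\<^esub> u = Fam (\<lambda>i. p \<odot>\<^bsub>D i\<^esub> fam u i)"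
  "piece (dsum D) a q = Fam ` {x. (\<forall>i. x i \<in> piece (D i) a q) \<and> finite {i. x i \<noteq> \<zero>\<^bsub>D i\<^esub>}}"
  "filt (dsum D) j = Fam ` {x. (\<forall>i. x i \<in> filt (D i) j) \<and> finite {i. x i \<noteq> \<zero>\<^bsub>D i\<^esub>}}"
  by (simp_all add: dsum_def Let_def)

definition braid_iso :: "'a bimodule \<Rightarrow> 'a bimodule \<Rightarrow> 'a univ \<Rightarrow> 'a univ \<times> 'a univ \<times> 'a univ" where
  "braid_iso A N u = (ev_I A (fam u (-1)), snd (ev_B N (fam u 1)))"

text \<open>Only the summands at -1 and 1, from I and from B, are non-trivial, so a family is
  determined by two entries, and these are read off by evaluation. Degrees and filtration carry over
  by \<open>tens_I_parts\<close> and \<open>tens_B_parts\<close>.\<close>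

lemma fgiso_braid_iso:
  assumes A: "fgmod A" and N: "fgmod N"
    and Dm: "D (-1) = shift (-1) (-1) (-2) (tens bimI A)" and Dp: "D 1 = shift 0 (-1) (-2) (tens bimB N)"
    and D0: "\<And>i. i \<noteq> -1 \<Longrightarrow> i \<noteq> 1 \<Longrightarrow> trivial_mod (D i)"
  shows "fgiso (dsum D) (bcone A N) (braid_iso A N)"
proof -
  interpret I: tens_eval bimI A A "phi_I A" by (rule tens_eval_I[OF A])
  interpret B: tens_eval bimB N "bcone N N" "phi_B N" by (rule tens_eval_B[OF N])
  have D0c: "x \<in> carrier (D i) \<longleftrightarrow> x = \<zero>\<^bsub>D i\<^esub>" "x \<in> piece (D i) a q \<longleftrightarrow> x = \<zero>\<^bsub>D i\<^esub>"
    "x \<in> filt (D i) j \<longleftrightarrow> x = \<zero>\<^bsub>D i\<^esub>" "\<zero>\<^bsub>D i\<^esub> \<oplus>\<^bsub>D i\<^esub> \<zero>\<^bsub>D i\<^esub> = \<zero>\<^bsub>D i\<^esub>" "p \<odot>\<^bsub>D i\<^esub> \<zero>\<^bsub>D i\<^esub> = \<zero>\<^bsub>D i\<^esub>"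
    if "i \<noteq> -1" "i \<noteq> 1" for x i a q j p
    using D0[OF that] by (auto simp: trivial_mod_def)
  have fin: "finite {i. x i \<noteq> \<zero>\<^bsub>D i\<^esub>}" if "\<And>i. i \<noteq> -1 \<Longrightarrow> i \<noteq> 1 \<Longrightarrow> x i = \<zero>\<^bsub>D i\<^esub>" for x
    by (rule finite_subset[of _ "{-1, 1}"]) (use that in auto)
  have car: "u \<in> carrier (dsum D) \<longleftrightarrow> (\<exists>x. u = Fam x \<and> x (-1) \<in> carrier (tens bimI A) \<and>
      x 1 \<in> carrier (tens bimB N) \<and> (\<forall>i. i \<noteq> -1 \<longrightarrow> i \<noteq> 1 \<longrightarrow> x i = \<zero>\<^bsub>D i\<^esub>))" for u
  proof
    assume "u \<in> carrier (dsum D)"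
    then obtain x where "u = Fam x" "\<And>i. x i \<in> carrier (D i)" by (auto simp: dsum_simps)
    moreover from this(2)[of "-1"] this(2)[of 1] have "x (-1) \<in> carrier (tens bimI A)" "x 1 \<in> carrier (tens bimB N)"
      by (simp_all add: Dm Dp)
    ultimately show "\<exists>x. u = Fam x \<and> x (-1) \<in> carrier (tens bimI A) \<and>
      x 1 \<in> carrier (tens bimB N) \<and> (\<forall>i. i \<noteq> -1 \<longrightarrow> i \<noteq> 1 \<longrightarrow> x i = \<zero>\<^bsub>D i\<^esub>)"
      using D0c(1) by blast
  next
    assume "\<exists>x. u = Fam x \<and> x (-1) \<in> carrier (tens bimI A) \<and>
      x 1 \<in> carrier (tens bimB N) \<and> (\<forall>i. i \<noteq> -1 \<longrightarrow> i \<noteq> 1 \<longrightarrow> x i = \<zero>\<^bsub>D i\<^esub>)"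
    then obtain x where x: "u = Fam x" "x (-1) \<in> carrier (tens bimI A)"
      "x 1 \<in> carrier (tens bimB N)" "\<And>i. i \<noteq> -1 \<Longrightarrow> i \<noteq> 1 \<Longrightarrow> x i = \<zero>\<^bsub>D i\<^esub>" by blast
    have "x i \<in> carrier (D i)" for i
      using x D0c(1)[of i] by (cases "i = -1"; cases "i = 1") (auto simp: Dm Dp)
    then show "u \<in> carrier (dsum D)"
      using fin[of x] x by (auto simp: dsum_simps)
  qed
  define fm where "fm u x \<longleftrightarrow> u = Fam x \<and> x (-1) \<in> carrier (tens bimI A) \<and>
      x 1 \<in> carrier (tens bimB N) \<and> (\<forall>i. i \<noteq> -1 \<longrightarrow> i \<noteq> 1 \<longrightarrow> x i = \<zero>\<^bsub>D i\<^esub>)" for u x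
  have fmD: "u = Fam x" "x (-1) \<in> carrier (tens bimI A)" "x 1 \<in> carrier (tens bimB N)"
    "i \<noteq> -1 \<Longrightarrow> i \<noteq> 1 \<Longrightarrow> x i = \<zero>\<^bsub>D i\<^esub>" if "fm u x" for u x i
    using that by (simp_all add: fm_def)
  have bc: "ev_B N u = (\<zero>\<^bsub>N\<^esub>, snd (ev_B N u))" if "u \<in> carrier (tens bimB N)" for u
    using ev_B_closed(1)[OF N that] by (cases "ev_B N u") auto
  have ic: "ev_I A u \<in> carrier A" if "u \<in> carrier (tens bimI A)" for u
    using I.ev_closed[OF that] by (simp add: ev_I_def)
  have badd: "snd (ev_B N (u \<oplus>\<^bsub>tens bimB N\<^esub> v)) = (fst (snd (ev_B N u)) \<oplus>\<^bsub>N\<^esub> fst (snd (ev_B N v)),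
      snd (snd (ev_B N u)) \<oplus>\<^bsub>N\<^esub> snd (snd (ev_B N v)))"
    if "u \<in> carrier (tens bimB N)" "v \<in> carrier (tens bimB N)" for u v
    using B.ev_add[OF that] unfolding ev_B_def[symmetric]
    by (cases "ev_B N u"; cases "ev_B N v") simp
  have bsm: "snd (ev_B N (p \<odot>\<^bsub>tens bimB N\<^esub> u)) = (p \<odot>\<^bsub>N\<^esub> fst (snd (ev_B N u)),
      dem p \<odot>\<^bsub>N\<^esub> fst (snd (ev_B N u)) \<oplus>\<^bsub>N\<^esub> swapY p \<odot>\<^bsub>N\<^esub> snd (snd (ev_B N u)))"
    if "u \<in> carrier (tens bimB N)" for u p
    using B.tens_smult(2)[OF that, of p] unfolding ev_B_def[symmetric]
    by (cases "ev_B N u") simp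
  show ?thesis
    unfolding fgiso_def
  proof (intro conjI allI ballI)
    show "bij_betw (braid_iso A N) (carrier (dsum D)) (carrier (bcone A N))"
      unfolding bij_betw_def
    proof
      show "inj_on (braid_iso A N) (carrier (dsum D))"
      proof (rule inj_onI)
        fix u v assume uc: "u \<in> carrier (dsum D)" and vc: "v \<in> carrier (dsum D)"
          and eq: "braid_iso A N u = braid_iso A N v"
        from uc obtain x where "fm u x" unfolding car fm_def[symmetric] ..
        note u = fmD[OF this]
        from vc obtain y where "fm v y" unfolding car fm_def[symmetric] ..
        note v = fmD[OF this]
        have "ev_I A (x (-1)) = ev_I A (y (-1))" and B: "snd (ev_B N (x 1)) = snd (ev_B N (y 1))"
          using eq by (simp_all add: braid_iso_def u(1) v(1))
        then have "x (-1) = y (-1)"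
          using sec_I_ev_I[OF A u(2)] sec_I_ev_I[OF A v(2)] by metis
        moreover have "x 1 = y 1"
          using sec_B_ev_B[OF N u(3)] sec_B_ev_B[OF N v(3)] B by metis
        ultimately have "x i = y i" for i
          using u(4)[of i] v(4)[of i] by (cases "i = -1"; cases "i = 1") simp_all
        then have "x = y" by (rule HOL.ext)
        then show "u = v" using u(1) v(1) by simp
      qed
      show "braid_iso A N ` carrier (dsum D) = carrier (bcone A N)"
      proof (intro equalityI subsetI)
        fix w assume "w \<in> braid_iso A N ` carrier (dsum D)"
        then obtain x where "w = braid_iso A N (Fam x)" "x (-1) \<in> carrier (tens bimI A)" "x 1 \<in> carrier (tens bimB N)"
          by (auto simp: car)
        then show "w \<in> carrier (bcone A N)"
          using ic ev_B_closed(2,3)[OF N] by (auto simp: braid_iso_def prod_eq_iff mem_Times_iff)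
      next
        fix w assume "w \<in> carrier (bcone A N)"
        then obtain x y z where w: "w = (x, y, z)" "x \<in> carrier A" "y \<in> carrier N" "z \<in> carrier N" by auto
        let ?x = "\<lambda>i. if i = -1 then sec_I A x else if i = 1 then sec_B N y z else \<zero>\<^bsub>D i\<^esub>"
        let ?u = "Fam ?x"
        have "?u \<in> carrier (dsum D)"
          unfolding car using ev_I_sec_I(1)[OF A w(2)] ev_B_sec_B(1)[OF N w(3,4)] by (intro exI[of _ ?x]) simp
        moreover have "braid_iso A N ?u = w"
          using ev_I_sec_I(2)[OF A w(2)] ev_B_sec_B(2)[OF N w(3,4)] by (simp add: braid_iso_def w(1))
        ultimately show "w \<in> braid_iso A N ` carrier (dsum D)" by force
      qed
    qed
    show "\<zero>\<^bsub>dsum D\<^esub> \<in> carrier (dsum D)"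
      unfolding car by (intro exI[of _ "\<lambda>i. \<zero>\<^bsub>D i\<^esub>"]) (simp add: dsum_simps Dm Dp I.tens_zero_closed B.tens_zero_closed)
    show "braid_iso A N \<zero>\<^bsub>dsum D\<^esub> = \<zero>\<^bsub>bcone A N\<^esub>"
      using I.ev_zero B.ev_zero by (simp add: braid_iso_def dsum_simps Dm Dp ev_I_def ev_B_def)
    fix u assume uc: "u \<in> carrier (dsum D)"
    from uc obtain x where "fm u x" unfolding car fm_def[symmetric] ..
    note u = fmD[OF this]
    show "p \<odot>\<^bsub>dsum D\<^esub> u \<in> carrier (dsum D)" for p
      unfolding car using u by (intro exI[of _ "\<lambda>i. p \<odot>\<^bsub>D i\<^esub> x i"])
        (simp add: dsum_simps Dm Dp I.tens_smult B.tens_smult D0c)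
    show "braid_iso A N (p \<odot>\<^bsub>dsum D\<^esub> u) = p \<odot>\<^bsub>bcone A N\<^esub> braid_iso A N u" for p
      using u(2,3) I.tens_smult(2)[OF u(2), of p] bsm[OF u(3), of p]
      by (cases "snd (ev_B N (x 1))") (simp add: braid_iso_def dsum_simps Dm Dp u(1) ev_I_def)
    show "u \<in> piece (dsum D) a q \<longleftrightarrow> braid_iso A N u \<in> piece (bcone A N) a q" for a q
    proof -
      have "u \<in> piece (dsum D) a q \<longleftrightarrow> x (-1) \<in> piece (D (-1)) a q \<and> x 1 \<in> piece (D 1) a q"
      proof
        assume "x (-1) \<in> piece (D (-1)) a q \<and> x 1 \<in> piece (D 1) a q"
        then have "x i \<in> piece (D i) a q" for i
          using D0c(2)[of i] u(4) by (cases "i = -1"; cases "i = 1") auto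
        then show "u \<in> piece (dsum D) a q"
          using fin[of x] u by (auto simp: dsum_simps)
      qed (auto simp: dsum_simps u(1))
      also have "\<dots> \<longleftrightarrow> ev_I A (x (-1)) \<in> piece A (a + 1) (q + 2) \<and> ev_B N (x 1) \<in> piece (bcone N N) a q"
        using tens_I_parts(1)[OF A u(2), of "a + 1" "q + 2"] tens_B_parts(1)[OF N u(3), of a "q + 2"]
        by (simp add: Dm Dp)
      also have "\<dots> \<longleftrightarrow> braid_iso A N u \<in> piece (bcone A N) a q"
        using bc[OF u(3)] B.N.piece_zero
        by (cases "ev_B N (x 1)") (auto simp: braid_iso_def u(1))
      finally show ?thesis .
    qed
    show "u \<in> filt (dsum D) j \<longleftrightarrow> braid_iso A N u \<in> filt (bcone A N) j" for j
    proof -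
      have "u \<in> filt (dsum D) j \<longleftrightarrow> x (-1) \<in> filt (D (-1)) j \<and> x 1 \<in> filt (D 1) j"
      proof
        assume "x (-1) \<in> filt (D (-1)) j \<and> x 1 \<in> filt (D 1) j"
        then have "x i \<in> filt (D i) j" for i
          using D0c(3)[of i] u(4) by (cases "i = -1"; cases "i = 1") auto
        then show "u \<in> filt (dsum D) j"
          using fin[of x] u by (auto simp: dsum_simps)
      qed (auto simp: dsum_simps u(1))
      also have "\<dots> \<longleftrightarrow> ev_I A (x (-1)) \<in> filt A (j + 1) \<and> ev_B N (x 1) \<in> filt (bcone N N) j"
        using tens_I_parts(2)[OF A u(2), of "j + 1"] tens_B_parts(2)[OF N u(3), of "j + 1"]
        by (simp add: Dm Dp)
      also have "\<dots> \<longleftrightarrow> braid_iso A N u \<in> filt (bcone A N) j"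
        using bc[OF u(3)] B.N.filt_zero
        by (cases "ev_B N (x 1)") (auto simp: braid_iso_def u(1))
      finally show ?thesis .
    qed
    fix v assume vc: "v \<in> carrier (dsum D)"
    from vc obtain y where "fm v y" unfolding car fm_def[symmetric] ..
    note v = fmD[OF this]
    show "u \<oplus>\<^bsub>dsum D\<^esub> v \<in> carrier (dsum D)"
      unfolding car using u v by (intro exI[of _ "\<lambda>i. x i \<oplus>\<^bsub>D i\<^esub> y i"])
        (simp add: dsum_simps Dm Dp I.tens_add_closed B.tens_add_closed D0c)
    show "braid_iso A N (u \<oplus>\<^bsub>dsum D\<^esub> v) = braid_iso A N u \<oplus>\<^bsub>bcone A N\<^esub> braid_iso A N v"
      using u(2,3) v(2,3) I.ev_add[OF u(2) v(2)] badd[OF u(3) v(3)]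
      by (cases "snd (ev_B N (x 1))"; cases "snd (ev_B N (y 1))")
         (simp add: braid_iso_def dsum_simps Dm Dp u(1) v(1) ev_I_def)
  next
    have Dsub: "piece (D i) a q \<subseteq> carrier (D i)" "filt (D i) j \<subseteq> carrier (D i)" for i a q j
      using tens_parts_subset(3,4)[OF fgmod_bims(1) A] tens_parts_subset(3,4)[OF fgmod_bims(2) N] D0c(1-3)[of i]
      by (cases "i = -1"; cases "i = 1"; auto simp: Dm Dp)+
    show "piece (dsum D) a q \<subseteq> carrier (dsum D)" "filt (dsum D) j \<subseteq> carrier (dsum D)" for a q j
      unfolding dsum_simps using Dsub by blast+
  qed
qed

section \<open>Transport of complexes along isomorphisms\<close>

lemma fgiso_bhom:
  assumes iso: "fgiso M N f" and "fgmod M" "fgmod N"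
  shows "bhom M N f" "bhom N M (inv_into (carrier M) f)"
proof -
  interpret M: fgmod M by fact
  interpret N: fgmod N by fact
  let ?g = "inv_into (carrier M) f"
  have bij: "bij_betw f (carrier M) (carrier N)"
    and ad: "\<And>x y. x \<in> carrier M \<Longrightarrow> y \<in> carrier M \<Longrightarrow> f (x \<oplus>\<^bsub>M\<^esub> y) = f x \<oplus>\<^bsub>N\<^esub> f y"
    and sm: "\<And>p x. x \<in> carrier M \<Longrightarrow> f (p \<odot>\<^bsub>M\<^esub> x) = p \<odot>\<^bsub>N\<^esub> f x"
    and pc: "\<And>x a q. x \<in> carrier M \<Longrightarrow> x \<in> piece M a q \<longleftrightarrow> f x \<in> piece N a q"
    and fl: "\<And>x p. x \<in> carrier M \<Longrightarrow> x \<in> filt M p \<longleftrightarrow> f x \<in> filt N p"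
    using iso unfolding fgiso_def by blast+
  have fc: "x \<in> carrier M \<Longrightarrow> f x \<in> carrier N" for x
    using bij by (auto simp: bij_betw_def)
  have gc: "y \<in> carrier N \<Longrightarrow> ?g y \<in> carrier M" for y
    using bij by (auto simp: bij_betw_def inv_into_into)
  have fg: "y \<in> carrier N \<Longrightarrow> f (?g y) = y" for y
    using bij by (auto simp: bij_betw_def f_inv_into_f)
  have inj: "x = y" if "f x = f y" "x \<in> carrier M" "y \<in> carrier M" for x y
    using bij that by (auto simp: bij_betw_def inj_on_def)
  show "bhom M N f"
    unfolding bhom_def
  proof (intro conjI allI ballI)
    show "f x \<in> piece N a q" if "x \<in> piece M a q" for a q x
      using pc[OF M.piece_closed[OF that]] that by simp
    show "f x \<in> filt N i" if "x \<in> filt M i" for i x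
      using fl[OF M.filt_closed[OF that]] that by simp
  qed (simp_all add: fc ad sm)
  show "bhom N M ?g"
    unfolding bhom_def
  proof (intro conjI allI ballI)
    show "?g (x \<oplus>\<^bsub>N\<^esub> y) = ?g x \<oplus>\<^bsub>M\<^esub> ?g y" if "x \<in> carrier N" "y \<in> carrier N" for x y
      by (rule inj) (use that gc fg ad in auto)
    show "?g (p \<odot>\<^bsub>N\<^esub> x) = p \<odot>\<^bsub>M\<^esub> ?g x" if "x \<in> carrier N" for p x
      by (rule inj) (use that gc fg sm M.smult_closed N.smult_closed in auto)
    show "?g x \<in> piece M a q" if "x \<in> piece N a q" for a q x
      using that pc[OF gc] fg N.piece_closed by simp
    show "?g x \<in> filt M i" if "x \<in> filt N i" for i x
      using that fl[OF gc] fg N.filt_closed by simp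
  qed (rule gc)
qed

text \<open>The module axioms, d d = 0 and boundedness of \<open>T\<close> are all pulled back along
  the isomorphisms; the retract has zero homotopy.\<close>

lemma bcpx_iso:
  assumes T': "bcpx T' d'" and iso: "\<And>k. fgiso (T k) (T' k) (\<Phi> k)"
    and dc: "\<And>k u. u \<in> carrier (T k) \<Longrightarrow> d k u \<in> carrier (T (k - 2))"
    and d\<Phi>: "\<And>k u. u \<in> carrier (T k) \<Longrightarrow> \<Phi> (k - 2) (d k u) = d' k (\<Phi> k u)"
  shows "bcpx T d" "sdr T d T' d' \<Phi> (\<lambda>k. inv_into (carrier (T k)) (\<Phi> k)) (\<lambda>i x. \<zero>\<^bsub>T (i + 2)\<^esub>)"
proof -
  note D' = bcpxD[OF T']
  have fg: "fgmod (T k)" for k by (rule fgiso_fgmod[OF iso D'(1)])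
  note h = fgiso_bhom[OF iso fg D'(1)]
  let ?g = "\<lambda>k. inv_into (carrier (T k)) (\<Phi> k)"
  have bij: "bij_betw (\<Phi> k) (carrier (T k)) (carrier (T' k))" and z: "\<Phi> k \<zero>\<^bsub>T k\<^esub> = \<zero>\<^bsub>T' k\<^esub>"
    "\<zero>\<^bsub>T k\<^esub> \<in> carrier (T k)" for k
    using iso[of k] by (auto simp: fgiso_def)
  have gf: "?g k (\<Phi> k u) = u" if "u \<in> carrier (T k)" for k u
    using bij[of k] that by (auto simp: bij_betw_def)
  have fgy: "\<Phi> k (?g k y) = y" if "y \<in> carrier (T' k)" for k y
    using bij[of k] that by (auto simp: bij_betw_def f_inv_into_f)
  have inj: "x = y" if "\<Phi> k x = \<Phi> k y" "x \<in> carrier (T k)" "y \<in> carrier (T k)" for k x y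
    using bij[of k] that by (auto simp: bij_betw_def inj_on_def)
  show 1: "bcpx T d"
    unfolding bcpx_def
  proof (intro conjI allI ballI fg)
    fix k
    have "bhom (T k) (ash 1 (T (k - 2))) (\<lambda>u. ?g (k - 2) (d' k (\<Phi> k u)))"
      by (intro bhom_comp[OF bhom_comp[OF h(1) D'(2)]] bhom_shift h(2))
    then show "bhom (T k) (ash 1 (T (k - 2))) (d k)"
      by (rule bhom_cong[OF _ fg]) (metis d\<Phi> gf dc)
    show "d (k - 2) (d k u) = \<zero>\<^bsub>T (k - 4)\<^esub>" if u: "u \<in> carrier (T k)" for u
    proof -
      have "\<Phi> (k - 4) (d (k - 2) (d k u)) = d' (k - 2) (d' k (\<Phi> k u))"
        using d\<Phi>[OF dc[OF u]] d\<Phi>[OF u] by simp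
      also have "\<dots> = \<Phi> (k - 4) \<zero>\<^bsub>T (k - 4)\<^esub>"
        using D'(3) bhomD(1)[OF h(1) u] z by simp
      finally show ?thesis
        using inj[of "k - 4"] dc[OF dc[OF u]] z by simp
    qed
  next
    have "carrier (T k) = {\<zero>\<^bsub>T k\<^esub>}" if "carrier (T' k) = {\<zero>\<^bsub>T' k\<^esub>}" for k
    proof -
      have "x = \<zero>\<^bsub>T k\<^esub>" if x: "x \<in> carrier (T k)" for x
      proof (rule inj[OF _ x z(2)])
        have "\<Phi> k x \<in> carrier (T' k)" by (rule bhomD(1)[OF h(1) x])
        then show "\<Phi> k x = \<Phi> k \<zero>\<^bsub>T k\<^esub>"
          using \<open>carrier (T' k) = {\<zero>\<^bsub>T' k\<^esub>}\<close> z(1) by simp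
      qed
      then show ?thesis using z(2) by auto
    qed
    then show "finite {i. carrier (T i) \<noteq> {\<zero>\<^bsub>T i\<^esub>}}"
      by (intro finite_subset[OF _ D'(4)]) auto
  qed
  show "sdr T d T' d' \<Phi> ?g (\<lambda>i x. \<zero>\<^bsub>T (i + 2)\<^esub>)"
    by (rule sdr_iso[OF 1 D'(1) h(1) h(2) d\<Phi> fgy gf])
qed

lemma tens_map_closed:
  assumes "u \<in> carrier (tens M N)" "\<And>m. m \<in> carrier M \<Longrightarrow> f m \<in> carrier M'"
    "\<And>n. n \<in> carrier N \<Longrightarrow> g n \<in> carrier N'"
  shows "tens_map M' N' f g u \<in> carrier (tens M' N')"
proof -
  have "set (map (\<lambda>(m, n). (f m, g n)) (summands u)) \<subseteq> carrier M' \<times> carrier N'"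
    using assms by (auto simp: tens_carrier_iff)
  then show ?thesis unfolding tens_map_def by (rule tens_class_carrier)
qed

text \<open>Evaluation is a sum over elementary tensors, so naturality has to be checked on these,
  with \<open>G\<close> additive.\<close>

lemma tens_map_ev:
  assumes 1: "tens_eval M N P \<phi>" and 2: "tens_eval M' N' P' \<phi>'"
    and u: "u \<in> carrier (tens M N)" and f: "\<And>m. m \<in> carrier M \<Longrightarrow> f m \<in> carrier M'"
    and g: "\<And>n. n \<in> carrier N \<Longrightarrow> g n \<in> carrier N'"
    and G: "\<And>x y. x \<in> carrier P \<Longrightarrow> y \<in> carrier P \<Longrightarrow> G (x \<oplus>\<^bsub>P\<^esub> y) = G x \<oplus>\<^bsub>P'\<^esub> G y" "G \<zero>\<^bsub>P\<^esub> = \<zero>\<^bsub>P'\<^esub>"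
    and \<phi>: "\<And>m n. m \<in> carrier M \<Longrightarrow> n \<in> carrier N \<Longrightarrow> \<phi>' (f m) (g n) = G (\<phi> m n)"
  shows "tens_eval.ev P' \<phi>' (tens_map M' N' f g u) = G (tens_eval.ev P \<phi> u)"
proof -
  interpret A: tens_eval M N P \<phi> by fact
  interpret B: tens_eval M' N' P' \<phi>' by fact
  have s: "set (summands u) \<subseteq> carrier M \<times> carrier N" using u by (simp add: tens_carrier_iff)
  then have s': "set (map (\<lambda>(m, n). (f m, g n)) (summands u)) \<subseteq> carrier M' \<times> carrier N'"
    using f g by auto
  have "B.lsum (map (\<lambda>(m, n). (f m, g n)) l) = G (A.lsum l)" if "set l \<subseteq> carrier M \<times> carrier N" for l
    using that by (induction l) (auto simp: G \<phi> A.\<phi>_closed A.lsum_closed)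
  from this[OF s] show ?thesis
    unfolding tens_map_def by (simp add: B.ev_class[OF s']) (simp add: A.ev_def)
qed

section \<open>The complex of the composite with a crossing\<close>

lemma sigma_minus_term:
  "bterm sigma_minus (-1) = shift (-1) (-1) (-2) bimI" "bterm sigma_minus 1 = shift 0 (-1) (-2) bimB"
  "i \<noteq> -1 \<Longrightarrow> i \<noteq> 1 \<Longrightarrow> bterm sigma_minus i = shift (-1) (-1) (-2) bim0"
proof -
  show "bterm sigma_minus (-1) = shift (-1) (-1) (-2) bimI" "bterm sigma_minus 1 = shift 0 (-1) (-2) bimB"
    by (simp_all add: sigma_minus_def ts_aq_shift_def bshift_def integral_complex_def integral_term_def)
  show "bterm sigma_minus i = shift (-1) (-1) (-2) bim0" if "i \<noteq> -1" "i \<noteq> 1"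
  proof -
    \<comment> \<open>The integral t-degrees 0 and 1 have the indices 0 and 2, which the
      half-integral shift moves to -1 and 1.\<close>
    have "\<not> (even (i + 1) \<and> (i + 1) div 2 \<in> {0..1})"
      using that unfolding atLeastAtMost_iff by presburger
    then show ?thesis
      by (auto simp: sigma_minus_def ts_aq_shift_def bshift_def integral_complex_def integral_term_def)
  qed
qed

lemma sigma_minus_dif:
  "bdif sigma_minus 1 = chi_minus" "i \<noteq> 1 \<Longrightarrow> bdif sigma_minus i = (\<lambda>u. \<zero>\<^bsub>bterm sigma_minus (i - 2)\<^esub>)"
proof -
  show "bdif sigma_minus 1 = chi_minus"
    by (simp add: sigma_minus_def ts_aq_shift_def bshift_def integral_complex_def)
  show "bdif sigma_minus i = (\<lambda>u. \<zero>\<^bsub>bterm sigma_minus (i - 2)\<^esub>)" if "i \<noteq> 1"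
  proof -
    have "\<not> (even (i + 1) \<and> (i + 1) div 2 \<in> {0<..1})"
      using that unfolding greaterThanAtMost_iff by presburger
    then show ?thesis
      by (auto simp: sigma_minus_def ts_aq_shift_def bshift_def integral_complex_def)
  qed
qed

lemma fgmod_sigma_minus_term: "fgmod (bterm sigma_minus i)"
  by (cases "i = -1"; cases "i = 1") (auto simp: sigma_minus_term intro!: fgmod_shift fgmod_bims)

lemma chi_minus_class: "chi_minus (pol_class JM p) = pol_class JI p"
proof -
  have "p \<in> JI" if "p \<in> JM" for p using that by (simp add: JI_iff JM_iff)
  then show ?thesis
    unfolding chi_minus_def using pol_class_rep[OF hideal_JM hideal_JI, of "\<lambda>p. p"] by simp
qed

lemma sigma_minus_dif_closed:
  assumes "m \<in> carrier (bterm sigma_minus i)"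
  shows "bdif sigma_minus i m \<in> carrier (bterm sigma_minus (i - 2))"
proof (cases "i = 1")
  case True
  with assms show ?thesis
    by (auto simp: sigma_minus_term sigma_minus_dif bimB_simps bimI_simps chi_minus_class)
next
  case False
  interpret M: fgmod "bterm sigma_minus (i - 2)" by (rule fgmod_sigma_minus_term)
  show ?thesis using False by (simp add: sigma_minus_dif)
qed

lemma a_inv_shift: "\<ominus>\<^bsub>shift m k n M\<^esub> x = \<ominus>\<^bsub>M\<^esub> x"
  by (simp add: a_inv_def m_inv_def shift_def)

lemma bterm_sigma_minus_comp:
  "bterm (sigma_minus \<circ>\<^sub>b X) k = dsum (\<lambda>i. tens (bterm sigma_minus i) (bterm X (k - i)))"
  by (simp add: bcomp_def)

lemma fgiso_braid_term:
  assumes "\<And>i. fgmod (bterm X i)"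
  shows "fgiso (bterm (sigma_minus \<circ>\<^sub>b X) k) (cone_term (bterm X) k)
    (braid_iso (bterm X (k + 1)) (bterm X (k - 1)))"
  unfolding bterm_sigma_minus_comp cone_term_def
proof (rule fgiso_braid_iso[OF assms assms])
  fix i :: int assume "i \<noteq> -1" "i \<noteq> 1"
  then show "trivial_mod (tens (bterm sigma_minus i) (bterm X (k - i)))"
    unfolding sigma_minus_term(3)[OF \<open>i \<noteq> -1\<close> \<open>i \<noteq> 1\<close>] tens_shift
    by (intro trivial_mod_shift trivial_mod_tens fgmod_bims assms carrier_bim0)
qed (simp_all add: sigma_minus_term tens_shift)

text \<open>Only the entries of the composite at -1 and 1 matter; there the two parts of the
  differential, from the crossing and from \<open>X\<close>, are evaluated separately by
  naturality.\<close>

lemma braid_chain: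
  assumes X: "bcpx (bterm X) (bdif X)" and u: "u \<in> carrier (bterm (sigma_minus \<circ>\<^sub>b X) k)"
  shows "bdif (sigma_minus \<circ>\<^sub>b X) k u \<in> carrier (bterm (sigma_minus \<circ>\<^sub>b X) (k - 2))"
    "braid_iso (bterm X (k - 1)) (bterm X (k - 3)) (bdif (sigma_minus \<circ>\<^sub>b X) k u) =
      cone_dif (bterm X) (bdif X) k (braid_iso (bterm X (k + 1)) (bterm X (k - 1)) u)"
proof -
  let ?S = "bterm sigma_minus" and ?T = "bterm X" and ?d = "bdif X"
  note D = bcpxD[OF X]
  have dcl: "?d i n \<in> carrier (?T (i - 2))" if "n \<in> carrier (?T i)" for i n
    using bhomD(1)[OF D(2) that] by simp
  obtain x where ux: "u = Fam x" and x: "\<And>i. x i \<in> carrier (tens (?S i) (?T (k - i)))"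
    using u by (auto simp: bterm_sigma_minus_comp dsum_simps)
  define v where "v i = tens_map (?S i) (?T (k - 2 - i)) (bdif sigma_minus (i + 2)) (\<lambda>n. n) (x (i + 2))" for i
  define w where "w i = tens_map (?S i) (?T (k - 2 - i)) (\<lambda>m. m) (?d (k - i)) (x i)" for i
  define r where "r i = v i \<oplus>\<^bsub>tens (?S i) (?T (k - 2 - i))\<^esub>
    (if even (i div 2) then w i else \<ominus>\<^bsub>tens (?S i) (?T (k - 2 - i))\<^esub> w i)" for i
  have bd: "bdif (sigma_minus \<circ>\<^sub>b X) k u = Fam r"
    by (simp add: bcomp_def ux r_def v_def w_def Let_def fun_eq_iff)
  have vc: "v i \<in> carrier (tens (?S i) (?T (k - 2 - i)))" for i
    unfolding v_def
  proof (rule tens_map_closed)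
    have "k - (i + 2) = k - 2 - i" by simp
    then show "x (i + 2) \<in> carrier (tens (?S (i + 2)) (?T (k - 2 - i)))" using x[of "i + 2"] by metis
    show "bdif sigma_minus (i + 2) m \<in> carrier (?S i)" if "m \<in> carrier (?S (i + 2))" for m
      using sigma_minus_dif_closed[OF that] by simp
  qed
  have wc: "w i \<in> carrier (tens (?S i) (?T (k - 2 - i)))" for i
    unfolding w_def
  proof (rule tens_map_closed[OF x])
    show "?d (k - i) n \<in> carrier (?T (k - 2 - i))" if "n \<in> carrier (?T (k - i))" for n
    proof -
      have "k - i - 2 = k - 2 - i" by simp
      then show ?thesis using dcl[OF that] by metis
    qed
  qed
  have rc: "r i \<in> carrier (tens (?S i) (?T (k - 2 - i)))" for i
  proof -
    interpret E: tens_eval "?S i" "?T (k - 2 - i)" "?T (k - 2 - i)" "\<lambda>m n. \<zero>\<^bsub>?T (k - 2 - i)\<^esub>"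
      by (intro tens_eval_zero fgmod_sigma_minus_term D)
    show ?thesis
      unfolding r_def using vc[of i] wc[of i] by (auto intro!: E.tens_add_closed E.tens_neg)
  qed
  have r0: "r i = \<zero>\<^bsub>tens (?S i) (?T (k - 2 - i))\<^esub>" if "i \<noteq> -1" "i \<noteq> 1" for i
  proof -
    have "trivial_mod (tens (?S i) (?T (k - 2 - i)))"
      unfolding sigma_minus_term(3)[OF that] tens_shift
      by (intro trivial_mod_shift trivial_mod_tens fgmod_bims D carrier_bim0)
    then show ?thesis using rc[of i] by (simp add: trivial_mod_def)
  qed
  have "{i. r i \<noteq> \<zero>\<^bsub>tens (?S i) (?T (k - 2 - i))\<^esub>} \<subseteq> {-1, 1}"
  proof
    fix i assume "i \<in> {i. r i \<noteq> \<zero>\<^bsub>tens (?S i) (?T (k - 2 - i))\<^esub>}"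
    with r0[of i] show "i \<in> {-1, 1}" by blast
  qed
  then have "finite {i. r i \<noteq> \<zero>\<^bsub>tens (?S i) (?T (k - 2 - i))\<^esub>}"
    by (rule finite_subset) simp
  then show "bdif (sigma_minus \<circ>\<^sub>b X) k u \<in> carrier (bterm (sigma_minus \<circ>\<^sub>b X) (k - 2))"
    unfolding bd bterm_sigma_minus_comp dsum_simps by (intro imageI CollectI conjI allI rc)
  let ?A = "?T (k + 1)" and ?N = "?T (k - 1)" and ?N' = "?T (k - 3)"
  have xm: "x (-1) \<in> carrier (tens bimI ?A)" and xp: "x 1 \<in> carrier (tens bimB ?N)"
    using x[of "-1"] x[of 1] by (simp_all add: sigma_minus_term tens_shift)
  have vm: "v (-1) \<in> carrier (tens bimI ?N)" and wm: "w (-1) \<in> carrier (tens bimI ?N)"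
    using vc[of "-1"] wc[of "-1"] by (simp_all add: sigma_minus_term tens_shift)
  have vp: "v 1 \<in> carrier (tens bimB ?N')" and wp: "w 1 \<in> carrier (tens bimB ?N')"
    using vc[of 1] wc[of 1] by (simp_all add: sigma_minus_term tens_shift)
  interpret N: fgmod ?N by (rule D)
  interpret N': fgmod ?N' by (rule D)
  interpret I: tens_eval bimI ?N ?N "phi_I ?N" by (intro tens_eval_I D)
  interpret B: tens_eval bimB ?N' "bcone ?N' ?N'" "phi_B ?N'" by (intro tens_eval_B D)
  have d1: "bhom ?A (ash 1 ?N) (?d (k + 1))" using D(2)[of "k + 1"] by simp
  have d2: "bhom ?N (ash 1 ?N') (?d (k - 1))" using D(2)[of "k - 1"] by simp
  note e = bhomD[OF d1, simplified] and f = bhomD[OF d2, simplified]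
  have d1z: "?d (k + 1) \<zero>\<^bsub>?A\<^esub> = \<zero>\<^bsub>?N\<^esub>" using bhom_zero[OF D(1) fgmod_shift[OF D(1)] d1] by simp
  have d2z: "?d (k - 1) \<zero>\<^bsub>?N\<^esub> = \<zero>\<^bsub>?N'\<^esub>" using bhom_zero[OF D(1) fgmod_shift[OF D(1)] d2] by simp
  \<comment> \<open>\<open>chi_minus\<close> is the identity on polynomials and kills y_minus -
    x_minus, so the first coordinate survives.\<close>
  have ev_vm: "ev_I ?N (v (-1)) = fst (snd (ev_B ?N (x 1)))"
  proof -
    have "v (-1) = tens_map bimI ?N chi_minus (\<lambda>n. n) (x 1)"
      by (simp add: v_def sigma_minus_term sigma_minus_dif tens_map_shift)
    then show ?thesis
      unfolding ev_I_def ev_B_def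
      by (simp only:)
         (rule tens_map_ev[OF tens_eval_B[OF D(1)] tens_eval_I[OF D(1)] xp];
           auto simp: bimB_simps bimI_simps chi_minus_class phi_I_def phi_B_def XtoY_pol_JI XtoY_pol_JM)
  qed
  have ev_wm: "ev_I ?N (w (-1)) = ?d (k + 1) (ev_I ?A (x (-1)))"
  proof -
    have "w (-1) = tens_map bimI ?N (\<lambda>m. m) (?d (k + 1)) (x (-1))"
      by (simp add: w_def sigma_minus_term tens_map_shift)
    then show ?thesis
      unfolding ev_I_def
      by (simp only:)
         (rule tens_map_ev[OF tens_eval_I[OF D(1)] tens_eval_I[OF D(1)] xm];
           auto simp: e d1z phi_I_def)
  qed
  \<comment> \<open>This part starts at index 3, where the crossing is zero.\<close>
  have ev_vp: "ev_B ?N' (v 1) = \<zero>\<^bsub>bcone ?N' ?N'\<^esub>"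
  proof -
    have x3: "x 3 \<in> carrier (tens bim0 ?N')"
      using x[of 3] by (simp add: sigma_minus_term tens_shift)
    have "v 1 = tens_map bimB ?N' (\<lambda>m. pol_class JM 0) (\<lambda>n. n) (x 3)"
      by (simp add: v_def sigma_minus_term sigma_minus_dif tens_map_shift bimB_simps)
    then show ?thesis
      unfolding ev_B_def
      by (simp only:)
         (rule tens_map_ev[OF tens_eval_zero[OF fgmod_bims(4) D(1)[of "k - 3"]] tens_eval_B[OF D(1)] x3,
             where G = "\<lambda>x. \<zero>\<^bsub>bcone ?N' ?N'\<^esub>"];
           auto simp: bimB_simps phi_B_def XtoY_pol_JM N'.smult_l_null[simplified])
  qed
  have ev_wp: "ev_B ?N' (w 1) = (\<lambda>(a, y, z). (?d (k - 1) a, ?d (k - 1) y, ?d (k - 1) z)) (ev_B ?N (x 1))"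
  proof -
    have "w 1 = tens_map bimB ?N' (\<lambda>m. m) (?d (k - 1)) (x 1)"
      by (simp add: w_def sigma_minus_term tens_map_shift)
    then show ?thesis
      unfolding ev_B_def
      by (simp only:)
         (rule tens_map_ev[OF tens_eval_B[OF D(1)] tens_eval_B[OF D(1)] xp];
           auto simp: f d2z phi_B_def)
  qed
  \<comment> \<open>The sign at index i is given by the parity of i div 2, and (-1) div 2 = -1 is
    odd while 1 div 2 = 0 is even; so the sign occurs at I and not at B.\<close>
  have "r (-1) = v (-1) \<oplus>\<^bsub>tens bimI ?N\<^esub> \<ominus>\<^bsub>tens bimI ?N\<^esub> w (-1)"
    by (simp add: r_def sigma_minus_term tens_shift a_inv_shift)
  then have rm: "ev_I ?N (r (-1)) = ev_I ?N (v (-1)) \<oplus>\<^bsub>?N\<^esub> \<ominus>\<^bsub>?N\<^esub> ev_I ?N (w (-1))"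
    using I.ev_add[OF vm I.tens_neg(1)[OF wm]] I.tens_neg(2)[OF wm] by (simp add: ev_I_def)
  have "r 1 = v 1 \<oplus>\<^bsub>tens bimB ?N'\<^esub> w 1"
    by (simp add: r_def sigma_minus_term tens_shift)
  then have rp: "ev_B ?N' (r 1) = ev_B ?N' (w 1)"
    using B.ev_add[OF vp wp] ev_vp B.P.M.l_zero[OF B.ev_closed[OF wp]] by (simp add: ev_B_def)
  show "braid_iso (bterm X (k - 1)) (bterm X (k - 3)) (bdif (sigma_minus \<circ>\<^sub>b X) k u) =
      cone_dif (bterm X) (bdif X) k (braid_iso (bterm X (k + 1)) (bterm X (k - 1)) u)"
    by (cases "ev_B ?N (x 1)") (simp add: bd[unfolded ux] ux braid_iso_def rm rp ev_vm ev_wm ev_wp cone_dif_def)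
qed

lemma braid_step:
  assumes X: "bcpx (bterm X) (bdif X)"
  shows "bcpx (bterm (sigma_minus \<circ>\<^sub>b X)) (bdif (sigma_minus \<circ>\<^sub>b X))"
    "\<exists>p s h. sdr (bterm (sigma_minus \<circ>\<^sub>b X)) (bdif (sigma_minus \<circ>\<^sub>b X))
       (cone_term (bterm X)) (cone_dif (bterm X) (bdif X)) p s h"
proof -
  have chain: "braid_iso (bterm X (k - 2 + 1)) (bterm X (k - 2 - 1)) (bdif (sigma_minus \<circ>\<^sub>b X) k u) =
      cone_dif (bterm X) (bdif X) k (braid_iso (bterm X (k + 1)) (bterm X (k - 1)) u)"
    if "u \<in> carrier (bterm (sigma_minus \<circ>\<^sub>b X) k)" for k u
    using braid_chain(2)[OF X that] by simp
  note iso = bcpx_iso[OF bcpx_cone[OF X] fgiso_braid_term[OF bcpxD(1)[OF X]] braid_chain(1)[OF X] chain]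
  show "bcpx (bterm (sigma_minus \<circ>\<^sub>b X)) (bdif (sigma_minus \<circ>\<^sub>b X))"
    by (rule iso(1))
  show "\<exists>p s h. sdr (bterm (sigma_minus \<circ>\<^sub>b X)) (bdif (sigma_minus \<circ>\<^sub>b X))
       (cone_term (bterm X)) (cone_dif (bterm X) (bdif X)) p s h"
    by (intro exI) (rule iso(2))
qed

section \<open>The blob complexes\<close>

text \<open>Degrees outside the range and those of wrong parity are quotients by the unit ideal. One
  family of polynomial formulas then covers every degree.\<close>

definition slot_ideal :: "bool \<Rightarrow> int \<Rightarrow> int \<Rightarrow> bpoly set" where
  "slot_ideal \<epsilon> M j = (if \<epsilon> \<and> j = -1 then JI else if \<epsilon> \<and> 0 \<le> j \<and> j < M then JM else UNIV)"

definition slot_filt :: "int \<Rightarrow> int \<Rightarrow> bpoly set" where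
  "slot_filt j = (if j = -1 then trivial_filt
     else two_step_filt (if even j then y_minus - x_minus else y_minus + x_minus))"

definition slot_class :: "bool \<Rightarrow> int \<Rightarrow> int \<Rightarrow> bpoly \<Rightarrow> 'a univ" where
  "slot_class \<epsilon> M j = pol_class (slot_ideal \<epsilon> M j)"

text \<open>
  The term in \<open>t\<close>-degree \<open>j\<close> of the bracket with \<open>M\<close> blobs, with all shifts of the theorem
  applied. It is zero unless \<open>-1 \<le> j < M\<close>; the flag \<open>\<epsilon>\<close> is false in the \<open>t\<close>-degrees of the
  wrong parity.
\<close>

definition slot :: "bool \<Rightarrow> int \<Rightarrow> int \<Rightarrow> 'a bimodule" where
  "slot \<epsilon> M j = shift (1 - M + j) (2 * max j 0 - M) (2 * max j 0 - 2 * M)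
     (cyclic (slot_ideal \<epsilon> M j) (slot_filt j))"

text \<open>Membership in \<open>slot_ideal\<close> in coordinates. A formula is well defined,
  linear or a chain map on classes once it satisfies equations in \<open>YtoX\<close> and
  \<open>dem\<close>.\<close>

definition slot_zero :: "bool \<Rightarrow> int \<Rightarrow> int \<Rightarrow> bpoly \<Rightarrow> bool" where
  "slot_zero \<epsilon> M j p \<longleftrightarrow> (\<epsilon> \<and> j = -1 \<longrightarrow> YtoX p = 0) \<and>
     (\<epsilon> \<and> 0 \<le> j \<and> j < M \<longrightarrow> YtoX p = 0 \<and> YtoX (dem p) = 0)"

text \<open>
  \<open>V\<close> is the quotient of \<open>M\<close> by \<open>y_minus + x_minus\<close>, on which the class of \<open>p\<close> is
  \<open>YtoX (swapY p)\<close>.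
\<close>

definition slot_in :: "bool \<Rightarrow> int \<Rightarrow> int \<Rightarrow> int \<Rightarrow> bpoly \<Rightarrow> bool" where
  "slot_in \<epsilon> M j i p \<longleftrightarrow> (\<epsilon> \<and> j = -1 \<longrightarrow> i \<le> 0 \<or> YtoX p = 0) \<and>
     (\<epsilon> \<and> 0 \<le> j \<and> j < M \<longrightarrow> i \<le> 0 \<or> (i \<le> 2 \<and> YtoX (if even j then p else swapY p) = 0) \<or>
        YtoX p = 0 \<and> YtoX (dem p) = 0)"

lemma hideal_slot_ideal: "hideal (slot_ideal \<epsilon> M j)"
  by (simp add: slot_ideal_def hideal_JI hideal_JM hideal_UNIV)

lemma slot_ideal_iff: "p \<in> slot_ideal \<epsilon> M j \<longleftrightarrow> slot_zero \<epsilon> M j p"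
  by (auto simp: slot_ideal_def slot_zero_def JI_iff JM_iff)

lemma slot_class_eq_iff: "slot_class \<epsilon> M j p = slot_class \<epsilon> M j q \<longleftrightarrow> slot_zero \<epsilon> M j (p - q)"
  by (simp add: slot_class_def pol_class_eq_iff[OF hideal_slot_ideal] slot_ideal_iff)

lemma slot_zero_rep: "slot_zero \<epsilon> M j (pol (slot_class \<epsilon> M j p) - p)"
  using pol_pol_class[OF hideal_slot_ideal] by (simp add: slot_class_def flip: slot_ideal_iff)

lemma hideal_slot_filt: "hideal (slot_filt j i)"
  by (simp add: slot_filt_def hideal_trivial_filt hideal_two_step_filt homogeneous_add homogeneous_diff)

lemma slot_filt_Suc: "slot_filt j (i + 1) \<subseteq> slot_filt j i"
  by (auto simp: slot_filt_def trivial_filt_def two_step_filt_def PIdl_QXY intro: exI[of _ 0])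

lemma fgmod_slot: "fgmod (slot \<epsilon> M j)"
  unfolding slot_def
  by (rule fgmod_shift, rule fgmod_cyclic, rule hideal_slot_ideal, rule hideal_slot_filt, rule slot_filt_Suc)

text \<open>F^1 of B is the kernel of the projection to I, and the quotient is the second coordinate
  in the normal form.\<close>

lemma two_step_minus_iff: "(\<exists>r. p - r * (y_minus - x_minus) \<in> JM) \<longleftrightarrow> YtoX p = 0"
proof
  assume "\<exists>r. p - r * (y_minus - x_minus) \<in> JM"
  then show "YtoX p = 0" by (auto simp: JM_iff)
next
  assume "YtoX p = 0"
  then have "p - YtoX (dem p) * (y_minus - x_minus) \<in> JM"
    using JM_normal_form[of p] by (simp add: mult.commute)
  then show "\<exists>r. p - r * (y_minus - x_minus) \<in> JM" by blast
qed

text \<open>F^1 of G is the kernel of the projection to V, whose value on \<open>p\<close> is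
  \<open>YtoX (swapY p)\<close>.\<close>

lemma two_step_plus_iff: "(\<exists>r. p - r * (y_minus + x_minus) \<in> JM) \<longleftrightarrow> YtoX (swapY p) = 0"
proof
  assume "\<exists>r. p - r * (y_minus + x_minus) \<in> JM"
  then obtain r where "p - r * (y_minus + x_minus) \<in> JM" by blast
  then have "YtoX p = YtoX r * (x_minus + x_minus)" "YtoX (dem p) = YtoX (dem (r * (y_minus + x_minus)))"
    by (simp_all add: JM_iff dem_linear)
  then show "YtoX (swapY p) = 0"
    by (simp add: YtoX_swapY YtoX_dem_mult dem_linear)
next
  assume "YtoX (swapY p) = 0"
  \<comment> \<open>With f = \<open>YtoX (dem p)\<close> the normal form 2 x_minus f + (y_minus -
    x_minus) f is (y_minus + x_minus) f, so f is the required quotient.\<close>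
  then have "YtoX p = 2 * x_minus * YtoX (dem p)" by (simp add: YtoX_swapY)
  then have "p - YtoX (dem p) * (y_minus + x_minus) = p - (YtoX p + (y_minus - x_minus) * YtoX (dem p))"
    by (simp only:) (simp add: algebra_simps)
  then show "\<exists>r. p - r * (y_minus + x_minus) \<in> JM"
    using JM_normal_form[of p] by metis
qed

lemma slot_simps:
  "u \<in> carrier (slot \<epsilon> M j) \<longleftrightarrow> (\<exists>p. u = slot_class \<epsilon> M j p)"
  "\<zero>\<^bsub>slot \<epsilon> M j\<^esub> = slot_class \<epsilon> M j 0"
  "slot_class \<epsilon> M j p \<oplus>\<^bsub>slot \<epsilon> M j\<^esub> slot_class \<epsilon> M j q = slot_class \<epsilon> M j (p + q)"
  "r \<odot>\<^bsub>slot \<epsilon> M j\<^esub> slot_class \<epsilon> M j p = slot_class \<epsilon> M j (r * p)"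
  using cyclic_add[OF hideal_slot_ideal] cyclic_smult[OF hideal_slot_ideal]
  by (auto simp: slot_def slot_class_def)

lemma slot_neg: "\<ominus>\<^bsub>slot \<epsilon> M j\<^esub> slot_class \<epsilon> M j p = slot_class \<epsilon> M j (- p)"
proof -
  interpret S: fgmod "slot \<epsilon> M j" by (rule fgmod_slot)
  have "slot_class \<epsilon> M j p \<in> carrier (slot \<epsilon> M j)" by (auto simp: slot_simps)
  from S.neg_eq_smult[OF this] show ?thesis by (simp add: slot_simps)
qed

lemma slot_piece: "u \<in> piece (slot \<epsilon> M j) a q \<longleftrightarrow>
    (a = 1 - M + j \<and> (\<exists>p. homogeneous (q - (2 * max j 0 - 2 * M)) p \<and> u = slot_class \<epsilon> M j p)) \<or>
    u = slot_class \<epsilon> M j 0"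
proof -
  have "a - (1 - M + j) = 0 \<longleftrightarrow> a = 1 - M + j" by auto
  then show ?thesis
    unfolding slot_def shift_simps cyclic_simps slot_class_def
    by (auto simp: image_iff intro: exI[of _ 0])
qed

lemma slot_filt_iff: "slot_class \<epsilon> M j p \<in> filt (slot \<epsilon> M j) i \<longleftrightarrow> slot_in \<epsilon> M j (i - (2 * max j 0 - M)) p"
proof -
  let ?i = "i - (2 * max j 0 - M)"
  have "slot_class \<epsilon> M j p \<in> filt (slot \<epsilon> M j) i \<longleftrightarrow> (\<exists>f\<in>slot_filt j ?i. p - f \<in> slot_ideal \<epsilon> M j)"
    unfolding slot_def shift_simps cyclic_simps slot_class_def image_iff pol_class_eq_iff[OF hideal_slot_ideal] ..
  also have "\<dots> \<longleftrightarrow> slot_in \<epsilon> M j ?i p"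
  proof -
    consider "\<epsilon>" "j = -1" | "\<epsilon>" "0 \<le> j" "j < M" | "\<not> \<epsilon> \<or> j < -1 \<or> (j \<ge> 0 \<and> j \<ge> M)" by linarith
    then show ?thesis
    proof cases
      case 1
      then show ?thesis
        by (auto simp: slot_filt_def slot_ideal_def slot_in_def trivial_filt_def JI_iff intro: bexI[of _ p] exI[of _ p])
    next
      case 2
      have JMin: "YtoX p = 0 \<and> YtoX (dem p) = 0 \<longrightarrow> YtoX p = 0 \<and> YtoX (swapY p) = 0"
        by (simp add: YtoX_swapY)
      have self: "\<exists>f. p - f \<in> JM" by (rule exI[of _ p]) (simp add: JM_iff)
      have "(\<exists>f\<in>slot_filt j ?i. p - f \<in> JM) \<longleftrightarrow> ?i \<le> 0 \<or>
          (?i \<le> 2 \<and> (if even j then \<exists>r. p - r * (y_minus - x_minus) \<in> JM else \<exists>r. p - r * (y_minus + x_minus) \<in> JM)) \<or>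
          (?i > 2 \<and> p \<in> JM)"
        using 2 self by (auto simp: slot_filt_def two_step_filt_def PIdl_QXY)
      also have "\<dots> \<longleftrightarrow> slot_in \<epsilon> M j ?i p"
        unfolding two_step_minus_iff two_step_plus_iff
        using 2 JMin by (auto simp: slot_in_def JM_iff)
      finally show ?thesis using 2 by (simp add: slot_ideal_def)
    next
      case 3
      have "\<exists>f. f \<in> slot_filt j ?i" using hidealD(1)[OF hideal_slot_filt] by blast
      then show ?thesis using 3 by (auto simp: slot_ideal_def slot_in_def)
    qed
  qed
  finally show ?thesis .
qed

lemma slot_zero_0 [simp]: "slot_zero \<epsilon> M j 0"
  by (simp add: slot_zero_def)

lemma slot_in_zero: "slot_zero \<epsilon> M j p \<Longrightarrow> slot_in \<epsilon> M j i p"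
  by (simp add: slot_zero_def slot_in_def)

subsection \<open>Maps given by polynomial formulas\<close>

text \<open>In degree 0 the identity on polynomials stands for \<open>chi_minus\<close>, the
  projection from M to I.\<close>

definition slot_dif :: "int \<Rightarrow> int \<Rightarrow> bpoly \<Rightarrow> bpoly" where
  "slot_dif M j u = (if j < 0 \<or> j \<ge> M then 0 else if j = 0 then u
     else if odd j then (y_minus - x_minus) * u else (y_minus + x_minus) * u)"

definition dif_map :: "bool \<Rightarrow> int \<Rightarrow> int \<Rightarrow> 'a univ \<Rightarrow> 'a univ" where
  "dif_map \<epsilon> M j u = slot_class \<epsilon> M (j - 1) (slot_dif M j (pol u))"

text \<open>Gaussian elimination of \<open>u\<close> against the copy (y, dem y). For
  \<open>j > 0\<close> the complement is measured by z - dem y, on which p acts as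
  \<open>swapY p\<close>; a further \<open>swapY\<close> undoes the twist. The term \<open>u\<close>
  is the zigzag correction: the homotopy followed by the differential and this projection gives
  \<open>u\<close> back. It is cut off at \<open>j = M\<close>, where \<open>u\<close> is a class in
  a zero module. For \<open>j = 0\<close> the pair (y, z) in B o I is the element of B with these
  coordinates. The signs compensate that \<open>swapY\<close> turns y_minus - x_minus into -(y_minus
  + x_minus).\<close>

definition retr :: "int \<Rightarrow> int \<Rightarrow> bpoly \<Rightarrow> bpoly \<Rightarrow> bpoly \<Rightarrow> bpoly" where
  "retr M j u y z = (if j < 0 then - u
     else if j = 0 then u - (YtoX y + (y_minus - x_minus) * YtoX z)
     else (if even j then 1 else -1) * ((if j < M then u else 0) + swapY (z - dem y)))"

definition retr_map :: "bool \<Rightarrow> int \<Rightarrow> int \<Rightarrow> 'a univ \<times> 'a univ \<times> 'a univ \<Rightarrow> 'a univ" where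
  "retr_map \<epsilon> M j = (\<lambda>(u, y, z). slot_class \<epsilon> (M + 1) j (retr M j (pol u) (pol y) (pol z)))"

text \<open>For \<open>j > 0\<close> a blob of the opposite colour is included as the twisted second
  coordinate, for \<open>j = 0\<close> B is B o I, and for \<open>j < 0\<close> the copy of I is the
  first entry. The signs are those of \<open>retr\<close>.\<close>

definition sect1 :: "int \<Rightarrow> bpoly \<Rightarrow> bpoly" where "sect1 j w = (if j < 0 then - w else 0)"
definition sect2 :: "int \<Rightarrow> bpoly \<Rightarrow> bpoly" where "sect2 j w = (if j = 0 then - w else 0)"
definition sect3 :: "int \<Rightarrow> bpoly \<Rightarrow> bpoly" where
  "sect3 j w = (if j < 0 then 0 else if j = 0 then - dem w else (if even j then 1 else -1) * swapY w)"

definition sect_map :: "bool \<Rightarrow> int \<Rightarrow> int \<Rightarrow> 'a univ \<Rightarrow> 'a univ \<times> 'a univ \<times> 'a univ" where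
  "sect_map \<epsilon> M j w = (slot_class \<epsilon> M j (sect1 j (pol w)), slot_class \<epsilon> M (j - 1) (sect2 j (pol w)),
     slot_class \<epsilon> M (j - 1) (sect3 j (pol w)))"

text \<open>Minus the inclusion u -> (u, dem u) of a blob N into B o N, which splits the projection
  given by \<open>chi_minus\<close>. It is set to zero for \<open>j < 0\<close>, since
  \<open>dem\<close> does not descend to I.\<close>

definition htpy2 :: "int \<Rightarrow> bpoly \<Rightarrow> bpoly" where "htpy2 j u = (if j < 0 then 0 else - u)"
definition htpy3 :: "int \<Rightarrow> bpoly \<Rightarrow> bpoly" where "htpy3 j u = (if j < 0 then 0 else - dem u)"

definition htpy_map :: "bool \<Rightarrow> int \<Rightarrow> int \<Rightarrow> 'a univ \<times> 'a univ \<times> 'a univ \<Rightarrow> 'a univ \<times> 'a univ \<times> 'a univ" where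
  "htpy_map \<epsilon> M j = (\<lambda>(u, y, z). (slot_class \<epsilon> M (j + 1) 0, slot_class \<epsilon> M j (htpy2 j (pol u)),
     slot_class \<epsilon> M j (htpy3 j (pol u))))"

lemmas slot_defs = slot_dif_def retr_def sect1_def sect2_def sect3_def htpy2_def htpy3_def

lemma slot_maps_linear:
  "slot_dif M j (u + u') = slot_dif M j u + slot_dif M j u'"
  "slot_dif M j (u - u') = slot_dif M j u - slot_dif M j u'"
  "retr M j (u + u') (y + y') (z + z') = retr M j u y z + retr M j u' y' z'"
  "retr M j (u - u') (y - y') (z - z') = retr M j u y z - retr M j u' y' z'"
  "sect1 j (u + u') = sect1 j u + sect1 j u'" "sect1 j (u - u') = sect1 j u - sect1 j u'"
  "sect2 j (u + u') = sect2 j u + sect2 j u'" "sect2 j (u - u') = sect2 j u - sect2 j u'"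
  "sect3 j (u + u') = sect3 j u + sect3 j u'" "sect3 j (u - u') = sect3 j u - sect3 j u'"
  "htpy2 j (u + u') = htpy2 j u + htpy2 j u'" "htpy2 j (u - u') = htpy2 j u - htpy2 j u'"
  "htpy3 j (u + u') = htpy3 j u + htpy3 j u'" "htpy3 j (u - u') = htpy3 j u - htpy3 j u'"
  by (simp_all add: slot_defs dem_linear algebra_simps)

lemmas JM_simps = dem_linear YtoX_dem_mult YtoX_swapY

lemma slot_dif_zero: "slot_zero \<epsilon> M j u \<Longrightarrow> slot_zero \<epsilon> M (j - 1) (slot_dif M j u)"
  by (auto simp: slot_zero_def slot_dif_def JM_simps)

text \<open>In degree 0 the entry \<open>u\<close> has to be determined modulo \<open>JM\<close>;
  the hypothesis \<open>M \<ge> 1\<close> provides the blob there.\<close>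

lemma retr_zero: "M \<ge> 1 \<Longrightarrow> slot_zero \<epsilon> M j u \<Longrightarrow> slot_zero \<epsilon> M (j - 1) y \<Longrightarrow> slot_zero \<epsilon> M (j - 1) z \<Longrightarrow>
    slot_zero \<epsilon> (M + 1) j (retr M j u y z)"
  by (auto simp: slot_zero_def retr_def JM_simps)

lemma sect_zero:
  "M \<ge> 1 \<Longrightarrow> slot_zero \<epsilon> (M + 1) j w \<Longrightarrow> slot_zero \<epsilon> M j (sect1 j w)"
  "M \<ge> 1 \<Longrightarrow> slot_zero \<epsilon> (M + 1) j w \<Longrightarrow> slot_zero \<epsilon> M (j - 1) (sect2 j w)"
  "M \<ge> 1 \<Longrightarrow> slot_zero \<epsilon> (M + 1) j w \<Longrightarrow> slot_zero \<epsilon> M (j - 1) (sect3 j w)"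
  by (auto simp: slot_zero_def slot_defs JM_simps)

lemma htpy_zero: "slot_zero \<epsilon> M j u \<Longrightarrow> slot_zero \<epsilon> M j (htpy2 j u)"
  "slot_zero \<epsilon> M j u \<Longrightarrow> slot_zero \<epsilon> M j (htpy3 j u)"
  by (auto simp: slot_zero_def slot_defs JM_simps)

lemma dif_map_class: "dif_map \<epsilon> M j (slot_class \<epsilon> M j u) = slot_class \<epsilon> M (j - 1) (slot_dif M j u)"
  using slot_dif_zero[OF slot_zero_rep, of \<epsilon> M j u]
  by (simp add: dif_map_def slot_class_eq_iff slot_maps_linear)

lemma retr_map_class: "M \<ge> 1 \<Longrightarrow>
    retr_map \<epsilon> M j (slot_class \<epsilon> M j u, slot_class \<epsilon> M (j - 1) y, slot_class \<epsilon> M (j - 1) z) =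
    slot_class \<epsilon> (M + 1) j (retr M j u y z)"
  using retr_zero[OF _ slot_zero_rep slot_zero_rep slot_zero_rep, of M \<epsilon> j u y z]
  by (simp add: retr_map_def slot_class_eq_iff slot_maps_linear)

lemma sect_map_class: "M \<ge> 1 \<Longrightarrow> sect_map \<epsilon> M j (slot_class \<epsilon> (M + 1) j w) =
    (slot_class \<epsilon> M j (sect1 j w), slot_class \<epsilon> M (j - 1) (sect2 j w), slot_class \<epsilon> M (j - 1) (sect3 j w))"
  using sect_zero[OF _ slot_zero_rep, of M \<epsilon> j w]
  by (simp add: sect_map_def slot_class_eq_iff slot_maps_linear)

lemma htpy_map_class: "htpy_map \<epsilon> M j (slot_class \<epsilon> M j u, y, z) =
    (slot_class \<epsilon> M (j + 1) 0, slot_class \<epsilon> M j (htpy2 j u), slot_class \<epsilon> M j (htpy3 j u))"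
  using htpy_zero[OF slot_zero_rep, of \<epsilon> M j u]
  by (simp add: htpy_map_def slot_class_eq_iff slot_maps_linear)

lemma dem_2 [simp]: "dem 2 = 0"
  by (rule dem_swap_fixed) simp

lemma slot_pieceI:
  "homogeneous (q - (2 * max j 0 - 2 * M)) p \<Longrightarrow> a = 1 - M + j \<Longrightarrow> slot_class \<epsilon> M j p \<in> piece (slot \<epsilon> M j) a q"
  by (auto simp: slot_piece)

lemma slot_pieceE:
  assumes "x \<in> piece (slot \<epsilon> M j) a q"
  obtains (nonzero) p where "a = 1 - M + j" "homogeneous (q - (2 * max j 0 - 2 * M)) p" "x = slot_class \<epsilon> M j p"
    | (zero) "x = slot_class \<epsilon> M j 0"
  using assms[unfolded slot_piece]
  by (elim disjE conjE exE) (erule that, assumption+)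

lemma slot_piece_0: "slot_class \<epsilon> M j 0 \<in> piece (slot \<epsilon> M j) a q"
  by (simp add: slot_piece)

text \<open>The map (y, z) -> swapY (z - dem y) turns the twisted action on pairs into ordinary
  multiplication; this makes the projection to the complement linear.\<close>

lemma swapY_mult_retr: "swapY (dem p * y + swapY p * z - dem (p * y)) = p * swapY (z - dem y)"
  by (simp add: dem_mult algebra_simps)

lemma retr_smult: "slot_zero \<epsilon> (M + 1) j
    (retr M j (p * u) (p * y) (dem p * y + swapY p * z) - p * retr M j u y z)"
proof (cases "j \<le> 0")
  case True
  then show ?thesis
    by (auto simp: slot_zero_def retr_def JM_simps) (simp_all add: algebra_simps)
next
  case False
  then have "retr M j (p * u) (p * y) (dem p * y + swapY p * z) = p * retr M j u y z"
    unfolding retr_def by (simp only: swapY_mult_retr if_False) (simp add: algebra_simps)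
  then show ?thesis by simp
qed

lemma sect_smult:
  "slot_zero \<epsilon> M j (sect1 j (p * w) - p * sect1 j w)"
  "slot_zero \<epsilon> M (j - 1) (sect2 j (p * w) - p * sect2 j w)"
  "slot_zero \<epsilon> M (j - 1) (sect3 j (p * w) - (dem p * sect2 j w + swapY p * sect3 j w))"
  by (auto simp: slot_zero_def slot_defs JM_simps dem_mult algebra_simps)

text \<open>The pair is, up to sign, the result of letting \<open>u\<close> act on (1, 0), so
  linearity holds already for polynomials.\<close>

lemma htpy_smult:
  "htpy2 j (p * u) = p * htpy2 j u" "htpy3 j (p * u) = dem p * htpy2 j u + swapY p * htpy3 j u"
  by (simp_all add: slot_defs dem_mult)

lemma homogeneous_2_mult: "homogeneous 2 f \<Longrightarrow> homogeneous d p \<Longrightarrow> homogeneous (d + 2) (f * p)"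
  using homogeneous_mult[of 2 f d p] by (simp add: add.commute)

lemma homogeneous_sign: "homogeneous d p \<Longrightarrow> homogeneous d ((if b then 1 else -1) * p)"
  by (simp add: homogeneous_uminus)

lemmas slot_in_simps = slot_in_def JM_simps

lemma bhom_dif_map: "bhom (slot \<epsilon> M j) (ash 1 (slot \<epsilon> M (j - 1))) (dif_map \<epsilon> M j)"
  unfolding bhom_def
proof (intro conjI allI ballI)
  let ?N = "ash 1 (slot \<epsilon> M (j - 1))"
  show "dif_map \<epsilon> M j x \<in> carrier ?N" for x
    by (simp add: slot_simps dif_map_def) blast
  show "dif_map \<epsilon> M j (x \<oplus>\<^bsub>slot \<epsilon> M j\<^esub> y) = dif_map \<epsilon> M j x \<oplus>\<^bsub>?N\<^esub> dif_map \<epsilon> M j y"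
    if "x \<in> carrier (slot \<epsilon> M j)" "y \<in> carrier (slot \<epsilon> M j)" for x y
    using that by (auto simp: slot_simps dif_map_class slot_maps_linear)
  show "dif_map \<epsilon> M j (p \<odot>\<^bsub>slot \<epsilon> M j\<^esub> x) = p \<odot>\<^bsub>?N\<^esub> dif_map \<epsilon> M j x" if "x \<in> carrier (slot \<epsilon> M j)" for p x
  proof -
    have "slot_dif M j (p * u) = p * slot_dif M j u" for u by (simp add: slot_dif_def mult_ac)
    then show ?thesis using that by (auto simp: slot_simps dif_map_class)
  qed
  show "dif_map \<epsilon> M j x \<in> piece ?N a q" if xp: "x \<in> piece (slot \<epsilon> M j) a q" for a q x
  proof -
    have 0: "slot_dif M j 0 = 0" by (simp add: slot_dif_def)
    have "homogeneous (q - (2 * max (j - 1) 0 - 2 * M)) (slot_dif M j p)"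
      if "homogeneous (q - (2 * max j 0 - 2 * M)) p" for p
    proof (cases "j \<ge> 1")
      case True
      then show ?thesis
        using homogeneous_2_mult[OF _ that, of "y_minus - x_minus"] homogeneous_2_mult[OF _ that, of "y_minus + x_minus"]
        by (auto simp: slot_dif_def homogeneous_add homogeneous_diff max_def algebra_simps)
    next
      case False
      then show ?thesis using that by (auto simp: slot_dif_def)
    qed
    note hom = this
    from xp show ?thesis
    proof (cases rule: slot_pieceE)
      case (nonzero p)
      then show ?thesis using hom by (auto simp: dif_map_class intro: slot_pieceI)
    next
      case zero
      then show ?thesis by (simp add: dif_map_class 0 slot_piece_0)
    qed
  qed
  show "dif_map \<epsilon> M j x \<in> filt ?N i" if x: "x \<in> filt (slot \<epsilon> M j) i" for i x
  proof -
    interpret S: fgmod "slot \<epsilon> M j" by (rule fgmod_slot)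
    obtain u where u: "x = slot_class \<epsilon> M j u" using S.filt_closed[OF x] by (auto simp: slot_simps)
    have "slot_in \<epsilon> M j (i - (2 * max j 0 - M)) u" using x by (simp add: u slot_filt_iff)
    \<comment> \<open>For \<open>j \<ge> 1\<close> the filtration shift drops by one full step.
      Multiplication takes F^0 into F^1 and kills F^1 of the source, because the product of the two
      factors is zero in M. For \<open>j = 0\<close> the projection to I kills F^1.\<close>
    then have "slot_in \<epsilon> M (j - 1) (i - (2 * max (j - 1) 0 - M)) (slot_dif M j u)"
      by (auto simp: slot_in_simps slot_dif_def max_def) 
    then show ?thesis by (simp add: u dif_map_class slot_filt_iff)
  qed
qed

lemma bcone_slotE:
  assumes "x \<in> carrier (bcone (slot \<epsilon> M j) (slot \<epsilon> M j'))"
  obtains u y z where "x = (slot_class \<epsilon> M j u, slot_class \<epsilon> M j' y, slot_class \<epsilon> M j' z)"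
  using assms by (auto simp: slot_simps)

lemma slot_in_nonpos: "e \<le> 0 \<Longrightarrow> slot_in \<epsilon> M j e p"
  by (simp add: slot_in_def)

lemma slot_in_uminus: "slot_in \<epsilon> M j e p \<Longrightarrow> slot_in \<epsilon> M j e (- p)"
  by (auto simp: slot_in_def dem_uminus split: if_splits)

text \<open>The indices combine the offsets of \<open>bcone\<close> with the shifts of
  \<open>slot\<close>, which for \<open>j \<ge> 1\<close> differ by one full step between the
  degrees j and j - 1. The neighbouring blob has the opposite colour, so its F^1 condition on
  \<open>z\<close> is the one that \<open>swapY z\<close> has to satisfy.\<close>

lemma retr_filt:
  assumes "M \<ge> 1" and u: "slot_in \<epsilon> M j e u" and y: "slot_in \<epsilon> M (j - 1) (if j \<ge> 1 then e + 2 else e) y"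
    and z: "slot_in \<epsilon> M (j - 1) (if j \<ge> 1 then e else e - 2) z"
  shows "slot_in \<epsilon> (M + 1) j e (retr M j u y z)"
proof (cases "e \<le> 0")
  case False
  consider "\<not> \<epsilon>" | "j < 0" | "\<epsilon>" "j = 0" | "\<epsilon>" "j \<ge> 1" by linarith
  then show ?thesis
  proof cases
    case 1
    then show ?thesis by (simp add: slot_in_def)
  next
    case 2
    then show ?thesis using u False by (auto simp: slot_in_def retr_def)
  next
    case 3
    then have "(e \<le> 2 \<and> YtoX u = 0) \<or> YtoX u = 0 \<and> YtoX (dem u) = 0" "YtoX y = 0" "e \<le> 2 \<or> YtoX z = 0"
      using assms False by (simp_all add: slot_in_def)
    then show ?thesis
      using 3 by (auto simp: slot_in_def retr_def JM_simps)
  next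
    case 4
    show ?thesis
    proof (cases "j \<le> M")
      case True
      \<comment> \<open>As \<open>e\<close> is positive, the index \<open>e + 2\<close> lies beyond
        the last non-zero filtration step.\<close>
      then have y0: "YtoX y = 0" "YtoX (dem y) = 0"
        using 4 y False by (simp_all add: slot_in_def)
      have z0: "(e \<le> 2 \<and> YtoX (if even j then swapY z else z) = 0) \<or> YtoX z = 0 \<and> YtoX (dem z) = 0"
        using 4 z False True by (auto simp: slot_in_def)
      have u0: "j < M \<Longrightarrow> (e \<le> 2 \<and> YtoX (if even j then u else swapY u) = 0) \<or> YtoX u = 0 \<and> YtoX (dem u) = 0"
        using 4 u False by (auto simp: slot_in_def)
      let ?r = "(if j < M then u else 0) + swapY (z - dem y)"
      have "(e \<le> 2 \<and> YtoX (if even j then ?r else swapY ?r) = 0) \<or> YtoX ?r = 0 \<and> YtoX (dem ?r) = 0"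
      proof (cases "e \<le> 2")
        case True
        have "YtoX (if even j then swapY z else z) = 0"
          using z0 by (auto simp: YtoX_swapY)
        moreover have "j < M \<Longrightarrow> YtoX (if even j then u else swapY u) = 0"
          using u0 by (auto simp: YtoX_swapY)
        ultimately show ?thesis
          using True y0 by (cases "even j"; cases "j < M") simp_all
      next
        case False
        then show ?thesis
          using z0 u0 y0 by (auto simp: JM_simps)
      qed
      then have r: "slot_in \<epsilon> (M + 1) j e ?r"
        using 4 unfolding slot_in_def by simp
      have "retr M j u y z = (if even j then ?r else - ?r)"
        using 4 by (simp add: retr_def)
      then show ?thesis
        using r slot_in_uminus[OF r] by (simp only: split: if_split) simp
    next
      case False
      then show ?thesis using 4 by (simp add: slot_in_def)
    qed
  qed
qed (simp add: slot_in_nonpos)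

lemma bhom_retr_map:
  assumes M: "M \<ge> 1"
  shows "bhom (bcone (slot \<epsilon> M j) (slot \<epsilon> M (j - 1))) (slot \<epsilon> (M + 1) j) (retr_map \<epsilon> M j)"
  unfolding bhom_def
proof (intro conjI allI ballI)
  let ?C = "bcone (slot \<epsilon> M j) (slot \<epsilon> M (j - 1))" and ?N = "slot \<epsilon> (M + 1) j"
  note cls = retr_map_class[OF M]
  show "retr_map \<epsilon> M j x \<in> carrier ?N" for x
    by (cases x) (auto simp: slot_simps retr_map_def)
  show "retr_map \<epsilon> M j (x \<oplus>\<^bsub>?C\<^esub> x') = retr_map \<epsilon> M j x \<oplus>\<^bsub>?N\<^esub> retr_map \<epsilon> M j x'"
    if "x \<in> carrier ?C" "x' \<in> carrier ?C" for x x'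
    using that by (elim bcone_slotE) (simp add: slot_simps cls slot_maps_linear)
  show "retr_map \<epsilon> M j (p \<odot>\<^bsub>?C\<^esub> x) = p \<odot>\<^bsub>?N\<^esub> retr_map \<epsilon> M j x" if "x \<in> carrier ?C" for p x
    using that by (elim bcone_slotE) (simp add: slot_simps cls slot_class_eq_iff retr_smult)
  show "retr_map \<epsilon> M j x \<in> piece ?N a q" if x: "x \<in> piece ?C a q" for a q x
  proof -
    obtain u' y' z' where x': "x = (u', y', z')" by (cases x)
    let ?d = "q + 2 - (2 * max j 0 - 2 * M)" and ?e = "q + 2 - (2 * max (j - 1) 0 - 2 * M)"
    have um: "u' \<in> piece (slot \<epsilon> M j) (a + 1) (q + 2)" and ym: "y' \<in> piece (slot \<epsilon> M (j - 1)) a (q + 2)"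
      and zm: "z' \<in> piece (slot \<epsilon> M (j - 1)) a q" using x by (auto simp: x')
    have "(a = 1 - (M + 1) + j \<or> u' = slot_class \<epsilon> M j 0)" "(a = 1 - (M + 1) + j \<or> y' = slot_class \<epsilon> M (j - 1) 0)"
      "(a = 1 - (M + 1) + j \<or> z' = slot_class \<epsilon> M (j - 1) 0)"
      using um ym zm by (auto elim!: slot_pieceE)
    then consider "a = 1 - (M + 1) + j"
      | "u' = slot_class \<epsilon> M j 0" "y' = slot_class \<epsilon> M (j - 1) 0" "z' = slot_class \<epsilon> M (j - 1) 0" by blast
    then show ?thesis
    proof cases
      case 1
      obtain u where u: "u' = slot_class \<epsilon> M j u" "homogeneous ?d u"
        using um by (cases rule: slot_pieceE) (auto intro: that)
      obtain y where y: "y' = slot_class \<epsilon> M (j - 1) y" "homogeneous ?e y"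
        using ym by (cases rule: slot_pieceE) (auto intro: that)
      have e2: "?e - 2 = q - (2 * max (j - 1) 0 - 2 * M)" by simp
      obtain z where z: "z' = slot_class \<epsilon> M (j - 1) z" "homogeneous (?e - 2) z"
        unfolding e2 using zm by (cases rule: slot_pieceE) (auto intro: that)
      have "homogeneous (q - (2 * max j 0 - 2 * (M + 1))) (retr M j u y z)"
      proof -
        have d: "q - (2 * max j 0 - 2 * (M + 1)) = ?d" by simp
        consider "j < 0" | "j = 0" | "j \<ge> 1" by linarith
        then show ?thesis
        proof cases
          case 2
          then have e: "?e = ?d" by simp
          have "homogeneous (?e - 2 + 2) ((y_minus - x_minus) * YtoX z)"
            by (intro homogeneous_2_mult homogeneous_diff homogeneous_pm homogeneous_substs z)
          moreover have "?e - 2 + 2 = ?d" using e by simp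
          ultimately have "homogeneous ?d ((y_minus - x_minus) * YtoX z)"
            by (simp only:)
          then show ?thesis
            using 2 u(2) y(2)[unfolded e] unfolding d
            by (simp add: retr_def homogeneous_add homogeneous_diff homogeneous_substs)
        next
          case 3
          then have e: "?e - 2 = ?d" by (simp add: max_def)
          have "homogeneous ?d (swapY (z - dem y))"
            using homogeneous_dem[OF y(2)] z(2) unfolding e
            by (intro homogeneous_substs homogeneous_diff)
          then show ?thesis
            using 3 u(2) unfolding d retr_def
            by (auto intro!: homogeneous_add homogeneous_diff homogeneous_uminus simp del: substs_hom)
        next
          case 1
          then show ?thesis using u(2) unfolding d by (simp add: retr_def homogeneous_uminus)
        qed
      qed
      then show ?thesis
        unfolding x' u y z cls by (rule slot_pieceI) (rule 1)
    next
      case 2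
      then show ?thesis
        by (simp add: x' cls retr_def slot_piece_0)
    qed
  qed
  show "retr_map \<epsilon> M j x \<in> filt ?N i" if x: "x \<in> filt ?C i" for i x
  proof -
    interpret C: fgmod ?C by (intro fgmod_cone fgmod_slot)
    obtain u y z where u: "x = (slot_class \<epsilon> M j u, slot_class \<epsilon> M (j - 1) y, slot_class \<epsilon> M (j - 1) z)"
      using C.filt_closed[OF x] by (rule bcone_slotE)
    let ?e = "i - (2 * max j 0 - (M + 1))"
    have m: "i + 1 - (2 * max j 0 - M) = ?e"
      "i + 1 - (2 * max (j - 1) 0 - M) = (if j \<ge> 1 then ?e + 2 else ?e)"
      "i - 1 - (2 * max (j - 1) 0 - M) = (if j \<ge> 1 then ?e else ?e - 2)"
      by (simp_all add: max_def)
    have "slot_in \<epsilon> M j (i + 1 - (2 * max j 0 - M)) u" "slot_in \<epsilon> M (j - 1) (i + 1 - (2 * max (j - 1) 0 - M)) y"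
       "slot_in \<epsilon> M (j - 1) (i - 1 - (2 * max (j - 1) 0 - M)) z"
      using x by (simp_all add: u slot_filt_iff)
    then have "slot_in \<epsilon> (M + 1) j ?e (retr M j u y z)"
      unfolding m by (intro retr_filt M)
    then show ?thesis by (simp add: u cls slot_filt_iff)
  qed
qed

lemma slot_in_0 [simp]: "slot_in \<epsilon> M j e 0"
  by (simp add: slot_in_def)

text \<open>For \<open>j \<ge> 1\<close> the twist takes F^1 of one colour to F^1 of the other; in
  degree 0 the second coordinate of an element of F^1 may be non-zero, and it is tested with index
  \<open>e - 2\<close>.\<close>

lemma sect_filt:
  assumes M: "M \<ge> 1" and w: "slot_in \<epsilon> (M + 1) j e w"
  shows "slot_in \<epsilon> M j e (sect1 j w)" "slot_in \<epsilon> M (j - 1) (if j \<ge> 1 then e + 2 else e) (sect2 j w)"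
    "slot_in \<epsilon> M (j - 1) (if j \<ge> 1 then e else e - 2) (sect3 j w)"
proof -
  show "slot_in \<epsilon> M j e (sect1 j w)"
    using w by (auto simp: sect1_def slot_in_def)
  show "slot_in \<epsilon> M (j - 1) (if j \<ge> 1 then e + 2 else e) (sect2 j w)"
    using w M by (auto simp: sect2_def slot_in_def)
  show "slot_in \<epsilon> M (j - 1) (if j \<ge> 1 then e else e - 2) (sect3 j w)"
  proof (cases "j \<ge> 1")
    case True
    have "slot_in \<epsilon> M (j - 1) e (swapY w)"
    proof (cases "\<epsilon> \<and> j \<le> M")
      case b: True
      then have "e \<le> 0 \<or> (e \<le> 2 \<and> YtoX (if even j then w else swapY w) = 0) \<or> YtoX w = 0 \<and> YtoX (dem w) = 0"
        using w True by (simp add: slot_in_def)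
      moreover have "YtoX w = 0 \<and> YtoX (dem w) = 0 \<Longrightarrow> YtoX (swapY w) = 0"
        by (simp add: YtoX_swapY)
      ultimately show ?thesis
        using True b by (cases "even j") (auto simp: slot_in_def)
    next
      case False
      then show ?thesis using True by (auto simp: slot_in_def)
    qed
    then show ?thesis
      using True slot_in_uminus by (cases "even j") (simp_all add: sect3_def)
  next
    case False
    then show ?thesis
      using w M by (auto simp: sect3_def slot_in_def dem_uminus)
  qed
qed

lemma bhom_sect_map:
  assumes M: "M \<ge> 1"
  shows "bhom (slot \<epsilon> (M + 1) j) (bcone (slot \<epsilon> M j) (slot \<epsilon> M (j - 1))) (sect_map \<epsilon> M j)"
  unfolding bhom_def
proof (intro conjI allI ballI)
  let ?C = "bcone (slot \<epsilon> M j) (slot \<epsilon> M (j - 1))" and ?N = "slot \<epsilon> (M + 1) j"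
  note cls = sect_map_class[OF M]
  show "sect_map \<epsilon> M j x \<in> carrier ?C" for x
    by (auto simp: slot_simps sect_map_def)
  show "sect_map \<epsilon> M j (x \<oplus>\<^bsub>?N\<^esub> x') = sect_map \<epsilon> M j x \<oplus>\<^bsub>?C\<^esub> sect_map \<epsilon> M j x'"
    if "x \<in> carrier ?N" "x' \<in> carrier ?N" for x x'
    using that by (auto simp: slot_simps cls slot_maps_linear)
  show "sect_map \<epsilon> M j (p \<odot>\<^bsub>?N\<^esub> x) = p \<odot>\<^bsub>?C\<^esub> sect_map \<epsilon> M j x" if "x \<in> carrier ?N" for p x
    using that by (auto simp: slot_simps cls slot_class_eq_iff sect_smult)
  show "sect_map \<epsilon> M j x \<in> piece ?C a q" if x: "x \<in> piece ?N a q" for a q x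
  proof -
    let ?d = "q - (2 * max j 0 - 2 * (M + 1))"
    consider w where "a = 1 - (M + 1) + j" "homogeneous ?d w" "x = slot_class \<epsilon> (M + 1) j w"
      | "x = slot_class \<epsilon> (M + 1) j 0"
      using x by (rule slot_pieceE)
    then show ?thesis
    proof cases
      case 1
      have a: "a + 1 = 1 - M + j" "a = 1 - M + (j - 1)" using 1(1) by simp_all
      have 2: "homogeneous (q + 2 - (2 * max j 0 - 2 * M)) (sect1 j w)"
        using 1(2) by (auto simp: sect1_def homogeneous_uminus algebra_simps)
      have 3: "homogeneous (q + 2 - (2 * max (j - 1) 0 - 2 * M)) (sect2 j w)"
        using 1(2) by (auto simp: sect2_def homogeneous_uminus algebra_simps)
      have 4: "homogeneous (q - (2 * max (j - 1) 0 - 2 * M)) (sect3 j w)"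
      proof (cases "j \<ge> 1")
        case True
        then have "q - (2 * max (j - 1) 0 - 2 * M) = ?d" by (simp add: max_def)
        moreover have "sect3 j w = (if even j then 1 else -1) * swapY w"
          using True by (simp add: sect3_def)
        ultimately show ?thesis
          using homogeneous_sign[OF homogeneous_substs(1)[OF 1(2)], of "even j"] by (simp only:)
      next
        case False
        then show ?thesis
          using homogeneous_uminus[OF homogeneous_dem[OF 1(2)]] by (auto simp: sect3_def algebra_simps)
      qed
      show ?thesis
        unfolding 1(3) cls by (simp add: slot_pieceI[OF 2 a(1)] slot_pieceI[OF 3 a(2)] slot_pieceI[OF 4 a(2)])
    next
      case 2
      have "sect1 j 0 = 0" "sect2 j 0 = 0" "sect3 j 0 = 0" by (simp_all add: slot_defs)
      then show ?thesis by (simp add: 2 cls slot_piece_0)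
    qed
  qed
  show "sect_map \<epsilon> M j x \<in> filt ?C i" if x: "x \<in> filt ?N i" for i x
  proof -
    interpret N: fgmod ?N by (rule fgmod_slot)
    obtain w where w: "x = slot_class \<epsilon> (M + 1) j w"
      using N.filt_closed[OF x] by (auto simp: slot_simps)
    let ?e = "i - (2 * max j 0 - (M + 1))"
    have m: "i + 1 - (2 * max j 0 - M) = ?e"
      "i + 1 - (2 * max (j - 1) 0 - M) = (if j \<ge> 1 then ?e + 2 else ?e)"
      "i - 1 - (2 * max (j - 1) 0 - M) = (if j \<ge> 1 then ?e else ?e - 2)"
      by (simp_all add: max_def)
    have "slot_in \<epsilon> (M + 1) j ?e w"
      using x by (simp add: w slot_filt_iff)
    then have "slot_in \<epsilon> M j (i + 1 - (2 * max j 0 - M)) (sect1 j w)"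
      "slot_in \<epsilon> M (j - 1) (i + 1 - (2 * max (j - 1) 0 - M)) (sect2 j w)"
      "slot_in \<epsilon> M (j - 1) (i - 1 - (2 * max (j - 1) 0 - M)) (sect3 j w)"
      unfolding m by (rule sect_filt[OF M])+
    then show ?thesis by (simp add: w cls slot_filt_iff)
  qed
qed

lemma bhom_htpy_map:
  "bhom (bcone (slot \<epsilon> M j) (slot \<epsilon> M (j - 1))) (ash (-1) (bcone (slot \<epsilon> M (j + 1)) (slot \<epsilon> M j))) (htpy_map \<epsilon> M j)"
  unfolding bhom_def
proof (intro conjI allI ballI)
  let ?C = "bcone (slot \<epsilon> M j) (slot \<epsilon> M (j - 1))" and ?D = "ash (-1) (bcone (slot \<epsilon> M (j + 1)) (slot \<epsilon> M j))"
  note cls = htpy_map_class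
  show "htpy_map \<epsilon> M j x \<in> carrier ?D" for x
    by (cases x) (auto simp: slot_simps htpy_map_def)
  show "htpy_map \<epsilon> M j (x \<oplus>\<^bsub>?C\<^esub> x') = htpy_map \<epsilon> M j x \<oplus>\<^bsub>?D\<^esub> htpy_map \<epsilon> M j x'"
    if "x \<in> carrier ?C" "x' \<in> carrier ?C" for x x'
    using that by (elim bcone_slotE) (simp add: slot_simps cls slot_maps_linear)
  show "htpy_map \<epsilon> M j (p \<odot>\<^bsub>?C\<^esub> x) = p \<odot>\<^bsub>?D\<^esub> htpy_map \<epsilon> M j x" if "x \<in> carrier ?C" for p x
    using that by (elim bcone_slotE) (simp add: slot_simps cls htpy_smult)
  show "htpy_map \<epsilon> M j x \<in> piece ?D a q" if x: "x \<in> piece ?C a q" for a q x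
  proof -
    obtain u' y' z' where x': "x = (u', y', z')" by (cases x)
    let ?d = "q + 2 - (2 * max j 0 - 2 * M)"
    have "u' \<in> piece (slot \<epsilon> M j) (a + 1) (q + 2)" using x by (auto simp: x')
    then consider u where "a + 1 = 1 - M + j" "homogeneous ?d u" "u' = slot_class \<epsilon> M j u"
      | "u' = slot_class \<epsilon> M j 0"
      by (rule slot_pieceE)
    then show ?thesis
    proof cases
      case 1
      have 2: "homogeneous ?d (htpy2 j u)"
        using 1(2) by (auto simp: htpy2_def homogeneous_uminus)
      have 3: "homogeneous (q - (2 * max j 0 - 2 * M)) (htpy3 j u)"
        using homogeneous_uminus[OF homogeneous_dem[OF 1(2)]] by (auto simp: htpy3_def algebra_simps)
      show ?thesis
        unfolding x' 1(3) cls by (simp add: slot_pieceI[OF 2 1(1)] slot_pieceI[OF 3 1(1)] slot_piece_0)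
    next
      case 2
      have "htpy2 j 0 = 0" "htpy3 j 0 = 0" by (simp_all add: slot_defs)
      then show ?thesis by (simp add: x' 2 cls slot_piece_0)
    qed
  qed
  show "htpy_map \<epsilon> M j x \<in> filt ?D i" if x: "x \<in> filt ?C i" for i x
  proof -
    interpret C: fgmod ?C by (intro fgmod_cone fgmod_slot)
    obtain u y z where u: "x = (slot_class \<epsilon> M j u, slot_class \<epsilon> M (j - 1) y, slot_class \<epsilon> M (j - 1) z)"
      using C.filt_closed[OF x] by (rule bcone_slotE)
    have "slot_in \<epsilon> M j (i + 1 - (2 * max j 0 - M)) u"
      using x by (simp add: u slot_filt_iff)
    \<comment> \<open>The third entry is tested one full step below \<open>u\<close>; if its index
      is positive, the index of \<open>u\<close> exceeds 2 and its class is zero, so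
      \<open>dem\<close> need not respect F^1.\<close>
    then have "slot_in \<epsilon> M j (i + 1 - (2 * max j 0 - M)) (htpy2 j u)"
      "slot_in \<epsilon> M j (i - 1 - (2 * max j 0 - M)) (htpy3 j u)"
      by (auto simp: slot_in_simps slot_defs max_def)
    then show ?thesis by (simp add: u cls slot_filt_iff slot_in_zero)
  qed
qed

text \<open>The product of the two factors lies in \<open>JM\<close>, and y_minus - x_minus vanishes
  on I.\<close>

lemma slot_dif_dif: "slot_zero \<epsilon> M (j - 2) (slot_dif M (j - 1) (slot_dif M j u))"
proof -
  consider "j < 1" | "j = 1" | "j \<ge> 2" by linarith
  then show ?thesis
    by cases (auto simp: slot_zero_def slot_dif_def JM_simps algebra_simps)
qed

text \<open>For \<open>j \<ge> 2\<close> and f the factor of degree j - 1, the factor of degree j is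
  - swapY f = 2 y_minus - f. Expanding dem (f y) by the Leibniz rule and using y - swapY y = 2
  y_minus dem y, the entry \<open>y\<close> from the cone differential combines with the rest to
  this factor times dem y.\<close>

lemma retr_chain:
  assumes "M \<ge> 1"
  shows "slot_zero \<epsilon> (M + 1) (j - 1) (retr M (j - 1) (y - slot_dif M j u) (slot_dif M (j - 1) y) (slot_dif M (j - 1) z) -
    slot_dif (M + 1) j (retr M j u y z))"
proof -
  consider "j < 0" | "j = 0" | "j = 1" | "j \<ge> 2" by linarith
  then show ?thesis
    by cases (use assms in \<open>auto simp: slot_zero_def slot_defs JM_simps algebra_simps\<close>)
qed

lemma sect_chain:
  assumes "M \<ge> 1"
  shows "slot_zero \<epsilon> M (j - 1) (sect1 (j - 1) (slot_dif (M + 1) j w) - (sect2 j w - slot_dif M j (sect1 j w)))"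
    "slot_zero \<epsilon> M (j - 2) (sect2 (j - 1) (slot_dif (M + 1) j w) - slot_dif M (j - 1) (sect2 j w))"
    "slot_zero \<epsilon> M (j - 2) (sect3 (j - 1) (slot_dif (M + 1) j w) - slot_dif M (j - 1) (sect3 j w))"
proof -
  consider "j < 0" | "j = 0" | "j = 1" | "j \<ge> 2" by linarith
  then show "slot_zero \<epsilon> M (j - 1) (sect1 (j - 1) (slot_dif (M + 1) j w) - (sect2 j w - slot_dif M j (sect1 j w)))"
    "slot_zero \<epsilon> M (j - 2) (sect2 (j - 1) (slot_dif (M + 1) j w) - slot_dif M (j - 1) (sect2 j w))"
    "slot_zero \<epsilon> M (j - 2) (sect3 (j - 1) (slot_dif (M + 1) j w) - slot_dif M (j - 1) (sect3 j w))"
    by (cases; use assms in \<open>auto simp: slot_zero_def slot_defs JM_simps algebra_simps\<close>)+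
qed

lemma retr_sect:
  assumes "M \<ge> 1"
  shows "slot_zero \<epsilon> (M + 1) j (retr M j (sect1 j w) (sect2 j w) (sect3 j w) - w)"
proof -
  consider "j < 0" | "j = 0" | "j \<ge> 1" by linarith
  then show ?thesis
    by cases (use assms in \<open>auto simp: slot_zero_def slot_defs JM_simps algebra_simps\<close>)
qed

text \<open>The homotopy relation entry by entry: d h contributes (h2 u, d h2 u, d h3 u), and h d
  contributes h2 and h3 of the first entry y - d u of the cone differential.\<close>

lemma sect_retr:
  assumes "M \<ge> 1"
  shows "slot_zero \<epsilon> M j (sect1 j (retr M j u y z) - (u + htpy2 j u))"
    "slot_zero \<epsilon> M (j - 1) (sect2 j (retr M j u y z) -
      (y + (slot_dif M j (htpy2 j u) + htpy2 (j - 1) (y - slot_dif M j u))))"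
    "slot_zero \<epsilon> M (j - 1) (sect3 j (retr M j u y z) -
      (z + (slot_dif M j (htpy3 j u) + htpy3 (j - 1) (y - slot_dif M j u))))"
proof -
  consider "j < 0" | "j = 0" | "j \<ge> 1" by linarith
  then show "slot_zero \<epsilon> M j (sect1 j (retr M j u y z) - (u + htpy2 j u))"
    "slot_zero \<epsilon> M (j - 1) (sect2 j (retr M j u y z) -
      (y + (slot_dif M j (htpy2 j u) + htpy2 (j - 1) (y - slot_dif M j u))))"
    "slot_zero \<epsilon> M (j - 1) (sect3 j (retr M j u y z) -
      (z + (slot_dif M j (htpy3 j u) + htpy3 (j - 1) (y - slot_dif M j u))))"
    by (cases; use assms in \<open>auto simp: slot_zero_def slot_defs JM_simps algebra_simps\<close>)+
qed

section \<open>Identification of the shifted brackets with the slots\<close>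

lemma pol_class_UNIV: "pol_class UNIV p = pol_class UNIV 0"
  by (simp add: pol_class_eq_iff[OF hideal_UNIV])

text \<open>With a single class, all pieces and filtration steps are the same singleton, so shifts
  and the choice of filtration leave the record unchanged. Zero terms can then be matched by
  equality instead of isomorphism.\<close>

lemma shift_cyclic_UNIV:
  assumes "\<And>i. \<Phi> i \<noteq> {}"
  shows "shift a b c (cyclic UNIV \<Phi>) = (bim0 :: 'a bimodule)"
proof -
  have const: "(pol_class UNIV :: bpoly \<Rightarrow> 'a univ) = (\<lambda>p. pol_class UNIV 0)"
    using pol_class_UNIV by (intro HOL.ext)
  have im: "(pol_class UNIV :: bpoly \<Rightarrow> 'a univ) ` S = {pol_class UNIV 0}" if "S \<noteq> {}" for S
    using that by (subst const) auto
  have "Collect (homogeneous q) \<noteq> {}" for q using homogeneous_0 by blast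
  then have hom: "(pol_class UNIV :: bpoly \<Rightarrow> 'a univ) ` Collect (homogeneous q) = {pol_class UNIV 0}" for q
    by (rule im)
  have "trivial_filt i \<noteq> {}" for i using hidealD(1)[OF hideal_trivial_filt] by blast
  then show ?thesis
    by (simp add: shift_def bim0_def cyclic_def im hom assms cong: if_cong)
qed

definition blob_target :: "nat \<Rightarrow> 'a bcomplex" where
  "blob_target m = ts_aq_shift (- int m) (ta_shift (blob_complex m))"

lemma slot_trivial:
  assumes "M \<ge> 0" "\<not> (\<epsilon> \<and> -1 \<le> j \<and> j < M)"
  shows "slot \<epsilon> M j = bim0"
proof -
  have "slot_ideal \<epsilon> M j = UNIV" using assms by (auto simp: slot_ideal_def)
  moreover have "slot_filt j i \<noteq> {}" for i using hidealD(1)[OF hideal_slot_filt] by blast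
  ultimately show ?thesis
    unfolding slot_def by (simp add: shift_cyclic_UNIV)
qed

lemma shift_bim0: "shift a b c bim0 = bim0"
proof -
  have "trivial_filt i \<noteq> {}" for i using hidealD(1)[OF hideal_trivial_filt] by blast
  then show ?thesis unfolding bim0_def[symmetric] by (subst bim0_def) (simp add: shift_cyclic_UNIV)
qed

lemma slot_I: "M \<ge> 0 \<Longrightarrow> slot True M (-1) = shift (- M) (- M) (- 2 * M) bimI"
  by (simp add: slot_def slot_ideal_def slot_filt_def bimI_def)

lemma slot_BG: "0 \<le> j \<Longrightarrow> j < M \<Longrightarrow> slot True M j =
    shift (1 - M + j) (2 * j - M) (2 * j - 2 * M) (if even j then bimB else bimG)"
  by (simp add: slot_def slot_ideal_def slot_filt_def bimB_def bimG_def)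

lemma half_diff:
  "(k - 2 + M - 2) div 2 = (k + M - 2) div (2 :: int) - 1"
  "(k - 4 + M - 2) div 2 = (k + M - 2) div (2 :: int) - 2"
  "(k - 2 + M - 1) div 2 = (k + M - 1) div (2 :: int) - 1"
  "(k + 2 + M - 1) div 2 = (k + M - 1) div (2 :: int) + 1"
  by presburger+

lemma blob_target_eqs:
  fixes m :: nat and k :: int
  defines "F \<equiv> (\<lambda>j. if j = -1 then ash (-1) bimI else shift j (2 * j) (2 * j) (if even j then bimB else bimG))
      :: int \<Rightarrow> 'a bimodule"
    and "d \<equiv> (\<lambda>j. if j = 0 then chi_minus else if odd j then psi_plus else psi_minus) :: int \<Rightarrow> 'a univ \<Rightarrow> 'a univ"
  shows "bterm (blob_target m) k =
      shift (1 - int m) (- int m) (- 2 * int m) (integral_term (-1) (int m - 1) F (k + int m - 2))"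
    "bdif (blob_target m) k = (if even (k + int m) \<and> (k + int m - 2) div 2 \<in> {-1<..int m - 1}
       then d ((k + int m - 2) div 2) else (\<lambda>u. \<zero>\<^bsub>bterm (blob_target m) (k - 2)\<^esub>))"
proof -
  have bt: "bterm (blob_target m) k = shift (1 - int m) (- int m) (- 2 * int m) (bterm (blob_complex m) (k + int m - 2))"
    and bd: "bdif (blob_target m) k = bdif (blob_complex m) (k + int m - 2)" for k
    by (simp_all add: blob_target_def ts_aq_shift_def ta_shift_def bshift_def algebra_simps)
  have C: "(blob_complex m :: 'a bcomplex) = integral_complex (-1) (int m - 1) F d"
    by (simp add: blob_complex_def F_def d_def)
  show t: "bterm (blob_target m) k =
      shift (1 - int m) (- int m) (- 2 * int m) (integral_term (-1) (int m - 1) F (k + int m - 2))" for k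
    by (simp add: bt C integral_complex_def)
  have e: "k - 2 + int m - 2 = k + int m - 2 - 2" and ev: "even (k + int m - 2) = even (k + int m)" by simp_all
  show "bdif (blob_target m) k = (if even (k + int m) \<and> (k + int m - 2) div 2 \<in> {-1<..int m - 1}
       then d ((k + int m - 2) div 2) else (\<lambda>u. \<zero>\<^bsub>bterm (blob_target m) (k - 2)\<^esub>))"
    unfolding t bd C shift_simps e integral_complex_def bcomplex.simps ev ..
qed

text \<open>An index counts half t-degrees, so the shifts by t^(-m/2) and t put bracket degree j at
  index k = 2 j + 2 - m; the parity of k + m tells whether such a j exists.\<close>

lemma blob_target_term: "bterm (blob_target m) k = slot (even (k + int m)) (int m) ((k + int m - 2) div 2)"
proof -
  define i where "i = k + int m - 2"
  define j where "j = i div 2"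
  define \<epsilon> where "\<epsilon> = even (k + int m)"
  have ev: "even i = \<epsilon>" by (simp add: i_def \<epsilon>_def)
  note T = blob_target_eqs(1)[of m k, folded i_def]
  have "bterm (blob_target m) k = slot \<epsilon> (int m) j"
  proof (cases "\<epsilon> \<and> -1 \<le> j \<and> j < int m")
    case True
    then show ?thesis
      unfolding T integral_term_def ev j_def[symmetric]
      by (cases "j = -1") (auto simp: slot_I slot_BG)
  next
    case False
    then show ?thesis
      unfolding T integral_term_def ev j_def[symmetric] slot_trivial[OF of_nat_0_le_iff False]
      by (auto simp: shift_bim0)
  qed
  then show ?thesis by (simp only: \<epsilon>_def j_def i_def)
qed

lemma slot_class_False: "slot_class False M j p = slot_class False M j q"
  by (simp add: slot_class_eq_iff slot_zero_def)

lemma psi_class: "psi_minus (pol_class JM p) = pol_class JM ((y_minus + x_minus) * p)"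
  "psi_plus (pol_class JM p) = pol_class JM ((y_minus - x_minus) * p)"
proof -
  show "psi_minus (pol_class JM p) = pol_class JM ((y_minus + x_minus) * p)"
    unfolding psi_minus_def
    by (rule pol_class_rep[OF hideal_JM hideal_JM]) (simp_all add: right_diff_distrib JM_mult)
  show "psi_plus (pol_class JM p) = pol_class JM ((y_minus - x_minus) * p)"
    unfolding psi_plus_def
    by (rule pol_class_rep[OF hideal_JM hideal_JM]) (simp_all add: right_diff_distrib JM_mult)
qed

lemma blob_target_dif:
  assumes "x \<in> carrier (bterm (blob_target m) k)"
  shows "bdif (blob_target m) k x = dif_map (even (k + int m)) (int m) ((k + int m - 2) div 2) x"
proof -
  define \<epsilon> where "\<epsilon> = even (k + int m)"
  define j where "j = (k + int m - 2) div 2"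
  note d = blob_target_eqs(2)[of m k, folded \<epsilon>_def j_def]
  obtain u where u: "x = slot_class \<epsilon> (int m) j u"
    using assms unfolding blob_target_term \<epsilon>_def[symmetric] j_def[symmetric] slot_simps by blast
  have "bdif (blob_target m) k x = dif_map \<epsilon> (int m) j x"
  proof (cases "\<epsilon> \<and> 0 \<le> j \<and> j < int m")
    case True
    then show ?thesis
      unfolding d u dif_map_class
      by (auto simp: slot_dif_def slot_class_def slot_ideal_def chi_minus_class psi_class)
  next
    case False
    have e: "even (k - 2 + int m) = \<epsilon>" "(k - 2 + int m - 2) div 2 = j - 1"
      unfolding \<epsilon>_def j_def by (simp, rule half_diff)
    have "bdif (blob_target m) k x = \<zero>\<^bsub>bterm (blob_target m) (k - 2)\<^esub>"
      unfolding d using False by auto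
    also have "\<dots> = slot_class \<epsilon> (int m) (j - 1) 0"
      unfolding blob_target_term e slot_simps ..
    also have "\<dots> = dif_map \<epsilon> (int m) j x"
    proof (cases \<epsilon>)
      case True
      then show ?thesis using False by (auto simp: u dif_map_class slot_dif_def)
    next
      case False
      then show ?thesis using slot_class_False by (simp add: u dif_map_class)
    qed
    finally show ?thesis .
  qed
  then show ?thesis by (simp only: \<epsilon>_def j_def)
qed

lemma bcpx_blob_target: "bcpx (bterm (blob_target m)) (bdif (blob_target m))"
  unfolding bcpx_def
proof (intro conjI allI ballI)
  let ?M = "int m"
  fix k
  let ?\<epsilon> = "even (k + int m)" and ?j = "(k + int m - 2) div 2"
  have T2: "bterm (blob_target m) (k - 2) = slot ?\<epsilon> ?M (?j - 1)"
    unfolding blob_target_term half_diff by simp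
  show fg: "fgmod (bterm (blob_target m) k)" unfolding blob_target_term by (rule fgmod_slot)
  show hom: "bhom (bterm (blob_target m) k) (ash 1 (bterm (blob_target m) (k - 2))) (bdif (blob_target m) k)"
  proof (rule bhom_cong[OF _ fg blob_target_dif])
    show "bhom (bterm (blob_target m) k) (ash 1 (bterm (blob_target m) (k - 2))) (dif_map ?\<epsilon> ?M ?j)"
      unfolding T2 blob_target_term[of m k] by (rule bhom_dif_map)
  qed
  show "bdif (blob_target m) (k - 2) (bdif (blob_target m) k x) = \<zero>\<^bsub>bterm (blob_target m) (k - 4)\<^esub>"
    if x: "x \<in> carrier (bterm (blob_target m) k)" for x
  proof -
    obtain u where u: "x = slot_class ?\<epsilon> ?M ?j u"
      using x by (auto simp: blob_target_term slot_simps)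
    have c: "bdif (blob_target m) k x \<in> carrier (bterm (blob_target m) (k - 2))"
      using bhomD(1)[OF hom x] by simp
    have e: "even (k - 2 + ?M) = ?\<epsilon>" "(k - 2 + ?M - 2) div 2 = ?j - 1" by (simp, rule half_diff)
    have e4: "even (k - 4 + ?M) = ?\<epsilon>" "(k - 4 + ?M - 2) div 2 = ?j - 2"
      by (simp, rule half_diff)
    have "bdif (blob_target m) (k - 2) (bdif (blob_target m) k x) =
        dif_map ?\<epsilon> ?M (?j - 1) (dif_map ?\<epsilon> ?M ?j x)"
      using blob_target_dif[OF c] unfolding e blob_target_dif[OF x] .
    also have "\<dots> = slot_class ?\<epsilon> ?M (?j - 2) 0"
      using slot_dif_dif[of ?\<epsilon> ?M ?j u] by (simp add: u dif_map_class slot_class_eq_iff)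
    also have "\<dots> = \<zero>\<^bsub>bterm (blob_target m) (k - 4)\<^esub>"
      unfolding blob_target_term e4 slot_simps ..
    finally show ?thesis .
  qed
next
  have "{k. carrier (bterm (blob_target m) k :: 'a bimodule) \<noteq> {\<zero>\<^bsub>bterm (blob_target m) k\<^esub>}} \<subseteq> {- int m..int m + 2}"
  proof
    fix k assume "k \<in> {k. carrier (bterm (blob_target m) k :: 'a bimodule) \<noteq> {\<zero>\<^bsub>bterm (blob_target m) k\<^esub>}}"
    then have "bterm (blob_target m) k \<noteq> (bim0 :: 'a bimodule)"
      using carrier_bim0 by force
    then have "-1 \<le> (k + int m - 2) div 2" "(k + int m - 2) div 2 < int m"
      unfolding blob_target_term using slot_trivial[of "int m"] by force+
    then show "k \<in> {- int m..int m + 2}" unfolding atLeastAtMost_iff by presburger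
  qed
  then show "finite {k. carrier (bterm (blob_target m) k :: 'a bimodule) \<noteq> {\<zero>\<^bsub>bterm (blob_target m) k\<^esub>}}"
    by (rule finite_subset) simp
qed

text \<open>For m blobs the indices k + 1 and k - 1 carry the bracket degrees j and j - 1, and for m
  + 1 blobs the index k carries j. So all formulas above apply with one and the same j.\<close>

lemma sdr_cone_blob:
  assumes m: "m \<ge> 1"
  defines "T \<equiv> bterm (blob_target m) :: int \<Rightarrow> 'a bimodule" and "T' \<equiv> bterm (blob_target (Suc m)) :: int \<Rightarrow> 'a bimodule"
  shows "sdr (cone_term T) (cone_dif T (bdif (blob_target m))) T' (bdif (blob_target (Suc m)))
    (\<lambda>k. retr_map (even (k + 1 + int m)) (int m) ((k + int m - 1) div 2))
    (\<lambda>k. sect_map (even (k + 1 + int m)) (int m) ((k + int m - 1) div 2))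
    (\<lambda>k. htpy_map (even (k + 1 + int m)) (int m) ((k + int m - 1) div 2))"
proof -
  let ?M = "int m"
  have M: "?M \<ge> 1" using m by simp
  define \<epsilon> where "\<epsilon> k = even (k + 1 + ?M)" for k
  define j where "j k = (k + ?M - 1) div 2" for k
  have \<epsilon>2: "\<epsilon> (k - 2) = \<epsilon> k" "\<epsilon> (k + 2) = \<epsilon> k" for k by (simp_all add: \<epsilon>_def)
  have j2: "j (k - 2) = j k - 1" "j (k + 2) = j k + 1" for k
    unfolding j_def by (rule half_diff)+
  have i1: "even (k + 1 + ?M) = \<epsilon> k" "(k + 1 + ?M - 2) div 2 = j k" for k
    by (simp_all add: \<epsilon>_def j_def algebra_simps)
  have i2: "even (k - 1 + ?M) = \<epsilon> k" "(k - 1 + ?M - 2) div 2 = j k - 1" for k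
  proof -
    show "even (k - 1 + ?M) = \<epsilon> k" by (simp add: \<epsilon>_def)
    have "k - 1 + ?M - 2 = k - 2 + ?M - 1" by simp
    then show "(k - 1 + ?M - 2) div 2 = j k - 1" using j2(1)[of k] by (simp only: j_def)
  qed
  have i3: "even (k + int (Suc m)) = \<epsilon> k" "(k + int (Suc m) - 2) div 2 = j k" for k
    by (simp_all add: \<epsilon>_def j_def algebra_simps)
  have Tp: "T (k + 1) = slot (\<epsilon> k) ?M (j k)" and Tm: "T (k - 1) = slot (\<epsilon> k) ?M (j k - 1)" for k
    unfolding T_def blob_target_term i1 i2 by (rule HOL.refl)+
  have T': "T' k = slot (\<epsilon> k) (?M + 1) (j k)" for k
    unfolding T'_def blob_target_term i3 by (simp add: add.commute)
  have ct: "cone_term T k = bcone (slot (\<epsilon> k) ?M (j k)) (slot (\<epsilon> k) ?M (j k - 1))" for k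
    by (simp add: cone_term_def Tp Tm)
  have d': "bdif (blob_target (Suc m)) k x = dif_map (\<epsilon> k) (?M + 1) (j k) x" if "x \<in> carrier (T' k)" for k x
    using blob_target_dif[of x "Suc m" k] that unfolding T'_def i3 by (simp add: add.commute)
  have cd: "cone_dif T (bdif (blob_target m)) k (slot_class (\<epsilon> k) ?M (j k) u, slot_class (\<epsilon> k) ?M (j k - 1) y,
        slot_class (\<epsilon> k) ?M (j k - 1) z) =
      (slot_class (\<epsilon> k) ?M (j k - 1) (y - slot_dif ?M (j k) u), slot_class (\<epsilon> k) ?M (j k - 2) (slot_dif ?M (j k - 1) y),
       slot_class (\<epsilon> k) ?M (j k - 2) (slot_dif ?M (j k - 1) z))" for k u y z
  proof -
    have 1: "bdif (blob_target m) (k + 1) (slot_class (\<epsilon> k) ?M (j k) u) =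
        slot_class (\<epsilon> k) ?M (j k - 1) (slot_dif ?M (j k) u)"
    proof -
      have "slot_class (\<epsilon> k) ?M (j k) u \<in> carrier (bterm (blob_target m) (k + 1))"
        unfolding blob_target_term i1 slot_simps by blast
      from blob_target_dif[OF this] show ?thesis unfolding i1 by (simp add: dif_map_class)
    qed
    have 2: "bdif (blob_target m) (k - 1) (slot_class (\<epsilon> k) ?M (j k - 1) v) =
        slot_class (\<epsilon> k) ?M (j k - 2) (slot_dif ?M (j k - 1) v)" for v
    proof -
      have "slot_class (\<epsilon> k) ?M (j k - 1) v \<in> carrier (bterm (blob_target m) (k - 1))"
        unfolding blob_target_term i2 slot_simps by blast
      from blob_target_dif[OF this] show ?thesis unfolding i2 by (simp add: dif_map_class)
    qed
    show ?thesis
      by (simp add: cone_dif_def 1 2 Tm slot_neg slot_simps)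
  qed
  have repC: thesis if "x \<in> carrier (cone_term T k)"
    "\<And>u y z. x = (slot_class (\<epsilon> k) ?M (j k) u, slot_class (\<epsilon> k) ?M (j k - 1) y, slot_class (\<epsilon> k) ?M (j k - 1) z) \<Longrightarrow> thesis"
    for x k thesis
    using that(1) unfolding ct by (rule bcone_slotE) (rule that(2))
  have "sdr (cone_term T) (cone_dif T (bdif (blob_target m))) T' (bdif (blob_target (Suc m)))
    (\<lambda>k. retr_map (\<epsilon> k) ?M (j k)) (\<lambda>k. sect_map (\<epsilon> k) ?M (j k)) (\<lambda>k. htpy_map (\<epsilon> k) ?M (j k))"
    unfolding sdr_def
  proof (intro conjI allI ballI)
    fix k
    show "bhom (cone_term T k) (T' k) (retr_map (\<epsilon> k) ?M (j k))"
      unfolding ct T' by (rule bhom_retr_map[OF M])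
    show "bhom (T' k) (cone_term T k) (sect_map (\<epsilon> k) ?M (j k))"
      unfolding ct T' by (rule bhom_sect_map[OF M])
    show "bhom (cone_term T k) (ash (-1) (cone_term T (k + 2))) (htpy_map (\<epsilon> k) ?M (j k))"
      using bhom_htpy_map[of "\<epsilon> k" ?M "j k"] unfolding ct \<epsilon>2 j2 by simp
    have cd2: "cone_dif T (bdif (blob_target m)) (k + 2) (slot_class (\<epsilon> k) ?M (j k + 1) u, slot_class (\<epsilon> k) ?M (j k) y,
        slot_class (\<epsilon> k) ?M (j k) z) =
      (slot_class (\<epsilon> k) ?M (j k) (y - slot_dif ?M (j k + 1) u), slot_class (\<epsilon> k) ?M (j k - 1) (slot_dif ?M (j k) y),
       slot_class (\<epsilon> k) ?M (j k - 1) (slot_dif ?M (j k) z))" for u y z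
      using cd[of "k + 2" u y z] unfolding \<epsilon>2 j2 by simp
    have rm: "retr_map (\<epsilon> k) ?M (j k - 1) (slot_class (\<epsilon> k) ?M (j k - 1) u, slot_class (\<epsilon> k) ?M (j k - 2) y,
        slot_class (\<epsilon> k) ?M (j k - 2) z) = slot_class (\<epsilon> k) (?M + 1) (j k - 1) (retr ?M (j k - 1) u y z)" for u y z
      using retr_map_class[OF M, of "\<epsilon> k" "j k - 1" u y z] by simp
    have sm: "sect_map (\<epsilon> k) ?M (j k - 1) (slot_class (\<epsilon> k) (?M + 1) (j k - 1) w) =
        (slot_class (\<epsilon> k) ?M (j k - 1) (sect1 (j k - 1) w), slot_class (\<epsilon> k) ?M (j k - 2) (sect2 (j k - 1) w),
         slot_class (\<epsilon> k) ?M (j k - 2) (sect3 (j k - 1) w))" for w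
      using sect_map_class[OF M, of "\<epsilon> k" "j k - 1" w] by simp
    have hm: "htpy_map (\<epsilon> k) ?M (j k - 1) (slot_class (\<epsilon> k) ?M (j k - 1) u, y, z) =
        (slot_class (\<epsilon> k) ?M (j k) 0, slot_class (\<epsilon> k) ?M (j k - 1) (htpy2 (j k - 1) u),
         slot_class (\<epsilon> k) ?M (j k - 1) (htpy3 (j k - 1) u))" for u and y z :: "'a univ"
      using htpy_map_class[of "\<epsilon> k" ?M "j k - 1" u y z] by simp
    show "retr_map (\<epsilon> (k - 2)) ?M (j (k - 2)) (cone_dif T (bdif (blob_target m)) k x) =
        bdif (blob_target (Suc m)) k (retr_map (\<epsilon> k) ?M (j k) x)"
      if x: "x \<in> carrier (cone_term T k)" for x
    proof (rule repC[OF x])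
      fix u y z assume u: "x = (slot_class (\<epsilon> k) ?M (j k) u, slot_class (\<epsilon> k) ?M (j k - 1) y, slot_class (\<epsilon> k) ?M (j k - 1) z)"
      have c: "slot_class (\<epsilon> k) (?M + 1) (j k) (retr ?M (j k) u y z) \<in> carrier (T' k)"
        unfolding T' slot_simps by blast
      show ?thesis
        using retr_chain[OF M, of "\<epsilon> k" "j k" y u z]
        by (simp add: u cd \<epsilon>2 j2 rm retr_map_class[OF M] d'[OF c] dif_map_class slot_class_eq_iff)
    qed
    show "sect_map (\<epsilon> (k - 2)) ?M (j (k - 2)) (bdif (blob_target (Suc m)) k x) =
        cone_dif T (bdif (blob_target m)) k (sect_map (\<epsilon> k) ?M (j k) x)"
      if x: "x \<in> carrier (T' k)" for x
    proof -
      obtain w where w: "x = slot_class (\<epsilon> k) (?M + 1) (j k) w"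
        using x unfolding T' slot_simps by blast
      show ?thesis
        using sect_chain[OF M, of "\<epsilon> k" "j k" w] unfolding d'[OF x]
        by (simp add: w cd \<epsilon>2 j2 sm sect_map_class[OF M] dif_map_class slot_class_eq_iff)
    qed
    show "retr_map (\<epsilon> k) ?M (j k) (sect_map (\<epsilon> k) ?M (j k) x) = x"
      if x: "x \<in> carrier (T' k)" for x
    proof -
      obtain w where w: "x = slot_class (\<epsilon> k) (?M + 1) (j k) w"
        using x unfolding T' slot_simps by blast
      show ?thesis
        using retr_sect[OF M, of "\<epsilon> k" "j k" w]
        by (simp add: w sect_map_class[OF M] retr_map_class[OF M] slot_class_eq_iff)
    qed
    show "sect_map (\<epsilon> k) ?M (j k) (retr_map (\<epsilon> k) ?M (j k) x) = x \<oplus>\<^bsub>cone_term T k\<^esub>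
        (cone_dif T (bdif (blob_target m)) (k + 2) (htpy_map (\<epsilon> k) ?M (j k) x) \<oplus>\<^bsub>cone_term T k\<^esub>
         htpy_map (\<epsilon> (k - 2)) ?M (j (k - 2)) (cone_dif T (bdif (blob_target m)) k x))"
      if x: "x \<in> carrier (cone_term T k)" for x
    proof (rule repC[OF x])
      fix u y z assume u: "x = (slot_class (\<epsilon> k) ?M (j k) u, slot_class (\<epsilon> k) ?M (j k - 1) y, slot_class (\<epsilon> k) ?M (j k - 1) z)"
      have d0: "slot_dif ?M i 0 = 0" for i by (simp add: slot_dif_def)
      show ?thesis
        using sect_retr[OF M, of "\<epsilon> k" "j k" u y z]
        by (simp add: u ct cd cd2 \<epsilon>2 j2 hm htpy_map_class retr_map_class[OF M] sect_map_class[OF M]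
            slot_simps slot_class_eq_iff d0)
    qed
  qed
  then show ?thesis by (simp only: \<epsilon>_def j_def)
qed

subsection \<open>Induction on the number of crossings\<close>

lemma fgiso_id: "fgmod M \<Longrightarrow> fgiso M M (\<lambda>x. x)"
proof -
  assume "fgmod M"
  then interpret M: fgmod M .
  show ?thesis
    unfolding fgiso_def using M.smult_closed by (auto simp: bij_betw_def M.piece_closed M.filt_closed)
qed

text \<open>Functions that agree on the carriers may differ elsewhere, so equal terms do not make
  the complexes equal; the identity maps form the retract.\<close>

lemma sdr_same:
  assumes T': "bcpx T' d'" and T: "\<And>k. T k = T' k" and d: "\<And>k x. x \<in> carrier (T' k) \<Longrightarrow> d k x = d' k x"
  shows "bcpx T d" "\<exists>p s h. sdr T d T' d' p s h"
proof -
  note D' = bcpxD[OF T']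
  have iso: "fgiso (T k) (T' k) (\<lambda>x. x)" for k unfolding T by (rule fgiso_id[OF D'(1)])
  have dc: "d k x \<in> carrier (T (k - 2))" if "x \<in> carrier (T k)" for k x
    using bhomD(1)[OF D'(2)] that by (simp add: T d)
  have dd: "d k x = d' k x" if "x \<in> carrier (T k)" for k x using that by (simp add: T d)
  show "bcpx T d" by (rule bcpx_iso(1)[OF T' iso dc dd])
  show "\<exists>p s h. sdr T d T' d' p s h" by (intro exI) (rule bcpx_iso(2)[OF T' iso dc dd])
qed

text \<open>The bracket without blobs is I in degree -1, which the shifts bring to index 0.\<close>

lemma identity_complex_target:
  "bterm identity_complex k = bterm (blob_target 0) k"
  "x \<in> carrier (bterm (blob_target 0) k) \<Longrightarrow> bdif identity_complex k x = bdif (blob_target 0) k x"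
proof -
  have t: "bterm identity_complex k = bterm (blob_target 0) k" for k
  proof (cases "k = 0")
    case True
    then show ?thesis
      by (simp add: identity_complex_def integral_complex_def integral_term_def blob_target_term slot_I)
  next
    case False
    then have 1: "\<not> (even k \<and> k div 2 \<in> {0..0})" by (auto elim!: evenE)
    have 2: "\<not> (even (k + int 0) \<and> -1 \<le> (k + int 0 - 2) div 2 \<and> (k + int 0 - 2) div 2 < int 0)"
      using False by (auto elim!: evenE)
    show ?thesis
      unfolding blob_target_term slot_trivial[OF of_nat_0_le_iff 2]
      using 1 by (auto simp: identity_complex_def integral_complex_def integral_term_def)
  qed
  show "bterm identity_complex k = bterm (blob_target 0) k" by (rule t)
  show "bdif identity_complex k x = bdif (blob_target 0) k x" if x: "x \<in> carrier (bterm (blob_target 0) k)"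
  proof -
    have "bdif identity_complex k x = \<zero>\<^bsub>bterm identity_complex (k - 2)\<^esub>"
      by (simp add: identity_complex_def integral_complex_def)
    also have "\<dots> = slot_class (even (k + int 0)) (int 0) ((k + int 0 - 2) div 2 - 1) 0"
    proof -
      have e: "even (k - 2 + int 0) = even (k + int 0)" "(k - 2 + int 0 - 2) div 2 = (k + int 0 - 2) div 2 - 1"
        by (simp, rule half_diff)
      show ?thesis unfolding t blob_target_term e slot_simps ..
    qed
    also have "\<dots> = bdif (blob_target 0) k x"
      unfolding blob_target_dif[OF x] by (auto simp: dif_map_def slot_dif_def)
    finally show ?thesis .
  qed
qed

text \<open>For one blob the outer shift by t_a moves B to degree 1 and I to degree 0, which is the
  defining complex of the crossing.\<close>

lemma sigma_minus_target:
  "bterm sigma_minus k = bterm (blob_target 1) k"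
  "x \<in> carrier (bterm (blob_target 1) k) \<Longrightarrow> bdif sigma_minus k x = bdif (blob_target 1) k x"
proof -
  have t: "bterm sigma_minus k = bterm (blob_target 1) k" for k
  proof -
    consider "k = -1" | "k = 1" | "k \<noteq> -1" "k \<noteq> 1" by blast
    then show ?thesis
    proof cases
      case 3
      have 4: "\<not> (even (k + int 1) \<and> -1 \<le> (k + int 1 - 2) div 2 \<and> (k + int 1 - 2) div 2 < int 1)"
        using 3 by (simp, presburger)
      show ?thesis
        unfolding blob_target_term slot_trivial[OF of_nat_0_le_iff 4] sigma_minus_term(3)[OF 3] by (rule shift_bim0)
    qed (simp_all add: sigma_minus_term blob_target_term slot_I slot_BG)
  qed
  show "bterm sigma_minus k = bterm (blob_target 1) k" by (rule t)
  show "bdif sigma_minus k x = bdif (blob_target 1) k x" if x: "x \<in> carrier (bterm (blob_target 1) k)"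
  proof (cases "k = 1")
    case True
    then obtain u where u: "x = slot_class True 1 0 u"
      using x by (auto simp: blob_target_term slot_simps)
    have "bdif (blob_target 1) k x = dif_map True 1 0 x"
      using blob_target_dif[OF x] True by simp
    then show ?thesis
      using True by (simp add: u sigma_minus_dif dif_map_class slot_dif_def)
        (simp add: slot_class_def slot_ideal_def chi_minus_class)
  next
    case False
    let ?\<epsilon> = "even (k + int 1)" and ?j = "(k + int 1 - 2) div 2"
    obtain u where u: "x = slot_class ?\<epsilon> (int 1) ?j u"
      using x unfolding blob_target_term slot_simps by blast
    have e: "even (k - 2 + int 1) = ?\<epsilon>" "(k - 2 + int 1 - 2) div 2 = ?j - 1"
      by (simp, rule half_diff)
    have "bdif sigma_minus k x = \<zero>\<^bsub>bterm sigma_minus (k - 2)\<^esub>" using False by (simp add: sigma_minus_dif)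
    also have "\<dots> = slot_class ?\<epsilon> (int 1) (?j - 1) 0"
      unfolding t blob_target_term e slot_simps ..
    also have "\<dots> = dif_map ?\<epsilon> (int 1) ?j x"
    proof (cases ?\<epsilon>)
      case True
      then have "?j < 0 \<or> ?j \<ge> 1" using False by (simp, presburger)
      then show ?thesis unfolding u dif_map_class by (auto simp: slot_dif_def)
    next
      case False
      then show ?thesis unfolding u dif_map_class using slot_class_False by metis
    qed
    also have "\<dots> = bdif (blob_target 1) k x"
      unfolding blob_target_dif[OF x] ..
    finally show ?thesis .
  qed
qed

text \<open>The word with one letter is the crossing itself and not its composite with the identity,
  hence two base cases; the step starts from \<open>Suc k\<close> letters, where the elimination has
  its blob in degree 0.\<close>

lemma sigma_minus_power_retract:
  "bcpx (bterm (sigma_minus_power m :: 'a bcomplex)) (bdif (sigma_minus_power m)) \<and>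
   (\<exists>p s h. sdr (bterm (sigma_minus_power m :: 'a bcomplex)) (bdif (sigma_minus_power m))
      (bterm (blob_target m :: 'a bcomplex)) (bdif (blob_target m)) p s h)"
proof (induction m rule: sigma_minus_power.induct)
  case 1
  show ?case
    unfolding sigma_minus_power.simps
    by (intro conjI sdr_same[OF bcpx_blob_target identity_complex_target(1)]; rule identity_complex_target(2))
next
  case 2
  have "bcpx (bterm (sigma_minus :: 'a bcomplex)) (bdif sigma_minus)"
    "\<exists>p s h. sdr (bterm (sigma_minus :: 'a bcomplex)) (bdif sigma_minus)
      (bterm (blob_target 1 :: 'a bcomplex)) (bdif (blob_target 1)) p s h"
    by (rule sdr_same[OF bcpx_blob_target sigma_minus_target(1)]; rule sigma_minus_target(2); assumption)+
  then show ?case by simp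
next
  case (3 k)
  let ?X = "sigma_minus_power (Suc k) :: 'a bcomplex" and ?D = "blob_target (Suc k) :: 'a bcomplex"
    and ?D' = "blob_target (Suc (Suc k)) :: 'a bcomplex"
  have X: "bcpx (bterm ?X) (bdif ?X)" using 3 by blast
  obtain p s h where "sdr (bterm ?X) (bdif ?X) (bterm ?D) (bdif ?D) p s h" using 3 by blast
  from sdr_cone[OF X bcpx_blob_target this]
  obtain p1 s1 h1 where 1: "sdr (cone_term (bterm ?X)) (cone_dif (bterm ?X) (bdif ?X))
      (cone_term (bterm ?D)) (cone_dif (bterm ?D) (bdif ?D)) p1 s1 h1" by blast
  note step = braid_step[OF X]
  obtain p0 s0 h0 where 0: "sdr (bterm (sigma_minus \<circ>\<^sub>b ?X)) (bdif (sigma_minus \<circ>\<^sub>b ?X))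
       (cone_term (bterm ?X)) (cone_dif (bterm ?X) (bdif ?X)) p0 s0 h0"
    using step(2) by blast
  have "Suc k \<ge> 1" by simp
  note 2 = sdr_cone_blob[OF this]
  \<comment> \<open>From the composite to the cone on the power, from there to the cone on its
    bracket, and by elimination to the bracket with one more blob.\<close>
  note sdr_trans[OF step(1) bcpx_cone[OF X] 0 sdr_trans[OF bcpx_cone[OF X] bcpx_cone[OF bcpx_blob_target] 1 2]]
  then have "\<exists>p s h. sdr (bterm (sigma_minus \<circ>\<^sub>b ?X)) (bdif (sigma_minus \<circ>\<^sub>b ?X)) (bterm ?D') (bdif ?D') p s h"
    by blast
  then show ?case using step(1) by simp
qed

theorem theorem7p1:
  fixes n :: nat
  shows "to_ch (sigma_minus_power (2 * n) :: 'a bcomplex) \<simeq>\<^sub>h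
           to_ch (ts_aq_shift (- int (2 * n)) (ta_shift (blob_complex (2 * n)))) \<and>
         to_ch (sigma_minus_power (2 * n + 1) :: 'a bcomplex) \<simeq>\<^sub>h
           to_ch (ts_aq_shift (- int (2 * n + 1)) (ta_shift (blob_complex (2 * n + 1))))"
proof -
  have "to_ch (sigma_minus_power m :: 'a bcomplex) \<simeq>\<^sub>h to_ch (blob_target m)" for m
  proof -
    note r = sigma_minus_power_retract[where ?'a = 'a and m = m]
    from r obtain p s h where "sdr (bterm (sigma_minus_power m :: 'a bcomplex)) (bdif (sigma_minus_power m))
        (bterm (blob_target m :: 'a bcomplex)) (bdif (blob_target m)) p s h" by blast
    from sdr_homotopy_equivalent[OF conjunct1[OF r] bcpx_blob_target this] show ?thesis .
  qed
  then show ?thesis unfolding blob_target_def by blast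
qed

end
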